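(* (DiPerna–Lions theorem on a bounded domain.) Under the standing assumptions, there exists a map $X:\mathbb R\times\mathbb R\times\Omega\to\overline\Omega$ with the following properties. 1. For each fixed $t\in\mathbb R$, the map $(s,x)\mapsto X(s,t,x)$ is measurable on $\mathbb R\times\Omega$, and $(s,x)\mapsto v(s,X(s,t,x))$ belongs to $L^1([T_0,T_1]\times\Omega)^3$ for all $T_0<T_1$. 2. For all $s,t,\tau\in\mathbb R$ and every Borel set $A\subset\Omega$: $X(t,s,X(s,t,x))=x$ for a.e. $x\in\Omega$; $X(s,t,x)=X(s,\tau,X(\tau,t,x))$ for a.e. $x\in\Omega$; and $$\frac{1}{c^{s,t}}\,\mathrm{meas}(A)\le \mathrm{meas}\big(X(s,t,\cdot)^{-1}(A)\big)\le c^{s,t}\,\mathrm{meas}(A),$$ where $X(s,t,\cdot)^{-1}(A)=\{x\in\Omega: X(s,t,x)\in A\}$. 3. For each $t\in\mathbb R$ and a.e. $x\in\Omega$, the function $s\mapsto v(s,X(s,t,x))$ is locally integrable on $\mathbb R$ and there is a Lebesgue null set $N(t,x)\subset\mathbb R$ such that $$X(s,t,x)=x+\int_t^s v(r,X(r,t,x))\,dr\quad\text{for all } s\in\mathbb R\setminus N(t,x).$$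
   Context: Standing assumptions: $\Omega\subset\mathbb R^3$ is a bounded connected open set with $\mathrm{meas}(\Omega)=\mathrm{meas}(\overline\Omega)$ (Lebesgue measure). $v=(v_1,v_2,v_3):\mathbb R\times\Omega\to\mathbb R^3$ is measurable with $v_i\in L^1([T_0,T_1]\times\Omega)$ for all $T_0<T_1$; the weak spatial derivatives $\partial_{x_j}v_i$ exist and belong to $L^1([T_0,T_1]\times\Omega)$ for all $T_0<T_1$ ($i,j=1,2,3$); $v_i(t,\cdot)\in W^{1,1}_0(\Omega)$ for a.e. $t\in\mathbb R$; and the spatial divergence satisfies $\int_{T_0}^{T_1}\|\nabla\cdot v(t,\cdot)\|_{L^\infty(\Omega)}\,dt<\infty$ for all $T_0<T_1$. For $s,t\in\mathbb R$, $I^{s,t}$ denotes the closed interval with endpoints $s,t$ and $c^{s,t}:=\exp\big(\int_{I^{s,t}}\|\nabla\cdot v(r,\cdot)\|_{L^\infty(\Omega)}dr\big)$. *)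

theory Defs
  imports "HOL-Analysis.Analysis" "HOL-Probability.Essential_Supremum"
begin

definition partial :: "('a::euclidean_space \<Rightarrow> real) \<Rightarrow> 'a \<Rightarrow> 'a \<Rightarrow> real" where
  "partial f e x = frechet_derivative f (at x) e"

fun Ck :: "nat \<Rightarrow> ('a::euclidean_space \<Rightarrow> real) \<Rightarrow> bool" where
  "Ck 0 f = continuous_on UNIV f"
| "Ck (Suc k) f = ((\<forall>x. f differentiable (at x)) \<and> (\<forall>e\<in>Basis. Ck k (partial f e)))"

definition smooth :: "('a::euclidean_space \<Rightarrow> real) \<Rightarrow> bool" where
  "smooth f \<longleftrightarrow> (\<forall>k. Ck k f)"

definition tsupport :: "('a::euclidean_space \<Rightarrow> real) \<Rightarrow> 'a set" where
  "tsupport f = closure {x. f x \<noteq> 0}"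

definition test_fun :: "'a::euclidean_space set \<Rightarrow> ('a \<Rightarrow> real) \<Rightarrow> bool" where
  "test_fun U \<phi> \<longleftrightarrow> smooth \<phi> \<and> compact (tsupport \<phi>) \<and> tsupport \<phi> \<subseteq> U"

definition weak_partial ::
  "'a::euclidean_space set \<Rightarrow> ('a \<Rightarrow> real) \<Rightarrow> 'a \<Rightarrow> ('a \<Rightarrow> real) \<Rightarrow> bool" where
  "weak_partial U f e g \<longleftrightarrow>
     (\<forall>K. compact K \<and> K \<subseteq> U \<longrightarrow>
        set_integrable lebesgue K f \<and> set_integrable lebesgue K g) \<and>
     (\<forall>\<phi>. test_fun U \<phi> \<longrightarrow>
        (\<integral>x. f x * partial \<phi> e x \<partial>lebesgue_on U) = - (\<integral>x. g x * \<phi> x \<partial>lebesgue_on U))"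

definition W110 :: "'a::euclidean_space set \<Rightarrow> ('a \<Rightarrow> real) \<Rightarrow> bool" where
  "W110 U f \<longleftrightarrow>
     (\<exists>g :: 'a \<Rightarrow> 'a \<Rightarrow> real.
        integrable (lebesgue_on U) f \<and>
        (\<forall>e\<in>Basis. integrable (lebesgue_on U) (g e) \<and> weak_partial U f e (g e)) \<and>
        (\<exists>\<phi> :: nat \<Rightarrow> 'a \<Rightarrow> real. (\<forall>n. test_fun U (\<phi> n)) \<and>
           (\<lambda>n. (\<integral>x. \<bar>\<phi> n x - f x\<bar> \<partial>lebesgue_on U)
               + (\<Sum>e\<in>Basis. \<integral>x. \<bar>partial (\<phi> n) e x - g e x\<bar> \<partial>lebesgue_on U))
             \<longlonglongrightarrow> 0))"

text \<open>Dv t x $ i $ j stands for the weak spatial derivative d v_i / d x_j at (t,x).\<close>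
definition divergence :: "(real \<Rightarrow> real^3 \<Rightarrow> real^3^3) \<Rightarrow> real \<Rightarrow> real^3 \<Rightarrow> real" where
  "divergence Dv t x = (\<Sum>i\<in>UNIV. Dv t x $ i $ i)"

definition div_Linf :: "(real^3) set \<Rightarrow> (real \<Rightarrow> real^3 \<Rightarrow> real^3^3) \<Rightarrow> real \<Rightarrow> ennreal" where
  "div_Linf \<Omega> Dv t = e2ennreal (esssup (lebesgue_on \<Omega>) (\<lambda>x. ereal \<bar>divergence Dv t x\<bar>))"

definition cst :: "(real^3) set \<Rightarrow> (real \<Rightarrow> real^3 \<Rightarrow> real^3^3) \<Rightarrow> real \<Rightarrow> real \<Rightarrow> real" where
  "cst \<Omega> Dv s t =
     exp (enn2real (\<integral>\<^sup>+ r \<in> {min s t..max s t}. div_Linf \<Omega> Dv r \<partial>lebesgue))"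

definition standing_assumptions ::
  "(real^3) set \<Rightarrow> (real \<Rightarrow> real^3 \<Rightarrow> real^3) \<Rightarrow> (real \<Rightarrow> real^3 \<Rightarrow> real^3^3) \<Rightarrow> bool" where
  "standing_assumptions \<Omega> v Dv \<longleftrightarrow>
     open \<Omega> \<and> bounded \<Omega> \<and> connected \<Omega> \<and>
     emeasure lebesgue \<Omega> = emeasure lebesgue (closure \<Omega>) \<and>
     (\<lambda>p. v (fst p) (snd p)) \<in> borel_measurable (lebesgue_on (UNIV \<times> \<Omega>)) \<and>
     (\<forall>T0 T1. T0 < T1 \<longrightarrow> (\<forall>i. integrable (lebesgue_on ({T0..T1} \<times> \<Omega>))
                                   (\<lambda>p. v (fst p) (snd p) $ i))) \<and>
     (\<forall>i j. weak_partial (UNIV \<times> \<Omega>) (\<lambda>p. v (fst p) (snd p) $ i) (0, axis j 1)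
                (\<lambda>p. Dv (fst p) (snd p) $ i $ j)) \<and>
     (\<forall>T0 T1. T0 < T1 \<longrightarrow> (\<forall>i j. integrable (lebesgue_on ({T0..T1} \<times> \<Omega>))
                                   (\<lambda>p. Dv (fst p) (snd p) $ i $ j))) \<and>
     (AE t in lebesgue. \<forall>i. W110 \<Omega> (\<lambda>x. v t x $ i)) \<and>
     div_Linf \<Omega> Dv \<in> borel_measurable lebesgue \<and>
     (\<forall>T0 T1. T0 < T1 \<longrightarrow> (\<integral>\<^sup>+ t \<in> {T0..T1}. div_Linf \<Omega> Dv t \<partial>lebesgue) < \<infinity>)"

end

theory Submission
  imports Defs
begin

text \<open>The flow is constructed by a direct Lagrangian argument in the spirit of Crippa and De Lellis, without the
  transport equation. Extended by zero, \<open>v\<close> is a field \<open>u\<close> on the whole space with slices in \<open>W\<^sup>1\<^sup>,\<^sup>1\<close>,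
  because \<open>v(t, _)\<close> lies in \<open>W\<^sub>0\<^sup>1\<^sup>,\<^sup>1(\<Omega>)\<close>. If \<open>Y\<^sub>1\<close>, \<open>Y\<^sub>2\<close> are families of integral curves whose time slices
  compress Lebesgue measure by a bounded factor, then \<open>\<integral> ln (1 + \<bar>Y\<^sub>1 - Y\<^sub>2\<bar> / \<delta>) dx\<close> is at most the time integral of
  \<open>\<integral> \<bar>u(Y\<^sub>1) - u(Y\<^sub>2)\<bar> / (\<delta> + \<bar>Y\<^sub>1 - Y\<^sub>2\<bar>) dx\<close>. The latter is bounded by \<open>C ln (1/\<delta>)\<close> times the \<open>L\<^sup>1\<close> norm of the
  gradient, and it stays bounded as \<open>\<delta>\<close> tends to zero if \<open>u\<close> is smooth; approximating by smooth fields, it is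
  \<open>o(ln (1/\<delta>))\<close>. Hence the flow is unique and stable in measure. Existence follows: Euler polygons of the mollified
  field compress volumes by at most \<open>exp (\<integral> \<bar>div u\<bar>)\<close> up to a small error, and by stability they form a Cauchy
  sequence. Uniqueness also yields the group law and, comparing with constant curves outside \<open>\<Omega>\<close>, the invariance
  of \<open>\<Omega>\<close>.\<close>

section \<open>A logarithmic difference quotient estimate\<close>

text \<open>Crippa and De Lellis control difference quotients by the maximal function of the
  gradient, which is bounded on L^p only for p > 1. For merely integrable derivatives, an average
  over segments replaces it: its L^1 norm is finite at the price of a factor ln (1/\<delta>). This
  is borderline. Curves that are \<gamma> apart already contribute ln (1 + \<gamma>/\<delta>), which
  is of the same order, so a bound O(ln (1/\<delta>)) decides nothing; only the gain to o(ln
  (1/\<delta>)) forces the set of such points to be small. As that gain comes from density, it has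
  no rate: stability is qualitative, and convergence needs a fast subsequence. The compression bound
  has to survive every construction. It makes compositions such as \<open>u r (Y r x)\<close>
  insensitive to null sets and turns L^1 smallness of a field into L^1 smallness along a flow. Only
  bounds from above on preimages are ever propagated; the lower bound of the theorem is the upper
  bound for the inverse map.\<close>

lemma nn_integral_lborel_shift:
  fixes f :: "'a::euclidean_space \<Rightarrow> ennreal"
  assumes [measurable]: "f \<in> borel_measurable borel"
  shows "(\<integral>\<^sup>+x. f (c + x) \<partial>lborel) = (\<integral>\<^sup>+x. f x \<partial>lborel)"
  by (subst (2) lborel_distr_plus[of c, symmetric]) (simp add: nn_integral_distr)

lemma nn_integral_lborel_swap:
  fixes f :: "'a::euclidean_space \<Rightarrow> 'b::euclidean_space \<Rightarrow> ennreal"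
  assumes "(\<lambda>p. f (fst p) (snd p)) \<in> borel_measurable borel"
  shows "(\<integral>\<^sup>+y. \<integral>\<^sup>+x. f x y \<partial>lborel \<partial>lborel) = (\<integral>\<^sup>+x. \<integral>\<^sup>+y. f x y \<partial>lborel \<partial>lborel)"
proof -
  have "case_prod f \<in> borel_measurable (lborel \<Otimes>\<^sub>M lborel)"
    using assms by (simp add: case_prod_unfold lborel_prod)
  then show ?thesis by (rule lborel_pair.Fubini')
qed

text \<open>\<open>Y\<close> pushes Lebesgue measure on \<open>S\<close> forward to a measure with density at most \<open>L\<close>.\<close>

definition compr :: "'a set \<Rightarrow> real \<Rightarrow> ('a::euclidean_space \<Rightarrow> 'a) \<Rightarrow> bool" where
  "compr S L Y \<longleftrightarrow> Y \<in> borel_measurable borel \<and> 0 \<le> L \<and>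
     (\<forall>f\<in>borel_measurable borel. (\<integral>\<^sup>+x\<in>S. f (Y x) \<partial>lborel) \<le> ennreal L * (\<integral>\<^sup>+x. f x \<partial>lborel))"

lemma comprD:
  assumes "compr S L Y"
  shows "Y \<in> borel_measurable borel" "0 \<le> L"
    "f \<in> borel_measurable borel \<Longrightarrow> (\<integral>\<^sup>+x\<in>S. f (Y x) \<partial>lborel) \<le> ennreal L * (\<integral>\<^sup>+x. f x \<partial>lborel)"
  using assms by (auto simp: compr_def)

text \<open>C^1 functions with their gradient field as a separate argument, since a function and its
  gradient are later approximated in L^1 by two separate bounds.\<close>

definition has_grad :: "('a::euclidean_space \<Rightarrow> real) \<Rightarrow> ('a \<Rightarrow> 'a) \<Rightarrow> bool" where
  "has_grad \<phi> \<psi> \<longleftrightarrow> (\<forall>x. (\<phi> has_derivative (\<lambda>h. \<psi> x \<bullet> h)) (at x)) \<and> continuous_on UNIV \<psi>"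

lemma has_grad_measurable:
  assumes "has_grad \<phi> \<psi>"
  shows "\<phi> \<in> borel_measurable borel" "\<psi> \<in> borel_measurable borel" "continuous_on UNIV \<phi>"
proof -
  show *: "continuous_on UNIV \<phi>"
    using assms unfolding has_grad_def
    by (metis continuous_at_imp_continuous_on has_derivative_continuous)
  show "\<phi> \<in> borel_measurable borel" "\<psi> \<in> borel_measurable borel"
    using * assms by (auto simp: has_grad_def intro!: borel_measurable_continuous_onI)
qed

lemma has_grad_diff:
  assumes "has_grad \<phi> \<psi>" "has_grad \<phi>' \<psi>'"
  shows "has_grad (\<lambda>x. \<phi> x - \<phi>' x) (\<lambda>x. \<psi> x - \<psi>' x)"
  using assms unfolding has_grad_def
  by (auto intro!: derivative_eq_intros continuous_intros simp: inner_diff_left)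

lemma has_grad_segment_bound:
  assumes g: "has_grad \<phi> \<psi>" and d: "0 \<le> d"
  shows "ennreal \<bar>\<phi> (x + d *\<^sub>R z) - \<phi> x\<bar> \<le> (\<integral>\<^sup>+s\<in>{0..d}. ennreal (norm (\<psi> (x + s *\<^sub>R z)) * norm z) \<partial>lborel)"
proof -
  have c: "continuous_on A (\<lambda>s. \<psi> (x + s *\<^sub>R z) \<bullet> z)" for A
  proof -
    have "continuous_on A (\<lambda>s. \<psi> (x + s *\<^sub>R z))"
      by (rule continuous_on_compose2[of UNIV \<psi>])
        (use g in \<open>auto simp: has_grad_def intro!: continuous_intros\<close>)
    then show ?thesis by (intro continuous_on_inner continuous_on_const)
  qed
  have dv: "((\<lambda>s. \<phi> (x + s *\<^sub>R z)) has_vector_derivative (\<psi> (x + s *\<^sub>R z) \<bullet> z)) (at s within {0..d})" for s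
  proof -
    have "((\<lambda>s. \<phi> (x + s *\<^sub>R z)) has_derivative (\<lambda>h. \<psi> (x + s *\<^sub>R z) \<bullet> (h *\<^sub>R z))) (at s within {0..d})"
    proof (rule has_derivative_compose[where g=\<phi>])
      show "((\<lambda>s. x + s *\<^sub>R z) has_derivative (\<lambda>h. h *\<^sub>R z)) (at s within {0..d})"
        by (auto intro!: derivative_eq_intros)
      show "(\<phi> has_derivative (\<bullet>) (\<psi> (x + s *\<^sub>R z))) (at (x + s *\<^sub>R z))"
        using g unfolding has_grad_def by auto
    qed
    then show ?thesis by (simp add: has_vector_derivative_def)
  qed
  have *: "(LBINT s. indicator {0..d} s *\<^sub>R (\<psi> (x + s *\<^sub>R z) \<bullet> z)) = \<phi> (x + d *\<^sub>R z) - \<phi> (x + 0 *\<^sub>R z)"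
    by (rule integral_FTC_atLeastAtMost[OF d dv c])
  have "integrable lborel (\<lambda>s. indicator {0..d} s *\<^sub>R (\<psi> (x + s *\<^sub>R z) \<bullet> z))"
    by (rule borel_integrable_compact) (use c in auto)
  from integral_norm_bound_ennreal[OF this]
  have "ennreal \<bar>\<phi> (x + d *\<^sub>R z) - \<phi> x\<bar> \<le> (\<integral>\<^sup>+s. ennreal (norm (indicator {0..d} s *\<^sub>R (\<psi> (x + s *\<^sub>R z) \<bullet> z))) \<partial>lborel)"
    unfolding * by simp
  also have "\<dots> \<le> (\<integral>\<^sup>+s\<in>{0..d}. ennreal (norm (\<psi> (x + s *\<^sub>R z)) * norm z) \<partial>lborel)"
    by (intro nn_integral_mono) (auto simp: indicator_def Cauchy_Schwarz_ineq2)
  finally show ?thesis .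
qed

text \<open>To compare \<open>\<phi> x\<close> with \<open>\<phi> y\<close> one passes through \<open>x + \<bar>x - y\<bar> z\<close> and averages over \<open>z\<close> in the unit
  ball; since \<open>s \<le> \<bar>x - y\<bar>\<close> along both segments, the factor \<open>1 / (\<delta> + \<bar>x - y\<bar>)\<close> may be moved
  inside as \<open>1 / (\<delta> + s)\<close>, which integrates to a logarithm.\<close>

definition log_kernel :: "real \<Rightarrow> ('a::euclidean_space \<Rightarrow> 'a) \<Rightarrow> 'a \<Rightarrow> ennreal" where
  "log_kernel \<delta> \<psi> x =
     (\<integral>\<^sup>+z\<in>cball 0 2. \<integral>\<^sup>+s\<in>{0..1}. ennreal (norm (\<psi> (x + s *\<^sub>R z)) / (\<delta> + s)) \<partial>lborel \<partial>lborel)"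

lemma has_grad_segment_bound_log:
  assumes g: "has_grad \<phi> \<psi>" and d: "0 \<le> d" "d \<le> 1" and \<delta>: "\<delta> > 0" and z: "norm z \<le> 2"
  shows "ennreal (\<bar>\<phi> (x + d *\<^sub>R z) - \<phi> x\<bar> / (\<delta> + d))
    \<le> 2 * (\<integral>\<^sup>+s\<in>{0..1}. ennreal (norm (\<psi> (x + s *\<^sub>R z)) / (\<delta> + s)) \<partial>lborel)"
proof -
  note [measurable] = has_grad_measurable[OF g]
  have "ennreal (\<bar>\<phi> (x + d *\<^sub>R z) - \<phi> x\<bar> / (\<delta> + d)) = ennreal (1/(\<delta>+d)) * ennreal \<bar>\<phi> (x + d *\<^sub>R z) - \<phi> x\<bar>"
    using d \<delta> by (simp add: ennreal_mult'[symmetric])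
  also have "\<dots> \<le> ennreal (1/(\<delta>+d)) * (\<integral>\<^sup>+s\<in>{0..d}. ennreal (norm (\<psi> (x + s *\<^sub>R z)) * norm z) \<partial>lborel)"
    by (intro mult_left_mono has_grad_segment_bound[OF g d(1)]) auto
  also have "\<dots> = (\<integral>\<^sup>+s. ennreal (1/(\<delta>+d)) * (ennreal (norm (\<psi> (x + s *\<^sub>R z)) * norm z) * indicator {0..d} s) \<partial>lborel)"
    by (subst nn_integral_cmult) auto
  also have "\<dots> \<le> (\<integral>\<^sup>+s. 2 * (ennreal (norm (\<psi> (x + s *\<^sub>R z)) / (\<delta> + s)) * indicator {0..1} s) \<partial>lborel)"
  proof (intro nn_integral_mono)
    fix s
    have *: "1/(\<delta>+d) * (norm (\<psi> (x + s *\<^sub>R z)) * norm z) \<le> 2 * (norm (\<psi> (x + s *\<^sub>R z)) / (\<delta> + s))"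
      if "0 \<le> s" "s \<le> d"
    proof -
      have "1/(\<delta>+d) * (norm (\<psi> (x + s *\<^sub>R z)) * norm z) \<le> 1/(\<delta>+s) * (norm (\<psi> (x + s *\<^sub>R z)) * 2)"
        using that \<delta> z by (intro mult_mono divide_left_mono) auto
      then show ?thesis by (simp add: mult_ac)
    qed
    then have "ennreal (1/(\<delta>+d)) * ennreal (norm (\<psi> (x + s *\<^sub>R z)) * norm z) \<le> 2 * ennreal (norm (\<psi> (x + s *\<^sub>R z)) / (\<delta> + s))"
      if "0 \<le> s" "s \<le> d"
    proof -
      have "ennreal (1/(\<delta>+d)) * ennreal (norm (\<psi> (x + s *\<^sub>R z)) * norm z) = ennreal (1/(\<delta>+d) * (norm (\<psi> (x + s *\<^sub>R z)) * norm z))"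
        using \<delta> d by (intro ennreal_mult[symmetric]) auto
      also have "\<dots> \<le> ennreal (2 * (norm (\<psi> (x + s *\<^sub>R z)) / (\<delta> + s)))"
        using that * by (intro ennreal_leI) auto
      also have "\<dots> = 2 * ennreal (norm (\<psi> (x + s *\<^sub>R z)) / (\<delta> + s))"
        by (subst ennreal_mult') auto
      finally show ?thesis .
    qed
    then show "ennreal (1/(\<delta>+d)) * (ennreal (norm (\<psi> (x + s *\<^sub>R z)) * norm z) * indicator {0..d} s) \<le>
        2 * (ennreal (norm (\<psi> (x + s *\<^sub>R z)) / (\<delta> + s)) * indicator {0..1} s)"
      using d by (auto simp: indicator_def simp del: ennreal_mult' ennreal_mult'')
  qed
  also have "\<dots> = 2 * (\<integral>\<^sup>+s\<in>{0..1}. ennreal (norm (\<psi> (x + s *\<^sub>R z)) / (\<delta> + s)) \<partial>lborel)"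
    by (subst nn_integral_cmult) auto
  finally show ?thesis .
qed

lemma emeasure_cball_unit:
  "emeasure lborel (cball (0::'a::euclidean_space) r) = ennreal (measure lborel (cball (0::'a) r))"
  by (rule emeasure_eq_ennreal_measure) (use emeasure_lborel_cball_finite[of "0::'a" r] in auto)

lemma cball_borel[measurable]: "cball (x::'a::metric_space) r \<in> sets borel"
  by simp

lemma has_grad_log_kernel_bound:
  fixes \<phi> :: "'a::euclidean_space \<Rightarrow> real"
  assumes g: "has_grad \<phi> \<psi>" and \<delta>: "\<delta> > 0" and d: "norm (x - y) \<le> 1"
  shows "ennreal (measure lborel (cball (0::'a) 1)) * ennreal (\<bar>\<phi> x - \<phi> y\<bar> / (\<delta> + norm (x - y)))
    \<le> 2 * (log_kernel \<delta> \<psi> x + log_kernel \<delta> \<psi> y)"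
proof (cases "x = y")
  case True then show ?thesis by simp
next
  case False
  note [measurable] = has_grad_measurable[OF g]
  define d where "d = norm (x - y)"
  define e where "e = (1/d) *\<^sub>R (x - y)"
  have d: "0 < d" "d \<le> 1" and e: "norm e = 1" "d *\<^sub>R e = x - y"
    using assms False by (auto simp: d_def e_def)
  let ?P = "\<lambda>x z. (\<integral>\<^sup>+s\<in>{0..1}. ennreal (norm (\<psi> (x + s *\<^sub>R z)) / (\<delta> + s)) \<partial>lborel)"
  have pt: "ennreal (\<bar>\<phi> x - \<phi> y\<bar> / (\<delta> + d)) \<le> 2 * ?P x z + 2 * ?P y (e + z)" if z: "norm z \<le> 1" for z
  proof -
    \<comment> \<open>Both segments end in the same point. Seen from \<open>y\<close> its direction
      is \<open>e + z\<close>, with \<open>e\<close> the unit vector along \<open>x - y\<close>;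
      that direction has norm at most 2, which is why \<open>log_kernel\<close> averages over the
      ball of radius 2.\<close>
    have eq: "y + d *\<^sub>R (e + z) = x + d *\<^sub>R z" using e by (simp add: scaleR_add_right)
    have "\<bar>\<phi> x - \<phi> y\<bar> / (\<delta> + d) \<le> \<bar>\<phi> (x + d *\<^sub>R z) - \<phi> x\<bar> / (\<delta> + d) + \<bar>\<phi> (y + d *\<^sub>R (e + z)) - \<phi> y\<bar> / (\<delta> + d)"
      unfolding eq add_divide_distrib[symmetric] using d \<delta> by (intro divide_right_mono) auto
    then have "ennreal (\<bar>\<phi> x - \<phi> y\<bar> / (\<delta> + d)) \<le> ennreal (\<bar>\<phi> (x + d *\<^sub>R z) - \<phi> x\<bar> / (\<delta> + d)) + ennreal (\<bar>\<phi> (y + d *\<^sub>R (e + z)) - \<phi> y\<bar> / (\<delta> + d))"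
      using d \<delta> by (simp add: ennreal_leI flip: ennreal_plus)
    also have "\<dots> \<le> 2 * ?P x z + 2 * ?P y (e + z)"
      using z d \<delta> e norm_triangle_ineq[of e z]
      by (intro add_mono has_grad_segment_bound_log[OF g]) auto
    finally show ?thesis .
  qed
  have "ennreal (measure lborel (cball (0::'a) 1)) * ennreal (\<bar>\<phi> x - \<phi> y\<bar> / (\<delta> + d))
     = (\<integral>\<^sup>+z\<in>cball (0::'a) 1. ennreal (\<bar>\<phi> x - \<phi> y\<bar> / (\<delta> + d)) \<partial>lborel)"
    by (subst nn_integral_cmult_indicator) (auto simp: emeasure_cball_unit mult_ac)
  \<comment> \<open>Enlarging the domains from the unit ball, and from its translate by
    \<open>e\<close>, to the ball of radius 2 removes the dependence on \<open>e\<close>: the second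
    term is then a translate of \<open>log_kernel\<close> at \<open>y\<close>.\<close>
  also have "\<dots> \<le> (\<integral>\<^sup>+z. 2 * (?P x z * indicator (cball 0 2) z) + 2 * (?P y (e + z) * indicator (cball 0 2) (e + z)) \<partial>lborel)"
  proof (intro nn_integral_mono)
    fix z :: 'a
    have "norm (e + z) \<le> 2" if "norm z \<le> 1" using e that norm_triangle_ineq[of e z] by auto
    then show "ennreal (\<bar>\<phi> x - \<phi> y\<bar> / (\<delta> + d)) * indicator (cball 0 1) z \<le>
      2 * (?P x z * indicator (cball 0 2) z) + 2 * (?P y (e + z) * indicator (cball 0 2) (e + z))"
      using pt[of z] by (auto simp: indicator_def)
  qed
  also have "\<dots> = 2 * log_kernel \<delta> \<psi> x + 2 * (\<integral>\<^sup>+z. ?P y (e + z) * indicator (cball 0 2) (e + z) \<partial>lborel)"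
    by (subst nn_integral_add) (auto simp: nn_integral_cmult log_kernel_def)
  also have "(\<integral>\<^sup>+z. ?P y (e + z) * indicator (cball 0 2) (e + z) \<partial>lborel) = log_kernel \<delta> \<psi> y"
    unfolding log_kernel_def by (rule nn_integral_lborel_shift) measurable
  finally show ?thesis by (simp add: d_def distrib_left)
qed

lemma log_kernel_measurable[measurable]:
  assumes [measurable]: "\<psi> \<in> borel_measurable borel"
  shows "log_kernel \<delta> \<psi> \<in> borel_measurable borel"
  unfolding log_kernel_def by measurable

lemma nn_integral_inverse_shift:
  assumes "\<delta> > 0"
  shows "(\<integral>\<^sup>+s\<in>{0..1}. ennreal (1 / (\<delta> + s)) \<partial>lborel) = ennreal (ln (1 + 1/\<delta>))"
proof -
  have "(\<integral>\<^sup>+s. ennreal (1 / (\<delta> + s)) * indicator {0..1} s \<partial>lborel) = ennreal (ln (\<delta> + 1) - ln (\<delta> + 0))"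
    by (rule nn_integral_FTC_Icc) (use assms in \<open>auto intro!: derivative_eq_intros\<close>)
  also have "ln (\<delta> + 1) - ln (\<delta> + 0) = ln (1 + 1/\<delta>)"
    using assms by (subst ln_divide_pos[symmetric]) (auto simp: add_divide_distrib)
  finally show ?thesis .
qed

text \<open>Fubini and translation invariance give every point \<open>x + s z\<close> the same mass,
  so the integral factorises into the volume of the ball, the integral of 1 / (\<delta> + s) and the
  L^1 norm of the gradient. The middle factor is the whole loss compared with a maximal function
  estimate for p > 1.\<close>

lemma nn_integral_log_kernel:
  fixes \<psi> :: "'a::euclidean_space \<Rightarrow> 'a"
  assumes [measurable]: "\<psi> \<in> borel_measurable borel" and \<delta>: "\<delta> > 0"
  shows "(\<integral>\<^sup>+x. log_kernel \<delta> \<psi> x \<partial>lborel)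
    = ennreal (measure lborel (cball (0::'a) 2)) * (ennreal (ln (1 + 1/\<delta>)) * (\<integral>\<^sup>+x. norm (\<psi> x) \<partial>lborel))"
proof -
  let ?N = "\<integral>\<^sup>+x. norm (\<psi> x) \<partial>lborel"
  have "(\<integral>\<^sup>+x. log_kernel \<delta> \<psi> x \<partial>lborel) =
    (\<integral>\<^sup>+z. \<integral>\<^sup>+x. (\<integral>\<^sup>+s\<in>{0..1}. ennreal (norm (\<psi> (x + s *\<^sub>R z)) / (\<delta> + s)) \<partial>lborel) * indicator (cball 0 2) z \<partial>lborel \<partial>lborel)"
    unfolding log_kernel_def
  proof (rule nn_integral_lborel_swap)
    show "(\<lambda>p. (\<integral>\<^sup>+s\<in>{0..1}. ennreal (norm (\<psi> (snd p + s *\<^sub>R fst p)) / (\<delta> + s)) \<partial>lborel) * indicator (cball 0 2) (fst p))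
       \<in> borel_measurable borel"
      unfolding borel_prod[symmetric] by measurable
  qed
  also have "\<dots> = (\<integral>\<^sup>+z\<in>cball (0::'a) 2. (ennreal (ln (1 + 1/\<delta>)) * ?N) \<partial>lborel)"
  proof (intro nn_integral_cong)
    fix z :: 'a
    have "(\<integral>\<^sup>+x. (\<integral>\<^sup>+s\<in>{0..1}. ennreal (norm (\<psi> (x + s *\<^sub>R z)) / (\<delta> + s)) \<partial>lborel) * indicator (cball 0 2) z \<partial>lborel)
      = (\<integral>\<^sup>+x. (\<integral>\<^sup>+s\<in>{0..1}. ennreal (norm (\<psi> (x + s *\<^sub>R z)) / (\<delta> + s)) \<partial>lborel)\<partial>lborel) * indicator (cball 0 2) z"
      by (subst nn_integral_multc) auto
    also have "(\<integral>\<^sup>+x. (\<integral>\<^sup>+s\<in>{0..1}. ennreal (norm (\<psi> (x + s *\<^sub>R z)) / (\<delta> + s)) \<partial>lborel)\<partial>lborel)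
      = (\<integral>\<^sup>+s. \<integral>\<^sup>+x. ennreal (norm (\<psi> (x + s *\<^sub>R z)) / (\<delta> + s)) * indicator {0..1} s \<partial>lborel \<partial>lborel)"
      by (rule nn_integral_lborel_swap[symmetric]) (unfold borel_prod[symmetric], measurable)
    also have "\<dots> = (\<integral>\<^sup>+s. (ennreal (1 / (\<delta> + s)) * indicator {0..1} s) * ?N \<partial>lborel)"
    proof (intro nn_integral_cong)
      fix s :: real
      have "(\<integral>\<^sup>+x. ennreal (norm (\<psi> (x + s *\<^sub>R z)) / (\<delta> + s)) * indicator {0..1} s \<partial>lborel)
        = (\<integral>\<^sup>+x. (ennreal (1 / (\<delta> + s)) * indicator {0..1} s) * ennreal (norm (\<psi> (s *\<^sub>R z + x))) \<partial>lborel)"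
        using \<delta> by (intro nn_integral_cong) (auto simp: indicator_def ennreal_mult'[symmetric] add.commute)
      also have "\<dots> = (ennreal (1 / (\<delta> + s)) * indicator {0..1} s) * ?N"
        by (subst nn_integral_cmult, measurable) (subst nn_integral_lborel_shift[where f="\<lambda>x. ennreal (norm (\<psi> x))"], auto)
      finally show "(\<integral>\<^sup>+x. ennreal (norm (\<psi> (x + s *\<^sub>R z)) / (\<delta> + s)) * indicator {0..1} s \<partial>lborel)
        = (ennreal (1 / (\<delta> + s)) * indicator {0..1} s) * ?N" .
    qed
    also have "\<dots> = ennreal (ln (1 + 1/\<delta>)) * ?N"
      by (subst nn_integral_multc) (auto simp: nn_integral_inverse_shift[OF \<delta>])
    finally show "(\<integral>\<^sup>+x. (\<integral>\<^sup>+s\<in>{0..1}. ennreal (norm (\<psi> (x + s *\<^sub>R z)) / (\<delta> + s)) \<partial>lborel) * indicator (cball 0 2) z \<partial>lborel)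
      = ennreal (ln (1 + 1/\<delta>)) * ?N * indicator (cball 0 2) z" .
  qed
  also have "\<dots> = ennreal (measure lborel (cball (0::'a) 2)) * (ennreal (ln (1 + 1/\<delta>)) * ?N)"
    by (subst nn_integral_cmult_indicator) (auto simp: emeasure_cball_unit mult_ac)
  finally show ?thesis .
qed

text \<open>The quotient of volumes is what \<open>log_kernel\<close> costs after normalising the
  average over the unit ball. The factor 4 is 2 from the segment length times 2 for the two maps;
  the summand 2 pays for points that are far apart, again once for each map.\<close>

definition log_const :: "'a::euclidean_space itself \<Rightarrow> real" where
  "log_const _ = 4 * measure lborel (cball (0::'a) 2) / measure lborel (cball (0::'a) 1) + 2"

text \<open>At distance at most 1 the kernel bound applies. At larger distance the denominator
  exceeds 1 and the quotient is at most |\<phi> x| + |\<phi> y|, the origin of the L^1 norm of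
  \<phi> on the right. Both bounds are sums of a function of \<open>x\<close> and a function of
  \<open>y\<close>, so each summand can be moved to Lebesgue measure by the compression of one map
  alone.\<close>

lemma has_grad_log_estimate:
  fixes \<phi> :: "'a::euclidean_space \<Rightarrow> real"
  assumes g: "has_grad \<phi> \<psi>" and \<delta>: "\<delta> > 0" and Y: "compr S L Y1" "compr S L Y2" and [measurable]: "S \<in> sets borel"
  shows "(\<integral>\<^sup>+x\<in>S. ennreal (\<bar>\<phi> (Y1 x) - \<phi> (Y2 x)\<bar> / (\<delta> + norm (Y1 x - Y2 x))) \<partial>lborel)
    \<le> ennreal (log_const TYPE('a) * L) * (ennreal (ln (1 + 1/\<delta>)) * (\<integral>\<^sup>+x. norm (\<psi> x) \<partial>lborel) + (\<integral>\<^sup>+x. \<bar>\<phi> x\<bar> \<partial>lborel))"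
proof -
  note [measurable] = has_grad_measurable[OF g] comprD(1)[OF Y(1)] comprD(1)[OF Y(2)]
  let ?V1 = "measure lborel (cball (0::'a) 1)" and ?V2 = "measure lborel (cball (0::'a) 2)"
  have V: "?V1 > 0" "?V2 \<ge> 0"
    using content_cball_pos[of 1 "0::'a"] by auto
  let ?f = "\<lambda>x. ennreal (2 / ?V1) * log_kernel \<delta> \<psi> x + ennreal \<bar>\<phi> x\<bar>"
  have pt: "ennreal (\<bar>\<phi> x - \<phi> y\<bar> / (\<delta> + norm (x - y))) \<le> ?f x + ?f y" for x y
  proof (cases "norm (x - y) \<le> 1")
    case True
    have "ennreal (\<bar>\<phi> x - \<phi> y\<bar> / (\<delta> + norm (x - y))) = ennreal (1 / ?V1) * (ennreal ?V1 * ennreal (\<bar>\<phi> x - \<phi> y\<bar> / (\<delta> + norm (x - y))))"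
      using V by (simp add: mult.assoc[symmetric] ennreal_mult'[symmetric])
    also have "\<dots> \<le> ennreal (1 / ?V1) * (2 * (log_kernel \<delta> \<psi> x + log_kernel \<delta> \<psi> y))"
      by (intro mult_left_mono has_grad_log_kernel_bound[OF g \<delta> True]) auto
    also have "\<dots> = ennreal (2 / ?V1) * log_kernel \<delta> \<psi> x + ennreal (2 / ?V1) * log_kernel \<delta> \<psi> y"
    proof -
      have "ennreal (2 / ?V1) = ennreal (1 / ?V1 * 2)" by simp
      also have "\<dots> = ennreal (1 / ?V1) * 2" by (subst ennreal_mult'') auto
      finally have "ennreal (2 / ?V1) = ennreal (1 / ?V1) * 2" .
      then show ?thesis by (simp add: distrib_left mult.assoc)
    qed
    also have "\<dots> \<le> ?f x + ?f y" by (intro add_mono) auto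
    finally show ?thesis .
  next
    case False
    have "\<bar>\<phi> x - \<phi> y\<bar> / (\<delta> + norm (x - y)) \<le> \<bar>\<phi> x - \<phi> y\<bar> / 1"
      using False \<delta> by (intro divide_left_mono) auto
    also have "\<dots> \<le> \<bar>\<phi> x\<bar> + \<bar>\<phi> y\<bar>" by simp
    finally have "ennreal (\<bar>\<phi> x - \<phi> y\<bar> / (\<delta> + norm (x - y))) \<le> ennreal \<bar>\<phi> x\<bar> + ennreal \<bar>\<phi> y\<bar>"
      by (simp add: ennreal_leI flip: ennreal_plus)
    also have "\<dots> \<le> ?f x + ?f y" by (intro add_mono) auto
    finally show ?thesis .
  qed
  have "(\<integral>\<^sup>+x\<in>S. ennreal (\<bar>\<phi> (Y1 x) - \<phi> (Y2 x)\<bar> / (\<delta> + norm (Y1 x - Y2 x))) \<partial>lborel)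
    \<le> (\<integral>\<^sup>+x. ?f (Y1 x) * indicator S x + ?f (Y2 x) * indicator S x \<partial>lborel)"
    by (intro nn_integral_mono) (use pt in \<open>auto simp: indicator_def\<close>)
  also have "\<dots> = (\<integral>\<^sup>+x\<in>S. ?f (Y1 x) \<partial>lborel) + (\<integral>\<^sup>+x\<in>S. ?f (Y2 x) \<partial>lborel)"
    by (intro nn_integral_add) auto
  also have "\<dots> \<le> ennreal L * (\<integral>\<^sup>+x. ?f x \<partial>lborel) + ennreal L * (\<integral>\<^sup>+x. ?f x \<partial>lborel)"
    by (intro add_mono comprD(3)[OF Y(1)] comprD(3)[OF Y(2)]) auto
  also have "(\<integral>\<^sup>+x. ?f x \<partial>lborel) = ennreal (2 / ?V1) * (ennreal ?V2 * (ennreal (ln (1 + 1/\<delta>)) * (\<integral>\<^sup>+x. norm (\<psi> x) \<partial>lborel))) + (\<integral>\<^sup>+x. \<bar>\<phi> x\<bar> \<partial>lborel)"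
    by (subst nn_integral_add) (auto simp: nn_integral_cmult nn_integral_log_kernel[OF _ \<delta>])
  also have "ennreal L * (ennreal (2 / ?V1) * (ennreal ?V2 * (ennreal (ln (1 + 1/\<delta>)) * (\<integral>\<^sup>+x. norm (\<psi> x) \<partial>lborel))) + (\<integral>\<^sup>+x. \<bar>\<phi> x\<bar> \<partial>lborel))
    + ennreal L * (ennreal (2 / ?V1) * (ennreal ?V2 * (ennreal (ln (1 + 1/\<delta>)) * (\<integral>\<^sup>+x. norm (\<psi> x) \<partial>lborel))) + (\<integral>\<^sup>+x. \<bar>\<phi> x\<bar> \<partial>lborel))
    \<le> ennreal (log_const TYPE('a) * L) * (ennreal (ln (1 + 1/\<delta>)) * (\<integral>\<^sup>+x. norm (\<psi> x) \<partial>lborel) + (\<integral>\<^sup>+x. \<bar>\<phi> x\<bar> \<partial>lborel))"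
    (is "ennreal L * (_ * (_ * ?A) + ?B) + _ \<le> _")
  proof -
    have L: "0 \<le> L" using comprD[OF Y(1)] by simp
    let ?X = "ennreal (2 / ?V1) * (ennreal ?V2 * ?A) + ?B"
    have c: "log_const TYPE('a) / 2 = 2 / ?V1 * ?V2 + 1" by (simp add: log_const_def)
    have "?X = ennreal (2 / ?V1 * ?V2) * ?A + 1 * ?B"
      using V by (subst ennreal_mult) (auto simp: mult.assoc)
    also have "\<dots> \<le> ennreal (log_const TYPE('a) / 2) * ?A + ennreal (log_const TYPE('a) / 2) * ?B"
      unfolding c using V by (intro add_mono mult_right_mono) (auto intro!: ennreal_leI simp flip: ennreal_1)
    finally have X: "?X \<le> ennreal (log_const TYPE('a) / 2) * (?A + ?B)" by (simp add: distrib_left)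
    have "ennreal L * ?X + ennreal L * ?X = (ennreal L + ennreal L) * ?X"
      by (simp add: distrib_right)
    also have "\<dots> \<le> ennreal (2 * L) * (ennreal (log_const TYPE('a) / 2) * (?A + ?B))"
      using L X by (intro mult_mono) (auto simp flip: ennreal_plus)
    also have "\<dots> = ennreal (2 * L * (log_const TYPE('a) / 2)) * (?A + ?B)"
      using L V by (subst ennreal_mult) (auto simp: mult.assoc log_const_def)
    finally show ?thesis by (simp add: mult.commute)
  qed
  finally show ?thesis .
qed

section \<open>From C^1 functions to Sobolev functions\<close>

lemma ennreal_tendsto_0I:
  fixes f :: "'b \<Rightarrow> ennreal"
  assumes "\<And>e::real. e > 0 \<Longrightarrow> eventually (\<lambda>j. f j \<le> ennreal e) F"
  shows "(f \<longlongrightarrow> 0) F"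
proof (rule order_tendstoI)
  fix a :: ennreal assume "0 < a"
  then obtain e :: real where e: "0 < ennreal e" "ennreal e < a"
    by (metis dense ennreal_cases top.not_eq_extremum order_less_imp_not_less dual_order.strict_trans2 top_greatest)
  then have "e > 0" by (simp add: ennreal_less_zero_iff)
  from assms[OF this] show "eventually (\<lambda>j. f j < a) F"
    by eventually_elim (use e in auto)
qed auto

lemma ennreal_tendsto_0D:
  fixes f :: "'b \<Rightarrow> ennreal"
  assumes "(f \<longlongrightarrow> 0) F" "e > (0::real)"
  shows "eventually (\<lambda>j. f j \<le> ennreal e) F"
  using order_tendstoD(2)[OF assms(1), of "ennreal e"] assms(2)
  by (auto elim: eventually_mono)

definition compact_supp :: "('a::real_normed_vector \<Rightarrow> 'b::zero) \<Rightarrow> bool" where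
  "compact_supp f \<longleftrightarrow> (\<exists>R. \<forall>x. R < norm x \<longrightarrow> f x = 0)"

text \<open>The closure of the compactly supported \<open>C\<^sup>1\<close> functions in \<open>W\<^sup>1\<^sup>,\<^sup>1\<close>; \<open>g\<close> is the gradient of \<open>f\<close>.\<close>

definition W11 :: "('a::euclidean_space \<Rightarrow> real) \<Rightarrow> ('a \<Rightarrow> 'a) \<Rightarrow> bool" where
  "W11 f g \<longleftrightarrow> integrable lborel f \<and> integrable lborel g \<and>
     (\<forall>\<eta>>0. \<exists>\<phi> \<psi>. has_grad \<phi> \<psi> \<and> compact_supp \<phi> \<and> compact_supp \<psi> \<and>
        (\<integral>\<^sup>+x. \<bar>f x - \<phi> x\<bar> \<partial>lborel) \<le> ennreal \<eta> \<and> (\<integral>\<^sup>+x. norm (g x - \<psi> x) \<partial>lborel) \<le> ennreal \<eta>)"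

lemma W11_measurable:
  assumes "W11 f g"
  shows "f \<in> borel_measurable borel" "g \<in> borel_measurable borel"
  using assms by (auto simp: W11_def dest: borel_measurable_integrable)

lemma W11_approx:
  assumes "W11 f g" "\<eta> > 0"
  obtains \<phi> \<psi> where "has_grad \<phi> \<psi>" "compact_supp \<phi>" "compact_supp \<psi>"
    "(\<integral>\<^sup>+x. \<bar>f x - \<phi> x\<bar> \<partial>lborel) \<le> ennreal \<eta>" "(\<integral>\<^sup>+x. norm (g x - \<psi> x) \<partial>lborel) \<le> ennreal \<eta>"
  using assms by (auto simp: W11_def)

lemma compact_supp_bounded:
  fixes f :: "'a::euclidean_space \<Rightarrow> 'b::real_normed_vector"
  assumes "compact_supp f" "continuous_on UNIV f"
  obtains C where "C \<ge> 0" "\<And>x. norm (f x) \<le> C"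
proof -
  from assms(1) obtain R where R: "\<And>x. R < norm x \<Longrightarrow> f x = 0" by (auto simp: compact_supp_def)
  have "compact (f ` cball 0 R)"
    by (intro compact_continuous_image continuous_on_subset[OF assms(2)]) auto
  then obtain C where C: "\<And>y. y \<in> f ` cball 0 R \<Longrightarrow> norm y \<le> C"
    using compact_imp_bounded bounded_iff by metis
  have "norm (f x) \<le> max 0 C" for x
    using C[of "f x"] R[of x] by (cases "norm x \<le> R") (auto simp: le_max_iff_disj)
  then show thesis by (intro that[of "max 0 C"]) auto
qed

lemma compact_supp_integrable:
  fixes f :: "'a::euclidean_space \<Rightarrow> 'b::euclidean_space"
  assumes "compact_supp f" "continuous_on UNIV f"
  shows "integrable lborel f"
proof -
  from assms(1) obtain R where R: "\<And>x. R < norm x \<Longrightarrow> f x = 0" by (auto simp: compact_supp_def)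
  have "integrable lborel (\<lambda>x. indicator (cball 0 R) x *\<^sub>R f x)"
    by (rule borel_integrable_compact) (auto intro: continuous_on_subset[OF assms(2)])
  moreover have "(\<lambda>x. indicator (cball 0 R) x *\<^sub>R f x) = f"
    using R by (auto simp: indicator_def not_le)
  ultimately show ?thesis by simp
qed

lemma compact_supp_diff:
  fixes f g :: "'a::real_normed_vector \<Rightarrow> 'b::group_add"
  assumes "compact_supp f" "compact_supp g" shows "compact_supp (\<lambda>x. f x - g x)"
proof -
  from assms obtain R1 R2 where "\<forall>x. R1 < norm x \<longrightarrow> f x = 0" "\<forall>x. R2 < norm x \<longrightarrow> g x = 0"
    by (auto simp: compact_supp_def)
  then show ?thesis unfolding compact_supp_def by (intro exI[of _ "max R1 R2"]) auto
qed

text \<open>Serves \<open>W11_log_limit\<close>, where the logarithmic estimate is applied to the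
  small remainder that a smooth approximation leaves.\<close>

lemma W11_diff_smooth:
  assumes w: "W11 f g" and h: "has_grad \<phi> \<psi>" "compact_supp \<phi>" "compact_supp \<psi>"
  shows "W11 (\<lambda>x. f x - \<phi> x) (\<lambda>x. g x - \<psi> x)"
  unfolding W11_def
proof (intro conjI allI impI)
  have "integrable lborel \<phi>" "integrable lborel \<psi>"
    using h by (auto intro!: compact_supp_integrable simp: has_grad_measurable) (simp add: has_grad_def)
  then show "integrable lborel (\<lambda>x. f x - \<phi> x)" "integrable lborel (\<lambda>x. g x - \<psi> x)"
    using w by (auto simp: W11_def)
  fix \<eta> :: real assume "\<eta> > 0"
  from W11_approx[OF w this] obtain \<phi>' \<psi>' where a: "has_grad \<phi>' \<psi>'" "compact_supp \<phi>'" "compact_supp \<psi>'"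
    "(\<integral>\<^sup>+x. \<bar>f x - \<phi>' x\<bar> \<partial>lborel) \<le> ennreal \<eta>" "(\<integral>\<^sup>+x. norm (g x - \<psi>' x) \<partial>lborel) \<le> ennreal \<eta>" by metis
  then show "\<exists>\<phi>' \<psi>'. has_grad \<phi>' \<psi>' \<and> compact_supp \<phi>' \<and> compact_supp \<psi>' \<and>
       (\<integral>\<^sup>+ x. ennreal \<bar>f x - \<phi> x - \<phi>' x\<bar> \<partial>lborel) \<le> ennreal \<eta> \<and>
       (\<integral>\<^sup>+ x. ennreal (norm (g x - \<psi> x - \<psi>' x)) \<partial>lborel) \<le> ennreal \<eta>"
    using h by (intro exI[of _ "\<lambda>x. \<phi>' x - \<phi> x"] exI[of _ "\<lambda>x. \<psi>' x - \<psi> x"] conjI has_grad_diff compact_supp_diff)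
      (auto simp: algebra_simps)
qed

lemma log_const_ge: "log_const TYPE('a::euclidean_space) \<ge> 2"
  by (auto simp: log_const_def)

lemma nn_integral_norm_triangle:
  fixes f g :: "'a::euclidean_space \<Rightarrow> 'b::euclidean_space"
  assumes [measurable]: "f \<in> borel_measurable borel" "g \<in> borel_measurable borel"
  shows "(\<integral>\<^sup>+x. norm (f x) \<partial>lborel) \<le> (\<integral>\<^sup>+x. norm (g x) \<partial>lborel) + (\<integral>\<^sup>+x. norm (g x - f x) \<partial>lborel)"
  by (subst nn_integral_add[symmetric])
    (auto intro!: nn_integral_mono ennreal_leI simp flip: ennreal_plus simp: norm_triangle_sub norm_minus_commute)

lemma ennreal_combine1:
  assumes "0 \<le> K" "0 \<le> l" "0 \<le> x" "0 \<le> L" "0 \<le> y"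
  shows "ennreal K * (ennreal l * ennreal x + ennreal x) + ennreal L * ennreal y + ennreal L * ennreal y
    = ennreal (K * (l * x + x) + L * y + L * y)"
  using assms by (simp flip: ennreal_mult ennreal_plus)

lemma ennreal_combine2:
  assumes "0 \<le> B" "0 \<le> s" "0 \<le> K" "0 \<le> l" "0 \<le> x"
  shows "ennreal B * ennreal s + ennreal K * (ennreal l * ennreal x + ennreal x)
    = ennreal (B * s + K * (l * x + x))"
  using assms by (simp flip: ennreal_mult ennreal_plus)

text \<open>For fixed \<delta> the quotient depends continuously on \<open>f\<close> in L^1, with
  the poor constant L / \<delta> for each of the two maps. This is harmless, because the
  approximation may be chosen after \<delta> and the constants in the result do not see it.\<close>

lemma W11_log_estimate:
  fixes f :: "'a::euclidean_space \<Rightarrow> real"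
  assumes w: "W11 f g" and \<delta>: "\<delta> > 0" and Y: "compr S L Y1" "compr S L Y2" and S[measurable]: "S \<in> sets borel"
  shows "(\<integral>\<^sup>+x\<in>S. ennreal (\<bar>f (Y1 x) - f (Y2 x)\<bar> / (\<delta> + norm (Y1 x - Y2 x))) \<partial>lborel)
    \<le> ennreal (log_const TYPE('a) * L) * (ennreal (ln (1 + 1/\<delta>)) * (\<integral>\<^sup>+x. norm (g x) \<partial>lborel) + (\<integral>\<^sup>+x. \<bar>f x\<bar> \<partial>lborel))"
    (is "?I \<le> ennreal ?K * (ennreal ?l * ?G + ?F)")
proof (rule ennreal_le_epsilon)
  fix e :: real assume e: "e > 0"
  note [measurable] = W11_measurable[OF w] comprD(1)[OF Y(1)] comprD(1)[OF Y(2)]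
  have L: "L \<ge> 0" using comprD[OF Y(1)] by simp
  have K: "?K \<ge> 0" using L log_const_ge[where 'a='a] by simp
  have l: "?l \<ge> 0" using \<delta> by simp
  \<comment> \<open>Collects the cost of an approximation error: \<open>?K * (?l + 1)\<close> for
    replacing \<psi> and \<phi> by \<open>g\<close> and \<open>f\<close> on the right,
    \<open>2 * L / \<delta>\<close> for the remainder evaluated along both maps.\<close>
  define C where "C = ?K * (?l + 1) + 2 * L / \<delta> + 1"
  have C: "C > 0" unfolding C_def using K l L \<delta> by (intro add_nonneg_pos add_nonneg_nonneg) auto
  obtain \<phi> \<psi> where h: "has_grad \<phi> \<psi>"
    and a: "(\<integral>\<^sup>+x. \<bar>f x - \<phi> x\<bar> \<partial>lborel) \<le> ennreal (e/C)" "(\<integral>\<^sup>+x. norm (g x - \<psi> x) \<partial>lborel) \<le> ennreal (e/C)"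
    by (rule W11_approx[OF w, of "e/C"]) (use e C in auto)
  note [measurable] = has_grad_measurable[OF h]
  let ?r = "\<lambda>y. ennreal (\<bar>f y - \<phi> y\<bar> / \<delta>)"
  have "?I \<le> (\<integral>\<^sup>+x. (ennreal (\<bar>\<phi> (Y1 x) - \<phi> (Y2 x)\<bar> / (\<delta> + norm (Y1 x - Y2 x))) * indicator S x + ?r (Y1 x) * indicator S x) + ?r (Y2 x) * indicator S x \<partial>lborel)"
  proof (intro nn_integral_mono)
    fix x
    let ?d = "\<delta> + norm (Y1 x - Y2 x)"
    have d: "\<delta> \<le> ?d" "0 < ?d" using \<delta> by (auto intro: add_pos_nonneg)
    have "\<bar>f (Y1 x) - f (Y2 x)\<bar> / ?d \<le> (\<bar>\<phi> (Y1 x) - \<phi> (Y2 x)\<bar> + \<bar>f (Y1 x) - \<phi> (Y1 x)\<bar> + \<bar>f (Y2 x) - \<phi> (Y2 x)\<bar>) / ?d"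
      using d by (intro divide_right_mono) auto
    also have "\<dots> \<le> \<bar>\<phi> (Y1 x) - \<phi> (Y2 x)\<bar> / ?d + \<bar>f (Y1 x) - \<phi> (Y1 x)\<bar> / \<delta> + \<bar>f (Y2 x) - \<phi> (Y2 x)\<bar> / \<delta>"
      unfolding add_divide_distrib using d \<delta> by (intro add_mono divide_left_mono) auto
    finally show "ennreal (\<bar>f (Y1 x) - f (Y2 x)\<bar> / ?d) * indicator S x \<le> ennreal (\<bar>\<phi> (Y1 x) - \<phi> (Y2 x)\<bar> / ?d) * indicator S x + ?r (Y1 x) * indicator S x + ?r (Y2 x) * indicator S x"
      using \<delta> d by (auto simp: indicator_def intro!: ennreal_leI simp flip: ennreal_plus)
  qed
  also have "\<dots> = (\<integral>\<^sup>+x\<in>S. ennreal (\<bar>\<phi> (Y1 x) - \<phi> (Y2 x)\<bar> / (\<delta> + norm (Y1 x - Y2 x))) \<partial>lborel) + (\<integral>\<^sup>+x\<in>S. ?r (Y1 x) \<partial>lborel) + (\<integral>\<^sup>+x\<in>S. ?r (Y2 x) \<partial>lborel)"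
    by (simp add: nn_integral_add)
  also have "\<dots> \<le> ennreal ?K * (ennreal ?l * (\<integral>\<^sup>+x. norm (\<psi> x) \<partial>lborel) + (\<integral>\<^sup>+x. \<bar>\<phi> x\<bar> \<partial>lborel)) + ennreal L * (\<integral>\<^sup>+x. ?r x \<partial>lborel) + ennreal L * (\<integral>\<^sup>+x. ?r x \<partial>lborel)"
    by (intro add_mono has_grad_log_estimate[OF h \<delta> Y S] comprD(3)[OF Y(1)] comprD(3)[OF Y(2)]) auto
  also have "\<dots> \<le> ennreal ?K * (ennreal ?l * (?G + ennreal (e/C)) + (?F + ennreal (e/C))) + ennreal L * ennreal (e/C/\<delta>) + ennreal L * ennreal (e/C/\<delta>)"
  proof -
    have "(\<integral>\<^sup>+x. ?r x \<partial>lborel) = (\<integral>\<^sup>+x. ennreal (1/\<delta>) * ennreal \<bar>f x - \<phi> x\<bar> \<partial>lborel)"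
      using \<delta> by (simp add: ennreal_mult'[symmetric])
    also have "\<dots> \<le> ennreal (1/\<delta>) * ennreal (e/C)"
      by (subst nn_integral_cmult) (auto intro!: mult_left_mono a)
    also have "\<dots> = ennreal (e/C/\<delta>)" using \<delta> by (simp add: ennreal_mult'[symmetric] mult.commute)
    finally have r: "(\<integral>\<^sup>+x. ?r x \<partial>lborel) \<le> ennreal (e/C/\<delta>)" .
    have "(\<integral>\<^sup>+x. norm (\<psi> x) \<partial>lborel) \<le> ?G + (\<integral>\<^sup>+x. norm (g x - \<psi> x) \<partial>lborel)"
      by (rule nn_integral_norm_triangle) auto
    also have "\<dots> \<le> ?G + ennreal (e/C)" by (intro add_left_mono a)
    finally have g: "(\<integral>\<^sup>+x. norm (\<psi> x) \<partial>lborel) \<le> ?G + ennreal (e/C)" .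
    have "(\<integral>\<^sup>+x. \<bar>\<phi> x\<bar> \<partial>lborel) \<le> ?F + (\<integral>\<^sup>+x. \<bar>f x - \<phi> x\<bar> \<partial>lborel)"
      using nn_integral_norm_triangle[of \<phi> f] by simp
    also have "\<dots> \<le> ?F + ennreal (e/C)" by (intro add_left_mono a)
    finally have f: "(\<integral>\<^sup>+x. \<bar>\<phi> x\<bar> \<partial>lborel) \<le> ?F + ennreal (e/C)" .
    show ?thesis by (intro add_mono mult_left_mono r f g) auto
  qed
  also have "\<dots> = ennreal ?K * (ennreal ?l * ?G + ?F) + (ennreal ?K * (ennreal ?l * ennreal (e/C) + ennreal (e/C)) + ennreal L * ennreal (e/C/\<delta>) + ennreal L * ennreal (e/C/\<delta>))"
    by (simp add: distrib_left add_ac)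
  also have "ennreal ?K * (ennreal ?l * ennreal (e/C) + ennreal (e/C)) + ennreal L * ennreal (e/C/\<delta>) + ennreal L * ennreal (e/C/\<delta>)
     = ennreal (?K * (?l * (e/C) + e/C) + L * (e/C/\<delta>) + L * (e/C/\<delta>))"
    using K l L \<delta> C e by (intro ennreal_combine1) auto
  also have "?K * (?l * (e/C) + e/C) + L * (e/C/\<delta>) + L * (e/C/\<delta>) \<le> e"
  proof -
    have "?K * (?l * (e/C) + e/C) + L * (e/C/\<delta>) + L * (e/C/\<delta>) = (e/C) * (C - 1)"
    proof -
      have "?K * (?l * x + x) + L * (x/\<delta>) + L * (x/\<delta>) = x * (C - 1)" for x
        unfolding C_def by (simp add: algebra_simps)
      then show ?thesis .
    qed
    also have "\<dots> \<le> (e/C) * C" using e C by (intro mult_left_mono) auto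
    finally show ?thesis using C by simp
  qed
  then have "ennreal (?K * (?l * (e/C) + e/C) + L * (e/C/\<delta>) + L * (e/C/\<delta>)) \<le> ennreal e" by (rule ennreal_leI)
  finally show "?I \<le> ennreal ?K * (ennreal ?l * ?G + ?F) + ennreal e" by (simp add: add_left_mono)
qed

text \<open>Since \<gamma> \<le> 1, the numbers 1 + 1/\<delta> and 1 + \<gamma>/\<delta> differ at
  most by the factor 1/\<gamma>, so their logarithms differ at most by ln (1/\<gamma>). The bounds
  do not depend on \<delta> and provide the dominating constants for the limit \<delta>
  \<rightarrow> 0.\<close>

lemma log_ratio_bound:
  fixes \<gamma> \<delta> :: real
  assumes "0 < \<gamma>" "\<gamma> \<le> 1" "0 < \<delta>" "\<delta> \<le> 1"
  shows "1 / ln (1 + \<gamma>/\<delta>) * ln (1 + 1/\<delta>) \<le> 1 + ln (1/\<gamma>) / ln (1 + \<gamma>)"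
    and "1 / ln (1 + \<gamma>/\<delta>) \<le> 1 / ln (1 + \<gamma>)" and "0 < ln (1 + \<gamma>/\<delta>)"
proof -
  have "1 + \<gamma> \<le> 1 + \<gamma>/\<delta>" using assms by (simp add: le_divide_eq mult_left_le)
  then have l: "ln (1 + \<gamma>) \<le> ln (1 + \<gamma>/\<delta>)" "0 < ln (1 + \<gamma>)"
    using assms by (auto simp: ln_gt_zero add_pos_pos)
  show "0 < ln (1 + \<gamma>/\<delta>)" "1 / ln (1 + \<gamma>/\<delta>) \<le> 1 / ln (1 + \<gamma>)"
    using l by (auto intro!: divide_left_mono)
  have "1 + 1/\<delta> \<le> (1/\<gamma>) * (1 + \<gamma>/\<delta>)" using assms by (simp add: field_simps)
  then have "ln (1 + 1/\<delta>) \<le> ln ((1/\<gamma>) * (1 + \<gamma>/\<delta>))" using assms by (simp add: add_pos_pos)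
  also have "\<dots> = ln (1/\<gamma>) + ln (1 + \<gamma>/\<delta>)" using assms
    by (subst ln_mult_pos) (auto simp: add_pos_pos)
  finally have "1 / ln (1 + \<gamma>/\<delta>) * ln (1 + 1/\<delta>) \<le> 1 / ln (1 + \<gamma>/\<delta>) * (ln (1/\<gamma>) + ln (1 + \<gamma>/\<delta>))"
    using l by (intro mult_left_mono) auto
  also have "\<dots> = 1 + ln (1/\<gamma>) / ln (1 + \<gamma>/\<delta>)" using l by (simp add: field_simps)
  also have "\<dots> \<le> 1 + ln (1/\<gamma>) / ln (1 + \<gamma>)"
  proof -
    have "0 < ln (1 + \<gamma>/\<delta>) * ln (1 + \<gamma>)"
      by (intro mult_pos_pos l(2) less_le_trans[OF l(2) l(1)])
    then show ?thesis using assms by (intro add_left_mono divide_left_mono[OF l(1)]) auto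
  qed
  finally show "1 / ln (1 + \<gamma>/\<delta>) * ln (1 + 1/\<delta>) \<le> 1 + ln (1/\<gamma>) / ln (1 + \<gamma>)" .
qed

lemma has_grad_lipschitz:
  assumes h: "has_grad \<phi> \<psi>" and C: "\<And>x. norm (\<psi> x) \<le> C"
  shows "\<bar>\<phi> x - \<phi> y\<bar> \<le> C * norm (x - y)"
proof -
  have "norm (\<phi> x - \<phi> y) \<le> C * norm (x - y)"
  proof (rule differentiable_bound[OF convex_UNIV])
    show "(\<phi> has_derivative (\<lambda>h. \<psi> z \<bullet> h)) (at z within UNIV)" for z
      using h by (simp add: has_grad_def)
    show "onorm (\<lambda>h. \<psi> z \<bullet> h) \<le> C" for z
    proof (rule onorm_bound)
      show "0 \<le> C" using C[of z] norm_ge_zero order_trans by blast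
      show "norm (\<psi> z \<bullet> x) \<le> C * norm x" for x
        using order_trans[OF Cauchy_Schwarz_ineq2 mult_right_mono[OF C[of z] norm_ge_zero]] by simp
    qed
  qed auto
  then show ?thesis by simp
qed

text \<open>The order of the choices makes it work. The smooth part is fixed first, so close to
  \<open>f\<close> that the remainder contributes at most e/2 for every \<open>j\<close>, by the
  logarithmic estimate divided by the logarithm. Only then \<open>j\<close> grows, until the
  quotient of the Lipschitz part, bounded by \<open>B\<close>, is made negligible by the factor 1 /
  ln (1 + \<gamma>/d j). The maps may change with \<open>j\<close>, as only their common compression
  constant enters.\<close>

lemma W11_log_limit:
  fixes f :: "'a::euclidean_space \<Rightarrow> real"
  assumes w: "W11 f g" and Y: "\<And>j::nat. compr S L (Y1 j)" "\<And>j. compr S L (Y2 j)"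
    and S[measurable]: "S \<in> sets borel" and fin: "emeasure lborel S < \<infinity>"
    and d: "\<And>j. 0 < d j" "\<And>j. d j \<le> 1" "d \<longlonglongrightarrow> 0" and \<gamma>: "0 < \<gamma>" "\<gamma> \<le> 1"
  shows "(\<lambda>j. ennreal (1 / ln (1 + \<gamma>/d j)) *
    (\<integral>\<^sup>+x\<in>S. ennreal (\<bar>f (Y1 j x) - f (Y2 j x)\<bar> / (d j + norm (Y1 j x - Y2 j x))) \<partial>lborel)) \<longlonglongrightarrow> 0"
proof (rule ennreal_tendsto_0I)
  fix e :: real assume e: "e > 0"
  note [measurable] = W11_measurable[OF w] comprD(1)[OF Y(1)] comprD(1)[OF Y(2)]
  let ?K = "log_const TYPE('a) * L"
  have L: "L \<ge> 0" using comprD[OF Y(1)] by simp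
  have K: "?K \<ge> 0" using L log_const_ge[where 'a='a] by simp
  \<comment> \<open>By \<open>log_ratio_bound\<close>, \<open>M\<close> dominates the normalised
    logarithm together with the normalising factor itself, uniformly in \<open>j\<close>;
    \<open>C\<close> is the resulting cost of the remainder.\<close>
  define M where "M = 1 + ln (1/\<gamma>) / ln (1 + \<gamma>) + 1 / ln (1 + \<gamma>)"
  have M: "M \<ge> 0" unfolding M_def using \<gamma> by auto
  define C where "C = ?K * M + 1"
  have C: "C > 0" unfolding C_def using K M by (intro add_nonneg_pos) auto
  obtain \<phi> \<psi> where h: "has_grad \<phi> \<psi>" "compact_supp \<phi>" "compact_supp \<psi>"
    and a: "(\<integral>\<^sup>+x. \<bar>f x - \<phi> x\<bar> \<partial>lborel) \<le> ennreal (e/(2*C))" "(\<integral>\<^sup>+x. norm (g x - \<psi> x) \<partial>lborel) \<le> ennreal (e/(2*C))"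
    by (rule W11_approx[OF w, of "e/(2*C)"]) (use e C in auto)
  note [measurable] = has_grad_measurable[OF h(1)]
  obtain B where B: "B \<ge> 0" "\<And>x. norm (\<psi> x) \<le> B"
    by (rule compact_supp_bounded[OF h(3)]) (use h(1) in \<open>auto simp: has_grad_def\<close>)
  define s where "s = measure lborel S"
  have s: "emeasure lborel S = ennreal s" "s \<ge> 0" using fin by (auto simp: s_def emeasure_eq_ennreal_measure)
  let ?c = "\<lambda>j. 1 / ln (1 + \<gamma>/d j)"
  have c: "?c j \<ge> 0" for j using log_ratio_bound(3)[OF \<gamma> d(1,2)] by (simp add: less_imp_le)
  have "filterlim (\<lambda>j. \<gamma> / d j) at_top sequentially"
    using \<gamma> d by (intro LIM_at_top_divide[where a=\<gamma>]) (auto intro: always_eventually)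
  then have "filterlim (\<lambda>j. ln (1 + \<gamma> / d j)) at_top sequentially"
    by (intro filterlim_compose[OF ln_at_top] filterlim_tendsto_add_at_top[OF tendsto_const])
  then have c0: "?c \<longlonglongrightarrow> 0"
    by (intro tendsto_divide_0[OF tendsto_const] filterlim_at_top_imp_at_infinity)
  then have "(\<lambda>j. ?c j * (B * s)) \<longlonglongrightarrow> 0" by (rule tendsto_mult_left_zero)
  then have ev: "eventually (\<lambda>j. ?c j * (B * s) < e/2) sequentially"
    using e by (intro order_tendstoD(2)) auto
  show "eventually (\<lambda>j. ennreal (?c j) * (\<integral>\<^sup>+x\<in>S. ennreal (\<bar>f (Y1 j x) - f (Y2 j x)\<bar> / (d j + norm (Y1 j x - Y2 j x))) \<partial>lborel) \<le> ennreal e) sequentially"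
    using ev
  proof eventually_elim
    case (elim j)
    note dj = d(1)[of j] d(2)[of j]
    let ?q = "\<lambda>x. f x - \<phi> x" and ?l = "ln (1 + 1/d j)"
    have l: "?l \<ge> 0" using dj by simp
    have "(\<integral>\<^sup>+x\<in>S. ennreal (\<bar>f (Y1 j x) - f (Y2 j x)\<bar> / (d j + norm (Y1 j x - Y2 j x))) \<partial>lborel)
      \<le> (\<integral>\<^sup>+x. ennreal B * indicator S x + ennreal (\<bar>?q (Y1 j x) - ?q (Y2 j x)\<bar> / (d j + norm (Y1 j x - Y2 j x))) * indicator S x \<partial>lborel)"
    proof (intro nn_integral_mono)
      fix x
      let ?d = "d j + norm (Y1 j x - Y2 j x)"
      have dd: "norm (Y1 j x - Y2 j x) \<le> ?d" "0 < ?d" using dj by (auto intro: add_pos_nonneg)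
      have "\<bar>f (Y1 j x) - f (Y2 j x)\<bar> / ?d \<le> (\<bar>\<phi> (Y1 j x) - \<phi> (Y2 j x)\<bar> + \<bar>?q (Y1 j x) - ?q (Y2 j x)\<bar>) / ?d"
        using dd by (intro divide_right_mono) auto
      also have "\<bar>\<phi> (Y1 j x) - \<phi> (Y2 j x)\<bar> \<le> B * ?d"
        using has_grad_lipschitz[OF h(1) B(2)] dd(1) B(1) by (meson mult_left_mono order_trans)
      finally have "\<bar>f (Y1 j x) - f (Y2 j x)\<bar> / ?d \<le> B + \<bar>?q (Y1 j x) - ?q (Y2 j x)\<bar> / ?d"
        using dd by (simp add: add_divide_distrib divide_right_mono)
      then show "ennreal (\<bar>f (Y1 j x) - f (Y2 j x)\<bar> / ?d) * indicator S x \<le> ennreal B * indicator S x + ennreal (\<bar>?q (Y1 j x) - ?q (Y2 j x)\<bar> / ?d) * indicator S x"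
        using B dd by (auto simp: indicator_def intro!: ennreal_leI simp flip: ennreal_plus)
    qed
    also have "\<dots> = ennreal B * emeasure lborel S + (\<integral>\<^sup>+x\<in>S. ennreal (\<bar>?q (Y1 j x) - ?q (Y2 j x)\<bar> / (d j + norm (Y1 j x - Y2 j x))) \<partial>lborel)"
      by (subst nn_integral_add) (auto simp: nn_integral_cmult_indicator)
    also have "\<dots> \<le> ennreal B * ennreal s + ennreal ?K * (ennreal ?l * ennreal (e/(2*C)) + ennreal (e/(2*C)))"
      unfolding s by (intro add_left_mono order_trans[OF W11_log_estimate[OF W11_diff_smooth[OF w h] dj(1) Y S]] mult_left_mono add_mono a) auto
    also have "\<dots> = ennreal (B * s + ?K * (?l * (e/(2*C)) + e/(2*C)))"
      using B s K l C e by (intro ennreal_combine2) auto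
    finally have "ennreal (?c j) * (\<integral>\<^sup>+x\<in>S. ennreal (\<bar>f (Y1 j x) - f (Y2 j x)\<bar> / (d j + norm (Y1 j x - Y2 j x))) \<partial>lborel)
      \<le> ennreal (?c j) * ennreal (B * s + ?K * (?l * (e/(2*C)) + e/(2*C)))" by (intro mult_left_mono) auto
    also have "\<dots> = ennreal (?c j * (B * s + ?K * (?l * (e/(2*C)) + e/(2*C))))"
      using c by (intro ennreal_mult'[symmetric])
    also have "\<dots> \<le> ennreal e"
    proof (rule ennreal_leI)
      have "?c j * ?l + ?c j \<le> M" using log_ratio_bound(1,2)[OF \<gamma> dj] unfolding M_def by simp
      then have "?K * (?c j * ?l + ?c j) \<le> C" using K unfolding C_def by (meson mult_left_mono le_add_same_cancel1 order_trans zero_le_one)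
      then have "(e/(2*C)) * (?K * (?c j * ?l + ?c j)) \<le> (e/(2*C)) * C" using e C by (intro mult_left_mono) auto
      also have "\<dots> = e/2" using C by simp
      finally have h2: "(e/(2*C)) * (?K * (?c j * ?l + ?c j)) \<le> e/2" .
      have "c * (B * s + ?K * (?l * x + x)) = c * (B * s) + x * (?K * (c * ?l + c))" for c x
        by (simp add: algebra_simps)
      then have "?c j * (B * s + ?K * (?l * (e/(2*C)) + e/(2*C))) = ?c j * (B * s) + (e/(2*C)) * (?K * (?c j * ?l + ?c j))" .
      also have "\<dots> \<le> e/2 + e/2" by (intro add_mono h2 less_imp_le[OF elim])
      finally show "?c j * (B * s + ?K * (?l * (e/(2*C)) + e/(2*C))) \<le> e" by simp
    qed
    finally show ?case .
  qed
qed

section \<open>The logarithm of the distance of two curves\<close>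

definition jmeas :: "(real \<Rightarrow> 'a::euclidean_space \<Rightarrow> 'b::euclidean_space) \<Rightarrow> bool" where
  "jmeas Y \<longleftrightarrow> (\<lambda>p. Y (fst p) (snd p)) \<in> borel_measurable (borel \<Otimes>\<^sub>M borel)"

text \<open>Joint measurability in a form closed under composition: instances of it are declared as
  measurability rules, so that nested terms such as \<open>u r (Y r x)\<close> are recognised as
  measurable.\<close>

lemma jmeasD:
  assumes "jmeas Y" and [measurable]: "f \<in> borel_measurable M" "g \<in> borel_measurable M"
  shows "(\<lambda>w. Y (f w) (g w)) \<in> borel_measurable M"
proof -
  have [measurable]: "(\<lambda>p. Y (fst p) (snd p)) \<in> borel_measurable (borel \<Otimes>\<^sub>M borel)"
    using assms by (simp add: jmeas_def)
  have "(\<lambda>w. (\<lambda>p. Y (fst p) (snd p)) (f w, g w)) \<in> borel_measurable M" by measurable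
  then show ?thesis by simp
qed

lemma LBINT_singleton:
  fixes z :: "real \<Rightarrow> 'a::{banach, second_countable_topology}"
  shows "(LBINT r:{a..a}. z r) = 0"
  unfolding set_lebesgue_integral_def
proof (rule integral_eq_zero_AE)
  show "AE r in lborel. indicator {a..a} r *\<^sub>R z r = 0"
    using AE_lborel_singleton[of a] by eventually_elim (auto simp: indicator_def)
qed

lemma continuous_on_set_lebesgue_integral:
  fixes z :: "real \<Rightarrow> 'a::euclidean_space"
  assumes "set_integrable lborel {0..T} z"
  shows "continuous_on {0..T} (\<lambda>t. LBINT r:{0..t}. z r)"
proof -
  have i: "set_integrable lborel {0..t} z" if "t \<in> {0..T}" for t
    by (rule set_integrable_subset[OF assms]) (use that in auto)
  have "continuous_on {0..T} (\<lambda>t. integral {0..t} z)"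
    by (intro indefinite_integral_continuous_1 set_borel_integral_eq_integral(1) assms)
  then show ?thesis
    by (rule continuous_on_cong[THEN iffD1, rotated -1])
      (auto simp: set_borel_integral_eq_integral(2)[OF i])
qed

text \<open>The interval is half-open, so that the pieces of a grid are disjoint and their integrals
  add up.\<close>

lemma norm_increment_le:
  fixes z :: "real \<Rightarrow> 'a::euclidean_space"
  assumes zi: "set_integrable lborel {0..T} z" and t: "0 \<le> a" "a \<le> b" "b \<le> T"
  shows "ennreal (norm ((LBINT r:{0..b}. z r) - (LBINT r:{0..a}. z r))) \<le> (\<integral>\<^sup>+r\<in>{a..<b}. norm (z r) \<partial>lborel)"
proof -
  have i: "set_integrable lborel {0..t} z" if "t \<in> {0..T}" for t
    by (rule set_integrable_subset[OF zi]) (use that in auto)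
  have "(LBINT r:{0..b}. z r) - (LBINT r:{0..a}. z r) = (LBINT r. indicator {0..b} r *\<^sub>R z r - indicator {0..a} r *\<^sub>R z r)"
    using i[of a] i[of b] t unfolding set_lebesgue_integral_def set_integrable_def by (intro Bochner_Integration.integral_diff[symmetric]) auto
  also have "ennreal (norm \<dots>) \<le> (\<integral>\<^sup>+r. ennreal (norm (indicator {0..b} r *\<^sub>R z r - indicator {0..a} r *\<^sub>R z r)) \<partial>lborel)"
    using i[of a] i[of b] t unfolding set_integrable_def by (intro integral_norm_bound_ennreal Bochner_Integration.integrable_diff) auto
  also have "\<dots> \<le> (\<integral>\<^sup>+r\<in>{a..<b}. norm (z r) \<partial>lborel)"
  proof (rule nn_integral_mono_AE)
    show "AE r in lborel. ennreal (norm (indicator {0..b} r *\<^sub>R z r - indicator {0..a} r *\<^sub>R z r)) \<le> ennreal (norm (z r)) * indicator {a..<b} r"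
      using AE_lborel_singleton[of b] by eventually_elim (use t in \<open>auto simp: indicator_def\<close>)
  qed
  finally show ?thesis .
qed

lemma ln_shift_increment:
  fixes a b \<delta> :: real
  assumes "\<delta> > 0" "0 \<le> a" "0 \<le> b"
  shows "ln (1 + b/\<delta>) - ln (1 + a/\<delta>) \<le> (b - a) / (\<delta> + a)"
proof -
  have e: "1 + b/\<delta> = (\<delta> + b) / \<delta>" "1 + a/\<delta> = (\<delta> + a) / \<delta>"
    using assms by (auto simp: add_divide_distrib)
  have "ln (1 + b/\<delta>) - ln (1 + a/\<delta>) = ln ((\<delta> + b) / (\<delta> + a))"
    unfolding e using assms by (simp add: ln_divide_pos)
  also have "\<dots> \<le> (\<delta> + b) / (\<delta> + a) - 1"
    using assms by (intro ln_le_minus_one divide_pos_pos) auto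
  also have "\<dots> = (b - a) / (\<delta> + a)"
    using assms by (simp add: divide_simps)
  finally show ?thesis .
qed

text \<open>Replacing the chain rule for absolutely continuous curves: on a fine grid, concavity of the logarithm bounds
  its increments by \<open>\<integral> \<bar>z\<bar> / (\<delta> + \<bar>Z\<bar>)\<close> with \<open>Z\<close> frozen at the left grid point.\<close>

lemma ln_norm_bound:
  fixes z :: "real \<Rightarrow> 'a::euclidean_space"
  assumes zi: "set_integrable lborel {0..T} z" and zm[measurable]: "z \<in> borel_measurable borel"
    and Z: "\<And>t. t \<in> {0..T} \<Longrightarrow> Z t = (LBINT r:{0..t}. z r)" and \<delta>: "\<delta> > 0" and t: "t \<in> {0..T}"
  shows "ennreal (ln (1 + norm (Z t) / \<delta>)) \<le> (\<integral>\<^sup>+r\<in>{0..T}. ennreal (norm (z r) / (\<delta> + norm (Z r))) \<partial>lborel)"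
proof (cases "t = 0")
  case True
  have "Z 0 = 0" using Z[of 0] t LBINT_singleton[of 0 z] by auto
  then show ?thesis using True by simp
next
  case False
  then have t0: "0 < t" "t \<le> T" using t by auto
  have Zc: "continuous_on {0..T} Z"
    using continuous_on_set_lebesgue_integral[OF zi]
    by (rule continuous_on_cong[THEN iffD1, rotated -1]) (auto simp: Z)
  \<comment> \<open>\<open>Z\<close> is known only on the time interval; its cut-off is Borel on the
    whole line.\<close>
  define Z' where "Z' r = indicator {0..T} r *\<^sub>R Z r" for r
  have [measurable]: "Z' \<in> borel_measurable borel"
    unfolding Z'_def by (rule borel_measurable_continuous_on_indicator[OF _ Zc]) simp
  have Z': "Z' r = Z r" if "r \<in> {0..T}" for r using that by (simp add: Z'_def)
  \<comment> \<open>\<open>s n r\<close> rounds \<open>r\<close> down to the grid of mesh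
    \<open>t / (n + 1)\<close>. The mesh divides \<open>t\<close>, so that \<open>t\<close> itself
    is the grid point of index \<open>n + 1\<close>.\<close>
  define s where "s n r = (t / real (Suc n)) * real_of_int \<lfloor>r / (t / real (Suc n))\<rfloor>" for n r
  have [measurable]: "s n \<in> borel_measurable borel" for n unfolding s_def by measurable
  have s_bd: "s n r \<le> r" "r - s n r \<le> t / real (Suc n)" "0 \<le> r \<Longrightarrow> 0 \<le> s n r" for n r
  proof -
    define h where "h = t / real (Suc n)"
    have h: "h > 0" using t0 by (simp add: h_def)
    have "h * (r/h - 1) \<le> h * of_int \<lfloor>r/h\<rfloor>" "h * of_int \<lfloor>r/h\<rfloor> \<le> h * (r/h)"
      using h by (intro mult_left_mono; linarith)+
    then show "s n r \<le> r" "r - s n r \<le> t / real (Suc n)"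
      using h unfolding s_def h_def[symmetric] by (auto simp: algebra_simps)
    show "0 \<le> r \<Longrightarrow> 0 \<le> s n r" using h unfolding s_def h_def[symmetric] by simp
  qed
  let ?v = "\<lambda>n r. ennreal (norm (z r) / (\<delta> + norm (Z' (s n r))))"
  have grid: "ennreal (ln (1 + norm (Z t) / \<delta>)) \<le> (\<integral>\<^sup>+r. ?v n r * indicator {0..<t} r \<partial>lborel)" for n
  proof -
    define h where "h = t / real (Suc n)"
    have h: "h > 0" "h * real (Suc n) = t" using t0 by (auto simp: h_def)
    have "ennreal (ln (1 + norm (Z (real k * h)) / \<delta>)) \<le> (\<integral>\<^sup>+r. ?v n r * indicator {0..<real k * h} r \<partial>lborel)"
      if "k \<le> Suc n" for k
      using that
    proof (induction k)
      case 0
      have "Z 0 = 0" using Z[of 0] t0 LBINT_singleton[of 0 z] by auto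
      then show ?case by simp
    next
      case (Suc k)
      let ?a = "real k * h" and ?b = "real (Suc k) * h"
      have "?b \<le> real (Suc n) * h" using Suc.prems h by (intro mult_right_mono) auto
      also have "\<dots> = t" using h(2) by (simp only: mult.commute)
      finally have bT: "?b \<le> T" using t0 by simp
      have "?a \<le> ?b" using h by (intro mult_right_mono) auto
      then have ab: "0 \<le> ?a" "?a \<le> ?b" "?b \<le> T" using h bT by auto
      let ?A = "norm (Z ?a)" and ?B = "norm (Z ?b)"
      have "ln (1 + ?B/\<delta>) - ln (1 + ?A/\<delta>) \<le> (?B - ?A) / (\<delta> + ?A)"
        using \<delta> by (intro ln_shift_increment) auto
      also have "\<dots> \<le> norm (Z ?b - Z ?a) / (\<delta> + ?A)"
        using \<delta> by (intro divide_right_mono norm_triangle_ineq2 add_nonneg_nonneg) auto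
      finally have "ln (1 + ?B/\<delta>) \<le> ln (1 + ?A/\<delta>) + norm (Z ?b - Z ?a) / (\<delta> + ?A)" by simp
      then have inc: "ennreal (ln (1 + ?B/\<delta>)) \<le> ennreal (ln (1 + ?A/\<delta>)) + ennreal (norm (Z ?b - Z ?a) / (\<delta> + ?A))"
        using \<delta> by (simp add: ennreal_leI flip: ennreal_plus)
      have "ennreal (norm (Z ?b - Z ?a) / (\<delta> + ?A)) = ennreal (1 / (\<delta> + ?A)) * ennreal (norm (Z ?b - Z ?a))"
        using \<delta> by (simp add: ennreal_mult'[symmetric] add_nonneg_nonneg)
      also have "\<dots> \<le> ennreal (1 / (\<delta> + ?A)) * (\<integral>\<^sup>+r\<in>{?a..<?b}. norm (z r) \<partial>lborel)"
        using norm_increment_le[OF zi ab] Z[of ?a] Z[of ?b] ab by (intro mult_left_mono) auto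
      also have "\<dots> = (\<integral>\<^sup>+r. ennreal (1 / (\<delta> + ?A)) * (ennreal (norm (z r)) * indicator {?a..<?b} r) \<partial>lborel)"
        by (subst nn_integral_cmult) auto
      also have "\<dots> = (\<integral>\<^sup>+r. ?v n r * indicator {?a..<?b} r \<partial>lborel)"
      proof (intro nn_integral_cong)
        fix r
        show "ennreal (1 / (\<delta> + ?A)) * (ennreal (norm (z r)) * indicator {?a..<?b} r) = ?v n r * indicator {?a..<?b} r"
        proof (cases "r \<in> {?a..<?b}")
          case True
          have "\<lfloor>r / h\<rfloor> = int k"
            using True h by (intro floor_unique) (auto simp: le_divide_eq divide_less_eq add.commute)
          then have "s n r = ?a" unfolding s_def h_def[symmetric] by simp
          then have "Z' (s n r) = Z ?a" using ab by (simp add: Z')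
          then show ?thesis using True \<delta> by (simp add: ennreal_mult'[symmetric] add_nonneg_nonneg)
        qed auto
      qed
      finally have "ennreal (ln (1 + ?B/\<delta>)) \<le> (\<integral>\<^sup>+r. ?v n r * indicator {0..<?a} r \<partial>lborel) + (\<integral>\<^sup>+r. ?v n r * indicator {?a..<?b} r \<partial>lborel)"
        using Suc by (intro order_trans[OF inc] add_mono) auto
      also have "\<dots> = (\<integral>\<^sup>+r. ?v n r * indicator {0..<?b} r \<partial>lborel)"
        using ab by (subst nn_integral_add[symmetric]) (auto intro!: nn_integral_cong simp: indicator_def)
      finally show ?case .
    qed
    from this[of "Suc n"] show ?thesis using h by (simp add: mult.commute)
  qed
  \<comment> \<open>Continuity of \<open>Z\<close> unfreezes the denominators as the mesh shrinks.
    All of them are at least \<delta>, so |z| / \<delta> is an integrable majorant.\<close>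
  have "(\<lambda>n. \<integral>\<^sup>+r. ?v n r * indicator {0..<t} r \<partial>lborel) \<longlonglongrightarrow> (\<integral>\<^sup>+r. ennreal (norm (z r) / (\<delta> + norm (Z' r))) * indicator {0..<t} r \<partial>lborel)"
  proof (rule nn_integral_dominated_convergence[where w="\<lambda>r. ennreal (1/\<delta>) * ennreal (norm (indicator {0..T} r *\<^sub>R z r))"])
    have "norm (z r) / (\<delta> + norm (Z' (s j r))) \<le> 1 / \<delta> * norm (z r)" for j r
      using \<delta> divide_left_mono[of \<delta> "\<delta> + norm (Z' (s j r))" "norm (z r)"] by (simp add: mult_pos_pos add_pos_nonneg)
    then show "AE r in lborel. ?v j r * indicator {0..<t} r \<le> ennreal (1/\<delta>) * ennreal (norm (indicator {0..T} r *\<^sub>R z r))" for j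
      using t0 \<delta> by (intro AE_I2) (auto simp: indicator_def ennreal_mult'[symmetric] intro!: ennreal_leI)
    show "(\<integral>\<^sup>+r. ennreal (1/\<delta>) * ennreal (norm (indicator {0..T} r *\<^sub>R z r)) \<partial>lborel) < \<infinity>"
      using zi by (subst nn_integral_cmult) (auto simp: set_integrable_def integrable_iff_bounded ennreal_mult_less_top)
    show "AE r in lborel. (\<lambda>n. ?v n r * indicator {0..<t} r) \<longlonglongrightarrow> ennreal (norm (z r) / (\<delta> + norm (Z' r))) * indicator {0..<t} r"
    proof (rule AE_I2)
      fix r :: real
      show "(\<lambda>n. ?v n r * indicator {0..<t} r) \<longlonglongrightarrow> ennreal (norm (z r) / (\<delta> + norm (Z' r))) * indicator {0..<t} r"
      proof (cases "r \<in> {0..<t}")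
        case True
        have "(\<lambda>n. t / real (Suc n)) \<longlonglongrightarrow> 0"
          using LIMSEQ_Suc[OF lim_const_over_n[of t]] by simp
        then have "(\<lambda>n. r - t / real (Suc n)) \<longlonglongrightarrow> r - 0" by (intro tendsto_diff tendsto_const)
        then have lo: "(\<lambda>n. r - t / real (Suc n)) \<longlonglongrightarrow> r" by simp
        have lo': "r - t / real (Suc n) \<le> s n r" for n
          using s_bd(2)[where n=n and r=r] by linarith
        have sr: "(\<lambda>n. s n r) \<longlonglongrightarrow> r"
          by (rule tendsto_sandwich[OF always_eventually[OF allI[OF lo']] always_eventually[OF allI[OF s_bd(1)]] lo tendsto_const])
        have in_T: "s n r \<in> {0..T}" for n using s_bd[where n=n and r=r] True t0 by auto
        have "(\<lambda>n. Z (s n r)) \<longlonglongrightarrow> Z r"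
          by (rule continuous_on_tendsto_compose[OF Zc sr _ always_eventually[OF allI[OF in_T]]]) (use True t0 in auto)
        then have "(\<lambda>n. Z' (s n r)) \<longlonglongrightarrow> Z' r" using in_T True t0 by (simp add: Z')
        then have "(\<lambda>n. norm (z r) / (\<delta> + norm (Z' (s n r)))) \<longlonglongrightarrow> norm (z r) / (\<delta> + norm (Z' r))"
          using \<delta> add_pos_nonneg[of \<delta> "norm (Z' r)"] by (intro tendsto_intros) auto
        then show ?thesis using True by simp
      qed auto
    qed
  qed measurable
  then have "ennreal (ln (1 + norm (Z t) / \<delta>)) \<le> (\<integral>\<^sup>+r. ennreal (norm (z r) / (\<delta> + norm (Z' r))) * indicator {0..<t} r \<partial>lborel)"
    by (rule LIMSEQ_le_const) (use grid in auto)
  also have "\<dots> \<le> (\<integral>\<^sup>+r\<in>{0..T}. ennreal (norm (z r) / (\<delta> + norm (Z r))) \<partial>lborel)"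
    using t0 by (intro nn_integral_mono) (auto simp: indicator_def Z')
  finally show ?thesis .
qed

section \<open>Stability and uniqueness\<close>

text \<open>A vector field in W^{1,1} with bounds: \<open>g e\<close> is the gradient of the
  component along \<open>e\<close>, so the last sum is the divergence, bounded almost everywhere by
  \<open>d\<close>, while \<open>a\<close> bounds the L^1 norm of each gradient.\<close>

definition slice :: "('a::euclidean_space \<Rightarrow> 'a) \<Rightarrow> real \<Rightarrow> real \<Rightarrow> bool" where
  "slice f a d \<longleftrightarrow> (\<exists>g. (\<forall>e\<in>Basis. W11 (\<lambda>x. f x \<bullet> e) (g e) \<and> (\<integral>\<^sup>+x. norm (g e x) \<partial>lborel) \<le> ennreal a)
     \<and> (AE x in lborel. \<bar>\<Sum>e\<in>Basis. g e x \<bullet> e\<bar> \<le> d))"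

text \<open>The regularity of slices is demanded at every time rather than almost every time; a
  field meets this after being set to zero at its exceptional times. Time starts at 0 and runs
  forwards; other starting times and the backward direction come from shifting and reflecting the
  field.\<close>

locale sobolev_field =
  fixes u :: "real \<Rightarrow> 'a::euclidean_space \<Rightarrow> 'a" and A D :: "real \<Rightarrow> real"
  assumes u_jmeas: "jmeas u"
    and A_measurable[measurable]: "A \<in> borel_measurable borel" and D_measurable[measurable]: "D \<in> borel_measurable borel"
    and A_nonneg: "0 \<le> A r" and D_nonneg: "0 \<le> D r"
    and u_int: "(\<integral>\<^sup>+r\<in>{0..T}. \<integral>\<^sup>+x. norm (u r x) \<partial>lborel \<partial>lborel) < \<infinity>"
    and A_int: "(\<integral>\<^sup>+r\<in>{0..T}. A r \<partial>lborel) < \<infinity>"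
    and D_int: "(\<integral>\<^sup>+r\<in>{0..T}. D r \<partial>lborel) < \<infinity>"
    and slice: "slice (u r) (A r) (D r)"
begin

lemmas u_meas[measurable (raw)] = jmeasD[OF u_jmeas]

lemma slice_log_estimate:
  assumes \<delta>: "\<delta> > 0" and Y: "compr S L Y1" "compr S L Y2" and S[measurable]: "S \<in> sets borel"
  shows "(\<integral>\<^sup>+x\<in>S. ennreal (norm (u r (Y1 x) - u r (Y2 x)) / (\<delta> + norm (Y1 x - Y2 x))) \<partial>lborel)
    \<le> ennreal (DIM('a) * (log_const TYPE('a) * L)) * (ennreal (ln (1 + 1/\<delta>)) * ennreal (A r) + (\<integral>\<^sup>+x. norm (u r x) \<partial>lborel))"
    and slice_le_components: "(\<integral>\<^sup>+x\<in>S. ennreal (norm (u r (Y1 x) - u r (Y2 x)) / (\<delta> + norm (Y1 x - Y2 x))) \<partial>lborel)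
      \<le> (\<Sum>e\<in>Basis. \<integral>\<^sup>+x\<in>S. ennreal (\<bar>u r (Y1 x) \<bullet> e - u r (Y2 x) \<bullet> e\<bar> / (\<delta> + norm (Y1 x - Y2 x))) \<partial>lborel)"
proof -
  note [measurable] = comprD(1)[OF Y(1)] comprD(1)[OF Y(2)]
  have L: "L \<ge> 0" using comprD[OF Y(1)] by simp
  obtain g where g: "\<And>e. e \<in> Basis \<Longrightarrow> W11 (\<lambda>x. u r x \<bullet> e) (g e)" "\<And>e. e \<in> Basis \<Longrightarrow> (\<integral>\<^sup>+x. norm (g e x) \<partial>lborel) \<le> ennreal (A r)"
    using slice[of r] by (auto simp: slice_def)
  let ?K = "log_const TYPE('a) * L"
  let ?U = "ennreal (ln (1 + 1/\<delta>)) * ennreal (A r) + (\<integral>\<^sup>+x. norm (u r x) \<partial>lborel)"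
  have "(\<integral>\<^sup>+x\<in>S. ennreal (norm (u r (Y1 x) - u r (Y2 x)) / (\<delta> + norm (Y1 x - Y2 x))) \<partial>lborel)
    \<le> (\<integral>\<^sup>+x. (\<Sum>e\<in>Basis. ennreal (\<bar>u r (Y1 x) \<bullet> e - u r (Y2 x) \<bullet> e\<bar> / (\<delta> + norm (Y1 x - Y2 x))) * indicator S x) \<partial>lborel)"
  proof (intro nn_integral_mono)
    fix x
    let ?d = "\<delta> + norm (Y1 x - Y2 x)"
    have d: "?d > 0" using \<delta> by (intro add_pos_nonneg) auto
    have "norm (u r (Y1 x) - u r (Y2 x)) / ?d \<le> (\<Sum>e\<in>Basis. \<bar>(u r (Y1 x) - u r (Y2 x)) \<bullet> e\<bar>) / ?d"
      using d by (intro divide_right_mono norm_le_l1) auto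
    also have "\<dots> = (\<Sum>e\<in>Basis. \<bar>u r (Y1 x) \<bullet> e - u r (Y2 x) \<bullet> e\<bar> / ?d)"
      by (simp add: sum_divide_distrib inner_diff_left)
    finally have "ennreal (norm (u r (Y1 x) - u r (Y2 x)) / ?d) \<le> (\<Sum>e\<in>Basis. ennreal (\<bar>u r (Y1 x) \<bullet> e - u r (Y2 x) \<bullet> e\<bar> / ?d))"
      using d by (subst sum_ennreal) (auto intro!: ennreal_leI)
    then show "ennreal (norm (u r (Y1 x) - u r (Y2 x)) / ?d) * indicator S x \<le> (\<Sum>e\<in>Basis. ennreal (\<bar>u r (Y1 x) \<bullet> e - u r (Y2 x) \<bullet> e\<bar> / ?d) * indicator S x)"
      by (auto simp: indicator_def)
  qed
  also have "\<dots> = (\<Sum>e\<in>Basis. \<integral>\<^sup>+x\<in>S. ennreal (\<bar>u r (Y1 x) \<bullet> e - u r (Y2 x) \<bullet> e\<bar> / (\<delta> + norm (Y1 x - Y2 x))) \<partial>lborel)"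
    by (subst nn_integral_sum) auto
  finally show *: "(\<integral>\<^sup>+x\<in>S. ennreal (norm (u r (Y1 x) - u r (Y2 x)) / (\<delta> + norm (Y1 x - Y2 x))) \<partial>lborel) \<le> \<dots>" .
  also have "\<dots> \<le> (\<Sum>e\<in>(Basis::'a set). ennreal ?K * ?U)"
  proof (rule sum_mono)
    fix e :: 'a assume e: "e \<in> Basis"
    have "(\<integral>\<^sup>+x. \<bar>u r x \<bullet> e\<bar> \<partial>lborel) \<le> (\<integral>\<^sup>+x. norm (u r x) \<partial>lborel)"
      by (intro nn_integral_mono ennreal_leI Basis_le_norm e)
    then show "(\<integral>\<^sup>+x\<in>S. ennreal (\<bar>u r (Y1 x) \<bullet> e - u r (Y2 x) \<bullet> e\<bar> / (\<delta> + norm (Y1 x - Y2 x))) \<partial>lborel) \<le> ennreal ?K * ?U"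
      by (intro order_trans[OF W11_log_estimate[OF g(1)[OF e] \<delta> Y S]] mult_left_mono add_mono g(2) e) auto
  qed
  also have "\<dots> = ennreal (DIM('a) * ?K) * ?U"
    using L log_const_ge[where 'a='a] by (simp add: ennreal_mult ennreal_of_nat_eq_real_of_nat mult.assoc)
  finally show "(\<integral>\<^sup>+x\<in>S. ennreal (norm (u r (Y1 x) - u r (Y2 x)) / (\<delta> + norm (Y1 x - Y2 x))) \<partial>lborel) \<le> ennreal (DIM('a) * ?K) * ?U" .
qed

lemma slice_log_limit:
  assumes Y: "\<And>j::nat. compr S L (Y1 j)" "\<And>j. compr S L (Y2 j)"
    and S[measurable]: "S \<in> sets borel" and fin: "emeasure lborel S < \<infinity>"
    and d: "\<And>j. 0 < d j" "\<And>j. d j \<le> 1" "d \<longlonglongrightarrow> 0" and \<gamma>: "0 < \<gamma>" "\<gamma> \<le> 1"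
  shows "(\<lambda>j. ennreal (1 / ln (1 + \<gamma>/d j)) *
    (\<integral>\<^sup>+x\<in>S. ennreal (norm (u r (Y1 j x) - u r (Y2 j x)) / (d j + norm (Y1 j x - Y2 j x))) \<partial>lborel)) \<longlonglongrightarrow> 0"
proof -
  obtain g where g: "\<And>e. e \<in> Basis \<Longrightarrow> W11 (\<lambda>x. u r x \<bullet> e) (g e)"
    using slice[of r] by (auto simp: slice_def)
  have "(\<lambda>j. \<Sum>e\<in>(Basis::'a set). ennreal (1 / ln (1 + \<gamma>/d j)) *
    (\<integral>\<^sup>+x\<in>S. ennreal (\<bar>u r (Y1 j x) \<bullet> e - u r (Y2 j x) \<bullet> e\<bar> / (d j + norm (Y1 j x - Y2 j x))) \<partial>lborel)) \<longlonglongrightarrow> (\<Sum>e\<in>(Basis::'a set). 0)"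
    by (intro tendsto_sum W11_log_limit[OF g Y S fin d \<gamma>])
  then have *: "(\<lambda>j. \<Sum>e\<in>(Basis::'a set). ennreal (1 / ln (1 + \<gamma>/d j)) *
    (\<integral>\<^sup>+x\<in>S. ennreal (\<bar>u r (Y1 j x) \<bullet> e - u r (Y2 j x) \<bullet> e\<bar> / (d j + norm (Y1 j x - Y2 j x))) \<partial>lborel)) \<longlonglongrightarrow> 0" by simp
  show ?thesis
    by (rule tendsto_sandwich[OF _ _ tendsto_const *])
      (auto simp: sum_distrib_left[symmetric] intro!: always_eventually mult_left_mono slice_le_components[OF d(1) Y S])
qed

text \<open>\<open>w\<close> is the velocity of the curves \<open>Y\<close>; they solve the equation up to an \<open>L\<^sup>1\<close> error \<open>e\<close>.\<close>

definition approx_flow :: "'a set \<Rightarrow> real \<Rightarrow> real \<Rightarrow> real \<Rightarrow> (real \<Rightarrow> 'a \<Rightarrow> 'a) \<Rightarrow> (real \<Rightarrow> 'a \<Rightarrow> 'a) \<Rightarrow> bool" where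
  "approx_flow S T L e Y w \<longleftrightarrow> jmeas Y \<and> jmeas w \<and> (\<forall>r\<in>{0..T}. compr S L (Y r)) \<and>
    (AE x in lborel. x \<in> S \<longrightarrow> set_integrable lborel {0..T} (\<lambda>r. w r x) \<and> (\<forall>t\<in>{0..T}. Y t x = Y 0 x + (LBINT r:{0..t}. w r x))) \<and>
    (\<integral>\<^sup>+r\<in>{0..T}. \<integral>\<^sup>+x\<in>S. norm (w r x - u r (Y r x)) \<partial>lborel \<partial>lborel) \<le> ennreal e"

text \<open>The time integral of the logarithmic quotient, divided by \<open>ln (1 + \<gamma> / \<delta>)\<close>, tends to zero by dominated
  convergence in time; the choice \<open>\<delta> = 1 / (j + 1) \<ge> e\<close> absorbs the error terms.\<close>

lemma stability_seq:
  assumes S[measurable]: "S \<in> sets borel" and fin: "emeasure lborel S < \<infinity>" and T: "0 \<le> T" and \<gamma>: "0 < \<gamma>" "\<gamma> \<le> 1"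
    and a1: "\<And>j::nat. approx_flow S T L (1 / Suc j) (Y1 j) (w1 j)" and a2: "\<And>j. approx_flow S T L (1 / Suc j) (Y2 j) (w2 j)"
    and init: "\<And>j. AE x in lborel. x \<in> S \<longrightarrow> Y1 j 0 x = Y2 j 0 x"
  shows "\<exists>B. (\<forall>j. B j \<in> sets borel \<and> B j \<subseteq> S \<and> (AE x in lborel. x \<in> S - B j \<longrightarrow> (\<forall>t\<in>{0..T}. norm (Y1 j t x - Y2 j t x) \<le> \<gamma>)))
    \<and> (\<lambda>j. emeasure lborel (B j)) \<longlonglongrightarrow> 0"
proof -
  have jm: "jmeas (Y1 j)" "jmeas (Y2 j)" "jmeas (w1 j)" "jmeas (w2 j)" for j
    using a1[of j] a2[of j] by (auto simp: approx_flow_def)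
  note [measurable (raw)] = jm[THEN jmeasD]
  have Y: "compr S L (Y1 j r)" "compr S L (Y2 j r)" if "r \<in> {0..T}" for j r
    using that a1[of j] a2[of j] by (auto simp: approx_flow_def)
  define d where "d j = 1 / real (Suc j)" for j
  have d: "\<And>j. 0 < d j" "\<And>j. d j \<le> 1" "d \<longlonglongrightarrow> 0"
    unfolding d_def using LIMSEQ_Suc[OF lim_1_over_n] by (auto simp: field_simps)
  let ?c = "\<lambda>j. 1 / ln (1 + \<gamma>/d j)"
  have cpos: "0 < ln (1 + \<gamma>/d j)" for j by (rule log_ratio_bound(3)[OF \<gamma> d(1,2)])
  let ?N = "\<lambda>j r x. norm (Y1 j r x - Y2 j r x)"
  let ?q = "\<lambda>j r x. ennreal (norm (w1 j r x - w2 j r x) / (d j + ?N j r x))"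
  define F where "F j x = ennreal (?c j) * (\<integral>\<^sup>+r\<in>{0..T}. ?q j r x \<partial>lborel)" for j x
  have [measurable]: "F j \<in> borel_measurable borel" for j unfolding F_def by measurable
  \<comment> \<open>Chebyshev: \<open>F j x < 1\<close> says, through \<open>ln_norm_bound\<close>,
    that ln (1 + |Y1 - Y2| / d j) stays below ln (1 + \<gamma> / d j), that is, the curves from
    \<open>x\<close> stay \<gamma>-close for all times at once.\<close>
  define B where "B j = {x\<in>S. 1 \<le> F j x}" for j
  have B: "B j \<in> sets borel" "B j \<subseteq> S" for j unfolding B_def by auto
  have good: "AE x in lborel. x \<in> S - B j \<longrightarrow> (\<forall>t\<in>{0..T}. ?N j t x \<le> \<gamma>)" for j
  proof -
    have "AE x in lborel. x \<in> S \<longrightarrow> set_integrable lborel {0..T} (\<lambda>r. w1 j r x) \<and> (\<forall>t\<in>{0..T}. Y1 j t x = Y1 j 0 x + (LBINT r:{0..t}. w1 j r x))"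
      "AE x in lborel. x \<in> S \<longrightarrow> set_integrable lborel {0..T} (\<lambda>r. w2 j r x) \<and> (\<forall>t\<in>{0..T}. Y2 j t x = Y2 j 0 x + (LBINT r:{0..t}. w2 j r x))"
      using a1[of j] a2[of j] by (auto simp: approx_flow_def)
    with init[of j] show ?thesis
    proof eventually_elim
      case (elim x)
      show ?case
      proof (intro impI ballI)
        fix t assume x: "x \<in> S - B j" and t: "t \<in> {0..T}"
        let ?z = "\<lambda>r. w1 j r x - w2 j r x"
        have i: "set_integrable lborel {0..T} (\<lambda>r. w1 j r x)" "set_integrable lborel {0..T} (\<lambda>r. w2 j r x)"
          using conjunct1[OF mp[OF elim(2)]] conjunct1[OF mp[OF elim(3)]] x by simp_all
        have "ennreal (ln (1 + ?N j t x / d j)) \<le> (\<integral>\<^sup>+r\<in>{0..T}. ?q j r x \<partial>lborel)"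
        proof (rule ln_norm_bound[where Z="\<lambda>t. Y1 j t x - Y2 j t x", OF set_integral_diff(1)[OF i] _ _ d(1) t])
          fix s assume s: "s \<in> {0..T}"
          have i': "set_integrable lborel {0..s} (\<lambda>r. w1 j r x)" "set_integrable lborel {0..s} (\<lambda>r. w2 j r x)"
            using i s by (auto intro: set_integrable_subset)
          show "Y1 j s x - Y2 j s x = (LBINT r:{0..s}. w1 j r x - w2 j r x)"
          proof -
            have "Y1 j s x = Y1 j 0 x + (LBINT r:{0..s}. w1 j r x)" "Y2 j s x = Y2 j 0 x + (LBINT r:{0..s}. w2 j r x)" "Y1 j 0 x = Y2 j 0 x"
              using bspec[OF conjunct2[OF mp[OF elim(2)]] s] bspec[OF conjunct2[OF mp[OF elim(3)]] s] mp[OF elim(1)] x by simp_all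
            then show ?thesis unfolding set_integral_diff(2)[OF i'] by simp
          qed
        qed measurable
        then have "ennreal (?c j) * ennreal (ln (1 + ?N j t x / d j)) \<le> F j x"
          unfolding F_def by (intro mult_left_mono) auto
        also have "F j x < 1" using x by (auto simp: B_def)
        finally have lt: "ennreal (?c j) * ennreal (ln (1 + ?N j t x / d j)) < 1" .
        have "?c j * ln (1 + ?N j t x / d j) < 1"
        proof (rule ccontr)
          assume "\<not> ?c j * ln (1 + ?N j t x / d j) < 1"
          then have "ennreal 1 \<le> ennreal (?c j * ln (1 + ?N j t x / d j))" by (intro ennreal_leI) simp
          also have "\<dots> = ennreal (?c j) * ennreal (ln (1 + ?N j t x / d j))"
            using cpos[of j] by (intro ennreal_mult') simp
          finally show False using lt by simp
        qed
        then have "ln (1 + ?N j t x / d j) < ln (1 + \<gamma>/d j)"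
          using cpos[of j] by (simp add: divide_less_eq)
        moreover have "0 < 1 + ?N j t x / d j" "0 < 1 + \<gamma>/d j"
          using d(1)[of j] \<gamma> by (intro add_pos_nonneg divide_nonneg_pos; simp)+
        ultimately have "1 + ?N j t x / d j < 1 + \<gamma>/d j" by simp
        then show "?N j t x \<le> \<gamma>" using d(1)[of j] by (simp add: divide_less_cancel)
      qed
    qed
  qed
  let ?I = "\<lambda>j r. \<integral>\<^sup>+x\<in>S. ennreal (norm (u r (Y1 j r x) - u r (Y2 j r x)) / (d j + ?N j r x)) \<partial>lborel"
  let ?U = "\<lambda>r. \<integral>\<^sup>+x. norm (u r x) \<partial>lborel"
  have main: "(\<lambda>j. \<integral>\<^sup>+r. ennreal (?c j) * ?I j r * indicator {0..T} r \<partial>lborel) \<longlonglongrightarrow> integral\<^sup>N lborel (\<lambda>r::real. 0)"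
  proof (rule nn_integral_dominated_convergence)
    define M where "M = 1 + ln (1/\<gamma>) / ln (1 + \<gamma>) + 1 / ln (1 + \<gamma>)"
    have M: "M \<ge> 0" "?c j * ln (1 + 1/d j) \<le> M" "?c j \<le> M" for j
    proof -
      have "ln (1/\<gamma>) / ln (1 + \<gamma>) \<ge> 0" "1 / ln (1 + \<gamma>) \<ge> 0" using \<gamma> by auto
      then show "M \<ge> 0" "?c j * ln (1 + 1/d j) \<le> M" "?c j \<le> M"
        using log_ratio_bound(1,2)[OF \<gamma> d(1,2)[of j]] unfolding M_def by linarith+
    qed
    define K where "K = DIM('a) * (log_const TYPE('a) * L)"
    \<comment> \<open>The majorant is \<open>slice_log_estimate\<close> times the normalising
      factor; \<open>M\<close> bounds that factor and its product with the logarithm for all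
      \<open>j\<close>.\<close>
    let ?W = "\<lambda>r. ennreal K * (ennreal M * (ennreal (A r) * indicator {0..T} r + ?U r * indicator {0..T} r))"
    show "AE r in lborel. ennreal (?c j) * ?I j r * indicator {0..T} r \<le> ?W r" for j
    proof (rule AE_I2)
      fix r
      show "ennreal (?c j) * ?I j r * indicator {0..T} r \<le> ?W r"
      proof (cases "r \<in> {0..T}")
        case True
        have c0: "?c j \<ge> 0" using cpos[of j] by simp
        have "ennreal (?c j) * ?I j r \<le> ennreal (?c j) * (ennreal K * (ennreal (ln (1 + 1/d j)) * ennreal (A r) + ?U r))"
          unfolding K_def by (intro mult_left_mono slice_log_estimate[OF d(1) Y[OF True] S]) auto
        also have "\<dots> = ennreal K * (ennreal (?c j * ln (1 + 1/d j)) * ennreal (A r) + ennreal (?c j) * ?U r)"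
          unfolding ennreal_mult'[OF c0] by (simp add: distrib_left mult_ac)
        also have "\<dots> \<le> ennreal K * (ennreal M * ennreal (A r) + ennreal M * ?U r)"
          by (intro mult_left_mono add_mono mult_right_mono ennreal_leI M) auto
        finally show ?thesis using True by (simp add: distrib_left)
      qed auto
    qed
    show "(\<integral>\<^sup>+r. ?W r \<partial>lborel) < \<infinity>"
      using A_int[of T] u_int[of T]
      by (auto simp: nn_integral_cmult nn_integral_add ennreal_mult_less_top)
    show "AE r in lborel. (\<lambda>j. ennreal (?c j) * ?I j r * indicator {0..T} r) \<longlonglongrightarrow> 0"
    proof (rule AE_I2)
      fix r
      show "(\<lambda>j. ennreal (?c j) * ?I j r * indicator {0..T} r) \<longlonglongrightarrow> 0"
      proof (cases "r \<in> {0..T}")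
        case True
        then show ?thesis using slice_log_limit[OF Y[OF True] S fin d \<gamma>] by simp
      qed auto
    qed
  qed measurable
  \<comment> \<open>The difference of the velocities splits into two equation errors and
    \<open>u r (Y1) - u r (Y2)\<close>. Each error is divided by at least \<open>d j\<close> and has
    integral at most \<open>d j\<close>, so the two together cost only \<open>2 * ?c j\<close>,
    which still tends to zero.\<close>
  have FS: "(\<integral>\<^sup>+x\<in>S. F j x \<partial>lborel) \<le> ennreal (2 * ?c j) + (\<integral>\<^sup>+r. ennreal (?c j) * ?I j r * indicator {0..T} r \<partial>lborel)" for j
  proof -
    let ?e1 = "\<lambda>r x. norm (w1 j r x - u r (Y1 j r x))" and ?e2 = "\<lambda>r x. norm (w2 j r x - u r (Y2 j r x))"
    have "(\<integral>\<^sup>+x\<in>S. F j x \<partial>lborel) = (\<integral>\<^sup>+x. \<integral>\<^sup>+r. ennreal (?c j) * ?q j r x * indicator {0..T} r * indicator S x \<partial>lborel \<partial>lborel)"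
    proof (intro nn_integral_cong)
      fix x
      have "F j x * indicator S x = (\<integral>\<^sup>+r. (ennreal (?c j) * (?q j r x * indicator {0..T} r)) * indicator S x \<partial>lborel)"
        unfolding F_def by (subst nn_integral_multc, measurable, subst nn_integral_cmult, auto)
      then show "F j x * indicator S x = (\<integral>\<^sup>+r. ennreal (?c j) * ?q j r x * indicator {0..T} r * indicator S x \<partial>lborel)"
        by (simp add: mult.assoc)
    qed
    also have "\<dots> = (\<integral>\<^sup>+r. \<integral>\<^sup>+x. ennreal (?c j) * ?q j r x * indicator {0..T} r * indicator S x \<partial>lborel \<partial>lborel)"
      by (rule nn_integral_lborel_swap) (unfold borel_prod[symmetric], measurable)
    also have "\<dots> \<le> (\<integral>\<^sup>+r. ennreal (?c j / d j) * ((\<integral>\<^sup>+x\<in>S. ?e1 r x \<partial>lborel) * indicator {0..T} r) + ennreal (?c j / d j) * ((\<integral>\<^sup>+x\<in>S. ?e2 r x \<partial>lborel) * indicator {0..T} r)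
        + ennreal (?c j) * ?I j r * indicator {0..T} r \<partial>lborel)"
    proof (intro nn_integral_mono)
      fix r
      show "(\<integral>\<^sup>+x. ennreal (?c j) * ?q j r x * indicator {0..T} r * indicator S x \<partial>lborel) \<le> ennreal (?c j / d j) * ((\<integral>\<^sup>+x\<in>S. ?e1 r x \<partial>lborel) * indicator {0..T} r) + ennreal (?c j / d j) * ((\<integral>\<^sup>+x\<in>S. ?e2 r x \<partial>lborel) * indicator {0..T} r)
        + ennreal (?c j) * ?I j r * indicator {0..T} r"
      proof (cases "r \<in> {0..T}")
        case True
        have "(\<integral>\<^sup>+x. ennreal (?c j) * ?q j r x * indicator {0..T} r * indicator S x \<partial>lborel)
          \<le> (\<integral>\<^sup>+x. ennreal (?c j / d j) * (ennreal (?e1 r x) * indicator S x) + ennreal (?c j / d j) * (ennreal (?e2 r x) * indicator S x)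
             + ennreal (?c j) * (ennreal (norm (u r (Y1 j r x) - u r (Y2 j r x)) / (d j + ?N j r x)) * indicator S x) \<partial>lborel)"
        proof (intro nn_integral_mono)
          fix x
          let ?dd = "d j + ?N j r x" and ?uu = "norm (u r (Y1 j r x) - u r (Y2 j r x))"
          have dd: "d j \<le> ?dd" "0 < ?dd" using d(1)[of j] by (auto intro: add_pos_nonneg)
          have c0: "0 \<le> ?c j" using cpos[of j] by simp
          have "norm (w1 j r x - w2 j r x) \<le> ?e1 r x + ?e2 r x + ?uu"
            using norm_triangle_ineq[of "w1 j r x - u r (Y1 j r x)" "u r (Y2 j r x) - w2 j r x + (u r (Y1 j r x) - u r (Y2 j r x))"]
              norm_triangle_ineq[of "u r (Y2 j r x) - w2 j r x" "u r (Y1 j r x) - u r (Y2 j r x)"]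
            by (simp add: norm_minus_commute algebra_simps)
          then have "?c j * (norm (w1 j r x - w2 j r x) / ?dd) \<le> ?c j * ((?e1 r x + ?e2 r x + ?uu) / ?dd)"
            using c0 dd by (intro mult_left_mono divide_right_mono) auto
          also have "\<dots> \<le> ?c j * (?e1 r x / d j + ?e2 r x / d j + ?uu / ?dd)"
            unfolding add_divide_distrib using c0 dd d(1)[of j] by (intro mult_left_mono add_mono divide_left_mono mult_pos_pos) auto
          also have "\<dots> = ?c j / d j * ?e1 r x + ?c j / d j * ?e2 r x + ?c j * (?uu / ?dd)"
            by (simp add: distrib_left)
          finally have "ennreal (?c j * (norm (w1 j r x - w2 j r x) / ?dd)) \<le> ennreal (?c j / d j * ?e1 r x + ?c j / d j * ?e2 r x + ?c j * (?uu / ?dd))"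
            by (rule ennreal_leI)
          also have "\<dots> = ennreal (?c j / d j) * ennreal (?e1 r x) + ennreal (?c j / d j) * ennreal (?e2 r x) + ennreal (?c j) * ennreal (?uu / ?dd)"
            using c0 dd d(1)[of j] by (simp add: ennreal_plus ennreal_mult' del: times_divide_eq_left times_divide_eq_right)
          also have "ennreal (?c j * (norm (w1 j r x - w2 j r x) / ?dd)) = ennreal (?c j) * ?q j r x"
            by (rule ennreal_mult'[OF c0])
          finally show "ennreal (?c j) * ?q j r x * indicator {0..T} r * indicator S x \<le> ennreal (?c j / d j) * (ennreal (?e1 r x) * indicator S x) + ennreal (?c j / d j) * (ennreal (?e2 r x) * indicator S x)
             + ennreal (?c j) * (ennreal (?uu / ?dd) * indicator S x)"
            using True by (auto simp: indicator_def)
        qed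
        also have "\<dots> = ennreal (?c j / d j) * (\<integral>\<^sup>+x\<in>S. ?e1 r x \<partial>lborel) + ennreal (?c j / d j) * (\<integral>\<^sup>+x\<in>S. ?e2 r x \<partial>lborel) + ennreal (?c j) * ?I j r"
          by (simp add: nn_integral_add nn_integral_cmult)
        finally show ?thesis using True by simp
      qed auto
    qed
    also have "\<dots> = ennreal (?c j / d j) * (\<integral>\<^sup>+r\<in>{0..T}. (\<integral>\<^sup>+x\<in>S. ?e1 r x \<partial>lborel) \<partial>lborel) + ennreal (?c j / d j) * (\<integral>\<^sup>+r\<in>{0..T}. (\<integral>\<^sup>+x\<in>S. ?e2 r x \<partial>lborel) \<partial>lborel)
        + (\<integral>\<^sup>+r. ennreal (?c j) * ?I j r * indicator {0..T} r \<partial>lborel)"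
      by (simp add: nn_integral_add nn_integral_cmult)
    also have "\<dots> \<le> ennreal (?c j / d j) * ennreal (d j) + ennreal (?c j / d j) * ennreal (d j) + (\<integral>\<^sup>+r. ennreal (?c j) * ?I j r * indicator {0..T} r \<partial>lborel)"
      using a1[of j] a2[of j] unfolding approx_flow_def d_def[symmetric] by (intro add_mono mult_left_mono) auto
    also have "ennreal (?c j / d j) * ennreal (d j) + ennreal (?c j / d j) * ennreal (d j) = ennreal (2 * ?c j)"
      using d(1)[of j] cpos[of j] by (simp add: ennreal_mult''[symmetric] less_imp_le flip: ennreal_plus)
    finally show ?thesis .
  qed
  have c0: "?c \<longlonglongrightarrow> 0"
  proof -
    have "filterlim (\<lambda>j. \<gamma> / d j) at_top sequentially"
      using \<gamma> d by (intro LIM_at_top_divide[where a=\<gamma>]) (auto intro: always_eventually)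
    then have "filterlim (\<lambda>j. ln (1 + \<gamma> / d j)) at_top sequentially"
      by (intro filterlim_compose[OF ln_at_top] filterlim_tendsto_add_at_top[OF tendsto_const])
    then show ?thesis
      by (intro tendsto_divide_0[OF tendsto_const] filterlim_at_top_imp_at_infinity)
  qed
  have "(\<lambda>j. ennreal (2 * ?c j) + (\<integral>\<^sup>+r. ennreal (?c j) * ?I j r * indicator {0..T} r \<partial>lborel)) \<longlonglongrightarrow> ennreal (2 * 0) + 0"
    using main by (intro tendsto_add tendsto_ennrealI tendsto_mult tendsto_const c0) simp
  then have lim: "(\<lambda>j. ennreal (2 * ?c j) + (\<integral>\<^sup>+r. ennreal (?c j) * ?I j r * indicator {0..T} r \<partial>lborel)) \<longlonglongrightarrow> 0" by simp
  have "(\<lambda>j. emeasure lborel (B j)) \<longlonglongrightarrow> 0"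
  proof (rule tendsto_sandwich[OF _ _ tendsto_const lim]; intro always_eventually allI)
    fix j
    have "emeasure lborel (B j) = (\<integral>\<^sup>+x. indicator (B j) x \<partial>lborel)" using B by simp
    also have "\<dots> \<le> (\<integral>\<^sup>+x\<in>S. F j x \<partial>lborel)"
      by (intro nn_integral_mono) (auto simp: indicator_def B_def)
    finally show "emeasure lborel (B j) \<le> ennreal (2 * ?c j) + (\<integral>\<^sup>+r. ennreal (?c j) * ?I j r * indicator {0..T} r \<partial>lborel)"
      using FS[of j] by (rule order_trans)
  qed simp
  then show ?thesis using B good by blast
qed

lemma approx_flow_mono:
  assumes "approx_flow S T L e Y w" "e \<le> e'"
  shows "approx_flow S T L e' Y w"
  using assms unfolding approx_flow_def by (auto intro: order_trans ennreal_leI)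

text \<open>Turns the sequential statement into one with a tolerance \<open>e\<close>, by
  contradiction: counterexamples for e = 1 / (j + 1) would form sequences that violate
  \<open>stability_seq\<close>.\<close>

lemma stability:
  assumes S[measurable]: "S \<in> sets borel" and fin: "emeasure lborel S < \<infinity>" and T: "0 \<le> T" and \<gamma>: "0 < \<gamma>" "\<gamma> \<le> 1"
    and \<eta>: "0 < \<eta>"
  shows "\<exists>e>0. \<forall>Y1 w1 Y2 w2. approx_flow S T L e Y1 w1 \<longrightarrow> approx_flow S T L e Y2 w2 \<longrightarrow>
      (AE x in lborel. x \<in> S \<longrightarrow> Y1 0 x = Y2 0 x) \<longrightarrow>
      (\<exists>B\<in>sets borel. B \<subseteq> S \<and> emeasure lborel B \<le> ennreal \<eta> \<and>
         (AE x in lborel. x \<in> S - B \<longrightarrow> (\<forall>t\<in>{0..T}. norm (Y1 t x - Y2 t x) \<le> \<gamma>)))"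
proof (rule ccontr)
  define P where "P e Y1 w1 Y2 w2 \<longleftrightarrow> approx_flow S T L e Y1 w1 \<and> approx_flow S T L e Y2 w2 \<and>
      (AE x in lborel. x \<in> S \<longrightarrow> Y1 0 x = Y2 0 x)" for e :: real and Y1 w1 Y2 w2
  define Q where "Q Y1 Y2 \<longleftrightarrow> (\<exists>B\<in>sets borel. B \<subseteq> S \<and> emeasure lborel B \<le> ennreal \<eta> \<and>
         (AE x in lborel. x \<in> S - B \<longrightarrow> (\<forall>t\<in>{0..T}. norm (Y1 t x - Y2 t x) \<le> \<gamma>)))" for Y1 Y2 :: "real \<Rightarrow> 'a \<Rightarrow> 'a"
  assume not: "\<not> ?thesis"
  have not': "\<not> (\<exists>e>0. \<forall>Y1 w1 Y2 w2. approx_flow S T L e Y1 w1 \<longrightarrow> approx_flow S T L e Y2 w2 \<longrightarrow>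
      (AE x in lborel. x \<in> S \<longrightarrow> Y1 0 x = Y2 0 x) \<longrightarrow> Q Y1 Y2)"
    using not unfolding Q_def .
  have "\<exists>Y1 w1 Y2 w2. P (1 / real (Suc j)) Y1 w1 Y2 w2 \<and> \<not> Q Y1 Y2" for j :: nat
  proof (rule ccontr)
    assume "\<not> ?thesis"
    then have "\<forall>Y1 w1 Y2 w2. P (1 / real (Suc j)) Y1 w1 Y2 w2 \<longrightarrow> Q Y1 Y2" by blast
    moreover have "0 < 1 / real (Suc j)" by simp
    ultimately show False using not' unfolding P_def by blast
  qed
  then obtain Y1 w1 Y2 w2 where P: "\<And>j::nat. P (1 / real (Suc j)) (Y1 j) (w1 j) (Y2 j) (w2 j)" and Q: "\<And>j. \<not> Q (Y1 j) (Y2 j)"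
    by metis
  have P': "\<And>j. approx_flow S T L (1 / Suc j) (Y1 j) (w1 j)" "\<And>j. approx_flow S T L (1 / Suc j) (Y2 j) (w2 j)"
    "\<And>j. AE x in lborel. x \<in> S \<longrightarrow> Y1 j 0 x = Y2 j 0 x" using P unfolding P_def by auto
  obtain B where B: "\<And>j. B j \<in> sets borel" "\<And>j. B j \<subseteq> S"
      "\<And>j. AE x in lborel. x \<in> S - B j \<longrightarrow> (\<forall>t\<in>{0..T}. norm (Y1 j t x - Y2 j t x) \<le> \<gamma>)"
    and lim: "(\<lambda>j. emeasure lborel (B j)) \<longlonglongrightarrow> 0"
    using stability_seq[OF S fin T \<gamma> P'] by blast
  from ennreal_tendsto_0D[OF lim \<eta>] obtain j where "emeasure lborel (B j) \<le> ennreal \<eta>"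
    by (auto simp: eventually_sequentially)
  then have "Q (Y1 j) (Y2 j)" unfolding Q_def using B[of j] by blast
  then show False using Q by blast
qed

text \<open>Exact flows are approximate flows for every tolerance, so for each \<gamma> = 1 / (k +
  1) the points where they separate by more than \<gamma> are contained, up to null sets, in sets of
  arbitrarily small measure.\<close>

lemma uniqueness_finite:
  assumes S[measurable]: "S \<in> sets borel" and fin: "emeasure lborel S < \<infinity>" and T: "0 \<le> T"
    and a: "approx_flow S T L 0 Y1 w1" "approx_flow S T L 0 Y2 w2"
    and init: "AE x in lborel. x \<in> S \<longrightarrow> Y1 0 x = Y2 0 x"
  shows "AE x in lborel. x \<in> S \<longrightarrow> (\<forall>t\<in>{0..T}. Y1 t x = Y2 t x)"
proof -
  have k: "AE x in lborel. x \<in> S \<longrightarrow> (\<forall>t\<in>{0..T}. norm (Y1 t x - Y2 t x) \<le> 1 / Suc k)" for k :: nat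
  proof -
    define R where "R j B \<longleftrightarrow> B \<in> sets borel \<and> B \<subseteq> S \<and> emeasure lborel B \<le> ennreal (1 / Suc j) \<and>
         (AE x in lborel. x \<in> S - B \<longrightarrow> (\<forall>t\<in>{0..T}. norm (Y1 t x - Y2 t x) \<le> 1 / Suc k))" for j :: nat and B
    have "\<exists>B. R j B" for j
    proof -
      have k: "0 < 1 / real (Suc k)" "1 / real (Suc k) \<le> 1" "0 < 1 / real (Suc j)" by auto
      obtain e where "e > 0" and e: "\<forall>Y1 w1 Y2 w2. approx_flow S T L e Y1 w1 \<longrightarrow> approx_flow S T L e Y2 w2 \<longrightarrow>
        (AE x in lborel. x \<in> S \<longrightarrow> Y1 0 x = Y2 0 x) \<longrightarrow>
        (\<exists>B\<in>sets borel. B \<subseteq> S \<and> emeasure lborel B \<le> ennreal (1 / Suc j) \<and>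
         (AE x in lborel. x \<in> S - B \<longrightarrow> (\<forall>t\<in>{0..T}. norm (Y1 t x - Y2 t x) \<le> 1 / Suc k)))"
        using stability[OF S fin T k, of L] by blast
      have "0 \<le> e" using \<open>e > 0\<close> by simp
      then show ?thesis
        using e[rule_format, OF approx_flow_mono[OF a(1)] approx_flow_mono[OF a(2)] init] unfolding R_def by blast
    qed
    then obtain B where "\<And>j. R j (B j)" by metis
    then have B: "\<And>j. B j \<in> sets borel" "\<And>j. B j \<subseteq> S" "\<And>j. emeasure lborel (B j) \<le> ennreal (1 / Suc j)"
      "\<And>j. AE x in lborel. x \<in> S - B j \<longrightarrow> (\<forall>t\<in>{0..T}. norm (Y1 t x - Y2 t x) \<le> 1 / Suc k)"
      unfolding R_def by auto
    \<comment> \<open>All \<open>B j\<close> are exceptional sets for the same pair and the same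
      \<open>k\<close>, so their intersection is exceptional as well.\<close>
    have "emeasure lborel (\<Inter>j. B j) \<le> ennreal (1 / Suc j)" for j
      by (rule order_trans[OF emeasure_mono B(3)[of j]]) (use B(1) in auto)
    moreover have "(\<lambda>j. ennreal (1 / Suc j)) \<longlonglongrightarrow> ennreal 0"
      by (intro tendsto_ennrealI LIMSEQ_Suc[OF lim_1_over_n])
    ultimately have "emeasure lborel (\<Inter>j. B j) \<le> ennreal 0"
      by (intro LIMSEQ_le_const[of "\<lambda>j. ennreal (1 / Suc j)"]) auto
    then have "AE x in lborel. x \<notin> (\<Inter>j. B j)"
      using B(1) by (intro AE_not_in) (auto simp: null_sets_def)
    moreover have "AE x in lborel. \<forall>j. x \<in> S - B j \<longrightarrow> (\<forall>t\<in>{0..T}. norm (Y1 t x - Y2 t x) \<le> 1 / Suc k)"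
      unfolding AE_all_countable using B(4) by simp
    ultimately show ?thesis by eventually_elim blast
  qed
  have "AE x in lborel. \<forall>k::nat. x \<in> S \<longrightarrow> (\<forall>t\<in>{0..T}. norm (Y1 t x - Y2 t x) \<le> 1 / Suc k)"
    unfolding AE_all_countable using k by simp
  then show ?thesis
  proof eventually_elim
    case (elim x)
    show ?case
    proof (intro impI ballI)
      fix t assume "x \<in> S" "t \<in> {0..T}"
      then have "norm (Y1 t x - Y2 t x) \<le> 1 / Suc k" for k :: nat using elim by blast
      then have "norm (Y1 t x - Y2 t x) \<le> 0"
        by (intro LIMSEQ_le_const[OF LIMSEQ_Suc[OF lim_1_over_n]]) auto
      then show "Y1 t x = Y2 t x" by simp
    qed
  qed
qed

end

section \<open>Mollification\<close>

lemma integral_lborel_shift: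
  fixes f :: "'a::euclidean_space \<Rightarrow> 'b::{banach, second_countable_topology}"
  assumes [measurable]: "f \<in> borel_measurable borel"
  shows "(\<integral>x. f (c + x) \<partial>lborel) = (\<integral>x. f x \<partial>lborel)"
  by (subst (2) lborel_distr_plus[of c, symmetric]) (simp add: integral_distr)

lemma integrable_lborel_shift:
  fixes f :: "'a::euclidean_space \<Rightarrow> 'b::euclidean_space"
  assumes "integrable lborel f"
  shows "integrable lborel (\<lambda>x. f (c + x))"
proof -
  have [measurable]: "f \<in> borel_measurable borel" using assms by auto
  have "integrable (distr lborel borel ((+) c)) f" unfolding lborel_distr_plus by fact
  then show ?thesis by (subst (asm) integrable_distr_eq) auto
qed

text \<open>A quadratic bound for the remainder is stable under convolution and under integration in
  time, where mere differentiability would need differentiation under the integral. Hence the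
  kernel, the mollified field and the Euler step all carry their derivatives in this form.\<close>

lemma quadratic_has_derivative:
  fixes f :: "'a::real_normed_vector \<Rightarrow> 'b::real_normed_vector"
  assumes D: "bounded_linear D" and q: "\<And>h. norm (f (x + h) - f x - D h) \<le> C * (norm h)\<^sup>2"
  shows "(f has_derivative D) (at x)"
  unfolding has_derivative_at
proof (intro conjI D)
  have b: "norm (norm (f (x + h) - f x - D h) / norm h) \<le> C * norm h" for h
    using q[of h] by (cases "h = 0") (auto simp: divide_le_eq power2_eq_square mult.assoc)
  have "((\<lambda>h::'a. C * norm h) \<longlongrightarrow> C * norm (0::'a)) (at 0)"
    by (rule tendsto_mult[OF tendsto_const tendsto_norm[OF tendsto_ident_at]])
  then have c: "((\<lambda>h::'a. C * norm h) \<longlongrightarrow> 0) (at 0)" by simp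
  show "(\<lambda>h. norm (f (x + h) - f x - D h) / norm h) \<midarrow>0\<rightarrow> 0"
    by (rule Lim_null_comparison[OF always_eventually[OF allI[OF b]] c])
qed

text \<open>The square of the positive part is C^1 with derivative of Lipschitz constant 2, and this
  is its Taylor estimate across the kink of the second derivative at 0.\<close>

lemma pos_part_square_remainder:
  fixes s k :: real
  shows "\<bar>(max 0 (s + k))\<^sup>2 - (max 0 s)\<^sup>2 - 2 * max 0 s * k\<bar> \<le> k\<^sup>2"
proof -
  consider "0 \<le> s" "0 \<le> s + k" | "0 \<le> s" "s + k < 0" | "s < 0" "0 \<le> s + k" | "s < 0" "s + k < 0" by linarith
  then show ?thesis
  proof cases
    case 1 then show ?thesis by (simp add: power2_eq_square algebra_simps)
  next
    case 2
    have "0 \<le> (s + k)\<^sup>2" by simp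
    moreover have "0 \<le> s * (- s - 2 * k)" using 2 by (intro mult_nonneg_nonneg) auto
    ultimately show ?thesis using 2 by (simp add: power2_eq_square algebra_simps)
  next
    case 3
    have "(s + k)\<^sup>2 \<le> k\<^sup>2" using 3 by (intro power_mono) auto
    then show ?thesis using 3 by simp
  next
    case 4 then show ?thesis by simp
  qed
qed

text \<open>A mollifier of class C^1 with Lipschitz gradient. One constant \<open>C\<close> bounds
  value, gradient and quadratic remainder, so that it is the only quantity that depends on the width
  \<epsilon> in later estimates.\<close>

definition kernel :: "real \<Rightarrow> ('a::euclidean_space \<Rightarrow> real) \<Rightarrow> ('a \<Rightarrow> 'a) \<Rightarrow> real \<Rightarrow> bool" where
  "kernel \<epsilon> \<rho> \<gamma> C \<longleftrightarrow> 0 \<le> C \<and> has_grad \<rho> \<gamma> \<and> (\<forall>x. 0 \<le> \<rho> x \<and> \<rho> x \<le> C \<and> norm (\<gamma> x) \<le> C) \<and>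
     (\<forall>x h. \<bar>\<rho> (x + h) - \<rho> x - \<gamma> x \<bullet> h\<bar> \<le> C * (norm h)\<^sup>2) \<and>
     (\<forall>x. \<epsilon> < norm x \<longrightarrow> \<rho> x = 0 \<and> \<gamma> x = 0) \<and> (\<integral>\<^sup>+x. \<rho> x \<partial>lborel) = 1"

text \<open>The kernel is the square of the positive part of \<epsilon>^2 - |x|^2, normalised. It is
  regular enough for the Jacobians of Euler steps and its constants can be written down.\<close>

lemma kernel_exists:
  assumes \<epsilon>: "0 < \<epsilon>"
  shows "\<exists>(\<rho> :: 'a::euclidean_space \<Rightarrow> real) \<gamma> C. kernel \<epsilon> \<rho> \<gamma> C"
proof -
  define m where "m x = max 0 (\<epsilon>\<^sup>2 - x \<bullet> x)" for x :: 'a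
  define \<beta> where "\<beta> x = (m x)\<^sup>2" for x
  define g where "g x = (- 4 * m x) *\<^sub>R x" for x
  have m: "0 \<le> m x" "m x \<le> \<epsilon>\<^sup>2" for x by (auto simp: m_def)
  have m0: "m x = 0" if "\<epsilon> < norm x" for x
  proof -
    have "\<epsilon>\<^sup>2 \<le> (norm x)\<^sup>2" using that \<epsilon> by (intro power_mono) auto
    then show ?thesis by (simp add: m_def power2_norm_eq_inner)
  qed
  have \<beta>: "0 \<le> \<beta> x" "\<beta> x \<le> \<epsilon>^4" for x
    using power_mono[OF m(2,1)[of x], of 2] by (auto simp: \<beta>_def)
  have g_bd: "norm (g x) \<le> 4 * \<epsilon>^3" for x
  proof (cases "\<epsilon> < norm x")
    case False
    then have "m x * norm x \<le> \<epsilon>\<^sup>2 * \<epsilon>" using m[of x] by (intro mult_mono) auto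
    then show ?thesis using m[of x] by (simp add: g_def power3_eq_cube power2_eq_square)
  qed (use \<epsilon> m0 in \<open>simp add: g_def\<close>)
  \<comment> \<open>For |h| > \<epsilon> crude bounds of the three terms suffice. For |h| \<le>
    \<epsilon> and |x| > 2\<epsilon> everything vanishes. Otherwise \<epsilon>^2 - |x|^2 changes by
    \<open>k\<close> with |k| \<le> 5 \<epsilon> |h|, so \<open>k\<close>^2 contributes 25
    \<epsilon>^2 |h|^2 and the second order part of \<open>k\<close> contributes 2 \<epsilon>^2
    |h|^2, together 27.\<close>
  have rem: "\<bar>\<beta> (x + h) - \<beta> x - g x \<bullet> h\<bar> \<le> 27 * \<epsilon>\<^sup>2 * (norm h)\<^sup>2" for x h
  proof (cases "\<epsilon> < norm h")
    case True
    have "\<bar>g x \<bullet> h\<bar> \<le> 4 * \<epsilon>^3 * norm h"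
      using order_trans[OF Cauchy_Schwarz_ineq2 mult_right_mono[OF g_bd norm_ge_zero]] .
    then have "\<bar>\<beta> (x + h) - \<beta> x - g x \<bullet> h\<bar> \<le> \<epsilon>^4 + 4 * \<epsilon>^3 * norm h"
      using \<beta>[of x] \<beta>[of "x + h"] by linarith
    also have "\<dots> \<le> \<epsilon>\<^sup>2 * (norm h)\<^sup>2 + 4 * (\<epsilon>\<^sup>2 * (norm h)\<^sup>2)"
    proof (intro add_mono)
      have "\<epsilon>\<^sup>2 * \<epsilon>\<^sup>2 \<le> \<epsilon>\<^sup>2 * (norm h)\<^sup>2" using True \<epsilon> by (intro mult_left_mono power_mono) auto
      then show "\<epsilon>^4 \<le> \<epsilon>\<^sup>2 * (norm h)\<^sup>2" by (simp flip: power_add)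
      have "\<epsilon>\<^sup>2 * (\<epsilon> * norm h) \<le> \<epsilon>\<^sup>2 * (norm h * norm h)" using True \<epsilon> by (intro mult_left_mono mult_right_mono) auto
      then show "4 * \<epsilon>^3 * norm h \<le> 4 * (\<epsilon>\<^sup>2 * (norm h)\<^sup>2)" by (simp add: power3_eq_cube power2_eq_square mult.assoc)
    qed
    also have "\<dots> \<le> 27 * \<epsilon>\<^sup>2 * (norm h)\<^sup>2" by simp
    finally show ?thesis .
  next
    case h: False
    show ?thesis
    proof (cases "2 * \<epsilon> < norm x")
      case True
      have "\<epsilon> < norm (x + h)" using True h norm_diff_ineq[of x h] by linarith
      moreover have "\<epsilon> < norm x" using True \<epsilon> by linarith
      ultimately show ?thesis using m0 by (simp add: \<beta>_def g_def)
    next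
      case x: False
      define k where "k = - (2 * (x \<bullet> h) + h \<bullet> h)"
      have s: "\<epsilon>\<^sup>2 - (x + h) \<bullet> (x + h) = (\<epsilon>\<^sup>2 - x \<bullet> x) + k"
        by (simp add: k_def inner_add inner_commute algebra_simps)
      have "\<bar>k\<bar> \<le> 2 * (norm x * norm h) + norm h * norm h"
      proof -
        have "h \<bullet> h = norm h * norm h" by (simp add: dot_square_norm power2_eq_square)
        moreover have "\<bar>- (2 * a + b)\<bar> \<le> 2 * p + b" if "\<bar>a\<bar> \<le> p" "0 \<le> b" for a b p :: real
          using that by linarith
        ultimately show ?thesis using Cauchy_Schwarz_ineq2[of x h] unfolding k_def by simp
      qed
      also have "\<dots> \<le> 2 * ((2 * \<epsilon>) * norm h) + \<epsilon> * norm h"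
        using x h by (intro add_mono mult_left_mono mult_right_mono) auto
      finally have "\<bar>k\<bar> \<le> 5 * \<epsilon> * norm h" by simp
      then have "\<bar>k\<bar>\<^sup>2 \<le> (5 * \<epsilon> * norm h)\<^sup>2" by (intro power_mono) auto
      then have k: "k\<^sup>2 \<le> 25 * (\<epsilon>\<^sup>2 * (norm h)\<^sup>2)" by (simp add: power_mult_distrib)
      have eq: "\<beta> (x + h) - \<beta> x - g x \<bullet> h = (\<beta> (x + h) - \<beta> x - 2 * m x * k) - 2 * m x * (h \<bullet> h)"
        by (simp add: g_def k_def algebra_simps)
      have "\<bar>\<beta> (x + h) - \<beta> x - 2 * m x * k\<bar> \<le> k\<^sup>2"
        using pos_part_square_remainder[of "\<epsilon>\<^sup>2 - x \<bullet> x" k] unfolding \<beta>_def m_def s .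
      moreover have "0 \<le> 2 * m x * (h \<bullet> h)" "2 * m x * (h \<bullet> h) \<le> 2 * (\<epsilon>\<^sup>2 * (norm h)\<^sup>2)"
        using m[of x] by (auto simp: dot_square_norm intro!: mult_right_mono)
      ultimately show ?thesis unfolding eq using k by linarith
    qed
  qed
  have hg: "has_grad \<beta> g"
    unfolding has_grad_def
  proof (intro conjI allI)
    show "(\<beta> has_derivative (\<bullet>) (g x)) (at x)" for x
      by (rule quadratic_has_derivative[where C="27 * \<epsilon>\<^sup>2"]) (use rem in \<open>auto intro: bounded_linear_inner_right\<close>)
    show "continuous_on UNIV g" unfolding g_def m_def by (intro continuous_intros)
  qed
  have cs: "compact_supp \<beta>" unfolding compact_supp_def using m0 by (auto simp: \<beta>_def intro!: exI[of _ \<epsilon>])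
  have int: "integrable lborel \<beta>" by (rule compact_supp_integrable[OF cs has_grad_measurable(3)[OF hg]])
  define I where "I = integral\<^sup>L lborel \<beta>"
  have nnI: "(\<integral>\<^sup>+x. \<beta> x \<partial>lborel) = ennreal I"
    unfolding I_def using \<beta> by (intro nn_integral_eq_integral int) auto
  have I: "I > 0"
  proof -
    let ?B = "cball (0::'a) (\<epsilon>/2)"
    have "0 < measure lborel ?B" using content_cball_pos[of "\<epsilon>/2" "0::'a"] \<epsilon> by simp
    then have "0 < ennreal ((\<epsilon>\<^sup>2/2)\<^sup>2) * emeasure lborel ?B"
      using \<epsilon> by (simp add: emeasure_cball_unit ennreal_zero_less_mult_iff)
    also have "\<dots> = (\<integral>\<^sup>+x\<in>?B. ennreal ((\<epsilon>\<^sup>2/2)\<^sup>2) \<partial>lborel)" by (subst nn_integral_cmult_indicator) auto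
    also have "\<dots> \<le> (\<integral>\<^sup>+x. \<beta> x \<partial>lborel)"
    proof (intro nn_integral_mono)
      fix x :: 'a
      have "(\<epsilon>\<^sup>2/2)\<^sup>2 \<le> \<beta> x" if "norm x \<le> \<epsilon>/2"
      proof -
        have "(norm x)\<^sup>2 \<le> (\<epsilon>/2)\<^sup>2" using that by (intro power_mono) auto
        then have "x \<bullet> x \<le> \<epsilon>\<^sup>2/4" by (simp add: power2_norm_eq_inner power_divide)
        then have "\<epsilon>\<^sup>2/2 \<le> m x" unfolding m_def using zero_le_power2[of \<epsilon>] by (intro max.coboundedI2) linarith
        then show ?thesis unfolding \<beta>_def by (intro power_mono) auto
      qed
      then show "ennreal ((\<epsilon>\<^sup>2/2)\<^sup>2) * indicator ?B x \<le> ennreal (\<beta> x)"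
        by (auto simp: indicator_def intro!: ennreal_leI)
    qed
    finally show ?thesis unfolding nnI by simp
  qed
  define C where "C = (\<epsilon>^4 + 4 * \<epsilon>^3 + 27 * \<epsilon>\<^sup>2) / I"
  have C: "\<epsilon>^4 / I \<le> C" "4 * \<epsilon>^3 / I \<le> C" "27 * \<epsilon>\<^sup>2 / I \<le> C" "0 \<le> C"
    unfolding C_def using \<epsilon> I by (auto intro!: divide_right_mono)
  have "kernel \<epsilon> (\<lambda>x. \<beta> x / I) (\<lambda>x. (1/I) *\<^sub>R g x) C"
    unfolding kernel_def
  proof (intro conjI allI impI)
    show "has_grad (\<lambda>x. \<beta> x / I) (\<lambda>x. (1/I) *\<^sub>R g x)"
      using hg unfolding has_grad_def
      by (auto intro!: continuous_intros has_derivative_eq_rhs[OF bounded_linear.has_derivative[OF bounded_linear_divide]])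
    show "0 \<le> \<beta> x / I" "\<beta> x / I \<le> C" for x
      using \<beta>[of x] I C(1) divide_right_mono[of "\<beta> x" "\<epsilon>^4" I] by auto
    show "norm ((1/I) *\<^sub>R g x) \<le> C" for x
      using g_bd[of x] I C(2) divide_right_mono[of "norm (g x)" "4 * \<epsilon>^3" I] by auto
    show "\<bar>\<beta> (x + h) / I - \<beta> x / I - (1/I) *\<^sub>R g x \<bullet> h\<bar> \<le> C * (norm h)\<^sup>2" for x h
    proof -
      have "\<bar>\<beta> (x + h) / I - \<beta> x / I - (1/I) *\<^sub>R g x \<bullet> h\<bar> = \<bar>\<beta> (x + h) - \<beta> x - g x \<bullet> h\<bar> / I"
        using I by (simp add: diff_divide_distrib[symmetric])
      also have "\<dots> \<le> 27 * \<epsilon>\<^sup>2 * (norm h)\<^sup>2 / I" using rem I by (intro divide_right_mono) auto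
      also have "\<dots> = 27 * \<epsilon>\<^sup>2 / I * (norm h)\<^sup>2" by simp
      also have "\<dots> \<le> C * (norm h)\<^sup>2" using C(3) by (intro mult_right_mono) auto
      finally show ?thesis .
    qed
    show "(\<integral>\<^sup>+x. ennreal (\<beta> x / I) \<partial>lborel) = 1"
    proof -
      have [measurable]: "\<beta> \<in> borel_measurable borel" using has_grad_measurable[OF hg] by simp
      have "(\<integral>\<^sup>+x. ennreal (\<beta> x / I) \<partial>lborel) = (\<integral>\<^sup>+x. ennreal (1/I) * ennreal (\<beta> x) \<partial>lborel)"
        using I by (simp add: ennreal_mult'[symmetric])
      also have "\<dots> = ennreal (1/I) * ennreal I" by (subst nn_integral_cmult) (auto simp: nnI)
      finally show ?thesis using I by (simp add: ennreal_mult'[symmetric])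
    qed
  qed (use C m0 in \<open>auto simp: \<beta>_def g_def\<close>)
  then show ?thesis by blast
qed

text \<open>Difference quotients of an integrable function have integral zero by translation
  invariance, and they converge dominatedly to the directional derivative.\<close>

lemma has_grad_integral_zero:
  fixes H :: "'a::euclidean_space \<Rightarrow> real"
  assumes h: "has_grad H \<psi>" and cs: "compact_supp H" "compact_supp \<psi>"
  shows "(\<integral>x. \<psi> x \<bullet> e \<partial>lborel) = 0"
proof -
  note [measurable] = has_grad_measurable[OF h]
  obtain B where B: "B \<ge> 0" "\<And>x. norm (\<psi> x) \<le> B"
    by (rule compact_supp_bounded[OF cs(2)]) (use h in \<open>auto simp: has_grad_def\<close>)
  obtain R where R: "\<And>x. R < norm x \<Longrightarrow> H x = 0" using cs(1) by (auto simp: compact_supp_def)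
  define t where "t n = 1 / real (Suc n)" for n
  have t: "0 < t n" "t n \<le> 1" for n by (auto simp: t_def)
  have t0: "t \<longlonglongrightarrow> 0" unfolding t_def by (rule LIMSEQ_Suc[OF lim_1_over_n])
  have intH: "integrable lborel H" by (rule compact_supp_integrable[OF cs(1) has_grad_measurable(3)[OF h]])
  let ?q = "\<lambda>n x. (H (t n *\<^sub>R e + x) - H x) / t n"
  have "(\<lambda>n. \<integral>x. ?q n x \<partial>lborel) \<longlonglongrightarrow> (\<integral>x. \<psi> x \<bullet> e \<partial>lborel)"
  proof (rule integral_dominated_convergence[where w="\<lambda>x. (B * norm e) * indicator (cball 0 (R + norm e)) x"])
    show "integrable lborel (\<lambda>x::'a. (B * norm e) * indicator (cball 0 (R + norm e)) x)"
      using emeasure_lborel_cball_finite[of "0::'a" "R + norm e"]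
      by (intro integrable_mult_right) (auto intro!: integrable_real_indicator)
    show "AE x in lborel. norm (?q n x) \<le> (B * norm e) * indicator (cball 0 (R + norm e)) x" for n
    proof (rule AE_I2)
      fix x
      have te: "norm (t n *\<^sub>R e) \<le> norm e" using t[of n] by (simp add: mult_left_le_one_le)
      have "\<bar>H (t n *\<^sub>R e + x) - H x\<bar> \<le> B * norm (t n *\<^sub>R e)"
        using has_grad_lipschitz[OF h B(2), of "t n *\<^sub>R e + x" x] by simp
      then have "norm (?q n x) \<le> B * norm e" using t[of n] by (simp add: divide_le_eq mult_ac)
      moreover have "?q n x = 0" if "R + norm e < norm x"
      proof -
        have "R < norm x" "R < norm (t n *\<^sub>R e + x)"
          using that te norm_diff_ineq[of x "t n *\<^sub>R e"] norm_ge_zero[of e] by (auto simp: add.commute simp del: norm_scaleR norm_ge_zero)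
        then show ?thesis using R by simp
      qed
      ultimately show "norm (?q n x) \<le> (B * norm e) * indicator (cball 0 (R + norm e)) x"
        by (auto simp: indicator_def not_le)
    qed
    show "AE x in lborel. (\<lambda>n. ?q n x) \<longlonglongrightarrow> \<psi> x \<bullet> e"
    proof (rule AE_I2)
      fix x
      have "((\<lambda>s. H (x + s *\<^sub>R e)) has_derivative (\<lambda>s. \<psi> x \<bullet> (s *\<^sub>R e))) (at 0)"
      proof (rule has_derivative_compose[where g=H])
        show "((\<lambda>s. x + s *\<^sub>R e) has_derivative (\<lambda>s. s *\<^sub>R e)) (at 0)" by (auto intro!: derivative_eq_intros)
        show "(H has_derivative (\<bullet>) (\<psi> x)) (at (x + 0 *\<^sub>R e))" using h by (simp add: has_grad_def)
      qed
      then have "((\<lambda>s. H (x + s *\<^sub>R e)) has_field_derivative (\<psi> x \<bullet> e)) (at 0)"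
        by (simp add: has_field_derivative_def mult_commute_abs)
      then have "((\<lambda>s. (H (x + s *\<^sub>R e) - H x) / s) \<longlongrightarrow> \<psi> x \<bullet> e) (at 0)"
        by (simp add: has_field_derivative_iff)
      moreover have "filterlim t (at 0) sequentially"
        using t0 t by (auto simp: filterlim_at less_imp_neq[symmetric] intro!: always_eventually)
      ultimately show "(\<lambda>n. ?q n x) \<longlonglongrightarrow> \<psi> x \<bullet> e"
        by (auto dest: filterlim_compose simp: add.commute)
    qed
  qed measurable
  moreover have "(\<integral>x. ?q n x \<partial>lborel) = 0" for n
  proof -
    have "(\<integral>x. ?q n x \<partial>lborel) = ((\<integral>x. H (t n *\<^sub>R e + x) \<partial>lborel) - (\<integral>x. H x \<partial>lborel)) / t n"
      using intH integrable_lborel_shift[OF intH] by simp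
    then show ?thesis by (simp add: integral_lborel_shift)
  qed
  ultimately have "(\<lambda>n::nat. 0) \<longlonglongrightarrow> (\<integral>x. \<psi> x \<bullet> e \<partial>lborel)" by (simp only:)
  then show ?thesis by (simp add: LIMSEQ_const_iff)
qed

text \<open>The kernel is reflected, whence the sign of \<open>\<gamma>\<close> in the derivative.\<close>

definition mconv :: "('a::euclidean_space \<Rightarrow> real) \<Rightarrow> ('a \<Rightarrow> 'a) \<Rightarrow> 'a \<Rightarrow> 'a" where
  "mconv \<rho> U x = (\<integral>y. \<rho> (y - x) *\<^sub>R U y \<partial>lborel)"

definition mconv_deriv :: "('a::euclidean_space \<Rightarrow> 'a) \<Rightarrow> ('a \<Rightarrow> 'a) \<Rightarrow> 'a \<Rightarrow> 'a \<Rightarrow> 'a" where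
  "mconv_deriv \<gamma> U x h = (\<integral>y. (- (\<gamma> (y - x) \<bullet> h)) *\<^sub>R U y \<partial>lborel)"

section \<open>The mollified field: derivative, divergence and L^1 error\<close>

lemma integrable_bounded_scaleR:
  fixes U :: "'a::euclidean_space \<Rightarrow> 'b::euclidean_space" and c :: "'a \<Rightarrow> real"
  assumes U: "integrable lborel U" and [measurable]: "c \<in> borel_measurable borel" and c: "\<And>y. \<bar>c y\<bar> \<le> B"
  shows "integrable lborel (\<lambda>y. c y *\<^sub>R U y)" "norm (\<integral>y. c y *\<^sub>R U y \<partial>lborel) \<le> B * (\<integral>y. norm (U y) \<partial>lborel)"
proof -
  have [measurable]: "U \<in> borel_measurable borel" using U by auto
  have i: "integrable lborel (\<lambda>y. B * norm (U y))" using U by simp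
  have b: "norm (c y *\<^sub>R U y) \<le> B * norm (U y)" for y using c[of y] by (simp add: mult_right_mono)
  show *: "integrable lborel (\<lambda>y. c y *\<^sub>R U y)"
    by (rule Bochner_Integration.integrable_bound[OF i]) (use b order_trans[OF b abs_ge_self] in \<open>auto intro!: AE_I2\<close>)
  have "norm (\<integral>y. c y *\<^sub>R U y \<partial>lborel) \<le> (\<integral>y. B * norm (U y) \<partial>lborel)"
    by (rule Bochner_Integration.integral_norm_bound_integral[OF * i]) (rule b)
  then show "norm (\<integral>y. c y *\<^sub>R U y \<partial>lborel) \<le> B * (\<integral>y. norm (U y) \<partial>lborel)" by simp
qed

lemma nn_integral_norm_le_imp:
  fixes F :: "'a::euclidean_space \<Rightarrow> 'b::euclidean_space"
  assumes "integrable lborel F" "(\<integral>\<^sup>+x. norm (F x) \<partial>lborel) \<le> ennreal c" "0 \<le> c"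
  shows "(\<integral>x. norm (F x) \<partial>lborel) \<le> c"
  using assms by (subst (asm) nn_integral_eq_integral) auto

lemma slice_integrable:
  fixes U :: "'a::euclidean_space \<Rightarrow> 'a"
  assumes "slice U a d"
  shows "integrable lborel U"
proof -
  have "integrable lborel (\<lambda>x. U x \<bullet> e)" if "e \<in> Basis" for e
    using assms that by (auto simp: slice_def W11_def)
  then have "integrable lborel (\<lambda>x. \<Sum>e\<in>Basis. (U x \<bullet> e) *\<^sub>R e)" by auto
  then show ?thesis by (simp add: euclidean_representation)
qed

context
  fixes \<epsilon> C :: real and \<rho> :: "'a::euclidean_space \<Rightarrow> real" and \<gamma> :: "'a \<Rightarrow> 'a"
  assumes k: "kernel \<epsilon> \<rho> \<gamma> C"
begin

lemma kernel_facts: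
  "0 \<le> C" "has_grad \<rho> \<gamma>" "0 \<le> \<rho> x" "\<bar>\<rho> x\<bar> \<le> C" "norm (\<gamma> x) \<le> C" "\<bar>\<rho> (x + h) - \<rho> x - \<gamma> x \<bullet> h\<bar> \<le> C * (norm h)\<^sup>2"
  "\<epsilon> < norm x \<Longrightarrow> \<rho> x = 0" "\<epsilon> < norm x \<Longrightarrow> \<gamma> x = 0" "(\<integral>\<^sup>+x. \<rho> x \<partial>lborel) = 1"
  using k by (auto simp: kernel_def)

lemmas kernel_measurable = has_grad_measurable(1,2)[OF kernel_facts(2)]

lemma mconv_bound:
  assumes U: "integrable lborel U"
  shows "norm (mconv \<rho> U x) \<le> C * (\<integral>y. norm (U y) \<partial>lborel)"
proof -
  note [measurable] = kernel_measurable
  show ?thesis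
    unfolding mconv_def by (rule integrable_bounded_scaleR[OF U _ kernel_facts(4)]) measurable
qed

lemma mconv_lipschitz:
  assumes U: "integrable lborel U"
  shows "norm (mconv \<rho> U x - mconv \<rho> U x') \<le> C * (\<integral>y. norm (U y) \<partial>lborel) * norm (x - x')"
proof -
  note [measurable] = kernel_measurable
  have i: "integrable lborel (\<lambda>y. \<rho> (y - x) *\<^sub>R U y)" for x
    by (rule integrable_bounded_scaleR[OF U _ kernel_facts(4)]) measurable
  have "mconv \<rho> U x - mconv \<rho> U x' = (\<integral>y. (\<rho> (y - x) - \<rho> (y - x')) *\<^sub>R U y \<partial>lborel)"
    unfolding mconv_def using i by (simp add: scaleR_diff_left)
  also have "norm \<dots> \<le> (C * norm (x - x')) * (\<integral>y. norm (U y) \<partial>lborel)"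
  proof (rule integrable_bounded_scaleR[OF U])
    show "\<bar>\<rho> (y - x) - \<rho> (y - x')\<bar> \<le> C * norm (x - x')" for y
      using has_grad_lipschitz[OF kernel_facts(2,5), of "y - x" "y - x'"] by (simp add: norm_minus_commute)
  qed measurable
  finally show ?thesis by (simp add: mult_ac)
qed

lemma mconv_deriv_linear:
  assumes U: "integrable lborel U"
  shows "linear (mconv_deriv \<gamma> U x)" "norm (mconv_deriv \<gamma> U x h) \<le> C * (\<integral>y. norm (U y) \<partial>lborel) * norm h"
    "integrable lborel (\<lambda>y. (- (\<gamma> (y - x) \<bullet> h)) *\<^sub>R U y)"
proof -
  note [measurable] = kernel_measurable
  have b: "\<bar>- (\<gamma> (y - x) \<bullet> h)\<bar> \<le> C * norm h" for y h
    using order_trans[OF Cauchy_Schwarz_ineq2 mult_right_mono[OF kernel_facts(5) norm_ge_zero], of "y - x" h] by simp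
  have i: "integrable lborel (\<lambda>y. (- (\<gamma> (y - x) \<bullet> h)) *\<^sub>R U y)" for h
    by (rule integrable_bounded_scaleR(1)[OF U _ b]) measurable
  then show "integrable lborel (\<lambda>y. (- (\<gamma> (y - x) \<bullet> h)) *\<^sub>R U y)" .
  show "norm (mconv_deriv \<gamma> U x h) \<le> C * (\<integral>y. norm (U y) \<partial>lborel) * norm h"
  proof -
    have "norm (mconv_deriv \<gamma> U x h) \<le> (C * norm h) * (\<integral>y. norm (U y) \<partial>lborel)"
      unfolding mconv_deriv_def by (rule integrable_bounded_scaleR(2)[OF U]) (use b in auto)
    then show ?thesis by (simp add: mult_ac)
  qed
  show "linear (mconv_deriv \<gamma> U x)"
  proof (rule linearI)
    fix h h' c
    have "mconv_deriv \<gamma> U x (h + h') = (\<integral>y. (- (\<gamma> (y - x) \<bullet> h)) *\<^sub>R U y + (- (\<gamma> (y - x) \<bullet> h')) *\<^sub>R U y \<partial>lborel)"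
      unfolding mconv_deriv_def by (simp add: inner_add_right algebra_simps)
    also have "\<dots> = mconv_deriv \<gamma> U x h + mconv_deriv \<gamma> U x h'"
      unfolding mconv_deriv_def by (rule Bochner_Integration.integral_add[OF i i])
    finally show "mconv_deriv \<gamma> U x (h + h') = mconv_deriv \<gamma> U x h + mconv_deriv \<gamma> U x h'" .
    have "mconv_deriv \<gamma> U x (c *\<^sub>R h) = (\<integral>y. c *\<^sub>R ((- (\<gamma> (y - x) \<bullet> h)) *\<^sub>R U y) \<partial>lborel)"
      unfolding mconv_deriv_def by simp
    also have "\<dots> = c *\<^sub>R mconv_deriv \<gamma> U x h"
      unfolding mconv_deriv_def by (rule integral_scaleR_right)
    finally show "mconv_deriv \<gamma> U x (c *\<^sub>R h) = c *\<^sub>R mconv_deriv \<gamma> U x h" .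
  qed
qed

lemma mconv_remainder:
  assumes U: "integrable lborel U"
  shows "norm (mconv \<rho> U (x + h) - mconv \<rho> U x - mconv_deriv \<gamma> U x h) \<le> C * (\<integral>y. norm (U y) \<partial>lborel) * (norm h)\<^sup>2"
proof -
  note [measurable] = kernel_measurable
  have i: "integrable lborel (\<lambda>y. \<rho> (y - x) *\<^sub>R U y)" for x
    by (rule integrable_bounded_scaleR[OF U _ kernel_facts(4)]) measurable
  have "mconv \<rho> U (x + h) - mconv \<rho> U x - mconv_deriv \<gamma> U x h = (\<integral>y. (\<rho> (y - (x + h)) - \<rho> (y - x) - (- (\<gamma> (y - x) \<bullet> h))) *\<^sub>R U y \<partial>lborel)"
    unfolding mconv_def mconv_deriv_def scaleR_diff_left
    using i mconv_deriv_linear(3)[OF U] by simp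
  also have "norm \<dots> \<le> (C * (norm h)\<^sup>2) * (\<integral>y. norm (U y) \<partial>lborel)"
  proof (rule integrable_bounded_scaleR[OF U])
    show "\<bar>\<rho> (y - (x + h)) - \<rho> (y - x) - (- (\<gamma> (y - x) \<bullet> h))\<bar> \<le> C * (norm h)\<^sup>2" for y
      using kernel_facts(6)[of "y - x" "- h"] by (simp add: algebra_simps)
  qed measurable
  finally show ?thesis by (simp add: mult_ac)
qed

lemma nn_integral_kernel_shift: "(\<integral>\<^sup>+y. \<rho> (y - x) \<partial>lborel) = 1"
  using nn_integral_lborel_shift[of "\<lambda>y. ennreal (\<rho> y)" "- x"] kernel_facts(9) kernel_measurable(1) by simp

lemma kernel_integrable: "integrable lborel (\<lambda>y. \<rho> (y - x))" "(\<integral>y. \<rho> (y - x) \<partial>lborel) = 1"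
proof -
  note [measurable] = kernel_measurable
  show "integrable lborel (\<lambda>y. \<rho> (y - x))"
    using nn_integral_kernel_shift[of x] kernel_facts(3) by (intro integrableI_nonneg) auto
  show "(\<integral>y. \<rho> (y - x) \<partial>lborel) = 1"
    using nn_integral_kernel_shift[of x] kernel_facts(3) by (subst integral_eq_nn_integral) auto
qed

text \<open>If \<open>f\<close> is replaced by a compactly supported \<phi> of class C^1, the
  identity says that the gradient of \<phi> times the shifted kernel has integral zero. Kernel and
  kernel gradient are bounded by \<open>C\<close>, so both sides are continuous in L^1 and the
  identity passes to the closure.\<close>

lemma W11_integration_by_parts:
  assumes w: "W11 f g"
  shows "(\<integral>y. (- (\<gamma> (y - x) \<bullet> e)) * f y \<partial>lborel) = (\<integral>y. \<rho> (y - x) * (g y \<bullet> e) \<partial>lborel)" (is "?l = ?r")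
proof -
  note [measurable] = kernel_measurable
  note [measurable] = W11_measurable[OF w]
  have b: "\<bar>- (\<gamma> (y - x) \<bullet> e)\<bar> \<le> C * norm e" for y
    using order_trans[OF Cauchy_Schwarz_ineq2 mult_right_mono[OF kernel_facts(5) norm_ge_zero], of "y - x" e] by simp
  define K where "K = 2 * C * norm e + 1"
  have K: "K > 0" unfolding K_def using kernel_facts(1) by (intro add_nonneg_pos) auto
  have "\<bar>?l - ?r\<bar> \<le> \<eta>" if \<eta>: "\<eta> > 0" for \<eta>
  proof -
    obtain \<phi> \<psi> where h: "has_grad \<phi> \<psi>" and cs: "compact_supp \<phi>" "compact_supp \<psi>"
      and a: "(\<integral>\<^sup>+x. \<bar>f x - \<phi> x\<bar> \<partial>lborel) \<le> ennreal (\<eta>/K)" "(\<integral>\<^sup>+x. norm (g x - \<psi> x) \<partial>lborel) \<le> ennreal (\<eta>/K)"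
      by (rule W11_approx[OF w, of "\<eta>/K"]) (use \<eta> K in auto)
    note [measurable] = has_grad_measurable(1,2)[OF h]
    have ie: "integrable lborel \<phi>" "integrable lborel \<psi>" "integrable lborel f" "integrable lborel g"
      using compact_supp_integrable[OF cs(1) has_grad_measurable(3)[OF h]] compact_supp_integrable[OF cs(2)] h w
      by (auto simp: has_grad_def W11_def)
    have nb: "(\<integral>y. norm (f y - \<phi> y) \<partial>lborel) \<le> \<eta>/K" "(\<integral>y. norm (g y - \<psi> y) \<partial>lborel) \<le> \<eta>/K"
      using a ie K \<eta> nn_integral_norm_le_imp[of "\<lambda>y. f y - \<phi> y"] nn_integral_norm_le_imp[of "\<lambda>y. g y - \<psi> y"] by auto
    have hH: "has_grad (\<lambda>y. \<rho> (y - x) * \<phi> y) (\<lambda>y. \<phi> y *\<^sub>R \<gamma> (y - x) + \<rho> (y - x) *\<^sub>R \<psi> y)"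
      unfolding has_grad_def
    proof (intro conjI allI)
      fix y
      have 1: "((\<lambda>y. \<rho> (y - x)) has_derivative (\<lambda>h. \<gamma> (y - x) \<bullet> h)) (at y)"
      proof (rule has_derivative_compose[where g=\<rho>])
        show "((\<lambda>y. y - x) has_derivative (\<lambda>h. h)) (at y)" by (auto intro!: derivative_eq_intros)
        show "(\<rho> has_derivative (\<bullet>) (\<gamma> (y - x))) (at (y - x))" using kernel_facts(2) by (simp add: has_grad_def)
      qed
      have 2: "(\<phi> has_derivative (\<lambda>h. \<psi> y \<bullet> h)) (at y)" using h by (simp add: has_grad_def)
      show "((\<lambda>y. \<rho> (y - x) * \<phi> y) has_derivative (\<bullet>) (\<phi> y *\<^sub>R \<gamma> (y - x) + \<rho> (y - x) *\<^sub>R \<psi> y)) (at y)"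
        by (rule has_derivative_eq_rhs[OF has_derivative_mult[OF 1 2]]) (auto simp: inner_add_left)
    next
      have c: "continuous_on UNIV (\<lambda>y. \<rho> (y - x))" "continuous_on UNIV (\<lambda>y. \<gamma> (y - x))"
        using has_grad_measurable(3)[OF kernel_facts(2)] kernel_facts(2)
        by (auto simp: has_grad_def intro!: continuous_on_compose2[of UNIV _ UNIV "\<lambda>y. y - x"] continuous_on_diff continuous_on_id continuous_on_const)
      show "continuous_on UNIV (\<lambda>y. \<phi> y *\<^sub>R \<gamma> (y - x) + \<rho> (y - x) *\<^sub>R \<psi> y)"
        using has_grad_measurable(3)[OF h] h c by (auto simp: has_grad_def intro!: continuous_on_add continuous_on_scaleR)
    qed
    have csH: "compact_supp (\<lambda>y. \<rho> (y - x) * \<phi> y)" "compact_supp (\<lambda>y. \<phi> y *\<^sub>R \<gamma> (y - x) + \<rho> (y - x) *\<^sub>R \<psi> y)"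
    proof -
      obtain R1 R2 where "\<And>y. R1 < norm y \<Longrightarrow> \<phi> y = 0" "\<And>y. R2 < norm y \<Longrightarrow> \<psi> y = 0"
        using cs by (auto simp: compact_supp_def)
      then show "compact_supp (\<lambda>y. \<rho> (y - x) * \<phi> y)" "compact_supp (\<lambda>y. \<phi> y *\<^sub>R \<gamma> (y - x) + \<rho> (y - x) *\<^sub>R \<psi> y)"
        unfolding compact_supp_def by (auto intro!: exI[of _ "max R1 R2"])
    qed
    have i1: "integrable lborel (\<lambda>y. (- (\<gamma> (y - x) \<bullet> e)) *\<^sub>R F y)" if "integrable lborel F" for F :: "'a \<Rightarrow> real"
      by (rule integrable_bounded_scaleR(1)[OF that _ b]) measurable
    have i2: "integrable lborel (\<lambda>y. \<rho> (y - x) *\<^sub>R (F y \<bullet> e))" if "integrable lborel F" for F :: "'a \<Rightarrow> 'a"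
      by (rule integrable_bounded_scaleR(1)[OF _ _ kernel_facts(4)]) (use that in auto)
    have "0 = (\<integral>y. (\<phi> y *\<^sub>R \<gamma> (y - x) + \<rho> (y - x) *\<^sub>R \<psi> y) \<bullet> e \<partial>lborel)"
      using has_grad_integral_zero[OF hH csH, of e] by simp
    also have "\<dots> = (\<integral>y. \<rho> (y - x) *\<^sub>R (\<psi> y \<bullet> e) - (- (\<gamma> (y - x) \<bullet> e)) *\<^sub>R \<phi> y \<partial>lborel)"
      by (intro Bochner_Integration.integral_cong) (auto simp: inner_add_left)
    also have "\<dots> = (\<integral>y. \<rho> (y - x) *\<^sub>R (\<psi> y \<bullet> e) \<partial>lborel) - (\<integral>y. (- (\<gamma> (y - x) \<bullet> e)) *\<^sub>R \<phi> y \<partial>lborel)"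
      by (intro Bochner_Integration.integral_diff i1 i2 ie)
    finally have eq: "(\<integral>y. (- (\<gamma> (y - x) \<bullet> e)) *\<^sub>R \<phi> y \<partial>lborel) = (\<integral>y. \<rho> (y - x) *\<^sub>R (\<psi> y \<bullet> e) \<partial>lborel)" by simp
    have "?l - (\<integral>y. (- (\<gamma> (y - x) \<bullet> e)) *\<^sub>R \<phi> y \<partial>lborel) = (\<integral>y. (- (\<gamma> (y - x) \<bullet> e)) *\<^sub>R (f y - \<phi> y) \<partial>lborel)"
      using i1[OF ie(3)] i1[OF ie(1)] by (simp add: right_diff_distrib)
    also have "norm \<dots> \<le> C * norm e * (\<integral>y. norm (f y - \<phi> y) \<partial>lborel)"
      by (rule integrable_bounded_scaleR(2)[OF _ _ b]) (use ie in auto)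
    finally have d1: "\<bar>?l - (\<integral>y. (- (\<gamma> (y - x) \<bullet> e)) *\<^sub>R \<phi> y \<partial>lborel)\<bar> \<le> C * norm e * (\<eta>/K)"
      using mult_left_mono[OF nb(1), of "C * norm e"] kernel_facts(1) by simp
    have "?r - (\<integral>y. \<rho> (y - x) *\<^sub>R (\<psi> y \<bullet> e) \<partial>lborel) = (\<integral>y. \<rho> (y - x) *\<^sub>R ((g y - \<psi> y) \<bullet> e) \<partial>lborel)"
      using i2[OF ie(4)] i2[OF ie(2)] by (simp add: right_diff_distrib inner_diff_left)
    also have "norm \<dots> \<le> C * (\<integral>y. norm ((g y - \<psi> y) \<bullet> e) \<partial>lborel)"
      by (rule integrable_bounded_scaleR(2)[OF _ _ kernel_facts(4)]) (use ie in auto)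
    also have "\<dots> \<le> C * ((\<integral>y. norm (g y - \<psi> y) * norm e \<partial>lborel))"
      using ie kernel_facts(1) by (intro mult_left_mono integral_mono) (auto simp: Cauchy_Schwarz_ineq2)
    also have "\<dots> \<le> C * ((\<eta>/K) * norm e)"
      using nb(2) kernel_facts(1) by (subst integral_mult_left_zero) (intro mult_left_mono mult_right_mono; simp)
    finally have d2: "\<bar>?r - (\<integral>y. \<rho> (y - x) *\<^sub>R (\<psi> y \<bullet> e) \<partial>lborel)\<bar> \<le> C * norm e * (\<eta>/K)" by (simp add: mult_ac)
    have "\<bar>?l - ?r\<bar> \<le> C * norm e * (\<eta>/K) + C * norm e * (\<eta>/K)"
      using add_mono[OF d1[unfolded eq] d2]
        abs_triangle_ineq4[of "?l - (\<integral>y. \<rho> (y - x) *\<^sub>R (\<psi> y \<bullet> e) \<partial>lborel)" "?r - (\<integral>y. \<rho> (y - x) *\<^sub>R (\<psi> y \<bullet> e) \<partial>lborel)"]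
      by (simp del: real_scaleR_def)
    also have "\<dots> = (\<eta>/K) * (K - 1)" by (simp add: K_def)
    also have "\<dots> \<le> (\<eta>/K) * K" using K \<eta> by (intro mult_left_mono) auto
    also have "\<dots> = \<eta>" using K by simp
    finally show ?thesis .
  qed
  then have "\<bar>?l - ?r\<bar> \<le> 0" by (rule field_le_epsilon[where y=0, simplified])
  then show ?thesis by simp
qed

text \<open>Mollification commutes with the divergence and averages it against a probability
  density. The bound \<open>d\<close> therefore survives with the same constant, and turns from an
  almost everywhere bound into one at every point.\<close>

lemma mconv_divergence_bound:
  assumes s: "slice U a d"
  shows "\<bar>\<Sum>e\<in>Basis. mconv_deriv \<gamma> U x e \<bullet> e\<bar> \<le> d"
proof -
  note [measurable] = kernel_measurable
  have U: "integrable lborel U" by (rule slice_integrable[OF s])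
  obtain g where g: "\<And>e. e \<in> Basis \<Longrightarrow> W11 (\<lambda>x. U x \<bullet> e) (g e)" and d: "AE x in lborel. \<bar>\<Sum>e\<in>Basis. g e x \<bullet> e\<bar> \<le> d"
    using s by (auto simp: slice_def)
  have gi: "integrable lborel (\<lambda>y. \<rho> (y - x) * (g e y \<bullet> e))" if "e \<in> Basis" for e
    using integrable_bounded_scaleR(1)[of "\<lambda>y. g e y \<bullet> e" "\<lambda>y. \<rho> (y - x)" C] kernel_facts(4) g[OF that] by (auto simp: W11_def)
  have "mconv_deriv \<gamma> U x e \<bullet> e = (\<integral>y. \<rho> (y - x) * (g e y \<bullet> e) \<partial>lborel)" if "e \<in> Basis" for e
  proof -
    have "mconv_deriv \<gamma> U x e \<bullet> e = (\<integral>y. ((- (\<gamma> (y - x) \<bullet> e)) *\<^sub>R U y) \<bullet> e \<partial>lborel)"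
      unfolding mconv_deriv_def by (rule integral_inner_left[symmetric]) (use mconv_deriv_linear(3)[OF U] in auto)
    also have "\<dots> = (\<integral>y. (- (\<gamma> (y - x) \<bullet> e)) * (U y \<bullet> e) \<partial>lborel)" by simp
    finally show ?thesis using W11_integration_by_parts[OF g[OF that]] by simp
  qed
  then have "(\<Sum>e\<in>Basis. mconv_deriv \<gamma> U x e \<bullet> e) = (\<Sum>e\<in>Basis. (\<integral>y. \<rho> (y - x) * (g e y \<bullet> e) \<partial>lborel))" by simp
  also have "\<dots> = (\<integral>y. (\<Sum>e\<in>Basis. \<rho> (y - x) * (g e y \<bullet> e)) \<partial>lborel)"
    using gi by (subst Bochner_Integration.integral_sum) auto
  also have "norm \<dots> \<le> (\<integral>y. \<rho> (y - x) * d \<partial>lborel)"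
  proof (rule order_trans[OF integral_norm_bound integral_mono_AE])
    show "integrable lborel (\<lambda>y. norm (\<Sum>e\<in>Basis. \<rho> (y - x) * (g e y \<bullet> e)))" using gi by auto
    show "integrable lborel (\<lambda>y. \<rho> (y - x) * d)" using kernel_integrable(1) by simp
    show "AE y in lborel. norm (\<Sum>e\<in>Basis. \<rho> (y - x) * (g e y \<bullet> e)) \<le> \<rho> (y - x) * d"
      using d by eventually_elim (auto simp: sum_distrib_left[symmetric] abs_mult kernel_facts(3) mult_left_mono)
  qed
  finally show ?thesis using kernel_integrable(2)[of x] by simp
qed

end

text \<open>For C^1 functions the increment is an integral of the gradient along the segment, and by
  Fubini each point of the segment contributes the same L^1 norm. The approximation error enters
  once through the gradient and twice through the function, whence \<open>K\<close>.\<close>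

lemma W11_translation:
  fixes f :: "'a::euclidean_space \<Rightarrow> real"
  assumes w: "W11 f g"
  shows "(\<integral>\<^sup>+x. \<bar>f (x + z) - f x\<bar> \<partial>lborel) \<le> ennreal (norm z) * (\<integral>\<^sup>+x. norm (g x) \<partial>lborel)"
proof (rule ennreal_le_epsilon)
  fix e :: real assume e: "e > 0"
  note [measurable] = W11_measurable[OF w]
  define K where "K = 2 + norm z"
  have K: "K > 0" unfolding K_def by (intro add_pos_nonneg) auto
  obtain \<phi> \<psi> where h: "has_grad \<phi> \<psi>"
    and a: "(\<integral>\<^sup>+x. \<bar>f x - \<phi> x\<bar> \<partial>lborel) \<le> ennreal (e/K)" "(\<integral>\<^sup>+x. norm (g x - \<psi> x) \<partial>lborel) \<le> ennreal (e/K)"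
    by (rule W11_approx[OF w, of "e/K"]) (use e K in auto)
  note [measurable] = has_grad_measurable(1,2)[OF h]
  let ?G = "\<integral>\<^sup>+x. norm (g x) \<partial>lborel"
  have "(\<integral>\<^sup>+x. \<bar>\<phi> (x + z) - \<phi> x\<bar> \<partial>lborel) \<le> (\<integral>\<^sup>+x. (\<integral>\<^sup>+s\<in>{0..1}. ennreal (norm (\<psi> (x + s *\<^sub>R z)) * norm z) \<partial>lborel) \<partial>lborel)"
    using has_grad_segment_bound[OF h, of 1] by (intro nn_integral_mono) simp
  also have "\<dots> = (\<integral>\<^sup>+s. \<integral>\<^sup>+x. ennreal (norm (\<psi> (x + s *\<^sub>R z)) * norm z) * indicator {0..1} s \<partial>lborel \<partial>lborel)"
    by (rule nn_integral_lborel_swap[symmetric]) (unfold borel_prod[symmetric], measurable)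
  also have "\<dots> = (\<integral>\<^sup>+s. (ennreal (norm z) * (\<integral>\<^sup>+x. norm (\<psi> x) \<partial>lborel)) * indicator {0..1::real} s \<partial>lborel)"
  proof (intro nn_integral_cong)
    fix s :: real
    have "(\<integral>\<^sup>+x. ennreal (norm (\<psi> (x + s *\<^sub>R z)) * norm z) * indicator {0..1} s \<partial>lborel)
      = (\<integral>\<^sup>+x. (ennreal (norm z) * indicator {0..1} s) * ennreal (norm (\<psi> (s *\<^sub>R z + x))) \<partial>lborel)"
      by (intro nn_integral_cong) (simp add: ennreal_mult' ac_simps)
    also have "\<dots> = (ennreal (norm z) * indicator {0..1} s) * (\<integral>\<^sup>+x. norm (\<psi> x) \<partial>lborel)"
      by (subst nn_integral_cmult, measurable) (subst nn_integral_lborel_shift[where f="\<lambda>x. ennreal (norm (\<psi> x))"], auto)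
    finally show "(\<integral>\<^sup>+x. ennreal (norm (\<psi> (x + s *\<^sub>R z)) * norm z) * indicator {0..1} s \<partial>lborel)
      = (ennreal (norm z) * (\<integral>\<^sup>+x. norm (\<psi> x) \<partial>lborel)) * indicator {0..1} s" by (simp add: ac_simps)
  qed
  also have "\<dots> = ennreal (norm z) * (\<integral>\<^sup>+x. norm (\<psi> x) \<partial>lborel)"
    by (subst nn_integral_cmult_indicator) auto
  also have "\<dots> \<le> ennreal (norm z) * (?G + ennreal (e/K))"
    by (intro mult_left_mono order_trans[OF nn_integral_norm_triangle[of \<psi> g]] add_left_mono a) auto
  finally have \<phi>: "(\<integral>\<^sup>+x. \<bar>\<phi> (x + z) - \<phi> x\<bar> \<partial>lborel) \<le> ennreal (norm z) * (?G + ennreal (e/K))" .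
  have "(\<integral>\<^sup>+x. \<bar>f (x + z) - f x\<bar> \<partial>lborel) \<le> (\<integral>\<^sup>+x. ennreal \<bar>\<phi> (x + z) - \<phi> x\<bar> + ennreal \<bar>f (z + x) - \<phi> (z + x)\<bar> + ennreal \<bar>f x - \<phi> x\<bar> \<partial>lborel)"
    by (intro nn_integral_mono) (auto simp: add.commute intro!: ennreal_leI simp flip: ennreal_plus)
  also have "\<dots> = (\<integral>\<^sup>+x. \<bar>\<phi> (x + z) - \<phi> x\<bar> \<partial>lborel) + (\<integral>\<^sup>+x. \<bar>f (z + x) - \<phi> (z + x)\<bar> \<partial>lborel) + (\<integral>\<^sup>+x. \<bar>f x - \<phi> x\<bar> \<partial>lborel)"
    by (simp add: nn_integral_add)
  also have "(\<integral>\<^sup>+x. \<bar>f (z + x) - \<phi> (z + x)\<bar> \<partial>lborel) = (\<integral>\<^sup>+x. \<bar>f x - \<phi> x\<bar> \<partial>lborel)"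
    by (rule nn_integral_lborel_shift) measurable
  also have "(\<integral>\<^sup>+x. \<bar>\<phi> (x + z) - \<phi> x\<bar> \<partial>lborel) + (\<integral>\<^sup>+x. \<bar>f x - \<phi> x\<bar> \<partial>lborel) + (\<integral>\<^sup>+x. \<bar>f x - \<phi> x\<bar> \<partial>lborel)
    \<le> ennreal (norm z) * (?G + ennreal (e/K)) + ennreal (e/K) + ennreal (e/K)"
    by (intro add_mono \<phi> a)
  also have "\<dots> = ennreal (norm z) * ?G + ennreal (norm z * (e/K) + e/K + e/K)"
  proof -
    have "ennreal p * ennreal q + ennreal q + ennreal q = ennreal (p * q + q + q)" if "0 \<le> p" "0 \<le> q" for p q
      using that by (simp flip: ennreal_mult ennreal_plus)
    from this[of "norm z" "e/K"] show ?thesis using e K by (simp add: distrib_left add.assoc)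
  qed
  also have "norm z * (e/K) + e/K + e/K = (e/K) * K"
  proof -
    have "norm z * q + q + q = q * K" for q unfolding K_def by (simp add: algebra_simps)
    then show ?thesis .
  qed
  also have "\<dots> = e" using K by simp
  finally show "(\<integral>\<^sup>+x. \<bar>f (x + z) - f x\<bar> \<partial>lborel) \<le> ennreal (norm z) * ?G + ennreal e" .
qed

lemma slice_translation:
  fixes U :: "'a::euclidean_space \<Rightarrow> 'a"
  and a :: real
  assumes s: "slice U a d" and a: "0 \<le> a"
  shows "(\<integral>\<^sup>+x. norm (U (x + z) - U x) \<partial>lborel) \<le> ennreal (DIM('a) * a * norm z)"
proof -
  obtain g where g: "\<And>e. e \<in> Basis \<Longrightarrow> W11 (\<lambda>x. U x \<bullet> e) (g e)" "\<And>e. e \<in> Basis \<Longrightarrow> (\<integral>\<^sup>+x. norm (g e x) \<partial>lborel) \<le> ennreal a"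
    using s by (auto simp: slice_def)
  have [measurable]: "U \<in> borel_measurable borel" using slice_integrable[OF s] by auto
  have "(\<integral>\<^sup>+x. norm (U (x + z) - U x) \<partial>lborel) \<le> (\<integral>\<^sup>+x. (\<Sum>e\<in>Basis. ennreal \<bar>U (x + z) \<bullet> e - U x \<bullet> e\<bar>) \<partial>lborel)"
  proof (intro nn_integral_mono)
    fix x
    have "norm (U (x + z) - U x) \<le> (\<Sum>e\<in>Basis. \<bar>U (x + z) \<bullet> e - U x \<bullet> e\<bar>)"
      using norm_le_l1[of "U (x + z) - U x"] by (simp add: inner_diff_left)
    then show "ennreal (norm (U (x + z) - U x)) \<le> (\<Sum>e\<in>Basis. ennreal \<bar>U (x + z) \<bullet> e - U x \<bullet> e\<bar>)"
      by (subst sum_ennreal) (auto intro: ennreal_leI)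
  qed
  also have "\<dots> = (\<Sum>e\<in>Basis. \<integral>\<^sup>+x. \<bar>U (x + z) \<bullet> e - U x \<bullet> e\<bar> \<partial>lborel)"
    by (rule nn_integral_sum) auto
  also have "\<dots> \<le> (\<Sum>e\<in>(Basis::'a set). ennreal (norm z) * ennreal a)"
    by (intro sum_mono order_trans[OF W11_translation[OF g(1)]] mult_left_mono g(2)) auto
  also have "\<dots> = ennreal (DIM('a) * a * norm z)"
    using a by (simp add: ennreal_mult ennreal_of_nat_eq_real_of_nat mult_ac)
  finally show ?thesis .
qed

text \<open>The error is the average over |z| \<le> \<epsilon> of the L^1 translation errors. Being
  linear in \<open>a\<close>, it can be integrated in time and remains proportional to
  \<epsilon>.\<close>

lemma mconv_approx:
  fixes U :: "'a::euclidean_space \<Rightarrow> 'a" and a \<epsilon> :: real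
  assumes k: "kernel \<epsilon> \<rho> \<gamma> C" and \<epsilon>: "0 < \<epsilon>" and s: "slice U a d" and a: "0 \<le> a"
  shows "(\<integral>\<^sup>+x. norm (mconv \<rho> U x - U x) \<partial>lborel) \<le> ennreal (DIM('a) * a * \<epsilon>)"
proof -
  note kf = kernel_facts[OF k]
  note [measurable] = kernel_measurable[OF k]
  have U: "integrable lborel U" by (rule slice_integrable[OF s])
  then have [measurable]: "U \<in> borel_measurable borel" by auto
  have "(\<integral>\<^sup>+x. norm (mconv \<rho> U x - U x) \<partial>lborel) \<le> (\<integral>\<^sup>+x. \<integral>\<^sup>+z. ennreal (\<rho> z) * ennreal (norm (U (x + z) - U x)) \<partial>lborel \<partial>lborel)"
  proof (intro nn_integral_mono)
    fix x
    have i: "integrable lborel (\<lambda>y. \<rho> (y - x) *\<^sub>R U y)"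
      by (rule integrable_bounded_scaleR(1)[OF U _ kf(4)]) measurable
    have i': "integrable lborel (\<lambda>y. \<rho> (y - x) *\<^sub>R U x)" using kernel_integrable(1)[OF k, of x] by simp
    have "mconv \<rho> U x - U x = (\<integral>y. \<rho> (y - x) *\<^sub>R U y \<partial>lborel) - (\<integral>y. \<rho> (y - x) *\<^sub>R U x \<partial>lborel)"
      using kernel_integrable[OF k, of x] by (simp add: mconv_def)
    also have "\<dots> = (\<integral>y. \<rho> (y - x) *\<^sub>R (U y - U x) \<partial>lborel)"
      using i i' by (simp add: scaleR_diff_right)
    also have "ennreal (norm \<dots>) \<le> (\<integral>\<^sup>+y. ennreal (norm (\<rho> (y - x) *\<^sub>R (U y - U x))) \<partial>lborel)"
      using i i' by (intro integral_norm_bound_ennreal) (simp add: scaleR_diff_right)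
    also have "\<dots> = (\<integral>\<^sup>+z. ennreal (norm (\<rho> ((x + z) - x) *\<^sub>R (U (x + z) - U x))) \<partial>lborel)"
      by (rule nn_integral_lborel_shift[symmetric]) measurable
    also have "\<dots> = (\<integral>\<^sup>+z. ennreal (\<rho> z) * ennreal (norm (U (x + z) - U x)) \<partial>lborel)"
      using kf(3) by (simp add: ennreal_mult')
    finally show "ennreal (norm (mconv \<rho> U x - U x)) \<le> (\<integral>\<^sup>+z. ennreal (\<rho> z) * ennreal (norm (U (x + z) - U x)) \<partial>lborel)" .
  qed
  also have "\<dots> = (\<integral>\<^sup>+z. \<integral>\<^sup>+x. ennreal (\<rho> z) * ennreal (norm (U (x + z) - U x)) \<partial>lborel \<partial>lborel)"
    by (rule nn_integral_lborel_swap[symmetric]) (unfold borel_prod[symmetric], measurable)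
  also have "\<dots> \<le> (\<integral>\<^sup>+z. ennreal (\<rho> z) * ennreal (DIM('a) * a * \<epsilon>) \<partial>lborel)"
  proof (intro nn_integral_mono)
    fix z
    have "(\<integral>\<^sup>+x. ennreal (\<rho> z) * ennreal (norm (U (x + z) - U x)) \<partial>lborel) = ennreal (\<rho> z) * (\<integral>\<^sup>+x. ennreal (norm (U (x + z) - U x)) \<partial>lborel)"
      by (subst nn_integral_cmult) auto
    also have "\<dots> \<le> ennreal (\<rho> z) * ennreal (DIM('a) * a * norm z)"
      by (intro mult_left_mono slice_translation[OF s a]) auto
    also have "\<dots> \<le> ennreal (\<rho> z) * ennreal (DIM('a) * a * \<epsilon>)"
    proof (cases "\<epsilon> < norm z")
      case False
      then show ?thesis using a by (intro mult_left_mono ennreal_leI) auto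
    qed (use kf(7) in simp)
    finally show "(\<integral>\<^sup>+x. ennreal (\<rho> z) * ennreal (norm (U (x + z) - U x)) \<partial>lborel) \<le> ennreal (\<rho> z) * ennreal (DIM('a) * a * \<epsilon>)" .
  qed
  also have "\<dots> = ennreal (DIM('a) * a * \<epsilon>)" by (subst nn_integral_multc) (auto simp: kf(9))
  finally show ?thesis .
qed

section \<open>Changes of variables\<close>

text \<open>On Borel sets the bound says that the image measure is at most \<open>L\<close> times
  Lebesgue measure; such a comparison of measures extends to all nonnegative integrands.\<close>

lemma comprI:
  fixes Y :: "'a::euclidean_space \<Rightarrow> 'a"
  assumes [measurable]: "Y \<in> borel_measurable borel" and L: "0 \<le> L"
    and m: "\<And>B. B \<in> sets borel \<Longrightarrow> emeasure lborel (Y -` B) \<le> ennreal L * emeasure lborel B"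
  shows "compr UNIV L Y"
  unfolding compr_def
proof (intro conjI ballI L)
  show "Y \<in> borel_measurable borel" by fact
  fix f :: "'a \<Rightarrow> ennreal" assume [measurable]: "f \<in> borel_measurable borel"
  have le: "distr lborel borel Y \<le> scale_measure (ennreal L) lborel"
    by (subst le_measure) (auto simp: emeasure_distr m)
  have "(\<integral>\<^sup>+x\<in>UNIV. f (Y x) \<partial>lborel) = (\<integral>\<^sup>+y. f y \<partial>distr lborel borel Y)"
    by (subst nn_integral_distr) auto
  also have "\<dots> \<le> (\<integral>\<^sup>+y. f y \<partial>scale_measure (ennreal L) lborel)"
    by (rule nn_integral_mono_measure[OF _ le]) simp
  also have "\<dots> = ennreal L * (\<integral>\<^sup>+y. f y \<partial>lborel)" by (rule nn_integral_scale_measure) simp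
  finally show "(\<integral>\<^sup>+x\<in>UNIV. f (Y x) \<partial>lborel) \<le> ennreal L * (\<integral>\<^sup>+y. f y \<partial>lborel)" .
qed

lemma compr_emeasure:
  assumes c: "compr S L Y" and [measurable]: "S \<in> sets borel" "B \<in> sets borel"
  shows "emeasure lborel {x\<in>S. Y x \<in> B} \<le> ennreal L * emeasure lborel B"
proof -
  note [measurable] = comprD(1)[OF c]
  have "emeasure lborel {x\<in>S. Y x \<in> B} = (\<integral>\<^sup>+x. indicator {x\<in>S. Y x \<in> B} x \<partial>lborel)" by simp
  also have "\<dots> = (\<integral>\<^sup>+x\<in>S. indicator B (Y x) \<partial>lborel)" by (intro nn_integral_cong) (auto simp: indicator_def)
  also have "\<dots> \<le> ennreal L * (\<integral>\<^sup>+x. indicator B x \<partial>lborel)" by (rule comprD(3)[OF c]) simp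
  finally show ?thesis by simp
qed

lemma compr_subset:
  assumes "compr UNIV L Y"
  shows "compr S L Y"
  unfolding compr_def
proof (intro conjI ballI)
  show "Y \<in> borel_measurable borel" "0 \<le> L" using comprD[OF assms] by auto
  fix f :: "'a \<Rightarrow> ennreal" assume f: "f \<in> borel_measurable borel"
  have "(\<integral>\<^sup>+x\<in>S. f (Y x) \<partial>lborel) \<le> (\<integral>\<^sup>+x\<in>UNIV. f (Y x) \<partial>lborel)"
    by (intro nn_integral_mono) (auto simp: indicator_def)
  also have "\<dots> \<le> ennreal L * (\<integral>\<^sup>+x. f x \<partial>lborel)" by (rule comprD(3)[OF assms f])
  finally show "(\<integral>\<^sup>+x\<in>S. f (Y x) \<partial>lborel) \<le> ennreal L * (\<integral>\<^sup>+x. f x \<partial>lborel)" .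
qed

lemma compr_mono:
  assumes "compr S L Y" "L \<le> L'"
  shows "compr S L' Y"
  unfolding compr_def
proof (intro conjI ballI)
  show "Y \<in> borel_measurable borel" "0 \<le> L'" using comprD[OF assms(1)] assms(2) by auto
  fix f :: "'a \<Rightarrow> ennreal" assume f: "f \<in> borel_measurable borel"
  show "(\<integral>\<^sup>+x\<in>S. f (Y x) \<partial>lborel) \<le> ennreal L' * (\<integral>\<^sup>+x. f x \<partial>lborel)"
    using comprD(3)[OF assms(1) f] by (rule order_trans) (intro mult_right_mono ennreal_leI assms(2), simp)
qed

lemma compr_id: "compr UNIV 1 (\<lambda>x. x)"
  by (auto simp: compr_def)

lemma compr_compose:
  assumes f: "compr UNIV L1 f" and g: "compr S L2 g"
  shows "compr S (L1 * L2) (\<lambda>x. f (g x))"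
  unfolding compr_def
proof (intro conjI ballI)
  note [measurable] = comprD(1)[OF f] comprD(1)[OF g]
  show "(\<lambda>x. f (g x)) \<in> borel_measurable borel" by measurable
  have L: "0 \<le> L1" "0 \<le> L2" using comprD[OF f] comprD[OF g] by auto
  then show "0 \<le> L1 * L2" by simp
  fix \<phi> :: "'a \<Rightarrow> ennreal" assume [measurable]: "\<phi> \<in> borel_measurable borel"
  have "(\<integral>\<^sup>+x\<in>S. \<phi> (f (g x)) \<partial>lborel) \<le> ennreal L2 * (\<integral>\<^sup>+x. \<phi> (f x) \<partial>lborel)"
    by (rule comprD(3)[OF g]) measurable
  also have "\<dots> \<le> ennreal L2 * (ennreal L1 * (\<integral>\<^sup>+x. \<phi> x \<partial>lborel))"
    using comprD(3)[OF f, of \<phi>] by (intro mult_left_mono) auto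
  also have "\<dots> = ennreal (L1 * L2) * (\<integral>\<^sup>+x. \<phi> x \<partial>lborel)"
    using L by (simp add: ennreal_mult mult_ac)
  finally show "(\<integral>\<^sup>+x\<in>S. \<phi> (f (g x)) \<partial>lborel) \<le> ennreal (L1 * L2) * (\<integral>\<^sup>+x. \<phi> x \<partial>lborel)" .
qed

lemma compact_measure:
  fixes K :: "'a::euclidean_space set"
  assumes "compact K"
  shows "((\<lambda>x. 1::real) has_integral measure lebesgue K) K" "emeasure lborel K = ennreal (measure lebesgue K)"
proof -
  have K: "K \<in> sets borel" "emeasure lborel K < \<infinity>"
    using assms emeasure_bounded_finite[OF compact_imp_bounded[OF assms]] by (auto intro: borel_compact)
  then have m: "measure lebesgue K = measure lborel K" by simp
  show "((\<lambda>x. 1::real) has_integral measure lebesgue K) K"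
    unfolding m using has_integral_measure_lborel[of K] K by simp
  show "emeasure lborel K = ennreal (measure lebesgue K)"
    unfolding m using K by (intro emeasure_eq_ennreal_measure) auto
qed

lemma measure_image_det_lower_bound:
  fixes E :: "real^'n::{finite,wellorder} \<Rightarrow> real^'n::_"
  assumes K: "compact K" and der: "\<And>x. (E has_derivative E' x) (at x)" and inj: "inj E"
    and det: "\<And>x. c \<le> \<bar>det (matrix (E' x))\<bar>"
  shows "c * measure lebesgue K \<le> measure lebesgue (E ` K)"
proof -
  have cE: "continuous_on UNIV E"
    using has_derivative_continuous[OF der] by (auto intro!: continuous_at_imp_continuous_on)
  have EK: "E ` K \<in> lmeasurable"
    by (intro lmeasurable_compact compact_continuous_image continuous_on_subset[OF cE] K) auto
  \<comment> \<open>The integrand takes values in \<open>real^1\<close>, since the change of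
    variables formula concerns functions into some \<open>real^n\<close>; its single component gives
    the scalar statement.\<close>
  let ?f = "\<lambda>_. 1 :: real^1"
  have one: "?f absolutely_integrable_on (E ` K)" "integral (E ` K) ?f = measure lebesgue (E ` K) *\<^sub>R 1"
  proof -
    show a: "?f absolutely_integrable_on (E ` K)" using EK by (rule absolutely_integrable_on_const)
    have "(?f has_integral measure lebesgue (E ` K) *\<^sub>R (1::real^1)) (E ` K)"
    proof -
      have "((\<lambda>x. 1::real) has_integral measure lebesgue (E ` K)) (E ` K)"
        by (intro compact_measure(1) compact_continuous_image continuous_on_subset[OF cE] K) auto
      from has_integral_scaleR_left[OF this, of "1::real^1"] show ?thesis by simp
    qed
    then show "integral (E ` K) ?f = measure lebesgue (E ` K) *\<^sub>R 1" by (rule integral_unique)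
  qed
  have *: "(\<lambda>x. \<bar>det (matrix (E' x))\<bar> *\<^sub>R ?f (E x)) absolutely_integrable_on K \<and>
      integral K (\<lambda>x. \<bar>det (matrix (E' x))\<bar> *\<^sub>R ?f (E x)) = measure lebesgue (E ` K) *\<^sub>R 1"
    by (subst has_absolute_integral_change_of_variables_compact[OF K has_derivative_at_withinI[OF der] inj_on_subset[OF inj]])
      (use one in auto)
  have int: "(\<lambda>x. \<bar>det (matrix (E' x))\<bar> *\<^sub>R ?f (E x)) integrable_on K"
    by (rule set_lebesgue_integral_eq_integral(1)[OF conjunct1[OF *]])
  have "((\<lambda>x. \<bar>det (matrix (E' x))\<bar> *\<^sub>R (1::real^1)) has_integral measure lebesgue (E ` K) *\<^sub>R 1) K"
    using integrable_integral[OF int] conjunct2[OF *] by simp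
  from has_integral_linear[OF this bounded_linear_vec_nth[of 1]]
  have A: "((\<lambda>x. \<bar>det (matrix (E' x))\<bar>) has_integral measure lebesgue (E ` K)) K" by (simp add: o_def)
  have B: "((\<lambda>x. c) has_integral (c * measure lebesgue K)) K"
    using has_integral_mult_right[OF compact_measure(1)[OF K], of c] by simp
  show ?thesis by (rule has_integral_le[OF B A]) (rule det)
qed

text \<open>For compact T inside the preimage of B, the Jacobian bound gives c |T| \<le> |E(T)|
  \<le> |B|. Inner regularity extends this to bounded pieces of the preimage, and these exhaust it.
  Thus a lower bound for the Jacobian of the map itself controls preimages, without any regularity
  of the inverse.\<close>

lemma compr_of_det_bound:
  fixes E :: "real^'n::{finite,wellorder} \<Rightarrow> real^'n::_"
  assumes der: "\<And>x. (E has_derivative E' x) (at x)" and inj: "inj E"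
    and c: "0 < c" and det: "\<And>x. c \<le> \<bar>det (matrix (E' x))\<bar>"
  shows "compr UNIV (1 / c) E"
proof (rule comprI)
  have cE: "continuous_on UNIV E"
    using has_derivative_continuous[OF der] by (auto intro!: continuous_at_imp_continuous_on)
  then show [measurable]: "E \<in> borel_measurable borel" by (rule borel_measurable_continuous_onI)
  show "0 \<le> 1 / c" using c by simp
  fix B :: "(real^'n::{finite,wellorder}) set" assume [measurable]: "B \<in> sets borel"
  have Sm: "E -` B \<inter> cball 0 (real k) \<in> sets borel" for k :: nat
    using measurable_sets[OF \<open>E \<in> borel_measurable borel\<close> \<open>B \<in> sets borel\<close>] by (intro sets.Int) auto
  have bnd: "emeasure lborel (E -` B \<inter> cball 0 (real k)) \<le> ennreal (1 / c) * emeasure lborel B" for k :: nat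
  proof (rule ennreal_le_epsilon)
    fix e :: real assume e: "0 < e"
    let ?S = "E -` B \<inter> cball 0 (real k)"
    have SL: "?S \<in> sets lebesgue" using Sm[of k] by simp
    obtain T where T: "closed T" "T \<subseteq> ?S" "?S - T \<in> lmeasurable" "emeasure lebesgue (?S - T) < ennreal e"
      by (rule sets_lebesgue_inner_closed[OF SL e])
    have cT: "compact T"
      using T(1,2) by (auto simp: compact_eq_bounded_closed intro: bounded_subset[OF bounded_cball])
    have Tm: "T \<in> sets borel" using T(1) by simp
    have cEK: "compact (E ` T)" by (intro compact_continuous_image continuous_on_subset[OF cE] cT) auto
    have "ennreal (c * measure lebesgue T) \<le> ennreal (measure lebesgue (E ` T))"
      by (intro ennreal_leI measure_image_det_lower_bound[OF cT der inj det])
    also have "\<dots> = emeasure lborel (E ` T)"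
      by (rule compact_measure(2)[OF cEK, symmetric])
    also have "\<dots> \<le> emeasure lborel B" using T(2) by (intro emeasure_mono) auto
    finally have 1: "ennreal (c * measure lebesgue T) \<le> emeasure lborel B" .
    have "emeasure lborel T = ennreal (measure lebesgue T)"
      by (rule compact_measure(2)[OF cT])
    also have "\<dots> = ennreal (1 / c) * ennreal (c * measure lebesgue T)"
      using c by (simp add: ennreal_mult'[symmetric])
    also have "\<dots> \<le> ennreal (1 / c) * emeasure lborel B" by (intro mult_left_mono 1) simp
    finally have 2: "emeasure lborel T \<le> ennreal (1 / c) * emeasure lborel B" .
    have "emeasure lborel ?S = emeasure lborel (T \<union> (?S - T))" using T(2) by (simp add: Un_absorb1)
    also have "\<dots> \<le> emeasure lborel T + emeasure lborel (?S - T)"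
      using Tm Sm[of k] by (intro emeasure_subadditive) auto
    also have "emeasure lborel (?S - T) = emeasure lebesgue (?S - T)" using Tm Sm[of k] by simp
    also have "emeasure lborel T + emeasure lebesgue (?S - T) \<le> ennreal (1 / c) * emeasure lborel B + ennreal e"
      using T(4) by (intro add_mono 2) auto
    finally show "emeasure lborel ?S \<le> ennreal (1 / c) * emeasure lborel B + ennreal e" .
  qed
  have "(\<lambda>k. emeasure lborel (E -` B \<inter> cball 0 (real k))) \<longlonglongrightarrow> emeasure lborel (\<Union>k. E -` B \<inter> cball 0 (real k))"
    using Sm by (intro Lim_emeasure_incseq) (auto simp: incseq_def)
  moreover have "(\<Union>k. E -` B \<inter> cball 0 (real k)) = E -` B"
    using real_arch_simple by fastforce
  ultimately show "emeasure lborel (E -` B) \<le> ennreal (1 / c) * emeasure lborel B"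
    using bnd by (auto intro: LIMSEQ_le_const2)
qed

text \<open>Apart from 1 and the trace, the expanded determinant consists of six products of two
  entries and six products of three entries. Each is at most \<nu>^2, the triple products because
  \<nu> \<le> 1; this is the constant 12. The trace is kept apart, as it is the divergence and must
  not be estimated by the size of the matrix.\<close>

lemma det_identity_plus_lower_bound:
  fixes M :: "real^3 \<Rightarrow> real^3"
  assumes \<nu>: "0 \<le> \<nu>" "\<nu> \<le> 1" and M: "\<And>h. norm (M h) \<le> \<nu> * norm h"
    and tr: "\<bar>\<Sum>e\<in>Basis. M e \<bullet> e\<bar> \<le> d"
  shows "1 - d - 12 * \<nu>\<^sup>2 \<le> det (matrix (\<lambda>h. h + M h))"
proof -
  define m where "m i j = M (axis j 1) $ i" for i j
  have m: "\<bar>m i j\<bar> \<le> \<nu>" for i j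
    using order_trans[OF component_le_norm_cart M[of "axis j 1"]] by (simp add: m_def)
  have m2: "\<bar>m i j * m k l\<bar> \<le> \<nu>\<^sup>2" for i j k l
    unfolding abs_mult power2_eq_square by (intro mult_mono m) (use \<nu> in auto)
  have m3: "\<bar>m i j * m k l * m p q\<bar> \<le> \<nu>\<^sup>2" for i j k l p q
  proof -
    have "\<bar>m i j * m k l * m p q\<bar> \<le> \<nu>\<^sup>2 * 1"
      unfolding abs_mult[of "m i j * m k l"] by (intro mult_mono m2 order_trans[OF m \<nu>(2)]) auto
    then show ?thesis by simp
  qed
  have B: "(Basis :: (real^3) set) = range (\<lambda>i. axis i 1)" by (auto simp: Basis_vec_def)
  have "(\<Sum>e\<in>Basis. M e \<bullet> e) = (\<Sum>i\<in>UNIV. M (axis i 1) \<bullet> axis i 1)"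
    unfolding B by (rule sum.reindex[unfolded o_def]) (auto simp: inj_on_def axis_eq_axis)
  also have "\<dots> = m 1 1 + m 2 2 + m 3 3" by (simp add: sum_3 m_def inner_axis)
  finally have tr': "- d \<le> m 1 1 + m 2 2 + m 3 3" using tr by simp
  have e: "matrix (\<lambda>h. h + M h) $ i $ j = (if i = j then 1 else 0) + m i j" for i j
    by (auto simp: matrix_def m_def axis_def)
  have "det (matrix (\<lambda>h. h + M h)) = 1 + (m 1 1 + m 2 2 + m 3 3)
      + (m 1 1 * m 2 2 + m 1 1 * m 3 3 + m 2 2 * m 3 3 - m 2 3 * m 3 2 - m 1 2 * m 2 1 - m 1 3 * m 3 1)
      + (m 1 1 * m 2 2 * m 3 3 + m 1 2 * m 2 3 * m 3 1 + m 1 3 * m 2 1 * m 3 2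
         - m 1 1 * m 2 3 * m 3 2 - m 1 2 * m 2 1 * m 3 3 - m 1 3 * m 2 2 * m 3 1)"
    unfolding det_3 e by (simp add: algebra_simps)
  moreover note m2[of 1 1 2 2] m2[of 1 1 3 3] m2[of 2 2 3 3] m2[of 2 3 3 2] m2[of 1 2 2 1] m2[of 1 3 3 1]
    m3[of 1 1 2 2 3 3] m3[of 1 2 2 3 3 1] m3[of 1 3 2 1 3 2] m3[of 1 1 2 3 3 2] m3[of 1 2 2 1 3 3] m3[of 1 3 2 2 3 1] tr'
  ultimately show ?thesis by (simp only: abs_le_iff) linarith
qed

section \<open>Integrals over short time intervals\<close>

lemma LBINT_split:
  fixes f :: "real \<Rightarrow> 'a::euclidean_space"
  assumes f: "set_integrable lborel {a..c} f" and "a \<le> b" "b \<le> c"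
  shows "(LBINT r:{a..c}. f r) = (LBINT r:{a..b}. f r) + (LBINT r:{b..c}. f r)"
proof -
  have i: "set_integrable lborel {a..b} f" "set_integrable lborel {b..c} f"
    using assms by (auto intro: set_integrable_subset)
  show ?thesis
    using assms(2,3) unfolding set_borel_integral_eq_integral(2)[OF f] set_borel_integral_eq_integral(2)[OF i(1)] set_borel_integral_eq_integral(2)[OF i(2)]
    by (intro Henstock_Kurzweil_Integration.integral_combine[symmetric] set_borel_integral_eq_integral(1)[OF f])
qed

lemma set_integrable_nonneg:
  fixes f :: "real \<Rightarrow> real"
  assumes [measurable]: "f \<in> borel_measurable borel" and f: "\<And>r. 0 \<le> f r" "(\<integral>\<^sup>+r\<in>{0..c}. f r \<partial>lborel) < \<infinity>" and a: "0 \<le> a"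
  shows "set_integrable lborel {a..c} f"
proof (rule set_integrable_subset)
  show "set_integrable lborel {0..c} f"
    unfolding set_integrable_def
  proof (rule integrableI_nonneg)
    have "(\<integral>\<^sup>+r. ennreal (indicator {0..c} r *\<^sub>R f r) \<partial>lborel) = (\<integral>\<^sup>+r\<in>{0..c}. f r \<partial>lborel)"
      by (intro nn_integral_cong) (auto simp: indicator_def)
    then show "(\<integral>\<^sup>+r. ennreal (indicator {0..c} r *\<^sub>R f r) \<partial>lborel) < \<infinity>" using f by simp
  qed (use f in auto)
qed (use a in auto)

lemma norm_LBINT_le:
  fixes f :: "real \<Rightarrow> 'a::euclidean_space"
  assumes [measurable]: "f \<in> borel_measurable borel" and g: "set_integrable lborel {a..c} g" and le: "\<And>r. norm (f r) \<le> g r"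
  shows "set_integrable lborel {a..c} f" "norm (LBINT r:{a..c}. f r) \<le> (LBINT r:{a..c}. g r)"
proof -
  have b: "norm (indicator {a..c} r *\<^sub>R f r) \<le> indicator {a..c} r *\<^sub>R g r" for r
    using le[of r] by (auto simp: indicator_def)
  show i: "set_integrable lborel {a..c} f"
    unfolding set_integrable_def
    by (rule Bochner_Integration.integrable_bound[OF g[unfolded set_integrable_def]])
      (use order_trans[OF b abs_ge_self] in auto)
  show "norm (LBINT r:{a..c}. f r) \<le> (LBINT r:{a..c}. g r)"
    unfolding set_lebesgue_integral_def
    by (rule Bochner_Integration.integral_norm_bound_integral[OF i[unfolded set_integrable_def] g[unfolded set_integrable_def]]) (rule b)
qed

text \<open>Absolute continuity of the integral, read off from uniform continuity of the primitive.
  It provides the mesh of the polygons.\<close>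

lemma uniform_small_integrals:
  fixes f :: "real \<Rightarrow> real"
  assumes f: "set_integrable lborel {0..T} f" and \<theta>: "0 < \<theta>"
  shows "\<exists>h>0. \<forall>a c. 0 \<le> a \<longrightarrow> a \<le> c \<longrightarrow> c \<le> T \<longrightarrow> c - a \<le> h \<longrightarrow> (LBINT r:{a..c}. f r) \<le> \<theta>"
proof -
  have "uniformly_continuous_on {0..T} (\<lambda>t. LBINT r:{0..t}. f r)"
    by (intro compact_uniformly_continuous continuous_on_set_lebesgue_integral f) auto
  then obtain d where d: "0 < d" "\<And>a c. a \<in> {0..T} \<Longrightarrow> c \<in> {0..T} \<Longrightarrow> dist a c < d \<Longrightarrow> dist (LBINT r:{0..a}. f r) (LBINT r:{0..c}. f r) < \<theta>"
    using \<theta> unfolding uniformly_continuous_on_def by metis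
  show ?thesis
  proof (intro exI[of _ "d/2"] conjI allI impI)
    show "0 < d/2" using d by simp
    fix a c assume ac: "0 \<le> a" "a \<le> c" "c \<le> T" "c - a \<le> d/2"
    have "set_integrable lborel {0..c} f" using f ac by (auto intro: set_integrable_subset)
    from LBINT_split[OF this ac(1,2)] have "(LBINT r:{a..c}. f r) = (LBINT r:{0..c}. f r) - (LBINT r:{0..a}. f r)" by simp
    also have "\<dots> \<le> dist (LBINT r:{0..a}. f r) (LBINT r:{0..c}. f r)" by (simp add: dist_real_def)
    also have "\<dots> \<le> \<theta>" using ac d(1) by (intro less_imp_le d(2)) (auto simp: dist_real_def)
    finally show "(LBINT r:{a..c}. f r) \<le> \<theta>" .
  qed
qed

section \<open>Euler polygons\<close>

text \<open>With \<kappa> = d + q n^2 \<le> 1/2 one has - ln (1 - \<kappa>) \<le> \<kappa> + 2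
  \<kappa>^2. Everything here beyond \<open>d\<close> is quadratic in \<open>d + n\<close>, so
  smallness \<theta> of one step makes it at most \<open>l * (n + d)\<close>. This excess is
  additive over steps, with a small factor.\<close>

lemma one_over_one_minus_le:
  fixes d n q l \<theta> :: real
  assumes d: "0 \<le> d" "0 \<le> n" "d + n \<le> \<theta>" and q: "0 \<le> q"
    and \<theta>: "\<theta> \<le> 1" "(q + 2 * (1 + q)\<^sup>2) * \<theta> \<le> l" "(1 + q) * \<theta> \<le> 1/2"
  shows "0 < 1 - d - q * n\<^sup>2" "1 / (1 - d - q * n\<^sup>2) \<le> exp (d + l * (n + d))"
proof -
  define \<kappa> where "\<kappa> = d + q * n\<^sup>2"
  have \<theta>0: "0 \<le> \<theta>" using d by linarith
  have n2: "q * n\<^sup>2 \<le> q * \<theta> * n"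
    using d q mult_right_mono[of n \<theta> n] by (simp add: power2_eq_square mult.assoc mult_left_mono)
  have \<kappa>1: "\<kappa> \<le> (1 + q) * (d + n)"
  proof -
    have "q * \<theta> * n \<le> q * 1 * n" using \<theta> q d by (intro mult_right_mono mult_left_mono) auto
    then have "\<kappa> \<le> d + q * n" using n2 unfolding \<kappa>_def by linarith
    also have "\<dots> \<le> (1 + q) * (d + n)" using d q by (simp add: algebra_simps)
    finally show ?thesis .
  qed
  have \<kappa>2: "\<kappa> \<le> (1 + q) * \<theta>" using \<kappa>1 d q mult_left_mono[of "d + n" \<theta> "1 + q"] by linarith
  have \<kappa>0: "0 \<le> \<kappa>" "\<kappa> \<le> 1/2" using d q \<theta> \<kappa>2 unfolding \<kappa>_def by auto
  then show "0 < 1 - d - q * n\<^sup>2" unfolding \<kappa>_def by linarith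
  have "\<kappa>\<^sup>2 \<le> ((1 + q) * \<theta>) * ((1 + q) * (d + n))"
    unfolding power2_eq_square using \<kappa>0 \<kappa>1 \<kappa>2 by (intro mult_mono) auto
  also have "\<dots> = (1 + q)\<^sup>2 * \<theta> * (d + n)" by (simp add: power2_eq_square)
  finally have sq: "2 * \<kappa>\<^sup>2 \<le> 2 * (1 + q)\<^sup>2 * \<theta> * (d + n)" by simp
  have "q * \<theta> * n \<le> q * \<theta> * (d + n)" using d q \<theta>0 by (intro mult_left_mono) auto
  then have "\<kappa> + 2 * \<kappa>\<^sup>2 \<le> d + (q * \<theta> * (d + n) + 2 * (1 + q)\<^sup>2 * \<theta> * (d + n))"
    using n2 sq unfolding \<kappa>_def by linarith
  also have "q * \<theta> * (d + n) + 2 * (1 + q)\<^sup>2 * \<theta> * (d + n) = ((q + 2 * (1 + q)\<^sup>2) * \<theta>) * (n + d)"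
    by (simp add: algebra_simps)
  also have "\<dots> \<le> l * (n + d)" using \<theta>(2) d by (intro mult_right_mono) auto
  finally have e: "\<kappa> + 2 * \<kappa>\<^sup>2 \<le> d + l * (n + d)" by simp
  have "- ln (1 - \<kappa>) \<le> \<kappa> + 2 * \<kappa>\<^sup>2" using ln_one_minus_pos_lower_bound[OF \<kappa>0] by linarith
  then have "exp (- ln (1 - \<kappa>)) \<le> exp (d + l * (n + d))" using e by simp
  moreover have "exp (- ln (1 - \<kappa>)) = 1 / (1 - \<kappa>)" using \<kappa>0 by (simp add: exp_minus field_simps)
  ultimately have "1 / (1 - \<kappa>) \<le> exp (d + l * (n + d))" by (simp only:)
  then show "1 / (1 - d - q * n\<^sup>2) \<le> exp (d + l * (n + d))" by (simp add: \<kappa>_def diff_diff_eq)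
qed

locale euler = sobolev_field u A D for u :: "real \<Rightarrow> real^3 \<Rightarrow> real^3" and A D +
  fixes \<epsilon> C :: real and \<rho> :: "real^3 \<Rightarrow> real" and \<gamma> :: "real^3 \<Rightarrow> real^3"
  assumes k: "kernel \<epsilon> \<rho> \<gamma> C" and \<epsilon>: "0 < \<epsilon>"
begin

abbreviation "b r x \<equiv> mconv \<rho> (u r) x"

text \<open>\<open>C * N r\<close> bounds both the size and the Lipschitz constant of the mollified
  field at time \<open>r\<close>.\<close>

definition N :: "real \<Rightarrow> real" where "N r = (\<integral>y. norm (u r y) \<partial>lborel)"

definition step :: "real \<Rightarrow> real \<Rightarrow> real^3 \<Rightarrow> real^3" where
  "step a c x = x + (LBINT r:{a..c}. b r x)"

lemma u_integrable: "integrable lborel (u r)"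
  by (rule slice_integrable[OF slice])

lemma N_measurable[measurable]: "N \<in> borel_measurable borel"
  unfolding N_def by measurable

lemma N_nonneg: "0 \<le> N r"
  by (simp add: N_def)

lemma ennreal_N: "ennreal (N r) = (\<integral>\<^sup>+x. norm (u r x) \<partial>lborel)"
  unfolding N_def using u_integrable by (intro nn_integral_eq_integral[symmetric]) auto

lemma N_integrable: "0 \<le> a \<Longrightarrow> set_integrable lborel {a..c} N"
  using u_int[of c] by (intro set_integrable_nonneg N_nonneg) (auto simp: ennreal_N)

lemma D_integrable: "0 \<le> a \<Longrightarrow> set_integrable lborel {a..c} D"
  using D_int[of c] by (intro set_integrable_nonneg D_nonneg) auto

lemma b_jmeas: "jmeas b"
proof -
  note [measurable] = kernel_measurable[OF k]
  show ?thesis unfolding jmeas_def mconv_def by measurable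
qed

lemmas b_measurable[measurable (raw)] = jmeasD[OF b_jmeas]

lemma C_nonneg: "0 \<le> C" using kernel_facts(1)[OF k] .

lemma b_bound: "norm (b r x) \<le> C * N r"
  unfolding N_def by (rule mconv_bound[OF k u_integrable])

lemma b_lipschitz: "norm (b r x - b r x') \<le> C * N r * norm (x - x')"
  unfolding N_def by (rule mconv_lipschitz[OF k u_integrable])

lemma CN_integrable: "0 \<le> a \<Longrightarrow> set_integrable lborel {a..c} (\<lambda>r. C * N r)"
  using N_integrable by (rule set_integrable_mult_right)

lemma b_integrable: "0 \<le> a \<Longrightarrow> set_integrable lborel {a..c} (\<lambda>r. b r x)"
  by (rule norm_LBINT_le(1)[OF _ CN_integrable]) (auto intro: b_bound)

lemma LBINT_CN: "(LBINT r:{a..c}. C * N r) = C * (LBINT r:{a..c}. N r)"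
  by (rule set_integral_mult_right)

lemma step_lipschitz:
  assumes a: "0 \<le> a"
  shows "norm ((step a c x - x) - (step a c x' - x')) \<le> C * (LBINT r:{a..c}. N r) * norm (x - x')"
proof -
  have "(step a c x - x) - (step a c x' - x') = (LBINT r:{a..c}. b r x - b r x')"
    unfolding step_def using b_integrable[OF a] by (simp add: set_integral_diff)
  also have "norm \<dots> \<le> (LBINT r:{a..c}. (C * N r) * norm (x - x'))"
    by (rule norm_LBINT_le(2)[OF _ set_integrable_mult_left]) (auto intro: b_lipschitz CN_integrable[OF a])
  also have "\<dots> = C * (LBINT r:{a..c}. N r) * norm (x - x')"
    by (simp only: set_integral_mult_left LBINT_CN)
  finally show ?thesis .
qed

definition step_deriv :: "real \<Rightarrow> real \<Rightarrow> real^3 \<Rightarrow> real^3 \<Rightarrow> real^3" where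
  "step_deriv a c x h = (LBINT r:{a..c}. mconv_deriv \<gamma> (u r) x h)"

lemma mconv_deriv_measurable[measurable]: "(\<lambda>r. mconv_deriv \<gamma> (u r) x h) \<in> borel_measurable borel"
proof -
  note [measurable] = kernel_measurable[OF k]
  show ?thesis unfolding mconv_deriv_def by measurable
qed

lemma mconv_deriv_bound: "norm (mconv_deriv \<gamma> (u r) x h) \<le> C * N r * norm h"
  unfolding N_def by (rule mconv_deriv_linear(2)[OF k u_integrable])

lemma mconv_deriv_integrable: "0 \<le> a \<Longrightarrow> set_integrable lborel {a..c} (\<lambda>r. mconv_deriv \<gamma> (u r) x h)"
  by (rule norm_LBINT_le(1)[where g="\<lambda>r. C * N r * norm h"])
    (auto intro: mconv_deriv_bound CN_integrable set_integrable_mult_left)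

lemma step_deriv_bound:
  assumes a: "0 \<le> a"
  shows "norm (step_deriv a c x h) \<le> C * (LBINT r:{a..c}. N r) * norm h"
proof -
  have "norm (step_deriv a c x h) \<le> (LBINT r:{a..c}. (C * N r) * norm h)"
    unfolding step_deriv_def
    by (rule norm_LBINT_le(2)[OF _ set_integrable_mult_left]) (auto intro: mconv_deriv_bound CN_integrable[OF a])
  also have "\<dots> = C * (LBINT r:{a..c}. N r) * norm h"
    by (simp only: set_integral_mult_left LBINT_CN)
  finally show ?thesis .
qed

lemma step_deriv_linear:
  assumes a: "0 \<le> a"
  shows "linear (step_deriv a c x)"
proof (rule linearI)
  fix h h' and s :: real
  have l: "linear (mconv_deriv \<gamma> (u r) x)" for r by (rule mconv_deriv_linear(1)[OF k u_integrable])
  show "step_deriv a c x (h + h') = step_deriv a c x h + step_deriv a c x h'"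
    unfolding step_deriv_def linear_add[OF l] using mconv_deriv_integrable[OF a] by (intro set_integral_add(2))
  show "step_deriv a c x (s *\<^sub>R h) = s *\<^sub>R step_deriv a c x h"
    unfolding step_deriv_def linear_scale[OF l] by (rule set_integral_scaleR_right)
qed

lemma step_has_derivative:
  assumes a: "0 \<le> a"
  shows "(step a c has_derivative (\<lambda>h. h + step_deriv a c x h)) (at x)"
proof (rule quadratic_has_derivative)
  show "bounded_linear (\<lambda>h. h + step_deriv a c x h)"
    using step_deriv_linear[OF a] by (intro bounded_linear_add bounded_linear_ident) (simp add: linear_conv_bounded_linear)
  fix h
  have "step a c (x + h) - step a c x - (h + step_deriv a c x h)
     = (LBINT r:{a..c}. b r (x + h) - b r x - mconv_deriv \<gamma> (u r) x h)"
    unfolding step_def step_deriv_def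
    using b_integrable[OF a] mconv_deriv_integrable[OF a] by (simp add: set_integral_diff)
  also have "norm \<dots> \<le> (LBINT r:{a..c}. (C * N r) * (norm h)\<^sup>2)"
  proof (rule norm_LBINT_le(2)[OF _ set_integrable_mult_left])
    show "norm (b r (x + h) - b r x - mconv_deriv \<gamma> (u r) x h) \<le> C * N r * (norm h)\<^sup>2" for r
      unfolding N_def by (rule mconv_remainder[OF k u_integrable])
  qed (auto intro: CN_integrable[OF a])
  finally show "norm (step a c (x + h) - step a c x - (h + step_deriv a c x h)) \<le> (C * (LBINT r:{a..c}. N r)) * (norm h)\<^sup>2"
    by (simp only: set_integral_mult_left LBINT_CN)
qed

lemma step_deriv_trace:
  assumes a: "0 \<le> a"
  shows "\<bar>\<Sum>e\<in>Basis. step_deriv a c x e \<bullet> e\<bar> \<le> (LBINT r:{a..c}. D r)"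
proof -
  let ?m = "\<lambda>r e. indicator {a..c} r *\<^sub>R mconv_deriv \<gamma> (u r) x e"
  have i: "integrable lborel (\<lambda>r. ?m r e)" for e
    using mconv_deriv_integrable[OF a, of c x e] by (simp add: set_integrable_def)
  have "(\<Sum>e\<in>Basis. step_deriv a c x e \<bullet> e) = (\<Sum>e\<in>Basis. \<integral>r. ?m r e \<bullet> e \<partial>lborel)"
    unfolding step_deriv_def set_lebesgue_integral_def using i by (intro sum.cong refl integral_inner_left[symmetric]) auto
  also have "\<dots> = (\<integral>r. (\<Sum>e\<in>Basis. ?m r e \<bullet> e) \<partial>lborel)"
    using i by (intro Bochner_Integration.integral_sum[symmetric] integrable_inner_left) auto
  also have "\<dots> = (LBINT r:{a..c}. (\<Sum>e\<in>Basis. mconv_deriv \<gamma> (u r) x e \<bullet> e))"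
    unfolding set_lebesgue_integral_def by (simp add: scaleR_sum_right sum_distrib_left)
  also have "norm \<dots> \<le> (LBINT r:{a..c}. D r)"
    by (rule norm_LBINT_le(2)[OF _ D_integrable[OF a]]) (auto intro: mconv_divergence_bound[OF k slice])
  finally show ?thesis by simp
qed

text \<open>The Jacobian of a step is at least 1 - d - q n^2, where the trace accounts for
  \<open>d\<close> and all other terms are of second order. Writing the inverse as the exponential
  of an integral over the step makes the factors of consecutive steps multiply to the exponential of
  the integral over their union.\<close>

lemma step_compr:
  assumes l: "0 < l"
  shows "\<exists>\<theta>>0. \<forall>a c. 0 \<le> a \<longrightarrow> (LBINT r:{a..c}. N r + D r) \<le> \<theta> \<longrightarrow>
    compr UNIV (exp (LBINT r:{a..c}. D r + l * (N r + D r))) (step a c)"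
proof -
  define q where "q = 12 * C\<^sup>2"
  have q: "0 \<le> q" by (simp add: q_def)
  define p where "p = q + 2 * (1 + q)\<^sup>2"
  have p: "0 < p" unfolding p_def using q by (intro add_nonneg_pos) auto
  \<comment> \<open>Four demands: \<theta> \<le> 1 and \<open>p * \<theta> \<le> l\<close> and
    \<open>(1 + q) * \<theta> \<le> 1/2\<close> for \<open>one_over_one_minus_le\<close>, and
    \<open>(1 + C) * \<theta> \<le> 1/2\<close>, which gives the displacement Lipschitz constant at
    most 1/2 and thereby makes the step injective. Here q = 12 C^2 comes from the determinant bound
    with \<nu> = C n.\<close>
  define \<theta> where "\<theta> = min (min 1 (l / p)) (min (1 / (2 * (1 + q))) (1 / (2 * (1 + C))))"
  have \<theta>: "0 < \<theta>" "\<theta> \<le> 1" "\<theta> \<le> l / p" "\<theta> \<le> 1 / (2 * (1 + q))" "\<theta> \<le> 1 / (2 * (1 + C))"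
    unfolding \<theta>_def using l p q C_nonneg by auto
  have \<theta>': "p * \<theta> \<le> l" "(1 + q) * \<theta> \<le> 1/2" "(1 + C) * \<theta> \<le> 1/2"
    using \<theta> p q C_nonneg by (auto simp: field_simps)
  show ?thesis
  proof (intro exI[of _ \<theta>] conjI allI impI \<theta>(1))
    fix a c :: real assume a: "0 \<le> a" and le: "(LBINT r:{a..c}. N r + D r) \<le> \<theta>"
    define n d where "n = (LBINT r:{a..c}. N r)" and "d = (LBINT r:{a..c}. D r)"
    have nd: "0 \<le> n" "0 \<le> d" unfolding n_def d_def set_lebesgue_integral_def
      by (auto intro!: integral_nonneg_AE simp: N_nonneg D_nonneg)
    have sum: "(LBINT r:{a..c}. N r + D r) = n + d"
      unfolding n_def d_def by (rule set_integral_add(2)[OF N_integrable[OF a] D_integrable[OF a]])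
    have tot: "(LBINT r:{a..c}. D r + l * (N r + D r)) = d + l * (n + d)"
    proof -
      have i: "set_integrable lborel {a..c} (\<lambda>r. N r + D r)" by (rule set_integral_add(1)[OF N_integrable[OF a] D_integrable[OF a]])
      show ?thesis
        unfolding set_integral_add(2)[OF D_integrable[OF a] set_integrable_mult_right[OF i]] set_integral_mult_right sum d_def ..
    qed
    have dn: "d + n \<le> \<theta>" using le sum by simp
    define \<nu> where "\<nu> = C * n"
    have "C * n \<le> C * \<theta>" using dn nd C_nonneg by (intro mult_left_mono) auto
    also have "\<dots> \<le> (1 + C) * \<theta>" using \<theta>(1) by (intro mult_right_mono) auto
    also have "\<dots> \<le> 1/2" by (rule \<theta>'(3))
    finally have \<nu>: "0 \<le> \<nu>" "\<nu> \<le> 1/2" unfolding \<nu>_def using C_nonneg nd by auto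
    have key: "0 < 1 - d - q * n\<^sup>2" "1 / (1 - d - q * n\<^sup>2) \<le> exp (d + l * (n + d))"
      by (rule one_over_one_minus_le[where \<theta>=\<theta>]; use nd dn q \<theta> \<theta>' in \<open>simp add: p_def\<close>)+
    have "compr UNIV (1 / (1 - d - q * n\<^sup>2)) (step a c)"
    proof (rule compr_of_det_bound[OF step_has_derivative[OF a] _ key(1)])
      show "inj (step a c)"
      proof (rule injI)
        fix x y assume "step a c x = step a c y"
        then have "norm (x - y) \<le> \<nu> * norm (x - y)"
          using step_lipschitz[OF a, of c x y] unfolding \<nu>_def n_def by (simp add: norm_minus_commute)
        also have "\<dots> \<le> 1/2 * norm (x - y)" using \<nu> by (intro mult_right_mono) auto
        finally show "x = y" by simp
      qed
      fix x
      have "1 - d - 12 * \<nu>\<^sup>2 \<le> det (matrix (\<lambda>h. h + step_deriv a c x h))"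
        by (rule det_identity_plus_lower_bound)
          (use \<nu> step_deriv_bound[OF a, of c x] step_deriv_trace[OF a, of c x] in \<open>auto simp: \<nu>_def n_def d_def\<close>)
      also have "12 * \<nu>\<^sup>2 = q * n\<^sup>2" by (simp add: \<nu>_def q_def power_mult_distrib)
      finally show "1 - d - q * n\<^sup>2 \<le> \<bar>det (matrix (\<lambda>h. h + step_deriv a c x h))\<bar>" by simp
    qed
    then show "compr UNIV (exp (LBINT r:{a..c}. D r + l * (N r + D r))) (step a c)"
      unfolding tot using key(2) by (rule compr_mono)
  qed
qed

end

context euler
begin

lemma step_measurable[measurable]: "step a c \<in> borel_measurable borel"
  unfolding step_def set_lebesgue_integral_def by measurable

text \<open>\<open>Y\<close> interpolates the polygon with vertices \<open>Z\<close>. On each step the field is integrated in time at the frozen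
  position of the last vertex, since no regularity in time is available.\<close>

primrec Z :: "real \<Rightarrow> nat \<Rightarrow> real^3 \<Rightarrow> real^3" where
  "Z h 0 x = x"
| "Z h (Suc k) x = step (real k * h) (real (Suc k) * h) (Z h k x)"

definition w :: "real \<Rightarrow> real \<Rightarrow> real^3 \<Rightarrow> real^3" where
  "w h r x = b r (Z h (nat \<lfloor>r / h\<rfloor>) x)"

definition Y :: "real \<Rightarrow> real \<Rightarrow> real^3 \<Rightarrow> real^3" where
  "Y h t x = x + (LBINT r:{0..t}. w h r x)"

lemma Z_measurable[measurable]: "Z h k \<in> borel_measurable borel"
proof (induction k)
  case 0
  have "Z h 0 = (\<lambda>x. x)" by auto
  then show ?case by simp
next
  case (Suc k)
  note [measurable] = Suc
  have "Z h (Suc k) = (\<lambda>x. step (real k * h) (real (Suc k) * h) (Z h k x))" by auto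
  then show ?case by simp
qed

lemma w_jmeas: "jmeas (w h)"
proof -
  have [measurable]: "(\<lambda>p. Z h (nat \<lfloor>fst p / h\<rfloor>) (snd p)) \<in> borel_measurable (borel \<Otimes>\<^sub>M borel)"
    by (rule measurable_compose_countable[where f="\<lambda>k p. Z h k (snd p)" and g="\<lambda>p. nat \<lfloor>fst p / h\<rfloor>"]) measurable
  show ?thesis unfolding jmeas_def w_def by measurable
qed

lemmas w_measurable[measurable (raw)] = jmeasD[OF w_jmeas]

lemma Y_jmeas: "jmeas (Y h)"
proof -
  have e: "indicator {0..t} r = (if 0 \<le> r \<and> r \<le> t then 1 else (0::real))" for t r :: real
    by (auto simp: indicator_def)
  show ?thesis unfolding jmeas_def Y_def set_lebesgue_integral_def e by measurable
qed

lemma w_bound: "norm (w h r x) \<le> C * N r"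
  unfolding w_def by (rule b_bound)

lemma w_integrable: "0 \<le> a \<Longrightarrow> set_integrable lborel {a..c} (\<lambda>r. w h r x)"
  by (rule norm_LBINT_le(1)[OF _ CN_integrable]) (auto intro: w_bound)

lemma step_displacement:
  assumes a: "0 \<le> a"
  shows "norm (step a c x - x) \<le> C * (LBINT r:{a..c}. N r)"
proof -
  have "norm (LBINT r:{a..c}. b r x) \<le> (LBINT r:{a..c}. C * N r)"
    by (rule norm_LBINT_le(2)[OF _ CN_integrable[OF a]]) (auto intro: b_bound)
  then show ?thesis by (simp add: step_def LBINT_CN)
qed

lemma Y_on_slab:
  assumes h: "0 < h"
  shows "real k * h \<le> t \<Longrightarrow> t \<le> real (Suc k) * h \<Longrightarrow> Y h t x = step (real k * h) t (Z h k x)"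
proof (induction k arbitrary: t)
  have slab: "(LBINT r:{real k * h..t}. w h r x) = (LBINT r:{real k * h..t}. b r (Z h k x))"
    if t: "t \<le> real (Suc k) * h" for k t
    unfolding set_lebesgue_integral_def
  proof (rule integral_cong_AE)
    \<comment> \<open>At the right end of the slab the index
      \<open>nat \<lfloor>r / h\<rfloor>\<close> has already jumped to the next vertex; this single
      time is discarded.\<close>
    show "AE r in lborel. indicator {real k * h..t} r *\<^sub>R w h r x = indicator {real k * h..t} r *\<^sub>R b r (Z h k x)"
      using AE_lborel_singleton[of "real (Suc k) * h"]
    proof eventually_elim
      case (elim r)
      show ?case
      proof (cases "r \<in> {real k * h..t}")
        case True
        then have "real k * h \<le> r" "r < real (Suc k) * h" using elim t by auto
        then have "\<lfloor>r / h\<rfloor> = int k"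
          using h by (intro floor_unique) (auto simp: le_divide_eq divide_less_eq add.commute)
        then show ?thesis by (simp add: w_def)
      qed auto
    qed
  qed measurable
  {
    case 0
    then show ?case using slab[of t 0] by (simp add: Y_def step_def)
  next
    case (Suc k)
    have "0 \<le> real (Suc k) * h" using h by simp
    have i: "set_integrable lborel {0..t} (\<lambda>r. w h r x)" by (rule w_integrable) simp
    have "Y h t x = x + (LBINT r:{0..real (Suc k) * h}. w h r x) + (LBINT r:{real (Suc k) * h..t}. w h r x)"
      unfolding Y_def using LBINT_split[OF i, of "real (Suc k) * h"] Suc.prems h by (simp add: add.assoc)
    also have "x + (LBINT r:{0..real (Suc k) * h}. w h r x) = Z h (Suc k) x"
      using Suc.IH[of "real (Suc k) * h"] h by (simp add: Y_def)
    finally show ?case using slab[OF Suc.prems(2)] by (simp add: step_def)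
  }
qed

lemma slab_index:
  assumes h: "0 < h" and t: "0 \<le> t"
  shows "real (nat \<lfloor>t / h\<rfloor>) * h \<le> t" "t \<le> real (Suc (nat \<lfloor>t / h\<rfloor>)) * h"
proof -
  have k: "real (nat \<lfloor>t / h\<rfloor>) = of_int \<lfloor>t / h\<rfloor>" using h t by simp
  have "of_int \<lfloor>t / h\<rfloor> \<le> t / h" by (rule of_int_floor_le)
  then show "real (nat \<lfloor>t / h\<rfloor>) * h \<le> t" unfolding k using h by (simp add: le_divide_eq)
  have "t / h \<le> of_int \<lfloor>t / h\<rfloor> + 1" by linarith
  then have "t \<le> (of_int \<lfloor>t / h\<rfloor> + 1) * h" by (rule pos_divide_le_eq[THEN iffD1, OF h])
  also have "of_int \<lfloor>t / h\<rfloor> + 1 = real (Suc (nat \<lfloor>t / h\<rfloor>))" using k by simp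
  finally show "t \<le> real (Suc (nat \<lfloor>t / h\<rfloor>)) * h" .
qed

lemma Y_eq_step:
  assumes "0 < h" "0 \<le> t"
  shows "Y h t x = step (real (nat \<lfloor>t / h\<rfloor>) * h) t (Z h (nat \<lfloor>t / h\<rfloor>) x)"
  by (rule Y_on_slab[OF assms(1) slab_index[OF assms]])

text \<open>Compression factors multiply under composition while the integrals in the exponents add,
  so the bound accumulated up to time \<open>t\<close> does not depend on the number of steps. The
  last, possibly incomplete step is treated like the others.\<close>

lemma Y_compr:
  assumes h: "0 < h" and l: "0 \<le> l"
    and small: "\<And>a c. 0 \<le> a \<Longrightarrow> a \<le> c \<Longrightarrow> c \<le> T \<Longrightarrow> c - a \<le> h \<Longrightarrow> compr UNIV (exp (LBINT r:{a..c}. D r + l * (N r + D r))) (step a c)"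
    and t: "0 \<le> t" "t \<le> T"
  shows "compr UNIV (exp (LBINT r:{0..t}. D r + l * (N r + D r))) (Y h t)"
proof -
  let ?P = "\<lambda>r. D r + l * (N r + D r)"
  have Pi: "set_integrable lborel {0..c} ?P" for c
    by (intro set_integral_add(1) set_integrable_mult_right N_integrable D_integrable) auto
  have glue: "compr UNIV (exp (LBINT r:{0..c}. ?P r)) (\<lambda>x. step a c (F x))"
    if "compr UNIV (exp (LBINT r:{0..a}. ?P r)) F" "0 \<le> a" "a \<le> c" "c \<le> T" "c - a \<le> h" for a c F
    using compr_compose[OF small[OF that(2-5)] that(1)] LBINT_split[OF Pi[of c] that(2,3)]
    by (simp add: exp_add mult.commute)
  have Z: "real k * h \<le> T \<Longrightarrow> compr UNIV (exp (LBINT r:{0..real k * h}. ?P r)) (Z h k)" for k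
  proof (induction k)
    case 0
    then show ?case using compr_id LBINT_singleton[of 0 ?P] by (simp add: fun_eq_iff[of "Z h 0"])
  next
    case (Suc k)
    have kk: "real k * h \<le> real (Suc k) * h" using h by (intro mult_right_mono) auto
    have "compr UNIV (exp (LBINT r:{0..real (Suc k) * h}. ?P r)) (\<lambda>x. step (real k * h) (real (Suc k) * h) (Z h k x))"
      using Suc.prems kk h by (intro glue Suc.IH) (auto simp: algebra_simps)
    then show ?case by (simp add: fun_eq_iff flip: Z.simps(2) del: of_nat_Suc)
  qed
  let ?k = "nat \<lfloor>t / h\<rfloor>"
  have "compr UNIV (exp (LBINT r:{0..t}. ?P r)) (\<lambda>x. step (real ?k * h) t (Z h ?k x))"
    using slab_index[OF h t(1)] t h by (intro glue Z) (auto simp: algebra_simps)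
  then show ?thesis using Y_eq_step[OF h t(1)] by presburger
qed

text \<open>The velocity differs from \<open>u\<close> along the polygon by two effects. Freezing
  the position costs the Lipschitz constant \<open>C * N r\<close> times the displacement
  \<open>C * \<theta>\<close> of a step, on a set of measure \<open>s\<close>. Mollification costs
  the L^1 distance of \<open>mconv\<close> to \<open>u\<close>, transported by the compression
  factor \<open>L\<close>; the 3 is the dimension.\<close>

lemma Y_error:
  assumes h: "0 < h" and T: "0 \<le> T" and L: "0 \<le> L" and S[measurable]: "S \<in> sets borel" and s: "emeasure lborel S = ennreal s" "0 \<le> s"
    and \<theta>: "0 \<le> \<theta>" and small: "\<And>a c. 0 \<le> a \<Longrightarrow> a \<le> c \<Longrightarrow> c \<le> T \<Longrightarrow> c - a \<le> h \<Longrightarrow> (LBINT r:{a..c}. N r) \<le> \<theta>"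
    and Yc: "\<And>t. t \<in> {0..T} \<Longrightarrow> compr UNIV L (Y h t)"
  shows "(\<integral>\<^sup>+r\<in>{0..T}. \<integral>\<^sup>+x\<in>S. norm (w h r x - u r (Y h r x)) \<partial>lborel \<partial>lborel)
    \<le> ennreal (C\<^sup>2 * \<theta> * s * (LBINT r:{0..T}. N r) + L * (3 * \<epsilon>) * (LBINT r:{0..T}. A r))"
proof -
  note [measurable (raw)] = jmeasD[OF Y_jmeas]
  have Ai: "set_integrable lborel {0..T} A" using A_int[of T] by (intro set_integrable_nonneg A_nonneg) auto
  have sl: "(\<integral>\<^sup>+x\<in>S. norm (w h r x - u r (Y h r x)) \<partial>lborel) \<le> ennreal (C\<^sup>2 * \<theta> * s * N r + L * (3 * \<epsilon>) * A r)" if r: "r \<in> {0..T}" for r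
  proof -
    let ?k = "nat \<lfloor>r / h\<rfloor>"
    have idx: "real ?k * h \<le> r" "r \<le> real (Suc ?k) * h" "0 \<le> real ?k * h" using slab_index[OF h, of r] r h by auto
    have pt: "norm (w h r x - u r (Y h r x)) \<le> C\<^sup>2 * \<theta> * N r + norm (b r (Y h r x) - u r (Y h r x))" for x
    proof -
      have "norm (Y h r x - Z h ?k x) \<le> C * (LBINT r:{real ?k * h..r}. N r)"
        unfolding Y_eq_step[OF h, of r, OF atLeastAtMost_iff[THEN iffD1, OF r, THEN conjunct1]] by (rule step_displacement[OF idx(3)])
      also have "\<dots> \<le> C * \<theta>"
      proof (intro mult_left_mono C_nonneg small idx)
        have "r - real k * h \<le> h" if "r \<le> real (Suc k) * h" for k
          using that by (simp add: algebra_simps)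
        from this[OF idx(2)] show "r - real ?k * h \<le> h" .
      qed (use r in auto)
      finally have d: "norm (Y h r x - Z h ?k x) \<le> C * \<theta>" .
      have "norm (w h r x - b r (Y h r x)) \<le> C * N r * norm (Z h ?k x - Y h r x)"
        unfolding w_def by (rule b_lipschitz)
      also have "\<dots> \<le> C * N r * (C * \<theta>)"
        using d C_nonneg N_nonneg[of r] by (intro mult_left_mono) (auto simp: norm_minus_commute)
      also have "\<dots> = C\<^sup>2 * \<theta> * N r" by (simp add: power2_eq_square mult_ac)
      finally show ?thesis
        using norm_triangle_ineq[of "w h r x - b r (Y h r x)" "b r (Y h r x) - u r (Y h r x)"] by simp
    qed
    have "(\<integral>\<^sup>+x\<in>S. norm (w h r x - u r (Y h r x)) \<partial>lborel)
      \<le> (\<integral>\<^sup>+x. ennreal (C\<^sup>2 * \<theta> * N r) * indicator S x + ennreal (norm (b r (Y h r x) - u r (Y h r x))) * indicator S x \<partial>lborel)"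
    proof (intro nn_integral_mono)
      fix x
      have "ennreal (norm (w h r x - u r (Y h r x))) \<le> ennreal (C\<^sup>2 * \<theta> * N r) + ennreal (norm (b r (Y h r x) - u r (Y h r x)))"
        using pt[of x] \<theta> N_nonneg[of r] by (simp add: ennreal_leI flip: ennreal_plus)
      then show "ennreal (norm (w h r x - u r (Y h r x))) * indicator S x \<le> ennreal (C\<^sup>2 * \<theta> * N r) * indicator S x + ennreal (norm (b r (Y h r x) - u r (Y h r x))) * indicator S x"
        by (auto simp: indicator_def)
    qed
    also have "\<dots> = ennreal (C\<^sup>2 * \<theta> * N r) * ennreal s + (\<integral>\<^sup>+x\<in>S. norm (b r (Y h r x) - u r (Y h r x)) \<partial>lborel)"
      by (subst nn_integral_add) (auto simp: nn_integral_cmult_indicator s(1))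
    also have "\<dots> \<le> ennreal (C\<^sup>2 * \<theta> * N r) * ennreal s + ennreal L * ennreal (3 * A r * \<epsilon>)"
    proof (intro add_left_mono)
      have "(\<integral>\<^sup>+x\<in>S. norm (b r (Y h r x) - u r (Y h r x)) \<partial>lborel) \<le> ennreal L * (\<integral>\<^sup>+x. norm (b r x - u r x) \<partial>lborel)"
        by (rule comprD(3)[OF compr_subset[OF Yc[OF r]]]) measurable
      also have "\<dots> \<le> ennreal L * ennreal (DIM(real^3) * A r * \<epsilon>)"
        by (intro mult_left_mono mconv_approx[OF k \<epsilon> slice A_nonneg]) auto
      finally show "(\<integral>\<^sup>+x\<in>S. norm (b r (Y h r x) - u r (Y h r x)) \<partial>lborel) \<le> ennreal L * ennreal (3 * A r * \<epsilon>)" by simp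
    qed
    also have "\<dots> = ennreal (C\<^sup>2 * \<theta> * s * N r + L * (3 * \<epsilon>) * A r)"
    proof -
      have "ennreal p * ennreal s + ennreal L * ennreal q = ennreal (p * s + L * q)" if "0 \<le> p" "0 \<le> q" for p q
        using that s(2) L by (simp flip: ennreal_mult ennreal_plus)
      from this[of "C\<^sup>2 * \<theta> * N r" "3 * A r * \<epsilon>"] show ?thesis
        using \<theta> N_nonneg[of r] A_nonneg[of r] \<epsilon> by (simp add: mult_ac)
    qed
    finally show ?thesis .
  qed
  let ?g = "\<lambda>r. C\<^sup>2 * \<theta> * s * N r + L * (3 * \<epsilon>) * A r"
  have gi: "set_integrable lborel {0..T} ?g"
    by (intro set_integral_add(1) set_integrable_mult_right N_integrable Ai) simp
  have "(\<integral>\<^sup>+r\<in>{0..T}. \<integral>\<^sup>+x\<in>S. norm (w h r x - u r (Y h r x)) \<partial>lborel \<partial>lborel) \<le> (\<integral>\<^sup>+r. ennreal (indicator {0..T} r *\<^sub>R ?g r) \<partial>lborel)"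
    using sl by (intro nn_integral_mono) (auto simp: indicator_def)
  also have "\<dots> = ennreal (LBINT r:{0..T}. ?g r)"
    unfolding set_lebesgue_integral_def using gi \<theta> s(2) L N_nonneg A_nonneg \<epsilon>
    by (intro nn_integral_eq_integral) (auto simp: set_integrable_def)
  also have "(LBINT r:{0..T}. ?g r) = C\<^sup>2 * \<theta> * s * (LBINT r:{0..T}. N r) + L * (3 * \<epsilon>) * (LBINT r:{0..T}. A r)"
    by (subst set_integral_add(2)) (auto intro!: set_integrable_mult_right N_integrable Ai)
  finally show ?thesis .
qed

end

section \<open>Choice of mollifier and mesh\<close>

locale sobolev_field_R3 = sobolev_field u A D for u :: "real \<Rightarrow> real^3 \<Rightarrow> real^3" and A D
begin

text \<open>The order of the choices is essential. The compression bound \<open>L\<close> depends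
  only on \<open>D\<close> and \<eta>; otherwise choosing \<epsilon> in terms of \<open>L\<close>
  would be circular. Then \<epsilon> fixes a kernel together with its constant \<open>C\<close>, on
  which no uniform bound in \<epsilon> is available, and only afterwards can the smallness \<theta>
  of a step and the mesh \<open>h\<close> be adapted to \<open>C\<close>.\<close>

lemma approximate_flow_exists:
  assumes T: "0 \<le> T" and S[measurable]: "S \<in> sets borel" and fin: "emeasure lborel S < \<infinity>" and \<eta>: "0 < \<eta>"
  shows "\<exists>Y w. jmeas Y \<and> jmeas w \<and> (\<forall>x t. set_integrable lborel {0..t} (\<lambda>r. w r x) \<and> Y t x = x + (LBINT r:{0..t}. w r x)) \<and>
     (\<forall>t\<in>{0..T}. compr UNIV (exp ((LBINT r:{0..t}. D r) + \<eta>)) (Y t)) \<and>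
     (\<integral>\<^sup>+r\<in>{0..T}. \<integral>\<^sup>+x\<in>S. norm (w r x - u r (Y r x)) \<partial>lborel \<partial>lborel) \<le> ennreal \<eta>"
proof -
  define s where "s = measure lborel S"
  have s: "emeasure lborel S = ennreal s" "0 \<le> s" using fin by (auto simp: s_def emeasure_eq_ennreal_measure)
  define A1 where "A1 = (LBINT r:{0..T}. A r)"
  have A1: "0 \<le> A1" unfolding A1_def set_lebesgue_integral_def by (intro integral_nonneg_AE) (auto simp: A_nonneg)
  define L where "L = exp ((LBINT r:{0..T}. D r) + \<eta>)"
  have L: "0 < L" by (simp add: L_def)
  \<comment> \<open>One half of \<eta> is reserved for the mollification error
    \<open>L * (3 * \<epsilon>) * A1\<close>, the other half for the error of freezing positions,
    which the second bound on \<theta> controls.\<close>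
  define \<epsilon> where "\<epsilon> = \<eta> / (2 * (3 * L * A1 + 1))"
  have pos: "0 < 3 * L * A1 + 1" using L A1 by (intro add_nonneg_pos mult_nonneg_nonneg) auto
  have \<epsilon>: "0 < \<epsilon>" unfolding \<epsilon>_def using pos \<eta> by simp
  obtain \<rho> :: "real^3 \<Rightarrow> real" and \<gamma> C where k: "kernel \<epsilon> \<rho> \<gamma> C" using kernel_exists[OF \<epsilon>] by metis
  interpret E: euler u A D \<epsilon> C \<rho> \<gamma> by unfold_locales (rule k, rule \<epsilon>)
  have NDi: "set_integrable lborel {a..c} (\<lambda>r. E.N r + D r)" if "0 \<le> a" for a c
    using that by (intro set_integral_add(1) E.N_integrable E.D_integrable)
  define N1 where "N1 = (LBINT r:{0..T}. E.N r)"
  define M where "M = (LBINT r:{0..T}. E.N r + D r)"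
  have N1: "0 \<le> N1" "0 \<le> M" unfolding N1_def M_def set_lebesgue_integral_def by (auto intro!: integral_nonneg_AE simp: E.N_nonneg D_nonneg)
  \<comment> \<open>The total excess in the exponent is then at most \<open>l * M\<close>, hence at
    most \<eta>.\<close>
  define l where "l = \<eta> / (M + 1)"
  have l: "0 < l" using N1 \<eta> by (simp add: l_def)
  obtain \<theta>0 where \<theta>0: "0 < \<theta>0" "\<And>a c. 0 \<le> a \<Longrightarrow> (LBINT r:{a..c}. E.N r + D r) \<le> \<theta>0 \<Longrightarrow>
     compr UNIV (exp (LBINT r:{a..c}. D r + l * (E.N r + D r))) (E.step a c)"
    using E.step_compr[OF l] by metis
  have pos2: "0 < C\<^sup>2 * s * N1 + 1" using s N1 by (intro add_nonneg_pos mult_nonneg_nonneg) auto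
  define \<theta> where "\<theta> = min \<theta>0 (\<eta> / (2 * (C\<^sup>2 * s * N1 + 1)))"
  have \<theta>: "0 < \<theta>" "\<theta> \<le> \<theta>0" "\<theta> \<le> \<eta> / (2 * (C\<^sup>2 * s * N1 + 1))" unfolding \<theta>_def using \<theta>0 pos2 \<eta> by auto
  obtain h where h: "0 < h" "\<And>a c. 0 \<le> a \<Longrightarrow> a \<le> c \<Longrightarrow> c \<le> T \<Longrightarrow> c - a \<le> h \<Longrightarrow> (LBINT r:{a..c}. E.N r + D r) \<le> \<theta>"
    using uniform_small_integrals[OF NDi[OF order_refl] \<theta>(1)] by metis
  have hN: "(LBINT r:{a..c}. E.N r) \<le> \<theta>" if "0 \<le> a" "a \<le> c" "c \<le> T" "c - a \<le> h" for a c
  proof -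
    have "(LBINT r:{a..c}. E.N r) \<le> (LBINT r:{a..c}. E.N r + D r)"
      using that by (intro set_integral_mono E.N_integrable NDi) (auto simp: D_nonneg)
    then show ?thesis using h(2)[OF that] by linarith
  qed
  have Yc: "compr UNIV (exp ((LBINT r:{0..t}. D r) + \<eta>)) (E.Y h t)" if t: "t \<in> {0..T}" for t
  proof (rule compr_mono)
    show "compr UNIV (exp (LBINT r:{0..t}. D r + l * (E.N r + D r))) (E.Y h t)"
      using t l by (intro E.Y_compr[where T=T] h(1) \<theta>0(2) order_trans[OF h(2) \<theta>(2)]) auto
    have "(LBINT r:{0..t}. E.N r + D r) \<le> M"
    proof -
      have "0 \<le> (LBINT r:{t..T}. E.N r + D r)" unfolding set_lebesgue_integral_def by (intro integral_nonneg_AE) (auto simp: E.N_nonneg D_nonneg)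
      then show ?thesis using LBINT_split[OF NDi[OF order_refl, of T], of t] t unfolding M_def by simp
    qed
    then have "l * (LBINT r:{0..t}. E.N r + D r) \<le> l * M" using l by (intro mult_left_mono) auto
    also have "\<dots> \<le> \<eta>" unfolding l_def using N1 \<eta> by (simp add: field_simps)
    finally have "(LBINT r:{0..t}. D r + l * (E.N r + D r)) \<le> (LBINT r:{0..t}. D r) + \<eta>"
      by (subst set_integral_add(2)) (auto intro!: set_integrable_mult_right E.D_integrable NDi)
    then show "exp (LBINT r:{0..t}. D r + l * (E.N r + D r)) \<le> exp ((LBINT r:{0..t}. D r) + \<eta>)" by simp
  qed
  have YL: "compr UNIV L (E.Y h t)" if t: "t \<in> {0..T}" for t
  proof (rule compr_mono[OF Yc[OF t]])
    have "0 \<le> (LBINT r:{t..T}. D r)" unfolding set_lebesgue_integral_def by (intro integral_nonneg_AE) (auto simp: D_nonneg)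
    then show "exp ((LBINT r:{0..t}. D r) + \<eta>) \<le> L"
      using LBINT_split[OF E.D_integrable[OF order_refl, of T], of t] t unfolding L_def by simp
  qed
  have "(\<integral>\<^sup>+r\<in>{0..T}. \<integral>\<^sup>+x\<in>S. norm (E.w h r x - u r (E.Y h r x)) \<partial>lborel \<partial>lborel)
      \<le> ennreal (C\<^sup>2 * \<theta> * s * N1 + L * (3 * \<epsilon>) * A1)"
    unfolding N1_def A1_def using L \<theta>(1) by (intro E.Y_error h(1) T S s hN YL) auto
  also have "\<dots> \<le> ennreal \<eta>"
  proof (intro ennreal_leI)
    have half: "\<eta> / (2 * y) * y = \<eta> / 2" if "0 < y" for y using that by simp
    have "C\<^sup>2 * \<theta> * s * N1 = \<theta> * (C\<^sup>2 * s * N1)" by simp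
    also have "\<dots> \<le> \<theta> * (C\<^sup>2 * s * N1 + 1)" using \<theta>(1) by (intro mult_left_mono) auto
    also have "\<dots> \<le> \<eta> / (2 * (C\<^sup>2 * s * N1 + 1)) * (C\<^sup>2 * s * N1 + 1)" using \<theta>(3) pos2 by (intro mult_right_mono) auto
    also have "\<dots> = \<eta> / 2" by (rule half[OF pos2])
    finally have 1: "C\<^sup>2 * \<theta> * s * N1 \<le> \<eta> / 2" .
    have "L * (3 * \<epsilon>) * A1 = \<epsilon> * (3 * L * A1)" by simp
    also have "\<dots> \<le> \<epsilon> * (3 * L * A1 + 1)" using \<epsilon> by (intro mult_left_mono) auto
    also have "\<dots> = \<eta> / 2" unfolding \<epsilon>_def by (rule half[OF pos])
    finally show "C\<^sup>2 * \<theta> * s * N1 + L * (3 * \<epsilon>) * A1 \<le> \<eta>" using 1 by linarith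
  qed
  finally have err: "(\<integral>\<^sup>+r\<in>{0..T}. \<integral>\<^sup>+x\<in>S. norm (E.w h r x - u r (E.Y h r x)) \<partial>lborel \<partial>lborel) \<le> ennreal \<eta>" .
  show ?thesis
    by (intro exI[of _ "E.Y h"] exI[of _ "E.w h"] conjI allI ballI E.Y_jmeas E.w_jmeas E.w_integrable E.Y_def Yc err order_refl)
qed

end

section \<open>The forward flow\<close>

lemma geometric_cauchy:
  fixes v :: "nat \<Rightarrow> 'a::banach"
  assumes v: "\<And>k. K \<le> k \<Longrightarrow> norm (v k - v (Suc k)) \<le> (1/2)^k"
  shows "v \<longlonglongrightarrow> lim v" "\<And>k. K \<le> k \<Longrightarrow> norm (v k - lim v) \<le> 2 * (1/2)^k"
proof -
  have m: "norm (v k - v (k + m)) \<le> 2 * (1/2)^k - 2 * (1/2)^(k + m)" if k: "K \<le> k" for k m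
  proof (induction m)
    case (Suc m)
    have "norm (v k - v (k + Suc m)) \<le> norm (v k - v (k + m)) + norm (v (k + m) - v (Suc (k + m)))"
      using norm_triangle_ineq[of "v k - v (k + m)" "v (k + m) - v (Suc (k + m))"] by simp
    also have "\<dots> \<le> (2 * (1/2)^k - 2 * (1/2)^(k + m)) + (1/2)^(k + m)"
      using k by (intro add_mono Suc v) auto
    finally show ?case by simp
  qed simp
  have bd: "norm (v k - v (k + m)) \<le> 2 * (1/2)^k" if "K \<le> k" for k m
    using m[OF that, of m] zero_le_power[of "1/2::real" "k + m"] by linarith
  have "Cauchy v"
  proof (rule CauchyI)
    fix e :: real assume e: "0 < e"
    obtain k1 where k1: "(1/2::real)^k1 < e/4" using real_arch_pow_inv[of "e/4" "1/2"] e by auto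
    define k where "k = max K k1"
    have "(1/2::real)^k \<le> (1/2)^k1" unfolding k_def by (intro power_decreasing) auto
    then have k: "K \<le> k" "2 * (1/2::real)^k < e/2" using k1 by (simp add: k_def, linarith)
    show "\<exists>M. \<forall>m\<ge>M. \<forall>n\<ge>M. norm (v m - v n) < e"
    proof (intro exI[of _ k] allI impI)
      fix m n assume "k \<le> m" "k \<le> n"
      then have "norm (v k - v m) \<le> 2 * (1/2)^k" "norm (v k - v n) \<le> 2 * (1/2)^k"
        using bd[OF k(1), of "m - k"] bd[OF k(1), of "n - k"] by auto
      moreover have "norm (v m - v n) \<le> norm (v k - v n) + norm (v k - v m)"
        using norm_triangle_ineq4[of "v k - v n" "v k - v m"] by simp
      ultimately show "norm (v m - v n) < e" using k(2) by linarith
    qed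
  qed
  then show lim: "v \<longlonglongrightarrow> lim v" by (simp add: Cauchy_convergent_iff convergent_LIMSEQ_iff)
  fix k assume k: "K \<le> k"
  have "(\<lambda>m. norm (v k - v (m + k))) \<longlonglongrightarrow> norm (v k - lim v)"
    by (intro tendsto_norm tendsto_diff tendsto_const LIMSEQ_ignore_initial_segment lim)
  then show "norm (v k - lim v) \<le> 2 * (1/2)^k"
    by (rule LIMSEQ_le_const2) (use bd[OF k] in \<open>auto simp: add.commute\<close>)
qed

text \<open>Pointwise convergence of the maps says nothing about \<open>f\<close> along them, as
  \<open>f\<close> is not continuous. Compression permits replacing \<open>f\<close> by a continuous
  \<phi> along all maps at once, at the cost of \<open>L\<close> times the L^1 error; for \<phi>
  dominated convergence applies on the finite measure set \<open>S\<close>.\<close>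

lemma W11_compose_limit:
  fixes f :: "'a::euclidean_space \<Rightarrow> real"
  assumes w: "W11 f g" and V: "\<And>j::nat. compr S L (V j)" and Y: "compr S L Y"
    and S[measurable]: "S \<in> sets borel" and fin: "emeasure lborel S < \<infinity>"
    and conv: "AE x in lborel. (\<lambda>j. V j x) \<longlonglongrightarrow> Y x"
  shows "(\<lambda>j. \<integral>\<^sup>+x\<in>S. \<bar>f (V j x) - f (Y x)\<bar> \<partial>lborel) \<longlonglongrightarrow> 0"
proof (rule ennreal_tendsto_0I)
  fix e :: real assume e: "0 < e"
  note [measurable] = W11_measurable[OF w] comprD(1)[OF V] comprD(1)[OF Y]
  have L: "0 \<le> L" using comprD[OF Y] by simp
  define \<eta> where "\<eta> = e / (4 * (L + 1))"
  have \<eta>: "0 < \<eta>" using e L by (simp add: \<eta>_def)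
  obtain \<phi> \<psi> where h: "has_grad \<phi> \<psi>" "compact_supp \<phi>"
    and a: "(\<integral>\<^sup>+x. \<bar>f x - \<phi> x\<bar> \<partial>lborel) \<le> ennreal \<eta>"
    by (rule W11_approx[OF w \<eta>])
  note [measurable] = has_grad_measurable(1,2)[OF h(1)]
  have c\<phi>: "continuous_on UNIV \<phi>" by (rule has_grad_measurable(3)[OF h(1)])
  obtain B where B: "0 \<le> B" "\<And>x. norm (\<phi> x) \<le> B"
    by (rule compact_supp_bounded[OF h(2) c\<phi>]) auto
  have "(\<lambda>j. \<integral>\<^sup>+x. ennreal \<bar>\<phi> (V j x) - \<phi> (Y x)\<bar> * indicator S x \<partial>lborel) \<longlonglongrightarrow> integral\<^sup>N lborel (\<lambda>x::'a. 0)"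
  proof (rule nn_integral_dominated_convergence[where w="\<lambda>x. ennreal (2 * B) * indicator S x"])
    show "AE x in lborel. ennreal \<bar>\<phi> (V j x) - \<phi> (Y x)\<bar> * indicator S x \<le> ennreal (2 * B) * indicator S x" for j
    proof (rule AE_I2)
      fix x
      have "\<bar>\<phi> (V j x) - \<phi> (Y x)\<bar> \<le> 2 * B"
        using B(2)[of "V j x"] B(2)[of "Y x"] by simp
      then show "ennreal \<bar>\<phi> (V j x) - \<phi> (Y x)\<bar> * indicator S x \<le> ennreal (2 * B) * indicator S x"
        by (intro mult_right_mono ennreal_leI) auto
    qed
    show "(\<integral>\<^sup>+x. ennreal (2 * B) * indicator S x \<partial>lborel) < \<infinity>"
      using fin by (subst nn_integral_cmult_indicator) (auto simp: ennreal_mult_less_top)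
    show "AE x in lborel. (\<lambda>j. ennreal \<bar>\<phi> (V j x) - \<phi> (Y x)\<bar> * indicator S x) \<longlonglongrightarrow> 0"
      using conv
    proof eventually_elim
      case (elim x)
      have "(\<lambda>j. \<phi> (V j x)) \<longlonglongrightarrow> \<phi> (Y x)"
        by (rule continuous_on_tendsto_compose[OF c\<phi> elim]) auto
      then have "(\<lambda>j. \<bar>\<phi> (V j x) - \<phi> (Y x)\<bar>) \<longlonglongrightarrow> 0"
        using LIM_zero tendsto_rabs_zero by blast
      then have "(\<lambda>j. ennreal \<bar>\<phi> (V j x) - \<phi> (Y x)\<bar>) \<longlonglongrightarrow> ennreal 0" by (rule tendsto_ennrealI)
      then show ?case by (cases "x \<in> S") auto
    qed
  qed measurable
  then have "(\<lambda>j. \<integral>\<^sup>+x. ennreal \<bar>\<phi> (V j x) - \<phi> (Y x)\<bar> * indicator S x \<partial>lborel) \<longlonglongrightarrow> 0" by simp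
  from ennreal_tendsto_0D[OF this, of "e/2"] e
  have "eventually (\<lambda>j. (\<integral>\<^sup>+x. ennreal \<bar>\<phi> (V j x) - \<phi> (Y x)\<bar> * indicator S x \<partial>lborel) \<le> ennreal (e/2)) sequentially" by simp
  then show "eventually (\<lambda>j. (\<integral>\<^sup>+x\<in>S. \<bar>f (V j x) - f (Y x)\<bar> \<partial>lborel) \<le> ennreal e) sequentially"
  proof eventually_elim
    case (elim j)
    let ?r = "\<lambda>y. ennreal \<bar>f y - \<phi> y\<bar>"
    have "(\<integral>\<^sup>+x\<in>S. \<bar>f (V j x) - f (Y x)\<bar> \<partial>lborel) \<le>
      (\<integral>\<^sup>+x. ennreal \<bar>\<phi> (V j x) - \<phi> (Y x)\<bar> * indicator S x + ?r (V j x) * indicator S x + ?r (Y x) * indicator S x \<partial>lborel)"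
    proof (intro nn_integral_mono)
      fix x
      have "ennreal \<bar>f (V j x) - f (Y x)\<bar> \<le> ennreal \<bar>\<phi> (V j x) - \<phi> (Y x)\<bar> + ?r (V j x) + ?r (Y x)"
        by (simp add: ennreal_leI flip: ennreal_plus)
      then show "ennreal \<bar>f (V j x) - f (Y x)\<bar> * indicator S x \<le> ennreal \<bar>\<phi> (V j x) - \<phi> (Y x)\<bar> * indicator S x + ?r (V j x) * indicator S x + ?r (Y x) * indicator S x"
        by (auto simp: indicator_def)
    qed
    also have "\<dots> = (\<integral>\<^sup>+x\<in>S. \<bar>\<phi> (V j x) - \<phi> (Y x)\<bar> \<partial>lborel) + (\<integral>\<^sup>+x\<in>S. ?r (V j x) \<partial>lborel) + (\<integral>\<^sup>+x\<in>S. ?r (Y x) \<partial>lborel)"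
      by (simp add: nn_integral_add)
    also have "\<dots> \<le> ennreal (e/2) + ennreal L * ennreal \<eta> + ennreal L * ennreal \<eta>"
      by (intro add_mono elim order_trans[OF comprD(3)[OF V]] order_trans[OF comprD(3)[OF Y]] mult_left_mono a) auto
    also have "\<dots> = ennreal (e/2 + L * \<eta> + L * \<eta>)"
      using e L \<eta> by (simp flip: ennreal_mult ennreal_plus)
    also have "\<dots> \<le> ennreal e"
    proof (rule ennreal_leI)
      have "L * \<eta> \<le> (L + 1) * \<eta>" using \<eta> by (intro mult_right_mono) auto
      also have "\<dots> = e/4" using L unfolding \<eta>_def by (simp add: field_simps)
      finally show "e/2 + L * \<eta> + L * \<eta> \<le> e" by simp
    qed
    finally show ?case .
  qed
qed

context sobolev_field
begin

lemma slice_compose_limit: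
  assumes V: "\<And>j::nat. compr S L (V j)" and Y: "compr S L Y"
    and S[measurable]: "S \<in> sets borel" and fin: "emeasure lborel S < \<infinity>"
    and conv: "AE x in lborel. (\<lambda>j. V j x) \<longlonglongrightarrow> Y x"
  shows "(\<lambda>j. \<integral>\<^sup>+x\<in>S. norm (u r (V j x) - u r (Y x)) \<partial>lborel) \<longlonglongrightarrow> 0"
proof -
  note [measurable] = comprD(1)[OF V] comprD(1)[OF Y]
  obtain g where g: "\<And>e. e \<in> Basis \<Longrightarrow> W11 (\<lambda>x. u r x \<bullet> e) (g e)"
    using slice[of r] by (auto simp: slice_def)
  have "(\<lambda>j. \<Sum>e\<in>(Basis::'a set). \<integral>\<^sup>+x\<in>S. \<bar>u r (V j x) \<bullet> e - u r (Y x) \<bullet> e\<bar> \<partial>lborel) \<longlonglongrightarrow> (\<Sum>e\<in>(Basis::'a set). 0)"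
    by (intro tendsto_sum W11_compose_limit[OF g V Y S fin conv])
  then have *: "(\<lambda>j. \<Sum>e\<in>(Basis::'a set). \<integral>\<^sup>+x\<in>S. \<bar>u r (V j x) \<bullet> e - u r (Y x) \<bullet> e\<bar> \<partial>lborel) \<longlonglongrightarrow> 0" by simp
  show ?thesis
  proof (rule tendsto_sandwich[OF _ _ tendsto_const *]; intro always_eventually allI)
    fix j
    have "(\<integral>\<^sup>+x\<in>S. norm (u r (V j x) - u r (Y x)) \<partial>lborel) \<le> (\<integral>\<^sup>+x. (\<Sum>e\<in>Basis. ennreal \<bar>u r (V j x) \<bullet> e - u r (Y x) \<bullet> e\<bar> * indicator S x) \<partial>lborel)"
    proof (intro nn_integral_mono)
      fix x
      have "norm (u r (V j x) - u r (Y x)) \<le> (\<Sum>e\<in>Basis. \<bar>u r (V j x) \<bullet> e - u r (Y x) \<bullet> e\<bar>)"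
        using norm_le_l1[of "u r (V j x) - u r (Y x)"] by (simp add: inner_diff_left)
      then have "ennreal (norm (u r (V j x) - u r (Y x))) \<le> (\<Sum>e\<in>Basis. ennreal \<bar>u r (V j x) \<bullet> e - u r (Y x) \<bullet> e\<bar>)"
        by (subst sum_ennreal) (auto intro: ennreal_leI)
      then show "ennreal (norm (u r (V j x) - u r (Y x))) * indicator S x \<le> (\<Sum>e\<in>Basis. ennreal \<bar>u r (V j x) \<bullet> e - u r (Y x) \<bullet> e\<bar> * indicator S x)"
        by (auto simp: indicator_def)
    qed
    also have "\<dots> = (\<Sum>e\<in>Basis. \<integral>\<^sup>+x\<in>S. \<bar>u r (V j x) \<bullet> e - u r (Y x) \<bullet> e\<bar> \<partial>lborel)"
      by (rule nn_integral_sum) measurable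
    finally show "(\<integral>\<^sup>+x\<in>S. norm (u r (V j x) - u r (Y x)) \<partial>lborel) \<le> \<dots>" .
  qed simp
qed

definition flow :: "(real \<Rightarrow> 'a \<Rightarrow> 'a) \<Rightarrow> bool" where
  "flow Y \<longleftrightarrow> jmeas Y \<and> (\<forall>t\<ge>0. compr UNIV (exp (LBINT r:{0..t}. D r)) (Y t)) \<and>
     (AE x in lborel. \<forall>t\<ge>0. set_integrable lborel {0..t} (\<lambda>r. u r (Y r x)) \<and> Y t x = x + (LBINT r:{0..t}. u r (Y r x)))"

end

lemma compr_limit:
  fixes V :: "nat \<Rightarrow> 'a::euclidean_space \<Rightarrow> 'a"
  assumes V: "\<And>e. 0 < e \<Longrightarrow> eventually (\<lambda>j. compr UNIV (exp (c + e)) (V j)) sequentially"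
    and [measurable]: "\<And>j. V j \<in> borel_measurable borel" "Y \<in> borel_measurable borel"
    and conv: "AE x in lborel. (\<lambda>j. V j x) \<longlonglongrightarrow> Y x"
  shows "compr UNIV (exp c) Y"
proof (rule comprI)
  have op: "emeasure lborel (Y -` G) \<le> ennreal (exp c) * emeasure lborel G" if G: "open G" for G
  proof -
    have [measurable]: "G \<in> sets borel" using G by simp
    have le: "emeasure lborel (Y -` G) \<le> ennreal (exp (c + e)) * emeasure lborel G" if e: "0 < e" for e :: real
    proof -
      have "emeasure lborel (Y -` G) = (\<integral>\<^sup>+x. indicator (Y -` G) x \<partial>lborel)"
        using measurable_sets[OF \<open>Y \<in> borel_measurable borel\<close>, of G] by simp
      also have "\<dots> = (\<integral>\<^sup>+x. indicator G (Y x) \<partial>lborel)" by (intro nn_integral_cong) (auto simp: indicator_def)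
      also have "\<dots> \<le> (\<integral>\<^sup>+x. liminf (\<lambda>j. indicator G (V j x)) \<partial>lborel)"
      proof (rule nn_integral_mono_AE)
        show "AE x in lborel. indicator G (Y x) \<le> liminf (\<lambda>j. indicator G (V j x) :: ennreal)"
          using conv
        proof eventually_elim
          case (elim x)
          show ?case
          proof (cases "Y x \<in> G")
            case True
            then have "eventually (\<lambda>j. V j x \<in> G) sequentially" using elim G by (auto dest: topological_tendstoD)
            then have "eventually (\<lambda>j. (1::ennreal) \<le> indicator G (V j x)) sequentially" by eventually_elim simp
            then have "(1::ennreal) \<le> liminf (\<lambda>j. indicator G (V j x))" by (rule Liminf_bounded)
            then show ?thesis using True by simp
          qed simp
        qed
      qed
      also have "\<dots> \<le> liminf (\<lambda>j. \<integral>\<^sup>+x. indicator G (V j x) \<partial>lborel)"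
        by (rule nn_integral_liminf) measurable
      also have "\<dots> \<le> ennreal (exp (c + e)) * emeasure lborel G"
      proof -
        have "eventually (\<lambda>j. (\<integral>\<^sup>+x. indicator G (V j x) \<partial>lborel) \<le> ennreal (exp (c + e)) * emeasure lborel G) sequentially"
          using V[OF e]
        proof eventually_elim
          case (elim j)
          then show ?case using comprD(3)[OF elim, of "indicator G"] by simp
        qed
        then have "limsup (\<lambda>j. \<integral>\<^sup>+x. indicator G (V j x) \<partial>lborel) \<le> ennreal (exp (c + e)) * emeasure lborel G" by (rule Limsup_bounded)
        then show ?thesis using Liminf_le_Limsup[OF sequentially_bot] by (rule order_trans[rotated])
      qed
      finally show ?thesis .
    qed
    have "(\<lambda>j. 1 / real (Suc j)) \<longlonglongrightarrow> 0" by (rule LIMSEQ_Suc[OF lim_1_over_n])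
    then have "(\<lambda>j. exp (c + 1 / real (Suc j))) \<longlonglongrightarrow> exp (c + 0)" by (intro tendsto_exp tendsto_add tendsto_const)
    then have "(\<lambda>j. ennreal (exp (c + 1 / real (Suc j))) * emeasure lborel G) \<longlonglongrightarrow> ennreal (exp c) * emeasure lborel G"
      by (intro tendsto_mult_ennreal tendsto_ennrealI tendsto_const) auto
    then show ?thesis by (rule LIMSEQ_le_const) (use le in auto)
  qed
  fix B :: "'a set" assume B[measurable]: "B \<in> sets borel"
  show "emeasure lborel (Y -` B) \<le> ennreal (exp c) * emeasure lborel B"
  proof (rule ennreal_le_epsilon)
    fix e :: real assume e: "0 < e"
    obtain G where G: "open G" "B \<subseteq> G" "emeasure lebesgue (G - B) < ennreal (e / exp c)"
      by (rule sets_lebesgue_outer_open[of B "e / exp c"]) (use B e in auto)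
    have Gm: "G \<in> sets borel" using G(1) by simp
    have "emeasure lborel (Y -` B) \<le> emeasure lborel (Y -` G)"
      using G(2) measurable_sets[OF \<open>Y \<in> borel_measurable borel\<close> Gm] by (intro emeasure_mono) auto
    also have "\<dots> \<le> ennreal (exp c) * emeasure lborel G" by (rule op[OF G(1)])
    also have "emeasure lborel G = emeasure lborel (B \<union> (G - B))" using G(2) by (simp add: Un_absorb1)
    also have "\<dots> \<le> emeasure lborel B + emeasure lborel (G - B)" using Gm B by (intro emeasure_subadditive) auto
    also have "\<dots> \<le> emeasure lborel B + ennreal (e / exp c)"
      using G(3) Gm B by (intro add_left_mono) auto
    also have "ennreal (exp c) * (emeasure lborel B + ennreal (e / exp c)) = ennreal (exp c) * emeasure lborel B + ennreal e"
      by (simp add: distrib_left ennreal_mult'[symmetric])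
    finally show "emeasure lborel (Y -` B) \<le> ennreal (exp c) * emeasure lborel B + ennreal e"
      by (simp add: mult_left_mono)
  qed
qed auto

lemma (in sobolev_field) D_integrable': "0 \<le> a \<Longrightarrow> set_integrable lborel {a..c} D"
  using D_int[of c] by (intro set_integrable_nonneg D_nonneg) auto

lemma (in sobolev_field) DI_mono:
  assumes "0 \<le> t" "t \<le> T"
  shows "(LBINT r:{0..t}. D r) \<le> (LBINT r:{0..T}. D r)"
proof -
  have "0 \<le> (LBINT r:{t..T}. D r)" unfolding set_lebesgue_integral_def by (intro integral_nonneg_AE) (auto simp: D_nonneg)
  then show ?thesis using LBINT_split[OF D_integrable'[OF order_refl, of T] assms] by simp
qed

section \<open>A convergent sequence of polygons\<close>

context sobolev_field_R3
begin

text \<open>Time horizon, ball of starting points and tolerance all improve with the same index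
  \<open>n\<close>, so every bounded range of times and points is eventually covered by the whole
  tail of one sequence.\<close>

definition approximants :: "(nat \<Rightarrow> real \<Rightarrow> real^3 \<Rightarrow> real^3) \<Rightarrow> (nat \<Rightarrow> real \<Rightarrow> real^3 \<Rightarrow> real^3) \<Rightarrow> bool" where
  "approximants V W \<longleftrightarrow> (\<forall>n. jmeas (V n) \<and> jmeas (W n) \<and>
     (\<forall>x t. set_integrable lborel {0..t} (\<lambda>r. W n r x) \<and> V n t x = x + (LBINT r:{0..t}. W n r x)) \<and>
     (\<forall>t\<in>{0..real n}. compr UNIV (exp ((LBINT r:{0..t}. D r) + 1 / Suc n)) (V n t)) \<and>
     (\<integral>\<^sup>+r\<in>{0..real n}. \<integral>\<^sup>+x\<in>cball 0 (real n). norm (W n r x - u r (V n r x)) \<partial>lborel \<partial>lborel) \<le> ennreal (1 / Suc n))"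

lemma approximants_exist: "\<exists>V W. approximants V W"
proof -
  define P where "P n Y w \<longleftrightarrow> jmeas Y \<and> jmeas w \<and> (\<forall>x t. set_integrable lborel {0..t} (\<lambda>r. w r x) \<and> Y t x = x + (LBINT r:{0..t}. w r x)) \<and>
     (\<forall>t\<in>{0..real n}. compr UNIV (exp ((LBINT r:{0..t}. D r) + 1 / Suc n)) (Y t)) \<and>
     (\<integral>\<^sup>+r\<in>{0..real n}. \<integral>\<^sup>+x\<in>cball 0 (real n). norm (w r x - u r (Y r x)) \<partial>lborel \<partial>lborel) \<le> ennreal (1 / Suc n)"
    for n :: nat and Y w :: "real \<Rightarrow> real^3 \<Rightarrow> real^3"
  have "\<exists>Y w. P n Y w" for n
    unfolding P_def using emeasure_lborel_cball_finite[of "0::real^3" "real n"]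
    by (intro approximate_flow_exists) auto
  then obtain V W where "\<And>n. P n (V n) (W n)" by metis
  then show ?thesis unfolding P_def approximants_def by blast
qed

lemma approximants_approx_flow:
  assumes a: "approximants V W" and kn: "k \<le> n" and e: "1 / Suc n \<le> e"
  shows "approx_flow (cball 0 (real k)) (real k) (exp ((LBINT r:{0..real k}. D r) + 1)) e (V n) (W n)"
  unfolding approx_flow_def
proof (intro conjI ballI AE_I2 impI)
  show "jmeas (V n)" "jmeas (W n)" using a by (auto simp: approximants_def)
  show "set_integrable lborel {0..real k} (\<lambda>r. W n r x)" for x using a by (auto simp: approximants_def)
  have V: "V n t x = x + (LBINT r:{0..t}. W n r x)" for t x using a unfolding approximants_def by blast
  show "V n t x = V n 0 x + (LBINT r:{0..t}. W n r x)" for t x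
    unfolding V[of t] V[of 0] using LBINT_singleton[of 0] by simp
  fix r assume r: "r \<in> {0..real k}"
  have "compr UNIV (exp ((LBINT r:{0..r}. D r) + 1 / Suc n)) (V n r)"
    using a r kn by (auto simp: approximants_def)
  moreover have "exp ((LBINT r:{0..r}. D r) + 1 / Suc n) \<le> exp ((LBINT r:{0..real k}. D r) + 1)"
    using DI_mono[of r "real k"] r by (simp add: add_mono)
  ultimately show "compr (cball 0 (real k)) (exp ((LBINT r:{0..real k}. D r) + 1)) (V n r)"
    by (rule compr_subset[OF compr_mono])
next
  have "(\<integral>\<^sup>+r\<in>{0..real k}. \<integral>\<^sup>+x\<in>cball 0 (real k). norm (W n r x - u r (V n r x)) \<partial>lborel \<partial>lborel)
    \<le> (\<integral>\<^sup>+r\<in>{0..real n}. \<integral>\<^sup>+x\<in>cball 0 (real n). norm (W n r x - u r (V n r x)) \<partial>lborel \<partial>lborel)"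
    using kn by (intro nn_integral_mono mult_mono) (auto simp: indicator_def)
  also have "\<dots> \<le> ennreal (1 / Suc n)" using a unfolding approximants_def by blast
  also have "\<dots> \<le> ennreal e" using e by (rule ennreal_leI)
  finally show "(\<integral>\<^sup>+r\<in>{0..real k}. \<integral>\<^sup>+x\<in>cball 0 (real k). norm (W n r x - u r (V n r x)) \<partial>lborel \<partial>lborel) \<le> ennreal e" .
qed

lemma approximants_subseq:
  assumes a: "approximants V W" and f: "\<And>k. k \<le> f k"
  shows "approximants (\<lambda>k. V (f k)) (\<lambda>k. W (f k))"
  unfolding approximants_def
proof (intro allI conjI ballI)
  fix n
  show "jmeas (V (f n))" "jmeas (W (f n))" using a by (auto simp: approximants_def)
  show "set_integrable lborel {0..t} (\<lambda>r. W (f n) r x)" "V (f n) t x = x + (LBINT r:{0..t}. W (f n) r x)" for x t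
    using a unfolding approximants_def by blast+
  have le: "1 / real (Suc (f n)) \<le> 1 / real (Suc n)" using f[of n] by (intro divide_left_mono) auto
  fix t assume t: "t \<in> {0..real n}"
  have "compr UNIV (exp ((LBINT r:{0..t}. D r) + 1 / Suc (f n))) (V (f n) t)"
    using a t f[of n] unfolding approximants_def by auto
  then show "compr UNIV (exp ((LBINT r:{0..t}. D r) + 1 / Suc n)) (V (f n) t)"
    by (rule compr_mono) (use le in simp)
next
  fix n
  have le: "1 / real (Suc (f n)) \<le> 1 / real (Suc n)" using f[of n] by (intro divide_left_mono) auto
  show "(\<integral>\<^sup>+r\<in>{0..real n}. \<integral>\<^sup>+x\<in>cball 0 (real n). norm (W (f n) r x - u r (V (f n) r x)) \<partial>lborel \<partial>lborel) \<le> ennreal (1 / Suc n)"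
    using approximants_approx_flow[OF a f[of n] le] unfolding approx_flow_def by blast
qed

text \<open>Borel-Cantelli along a fast subsequence upgrades the stability estimate to locally uniform convergence in
  time for almost every starting point.\<close>

lemma convergent_approximants:
  "\<exists>V W. approximants V W \<and>
     (AE x in lborel. \<exists>k0. \<forall>k\<ge>k0. \<forall>t\<in>{0..real k}. norm (V k t x - V (Suc k) t x) \<le> (1/2)^k)"
proof -
  obtain V W where a: "approximants V W" using approximants_exist by blast
  let ?S = "\<lambda>k. cball (0::real^3) (real k)" and ?L = "\<lambda>k. exp ((LBINT r:{0..real k}. D r) + 1)"
  define G where "G k e \<longleftrightarrow> (\<forall>Y1 w1 Y2 w2. approx_flow (?S k) (real k) (?L k) e Y1 w1 \<longrightarrow> approx_flow (?S k) (real k) (?L k) e Y2 w2 \<longrightarrow>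
      (AE x in lborel. x \<in> ?S k \<longrightarrow> Y1 0 x = Y2 0 x) \<longrightarrow>
      (\<exists>B\<in>sets borel. B \<subseteq> ?S k \<and> emeasure lborel B \<le> ennreal ((1/2)^k) \<and>
         (AE x in lborel. x \<in> ?S k - B \<longrightarrow> (\<forall>t\<in>{0..real k}. norm (Y1 t x - Y2 t x) \<le> (1/2)^k))))" for k :: nat and e
  have "\<exists>e>0. G k e" for k
    unfolding G_def using emeasure_lborel_cball_finite[of "0::real^3" "real k"]
    by (intro stability) (auto simp: power_le_one)
  then obtain e where e: "\<And>k. 0 < e k" "\<And>k. G k (e k)" by metis
  have "\<exists>n. k \<le> n \<and> 1 / real (Suc n) \<le> e k" for k
  proof -
    obtain n where n: "1 / real (Suc n) < e k" using nat_approx_posE[OF e(1)[of k]] by metis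
    have "1 / real (Suc (max k n)) \<le> 1 / real (Suc n)" by (intro divide_left_mono) auto
    then show ?thesis using n by (intro exI[of _ "max k n"]) auto
  qed
  then obtain f0 where f0: "\<And>k. k \<le> f0 k" "\<And>k. 1 / real (Suc (f0 k)) \<le> e k" by metis
  \<comment> \<open>The maximum makes the indices increase, so that \<open>f (Suc k)\<close> also
    meets the tolerance \<open>e k\<close> and consecutive members of the subsequence can be
    compared on the same ball and time interval.\<close>
  define f where "f k = Max (f0 ` {..k})" for k
  have f: "f0 k \<le> f k" "f k \<le> f (Suc k)" for k
    unfolding f_def by (auto intro!: Max_ge Max_mono)
  have fk: "k \<le> f k" for k using f0(1) f(1) le_trans by blast
  have fe: "1 / real (Suc n) \<le> e k" if "f k \<le> n" for n k
  proof -
    have "1 / real (Suc n) \<le> 1 / real (Suc (f0 k))" using that f(1)[of k] by (intro divide_left_mono) auto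
    then show ?thesis using f0(2)[of k] by simp
  qed
  have init: "V n 0 x = x" for n x
    using a LBINT_singleton[of 0 "\<lambda>r. W n r x"] unfolding approximants_def by simp
  define R where "R k B \<longleftrightarrow> B \<in> sets borel \<and> B \<subseteq> ?S k \<and> emeasure lborel B \<le> ennreal ((1/2)^k) \<and>
         (AE x in lborel. x \<in> ?S k - B \<longrightarrow> (\<forall>t\<in>{0..real k}. norm (V (f k) t x - V (f (Suc k)) t x) \<le> (1/2)^k))" for k B
  have "\<exists>B. R k B" for k
  proof -
    have 1: "approx_flow (?S k) (real k) (?L k) (e k) (V (f k)) (W (f k))"
      by (rule approximants_approx_flow[OF a fk fe]) simp
    have 2: "approx_flow (?S k) (real k) (?L k) (e k) (V (f (Suc k))) (W (f (Suc k)))"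
      by (rule approximants_approx_flow[OF a _ fe]) (use fk[of k] f(2)[of k] in auto)
    have 3: "AE x in lborel. x \<in> ?S k \<longrightarrow> V (f k) 0 x = V (f (Suc k)) 0 x" by (simp add: init)
    from e(2)[of k, unfolded G_def, rule_format, OF 1 2 3[rule_format]]
    show ?thesis unfolding R_def Bex_def .
  qed
  then obtain B where "\<And>k. R k (B k)" by metis
  then have B: "\<And>k. B k \<in> sets borel" "\<And>k. emeasure lborel (B k) \<le> ennreal ((1/2)^k)"
    "\<And>k. AE x in lborel. x \<in> ?S k - B k \<longrightarrow> (\<forall>t\<in>{0..real k}. norm (V (f k) t x - V (f (Suc k)) t x) \<le> (1/2)^k)"
    unfolding R_def by blast+
  have fin: "emeasure lborel (B k) < \<infinity>" for k using le_less_trans[OF B(2)] by simp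
  have "AE x in lborel. eventually (\<lambda>k. x \<in> space lborel - B k) sequentially"
  proof (rule borel_cantelli_AE1)
    have "measure lborel (B k) \<le> (1/2)^k" for k
    proof -
      have "ennreal (measure lborel (B k)) \<le> ennreal ((1/2)^k)"
        using B(2)[of k] fin[of k] by (simp add: emeasure_eq_ennreal_measure)
      then show ?thesis by simp
    qed
    then show "summable (\<lambda>k. measure lborel (B k))"
      by (intro summable_comparison_test'[OF summable_geometric[of "1/2::real"]]) auto
  qed (use B(1) fin in simp_all)
  moreover have "AE x in lborel. \<forall>k. x \<in> ?S k - B k \<longrightarrow> (\<forall>t\<in>{0..real k}. norm (V (f k) t x - V (f (Suc k)) t x) \<le> (1/2)^k)"
    unfolding AE_all_countable using B(3) by blast
  ultimately have "AE x in lborel. \<exists>k0. \<forall>k\<ge>k0. \<forall>t\<in>{0..real k}. norm (V (f k) t x - V (f (Suc k)) t x) \<le> (1/2)^k"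
  proof eventually_elim
    case (elim x)
    obtain k1 where k1: "\<And>k. k1 \<le> k \<Longrightarrow> x \<notin> B k" using elim(1) by (auto simp: eventually_sequentially)
    obtain k2 :: nat where k2: "norm x \<le> real k2" using real_arch_simple by blast
    show ?case
    proof (intro exI[of _ "max k1 k2"] allI impI)
      fix k assume k: "max k1 k2 \<le> k"
      then have "x \<in> ?S k - B k" using k1[of k] k2 by auto
      then show "\<forall>t\<in>{0..real k}. norm (V (f k) t x - V (f (Suc k)) t x) \<le> (1/2)^k" using elim(2) by blast
    qed
  qed
  then show ?thesis using approximants_subseq[OF a fk] by blast
qed

text \<open>The compression bound passes to the limit by \<open>compr_limit\<close>. The integral
  equation is harder, since \<open>u r\<close> is not continuous: first the velocities
  \<open>W\<close> converge to \<open>u\<close> along \<open>Y\<close> in the mean over space and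
  time, with \<open>slice_compose_limit\<close> at each time and domination in time, and only then a
  subsequence is selected for each starting point.\<close>

theorem flow_exists: "\<exists>Y. flow Y"
proof -
  obtain V W where a: "approximants V W"
    and cau: "AE x in lborel. \<exists>k0. \<forall>k\<ge>k0. \<forall>t\<in>{0..real k}. norm (V k t x - V (Suc k) t x) \<le> (1/2)^k"
    using convergent_approximants by blast
  have jm: "jmeas (V n)" "jmeas (W n)" for n using a by (auto simp: approximants_def)
  note [measurable (raw)] = jm[THEN jmeasD]
  have W: "set_integrable lborel {0..t} (\<lambda>r. W n r x)" "V n t x = x + (LBINT r:{0..t}. W n r x)" for n t x
    using a unfolding approximants_def by blast+
  \<comment> \<open>Where the sequence diverges, \<open>lim\<close> takes an unspecified constant
    value. \<open>Y\<close> is Borel all the same, and one null set of \<open>x\<close> contains the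
    divergence at all times t \<ge> 0.\<close>
  define Y where "Y t x = lim (\<lambda>k. V k t x)" for t x
  have Yj: "jmeas Y" unfolding jmeas_def Y_def by (intro borel_measurable_lim_metric) measurable
  note [measurable (raw)] = jmeasD[OF Yj]
  have conv: "AE x in lborel. \<exists>k0. \<forall>k\<ge>k0. \<forall>t\<in>{0..real k}. norm (V k t x - Y t x) \<le> 2 * (1/2)^k"
    using cau
  proof eventually_elim
    case (elim x)
    then obtain k0 where k0: "\<And>k t. k0 \<le> k \<Longrightarrow> t \<in> {0..real k} \<Longrightarrow> norm (V k t x - V (Suc k) t x) \<le> (1/2)^k" by blast
    show ?case
    proof (intro exI[of _ k0] allI impI ballI)
      fix k t assume k: "k0 \<le> k" and t: "t \<in> {0..real k}"
      show "norm (V k t x - Y t x) \<le> 2 * (1/2)^k" unfolding Y_def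
      proof (rule geometric_cauchy(2)[where K=k])
        fix k' assume "k \<le> k'"
        then show "norm (V k' t x - V (Suc k') t x) \<le> (1/2)^k'" using k0[of k' t] k t by auto
      qed simp
    qed
  qed
  have pt: "AE x in lborel. \<forall>t\<ge>0. (\<lambda>k. V k t x) \<longlonglongrightarrow> Y t x"
    using cau
  proof eventually_elim
    case (elim x)
    then obtain k0 where k0: "\<And>k t. k0 \<le> k \<Longrightarrow> t \<in> {0..real k} \<Longrightarrow> norm (V k t x - V (Suc k) t x) \<le> (1/2)^k" by blast
    show ?case
    proof (intro allI impI)
      fix t :: real assume t: "0 \<le> t"
      obtain k1 :: nat where k1: "t \<le> real k1" using real_arch_simple by blast
      show "(\<lambda>k. V k t x) \<longlonglongrightarrow> Y t x" unfolding Y_def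
      proof (rule geometric_cauchy(1)[where K="max k0 k1"])
        fix k' assume "max k0 k1 \<le> k'"
        then show "norm (V k' t x - V (Suc k') t x) \<le> (1/2)^k'" using k0[of k' t] k1 t by auto
      qed
    qed
  qed
  have pt': "AE x in lborel. (\<lambda>k. V k t x) \<longlonglongrightarrow> Y t x" if "0 \<le> t" for t
    using pt by eventually_elim (use that in blast)
  have Yc: "compr UNIV (exp (LBINT r:{0..t}. D r)) (Y t)" if t: "0 \<le> t" for t
  proof (rule compr_limit[OF _ _ _ pt'[OF t]])
    fix e :: real assume e: "0 < e"
    obtain n where n: "1 / real (Suc n) < e" using nat_approx_posE[OF e] by metis
    obtain m :: nat where m: "t \<le> real m" using real_arch_simple by blast
    show "eventually (\<lambda>j. compr UNIV (exp ((LBINT r:{0..t}. D r) + e)) (V j t)) sequentially"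
      using eventually_ge_at_top[of "max n m"]
    proof eventually_elim
      case (elim j)
      have "compr UNIV (exp ((LBINT r:{0..t}. D r) + 1 / Suc j)) (V j t)"
        using a t m elim unfolding approximants_def by auto
      moreover have "1 / real (Suc j) \<le> 1 / real (Suc n)" using elim by (intro divide_left_mono) auto
      moreover have "exp ((LBINT r:{0..t}. D r) + 1 / Suc j) \<le> exp ((LBINT r:{0..t}. D r) + e)" using n calculation(2) by simp
      ultimately show ?case using compr_mono by blast
    qed
  qed measurable
  \<comment> \<open>The restriction to a ball and to a bounded time interval gives finite measure.
    The shifted index \<open>k + K\<close> used below keeps the approximants within the range in
    which their bounds hold.\<close>
  have ode: "AE x in lborel. x \<in> cball 0 (real K) \<longrightarrow> (\<forall>t\<in>{0..real K}. set_integrable lborel {0..t} (\<lambda>r. u r (Y r x)) \<and> Y t x = x + (LBINT r:{0..t}. u r (Y r x)))" for K :: nat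
  proof -
    let ?S = "cball (0::real^3) (real K)" and ?T = "real K"
    define L where "L = exp ((LBINT r:{0..real K}. D r) + 1)"
    have fin: "emeasure lborel ?S < \<infinity>" using emeasure_lborel_cball_finite[of "0::real^3" "real K"] by simp
    have VL: "compr ?S L (V (k + K) r)" if "r \<in> {0..?T}" for k r
      using approximants_approx_flow[OF a, of K "k + K" 1] that unfolding approx_flow_def L_def by auto
    have YL: "compr ?S L (Y r)" if r: "r \<in> {0..?T}" for r
    proof (rule compr_subset[OF compr_mono[OF Yc]])
      show "0 \<le> r" using r by simp
      show "exp (LBINT r:{0..r}. D r) \<le> L" using DI_mono[of r ?T] r unfolding L_def by auto
    qed
    \<comment> \<open>\<open>G k x\<close> bounds the defect of the integral equation along the
      curve from \<open>x\<close>, uniformly for times up to \<open>?T\<close>.\<close>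
    define G where "G k x = (\<integral>\<^sup>+r\<in>{0..?T}. norm (W (k + K) r x - u r (Y r x)) \<partial>lborel)" for k x
    have [measurable]: "G k \<in> borel_measurable borel" for k unfolding G_def by measurable
    let ?q = "\<lambda>k r. \<integral>\<^sup>+x\<in>?S. norm (u r (V (k + K) r x) - u r (Y r x)) \<partial>lborel"
    have q: "(\<lambda>k. \<integral>\<^sup>+r. ?q k r * indicator {0..?T} r \<partial>lborel) \<longlonglongrightarrow> integral\<^sup>N lborel (\<lambda>r::real. 0)"
    proof (rule nn_integral_dominated_convergence[where w="\<lambda>r. 2 * ennreal L * ((\<integral>\<^sup>+x. norm (u r x) \<partial>lborel) * indicator {0..?T} r)"])
      show "AE r in lborel. ?q k r * indicator {0..?T} r \<le> 2 * ennreal L * ((\<integral>\<^sup>+x. norm (u r x) \<partial>lborel) * indicator {0..?T} r)" for k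
      proof (rule AE_I2)
        fix r
        show "?q k r * indicator {0..?T} r \<le> 2 * ennreal L * ((\<integral>\<^sup>+x. norm (u r x) \<partial>lborel) * indicator {0..?T} r)"
        proof (cases "r \<in> {0..?T}")
          case True
          have "?q k r \<le> (\<integral>\<^sup>+x. ennreal (norm (u r (V (k + K) r x))) * indicator ?S x + ennreal (norm (u r (Y r x))) * indicator ?S x \<partial>lborel)"
          proof (intro nn_integral_mono)
            fix x
            have "ennreal (norm (u r (V (k + K) r x) - u r (Y r x))) \<le> ennreal (norm (u r (V (k + K) r x))) + ennreal (norm (u r (Y r x)))"
              by (simp add: ennreal_leI norm_triangle_ineq4 flip: ennreal_plus)
            then show "ennreal (norm (u r (V (k + K) r x) - u r (Y r x))) * indicator ?S x \<le> ennreal (norm (u r (V (k + K) r x))) * indicator ?S x + ennreal (norm (u r (Y r x))) * indicator ?S x"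
              by (auto simp: indicator_def)
          qed
          also have "\<dots> = (\<integral>\<^sup>+x\<in>?S. norm (u r (V (k + K) r x)) \<partial>lborel) + (\<integral>\<^sup>+x\<in>?S. norm (u r (Y r x)) \<partial>lborel)"
            by (rule nn_integral_add) measurable
          also have "\<dots> \<le> ennreal L * (\<integral>\<^sup>+x. norm (u r x) \<partial>lborel) + ennreal L * (\<integral>\<^sup>+x. norm (u r x) \<partial>lborel)"
            by (intro add_mono comprD(3)[OF VL[OF True]] comprD(3)[OF YL[OF True]]) measurable
          finally show ?thesis using True by (simp add: mult_2 distrib_right)
        qed auto
      qed
      show "(\<integral>\<^sup>+r. 2 * ennreal L * ((\<integral>\<^sup>+x. norm (u r x) \<partial>lborel) * indicator {0..?T} r) \<partial>lborel) < \<infinity>"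
        using u_int[of ?T] by (subst nn_integral_cmult) (auto simp: ennreal_mult_less_top)
      show "AE r in lborel. (\<lambda>k. ?q k r * indicator {0..?T} r) \<longlonglongrightarrow> 0"
      proof (rule AE_I2)
        fix r
        show "(\<lambda>k. ?q k r * indicator {0..?T} r) \<longlonglongrightarrow> 0"
        proof (cases "r \<in> {0..?T}")
          case True
          have "AE x in lborel. (\<lambda>k. V (k + K) r x) \<longlonglongrightarrow> Y r x"
            using pt'[of r] True by (auto elim: eventually_mono intro: LIMSEQ_ignore_initial_segment)
          from slice_compose_limit[OF VL[OF True] YL[OF True] _ fin this, of r] True show ?thesis by simp
        qed auto
      qed
    qed measurable
    have GS: "(\<integral>\<^sup>+x\<in>?S. G k x \<partial>lborel) \<le> ennreal (1 / Suc (k + K)) + (\<integral>\<^sup>+r. ?q k r * indicator {0..?T} r \<partial>lborel)" for k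
    proof -
      have "(\<integral>\<^sup>+x\<in>?S. G k x \<partial>lborel) = (\<integral>\<^sup>+x. \<integral>\<^sup>+r. ennreal (norm (W (k + K) r x - u r (Y r x))) * indicator {0..?T} r * indicator ?S x \<partial>lborel \<partial>lborel)"
        unfolding G_def by (intro nn_integral_cong) (subst nn_integral_multc, auto)
      also have "\<dots> = (\<integral>\<^sup>+r. \<integral>\<^sup>+x. ennreal (norm (W (k + K) r x - u r (Y r x))) * indicator {0..?T} r * indicator ?S x \<partial>lborel \<partial>lborel)"
        by (rule nn_integral_lborel_swap) (unfold borel_prod[symmetric], measurable)
      also have "\<dots> \<le> (\<integral>\<^sup>+r. (\<integral>\<^sup>+x\<in>?S. norm (W (k + K) r x - u r (V (k + K) r x)) \<partial>lborel) * indicator {0..?T} r + ?q k r * indicator {0..?T} r \<partial>lborel)"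
      proof (intro nn_integral_mono)
        fix r
        have "(\<integral>\<^sup>+x. ennreal (norm (W (k + K) r x - u r (Y r x))) * indicator {0..?T} r * indicator ?S x \<partial>lborel)
          \<le> (\<integral>\<^sup>+x. (ennreal (norm (W (k + K) r x - u r (V (k + K) r x))) * indicator ?S x) * indicator {0..?T} r + (ennreal (norm (u r (V (k + K) r x) - u r (Y r x))) * indicator ?S x) * indicator {0..?T} r \<partial>lborel)"
        proof (intro nn_integral_mono)
          fix x
          have "norm (W (k + K) r x - u r (Y r x)) \<le> norm (W (k + K) r x - u r (V (k + K) r x)) + norm (u r (V (k + K) r x) - u r (Y r x))"
            using norm_triangle_ineq[of "W (k + K) r x - u r (V (k + K) r x)" "u r (V (k + K) r x) - u r (Y r x)"] by simp
          then have "ennreal (norm (W (k + K) r x - u r (Y r x))) \<le> ennreal (norm (W (k + K) r x - u r (V (k + K) r x))) + ennreal (norm (u r (V (k + K) r x) - u r (Y r x)))"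
            by (simp add: ennreal_leI flip: ennreal_plus)
          then show "ennreal (norm (W (k + K) r x - u r (Y r x))) * indicator {0..?T} r * indicator ?S x \<le> (ennreal (norm (W (k + K) r x - u r (V (k + K) r x))) * indicator ?S x) * indicator {0..?T} r + (ennreal (norm (u r (V (k + K) r x) - u r (Y r x))) * indicator ?S x) * indicator {0..?T} r"
            by (auto simp: indicator_def)
        qed
        also have "\<dots> = (\<integral>\<^sup>+x\<in>?S. norm (W (k + K) r x - u r (V (k + K) r x)) \<partial>lborel) * indicator {0..?T} r + ?q k r * indicator {0..?T} r"
          by (subst nn_integral_add) (auto simp: nn_integral_multc)
        finally show "(\<integral>\<^sup>+x. ennreal (norm (W (k + K) r x - u r (Y r x))) * indicator {0..?T} r * indicator ?S x \<partial>lborel) \<le> \<dots>" .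
      qed
      also have "\<dots> = (\<integral>\<^sup>+r\<in>{0..?T}. (\<integral>\<^sup>+x\<in>?S. norm (W (k + K) r x - u r (V (k + K) r x)) \<partial>lborel) \<partial>lborel) + (\<integral>\<^sup>+r. ?q k r * indicator {0..?T} r \<partial>lborel)"
        by (rule nn_integral_add) measurable
      also have "\<dots> \<le> ennreal (1 / Suc (k + K)) + (\<integral>\<^sup>+r. ?q k r * indicator {0..?T} r \<partial>lborel)"
        using approximants_approx_flow[OF a, of K "k + K" "1 / Suc (k + K)"] unfolding approx_flow_def
        by (intro add_right_mono) auto
      finally show ?thesis .
    qed
    have "(\<lambda>k. 1 / real (Suc (k + K))) \<longlonglongrightarrow> 0"
      using LIMSEQ_ignore_initial_segment[OF LIMSEQ_Suc[OF lim_1_over_n], of K] by simp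
    then have lim: "(\<lambda>k. ennreal (1 / Suc (k + K)) + (\<integral>\<^sup>+r. ?q k r * indicator {0..?T} r \<partial>lborel)) \<longlonglongrightarrow> ennreal 0 + integral\<^sup>N lborel (\<lambda>r::real. 0)"
      by (intro tendsto_add tendsto_ennrealI q)
    have G0: "(\<lambda>k. \<integral>\<^sup>+x\<in>?S. G k x \<partial>lborel) \<longlonglongrightarrow> 0"
      by (rule tendsto_sandwich[OF _ _ tendsto_const]) (use GS lim in \<open>auto intro: always_eventually\<close>)
    \<comment> \<open>Convergence of \<open>G\<close> in the mean gives no pointwise limit, but by
      Fatou the lower limit vanishes almost everywhere. This suffices: for such \<open>x\<close>
      arbitrarily large \<open>k\<close> with small \<open>G k x\<close> exist, and \<open>V\<close>
      itself converges along the full sequence.\<close>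
    have "(\<integral>\<^sup>+x. liminf (\<lambda>k. G k x * indicator ?S x) \<partial>lborel) \<le> liminf (\<lambda>k. \<integral>\<^sup>+x\<in>?S. G k x \<partial>lborel)"
      by (rule nn_integral_liminf) measurable
    also have "\<dots> = 0" using lim_imp_Liminf[OF sequentially_bot G0] .
    finally have "(\<integral>\<^sup>+x. liminf (\<lambda>k. G k x * indicator ?S x) \<partial>lborel) = 0" by simp
    then have "AE x in lborel. liminf (\<lambda>k. G k x * indicator ?S x) = 0"
      by (subst (asm) nn_integral_0_iff_AE) auto
    then show ?thesis using conv
    proof eventually_elim
      case (elim x)
      show ?case
      proof (intro impI ballI)
        fix t assume x: "x \<in> ?S" and t: "t \<in> {0..?T}"
        have small: "\<exists>k\<ge>k1. G k x < ennreal e" if e: "0 < e" for e k1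
        proof (rule ccontr)
          assume "\<not> ?thesis"
          then have "eventually (\<lambda>k. ennreal e \<le> G k x * indicator ?S x) sequentially"
            using x by (auto simp: eventually_sequentially not_less)
          then have "ennreal e \<le> liminf (\<lambda>k. G k x * indicator ?S x)" by (rule Liminf_bounded)
          then show False using elim(1) e by simp
        qed
        have diff: "set_integrable lborel {0..?T} (\<lambda>r. W (k + K) r x - u r (Y r x))" if "G k x < ennreal e" for k e
          unfolding set_integrable_def
        proof (rule integrableI_bounded)
          have "(\<integral>\<^sup>+r. ennreal (norm (indicator {0..?T} r *\<^sub>R (W (k + K) r x - u r (Y r x)))) \<partial>lborel) = G k x"
            unfolding G_def by (intro nn_integral_cong) (auto simp: indicator_def)
          then show "(\<integral>\<^sup>+r. ennreal (norm (indicator {0..?T} r *\<^sub>R (W (k + K) r x - u r (Y r x)))) \<partial>lborel) < \<infinity>"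
            using that by (simp add: less_trans[OF _ ennreal_less_top])
        qed measurable
        obtain k where k: "G k x < ennreal 1" using small[of 1 0] by auto
        have iT: "set_integrable lborel {0..?T} (\<lambda>r. u r (Y r x))"
          using set_integral_diff(1)[OF W(1)[where n="k + K" and x=x] diff[OF k]] by simp
        then have it: "set_integrable lborel {0..t} (\<lambda>r. u r (Y r x))"
          by (rule set_integrable_subset) (use t in auto)
        obtain k0 where k0: "\<And>k t. k0 \<le> k \<Longrightarrow> t \<in> {0..real k} \<Longrightarrow> norm (V k t x - Y t x) \<le> 2 * (1/2)^k"
          using elim(2) by blast
        have "norm (Y t x - (x + (LBINT r:{0..t}. u r (Y r x)))) \<le> e" if e: "0 < e" for e
        proof -
          obtain k1 where k1: "(1/2::real)^k1 < e/4" using real_arch_pow_inv[of "e/4" "1/2"] e by auto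
          obtain k where k: "max k0 k1 \<le> k" and Gk: "G k x < ennreal (e/2)" using small[of "e/2" "max k0 k1"] e by auto
          have "(1/2::real)^(k + K) \<le> (1/2)^k1" using k by (intro power_decreasing) auto
          then have p: "2 * (1/2::real)^(k + K) \<le> e/2" using k1 by linarith
          have 1: "norm (V (k + K) t x - Y t x) \<le> e/2"
            using k0[of "k + K" t] k t p by auto
          have "V (k + K) t x - (x + (LBINT r:{0..t}. u r (Y r x))) = (LBINT r:{0..t}. W (k + K) r x - u r (Y r x))"
            unfolding W(2) using set_integral_diff(2)[OF W(1) it] by simp
          also have "ennreal (norm \<dots>) \<le> (\<integral>\<^sup>+r. ennreal (norm (indicator {0..t} r *\<^sub>R (W (k + K) r x - u r (Y r x)))) \<partial>lborel)"
            unfolding set_lebesgue_integral_def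
            by (rule integral_norm_bound_ennreal) (use set_integral_diff(1)[OF W(1) it] in \<open>simp add: set_integrable_def\<close>)
          also have "\<dots> \<le> G k x" unfolding G_def using t by (intro nn_integral_mono) (auto simp: indicator_def)
          also have "\<dots> \<le> ennreal (e/2)" using Gk by simp
          finally have 2: "norm (V (k + K) t x - (x + (LBINT r:{0..t}. u r (Y r x)))) \<le> e/2" using e by simp
          have "norm (Y t x - (x + (LBINT r:{0..t}. u r (Y r x)))) \<le> norm (V (k + K) t x - (x + (LBINT r:{0..t}. u r (Y r x)))) + norm (V (k + K) t x - Y t x)"
          proof -
            have "norm (a - b) \<le> norm (c - b) + norm (c - a)" for a b c :: "real^3"
              using norm_triangle_ineq4[of "c - b" "c - a"] by simp
            then show ?thesis .
          qed
          also have "\<dots> \<le> e/2 + e/2" by (intro add_mono 1 2)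
          finally show ?thesis by simp
        qed
        then have "norm (Y t x - (x + (LBINT r:{0..t}. u r (Y r x)))) \<le> 0"
          by (rule field_le_epsilon[where y=0, simplified])
        then have "Y t x = x + (LBINT r:{0..t}. u r (Y r x))" by simp
        with it show "set_integrable lborel {0..t} (\<lambda>r. u r (Y r x)) \<and> Y t x = x + (LBINT r:{0..t}. u r (Y r x))" ..
      qed
    qed
  qed
  have "AE x in lborel. \<forall>K::nat. x \<in> cball 0 (real K) \<longrightarrow> (\<forall>t\<in>{0..real K}. set_integrable lborel {0..t} (\<lambda>r. u r (Y r x)) \<and> Y t x = x + (LBINT r:{0..t}. u r (Y r x)))"
    unfolding AE_all_countable using ode by blast
  then have "AE x in lborel. \<forall>t\<ge>0. set_integrable lborel {0..t} (\<lambda>r. u r (Y r x)) \<and> Y t x = x + (LBINT r:{0..t}. u r (Y r x))"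
  proof eventually_elim
    case (elim x)
    show ?case
    proof (intro allI impI)
      fix t :: real assume t: "0 \<le> t"
      obtain K :: nat where "max (norm x) t \<le> real K" using real_arch_simple by blast
      then have "x \<in> cball 0 (real K)" "t \<in> {0..real K}" using t by auto
      then show "set_integrable lborel {0..t} (\<lambda>r. u r (Y r x)) \<and> Y t x = x + (LBINT r:{0..t}. u r (Y r x))"
        using elim by blast
    qed
  qed
  then show ?thesis unfolding flow_def using Yj Yc by blast
qed

end

section \<open>The flow for all times\<close>

text \<open>Preimages of null sets are null. This is what gives sense to compositions of flows that
  are determined only almost everywhere.\<close>

lemma compr_AE:
  assumes f: "compr UNIV L f" and P: "AE y in lborel. P y"
  shows "AE x in lborel. P (f x)"
proof -
  obtain N where N: "N \<in> null_sets lborel" "{y. \<not> P y} \<subseteq> N" using P by (auto simp: eventually_ae_filter)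
  have fm: "f \<in> borel_measurable borel" using comprD[OF f] by simp
  have "emeasure lborel {x\<in>UNIV. f x \<in> N} \<le> ennreal L * emeasure lborel N"
    by (rule compr_emeasure[OF f]) (use N in auto)
  then have "emeasure lborel {x. f x \<in> N} = 0" using N by (simp add: null_setsD1)
  moreover have "{x. f x \<in> N} \<in> sets lborel"
    using measurable_sets[OF fm, of N] N by (auto simp: vimage_def)
  ultimately have "{x. f x \<in> N} \<in> null_sets lborel" by auto
  then show ?thesis by (rule AE_I') (use N in auto)
qed

lemma compr_subset':
  assumes c: "compr S L Y" and S: "S' \<subseteq> S"
  shows "compr S' L Y"
  unfolding compr_def
proof (intro conjI ballI)
  show "Y \<in> borel_measurable borel" "0 \<le> L" using comprD[OF c] by auto
  fix f :: "'a \<Rightarrow> ennreal" assume f: "f \<in> borel_measurable borel"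
  have "(\<integral>\<^sup>+x\<in>S'. f (Y x) \<partial>lborel) \<le> (\<integral>\<^sup>+x\<in>S. f (Y x) \<partial>lborel)"
    using S by (intro nn_integral_mono) (auto simp: indicator_def)
  also have "\<dots> \<le> ennreal L * (\<integral>\<^sup>+x. f x \<partial>lborel)" by (rule comprD(3)[OF c f])
  finally show "(\<integral>\<^sup>+x\<in>S'. f (Y x) \<partial>lborel) \<le> ennreal L * (\<integral>\<^sup>+x. f x \<partial>lborel)" .
qed

lemma set_integral_eq_on:
  fixes F G :: "real \<Rightarrow> 'b::euclidean_space"
  assumes "\<And>q. q \<in> A \<Longrightarrow> F q = G q"
  shows "set_integrable lborel A F = set_integrable lborel A G" "(LBINT q:A. F q) = (LBINT q:A. G q)"
proof -
  have "(\<lambda>q. indicator A q *\<^sub>R F q) = (\<lambda>q. indicator A q *\<^sub>R G q)"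
    using assms by (auto simp: indicator_def fun_eq_iff)
  then show "set_integrable lborel A F = set_integrable lborel A G" "(LBINT q:A. F q) = (LBINT q:A. G q)"
    by (simp_all add: set_integrable_def set_lebesgue_integral_def)
qed

definition seg :: "real \<Rightarrow> real \<Rightarrow> real set" where
  "seg s t = {min s t..max s t}"

text \<open>The substitution r = t + \<sigma> q preserves Lebesgue measure for both signs, so
  forward and backward flows share one argument.\<close>

lemma affine_segment:
  fixes f :: "real \<Rightarrow> 'b::euclidean_space" and g :: "real \<Rightarrow> ennreal"
  assumes \<sigma>: "\<sigma> = 1 \<or> \<sigma> = -1" and T: "0 \<le> T"
  shows "set_integrable lborel {0..T} (\<lambda>q. f (t + \<sigma> * q)) \<longleftrightarrow> set_integrable lborel (seg t (t + \<sigma> * T)) f"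
    and "(LBINT q:{0..T}. f (t + \<sigma> * q)) = (LBINT q:seg t (t + \<sigma> * T). f q)"
    and "g \<in> borel_measurable borel \<Longrightarrow> (\<integral>\<^sup>+q\<in>{0..T}. g (t + \<sigma> * q) \<partial>lborel) = (\<integral>\<^sup>+q\<in>seg t (t + \<sigma> * T). g q \<partial>lborel)"
proof -
  have i: "indicator {0..T} q = (indicator (seg t (t + \<sigma> * T)) (t + \<sigma> * q) :: 'c::zero_neq_one)" for q
    using \<sigma> T by (auto simp: seg_def indicator_def min_def max_def)
  have \<sigma>0: "\<sigma> \<noteq> 0" "\<bar>\<sigma>\<bar> = 1" using \<sigma> by auto
  show "set_integrable lborel {0..T} (\<lambda>q. f (t + \<sigma> * q)) \<longleftrightarrow> set_integrable lborel (seg t (t + \<sigma> * T)) f"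
    unfolding set_integrable_def i
    using lborel_integrable_real_affine_iff[OF \<sigma>0(1), of "\<lambda>q. indicator (seg t (t + \<sigma> * T)) q *\<^sub>R f q" t] .
  show "(LBINT q:{0..T}. f (t + \<sigma> * q)) = (LBINT q:seg t (t + \<sigma> * T). f q)"
    unfolding set_lebesgue_integral_def i
    using lborel_integral_real_affine[OF \<sigma>0(1), of "\<lambda>q. indicator (seg t (t + \<sigma> * T)) q *\<^sub>R f q" t] \<sigma>0(2) by simp
  assume [measurable]: "g \<in> borel_measurable borel"
  have [measurable]: "seg t (t + \<sigma> * T) \<in> sets borel" by (simp add: seg_def)
  show "(\<integral>\<^sup>+q\<in>{0..T}. g (t + \<sigma> * q) \<partial>lborel) = (\<integral>\<^sup>+q\<in>seg t (t + \<sigma> * T). g q \<partial>lborel)"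
    unfolding i
    using nn_integral_real_affine[OF _ \<sigma>0(1), of "\<lambda>q. g q * indicator (seg t (t + \<sigma> * T)) q" t] \<sigma>0(2) by simp
qed

lemma W11_scale_sign:
  assumes \<sigma>: "\<sigma> = 1 \<or> \<sigma> = -1" and w: "W11 f g"
  shows "W11 (\<lambda>x. \<sigma> * f x) (\<lambda>x. \<sigma> *\<^sub>R g x)"
  unfolding W11_def
proof (intro conjI allI impI)
  show "integrable lborel (\<lambda>x. \<sigma> * f x)" "integrable lborel (\<lambda>x. \<sigma> *\<^sub>R g x)" using w by (auto simp: W11_def)
  fix \<eta> :: real assume "0 < \<eta>"
  obtain \<phi> \<psi> where h: "has_grad \<phi> \<psi>" "compact_supp \<phi>" "compact_supp \<psi>"
    "(\<integral>\<^sup>+x. \<bar>f x - \<phi> x\<bar> \<partial>lborel) \<le> ennreal \<eta>" "(\<integral>\<^sup>+x. norm (g x - \<psi> x) \<partial>lborel) \<le> ennreal \<eta>"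
    by (rule W11_approx[OF w \<open>0 < \<eta>\<close>])
  have n: "\<bar>\<sigma> * a - \<sigma> * b\<bar> = \<bar>a - b\<bar>" "norm (\<sigma> *\<^sub>R c - \<sigma> *\<^sub>R d) = norm (c - d)" for a b :: real and c d :: 'a
    using \<sigma> by (auto simp: norm_minus_commute)
  show "\<exists>\<phi> \<psi>. has_grad \<phi> \<psi> \<and> compact_supp \<phi> \<and> compact_supp \<psi> \<and> (\<integral>\<^sup>+x. \<bar>\<sigma> * f x - \<phi> x\<bar> \<partial>lborel) \<le> ennreal \<eta>
     \<and> (\<integral>\<^sup>+x. norm (\<sigma> *\<^sub>R g x - \<psi> x) \<partial>lborel) \<le> ennreal \<eta>"
  proof (intro exI conjI)
    show "has_grad (\<lambda>x. \<sigma> * \<phi> x) (\<lambda>x. \<sigma> *\<^sub>R \<psi> x)"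
      using h(1) unfolding has_grad_def by (auto intro!: continuous_intros derivative_eq_intros)
    show "compact_supp (\<lambda>x. \<sigma> * \<phi> x)" "compact_supp (\<lambda>x. \<sigma> *\<^sub>R \<psi> x)"
      using h(2,3) unfolding compact_supp_def by (metis mult_zero_right, metis scaleR_zero_right)
  qed (use h(4,5) n in simp_all)
qed

lemma slice_scale_sign:
  assumes \<sigma>: "\<sigma> = 1 \<or> \<sigma> = -1" and s: "slice f a d"
  shows "slice (\<lambda>x. \<sigma> *\<^sub>R f x) a d"
proof -
  obtain g where g: "\<And>e. e \<in> Basis \<Longrightarrow> W11 (\<lambda>x. f x \<bullet> e) (g e)" "\<And>e. e \<in> Basis \<Longrightarrow> (\<integral>\<^sup>+x. norm (g e x) \<partial>lborel) \<le> ennreal a"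
    "AE x in lborel. \<bar>\<Sum>e\<in>Basis. g e x \<bullet> e\<bar> \<le> d"
    using s by (auto simp: slice_def)
  have \<sigma>1: "\<bar>\<sigma>\<bar> = 1" using \<sigma> by auto
  show ?thesis
    unfolding slice_def
  proof (intro exI[of _ "\<lambda>e x. \<sigma> *\<^sub>R g e x"] conjI ballI)
    fix e :: 'a assume e: "e \<in> Basis"
    show "W11 (\<lambda>x. \<sigma> *\<^sub>R f x \<bullet> e) (\<lambda>x. \<sigma> *\<^sub>R g e x)"
      using W11_scale_sign[OF \<sigma> g(1)[OF e]] by simp
    show "(\<integral>\<^sup>+x. norm (\<sigma> *\<^sub>R g e x) \<partial>lborel) \<le> ennreal a" using g(2)[OF e] \<sigma>1 by simp
  next
    show "AE x in lborel. \<bar>\<Sum>e\<in>Basis. \<sigma> *\<^sub>R g e x \<bullet> e\<bar> \<le> d"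
      using g(3) by eventually_elim (simp add: sum_distrib_left[symmetric] abs_mult \<sigma>1)
  qed
qed

section \<open>Flows from an arbitrary time in both directions\<close>

locale sobolev_field_all_times =
  fixes u :: "real \<Rightarrow> real^3 \<Rightarrow> real^3" and A D :: "real \<Rightarrow> real"
  assumes u_jmeas: "jmeas u"
    and A_measurable[measurable]: "A \<in> borel_measurable borel" and D_measurable[measurable]: "D \<in> borel_measurable borel"
    and A_nonneg: "0 \<le> A r" and D_nonneg: "0 \<le> D r"
    and u_int: "(\<integral>\<^sup>+r\<in>{-T..T}. \<integral>\<^sup>+x. norm (u r x) \<partial>lborel \<partial>lborel) < \<infinity>"
    and A_int: "(\<integral>\<^sup>+r\<in>{-T..T}. A r \<partial>lborel) < \<infinity>"
    and D_int: "(\<integral>\<^sup>+r\<in>{-T..T}. D r \<partial>lborel) < \<infinity>"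
    and slice: "slice (u r) (A r) (D r)"
begin

lemmas u_meas[measurable (raw)] = jmeasD[OF u_jmeas]

lemma seg_finite:
  assumes "\<And>T. (\<integral>\<^sup>+r\<in>{-T..T}. g r \<partial>lborel) < (\<infinity>::ennreal)"
  shows "(\<integral>\<^sup>+r\<in>seg s t. g r \<partial>lborel) < \<infinity>"
proof -
  let ?T = "max \<bar>s\<bar> \<bar>t\<bar>"
  have "(\<integral>\<^sup>+r\<in>seg s t. g r \<partial>lborel) \<le> (\<integral>\<^sup>+r\<in>{-?T..?T}. g r \<partial>lborel)"
    by (intro nn_integral_mono) (auto simp: indicator_def seg_def)
  then show ?thesis using assms[of ?T] by (rule le_less_trans)
qed

lemma shifted_field:
  assumes \<sigma>: "\<sigma> = 1 \<or> \<sigma> = -1"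
  shows "sobolev_field_R3 (\<lambda>r x. \<sigma> *\<^sub>R u (t + \<sigma> * r) x) (\<lambda>r. A (t + \<sigma> * r)) (\<lambda>r. D (t + \<sigma> * r))"
proof
  show "jmeas (\<lambda>r x. \<sigma> *\<^sub>R u (t + \<sigma> * r) x)" unfolding jmeas_def by measurable
  show "(\<lambda>r. A (t + \<sigma> * r)) \<in> borel_measurable borel" "(\<lambda>r. D (t + \<sigma> * r)) \<in> borel_measurable borel" by measurable
  show "0 \<le> A (t + \<sigma> * r)" "0 \<le> D (t + \<sigma> * r)" for r by (auto simp: A_nonneg D_nonneg)
  show "slice (\<lambda>x. \<sigma> *\<^sub>R u (t + \<sigma> * r) x) (A (t + \<sigma> * r)) (D (t + \<sigma> * r))" for r by (rule slice_scale_sign[OF \<sigma> slice])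
  have n: "norm (\<sigma> *\<^sub>R y) = norm y" for y :: "real^3" using \<sigma> by auto
  have sh: "(\<integral>\<^sup>+r\<in>{0..T}. g (t + \<sigma> * r) \<partial>lborel) < \<infinity>" if "g \<in> borel_measurable borel" "\<And>T. (\<integral>\<^sup>+r\<in>{-T..T}. g r \<partial>lborel) < (\<infinity>::ennreal)" for g T
  proof (cases "0 \<le> T")
    case True
    show ?thesis unfolding affine_segment(3)[OF \<sigma> True that(1)] by (rule seg_finite[OF that(2)])
  qed simp
  show "(\<integral>\<^sup>+r\<in>{0..T}. \<integral>\<^sup>+x. norm (\<sigma> *\<^sub>R u (t + \<sigma> * r) x) \<partial>lborel \<partial>lborel) < \<infinity>" for T
    unfolding n by (rule sh[of "\<lambda>r. \<integral>\<^sup>+x. norm (u r x) \<partial>lborel"]) (use u_int in measurable)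
  show "(\<integral>\<^sup>+r\<in>{0..T}. A (t + \<sigma> * r) \<partial>lborel) < \<infinity>" "(\<integral>\<^sup>+r\<in>{0..T}. D (t + \<sigma> * r) \<partial>lborel) < \<infinity>" for T
    using sh[of "\<lambda>r. ennreal (A r)"] sh[of "\<lambda>r. ennreal (D r)"] A_int D_int by auto
qed

text \<open>The flow from time \<open>t\<close> on, forwards for \<open>\<sigma> = 1\<close> and backwards for \<open>\<sigma> = -1\<close>.\<close>

definition half_flow :: "real \<Rightarrow> real \<Rightarrow> (real \<Rightarrow> real^3 \<Rightarrow> real^3) \<Rightarrow> bool" where
  "half_flow t \<sigma> Y \<longleftrightarrow> jmeas Y \<and> (\<forall>r\<ge>0. compr UNIV (exp (LBINT q:{0..r}. D (t + \<sigma> * q))) (Y r)) \<and>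
     (AE x in lborel. \<forall>r\<ge>0. set_integrable lborel {0..r} (\<lambda>q. \<sigma> *\<^sub>R u (t + \<sigma> * q) (Y q x)) \<and>
        Y r x = x + (LBINT q:{0..r}. \<sigma> *\<^sub>R u (t + \<sigma> * q) (Y q x)))"

lemma half_flow_exists:
  assumes \<sigma>: "\<sigma> = 1 \<or> \<sigma> = -1"
  shows "\<exists>Y. half_flow t \<sigma> Y"
proof -
  interpret F: sobolev_field_R3 "\<lambda>r x. \<sigma> *\<^sub>R u (t + \<sigma> * r) x" "\<lambda>r. A (t + \<sigma> * r)" "\<lambda>r. D (t + \<sigma> * r)"
    by (rule shifted_field[OF \<sigma>])
  show ?thesis using F.flow_exists unfolding half_flow_def F.flow_def .
qed

text \<open>The flow is chosen separately for each starting time \<open>t\<close>, so nothing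
  relates different \<open>t\<close> at this stage; later only uniqueness does. Accordingly
  measurability is claimed in \<open>(s, x)\<close> for fixed \<open>t\<close>.\<close>

definition half :: "real \<Rightarrow> real \<Rightarrow> real \<Rightarrow> real^3 \<Rightarrow> real^3" where
  "half t \<sigma> = (SOME Y. half_flow t \<sigma> Y)"

lemma half: "\<sigma> = 1 \<or> \<sigma> = -1 \<Longrightarrow> half_flow t \<sigma> (half t \<sigma>)"
  unfolding half_def by (rule someI_ex[OF half_flow_exists])

definition X :: "real \<Rightarrow> real \<Rightarrow> real^3 \<Rightarrow> real^3" where
  "X s t x = (if t \<le> s then half t 1 (s - t) x else half t (-1) (t - s) x)"

lemma X_jmeas: "jmeas (\<lambda>s. X s t)"
proof -
  have j: "jmeas (half t 1)" "jmeas (half t (-1))" using half[of 1 t] half[of "-1" t] by (auto simp: half_flow_def)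
  note [measurable (raw)] = jmeasD[OF j(1)] jmeasD[OF j(2)]
  show ?thesis unfolding jmeas_def X_def by measurable
qed

lemma X_compr: "compr UNIV (exp (LBINT r:seg t s. D r)) (X s t)"
proof (cases "t \<le> s")
  case True
  have "compr UNIV (exp (LBINT q:{0..s - t}. D (t + 1 * q))) (half t 1 (s - t))"
    using half[of 1 t] True unfolding half_flow_def by auto
  moreover have "(LBINT q:{0..s - t}. D (t + 1 * q)) = (LBINT r:seg t s. D r)"
    using True by (subst affine_segment(2)) auto
  moreover have "X s t = half t 1 (s - t)" using True by (auto simp: X_def)
  ultimately show ?thesis by simp
next
  case False
  have "compr UNIV (exp (LBINT q:{0..t - s}. D (t + (-1) * q))) (half t (-1) (t - s))"
    using half[of "-1" t] False unfolding half_flow_def by auto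
  moreover have "(LBINT q:{0..t - s}. D (t + (-1) * q)) = (LBINT r:seg t s. D r)"
    using False by (subst affine_segment(2)) auto
  moreover have "X s t = half t (-1) (t - s)" using False by (auto simp: X_def)
  ultimately show ?thesis by simp
qed

text \<open>Written with increments, so that no starting time is distinguished and one curve can be
  compared with others from any time on.\<close>

definition integral_curve :: "(real \<Rightarrow> real^3) \<Rightarrow> bool" where
  "integral_curve y \<longleftrightarrow> (\<forall>a b. set_integrable lborel {a..b} (\<lambda>r. u r (y r))) \<and>
     (\<forall>a b. a \<le> b \<longrightarrow> y b - y a = (LBINT r:{a..b}. u r (y r)))"

lemma X_integral_curve: "AE x in lborel. integral_curve (\<lambda>s. X s t x) \<and> X t t x = x"
proof -
  have h: "AE x in lborel. \<forall>r\<ge>0. set_integrable lborel {0..r} (\<lambda>q. \<sigma> *\<^sub>R u (t + \<sigma> * q) (half t \<sigma> q x)) \<and>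
        half t \<sigma> r x = x + (LBINT q:{0..r}. \<sigma> *\<^sub>R u (t + \<sigma> * q) (half t \<sigma> q x))" if "\<sigma> = 1 \<or> \<sigma> = -1" for \<sigma>
    using half[OF that, of t] unfolding half_flow_def by blast
  have one: "1 = (1::real) \<or> 1 = (-1::real)" "-1 = (1::real) \<or> -1 = (-1::real)" by auto
  show ?thesis
    using h[OF one(1)] h[OF one(2)]
  proof eventually_elim
    case (elim x)
    define y where "y s = X s t x" for s
    let ?f = "\<lambda>r. u r (y r)"
    have h0: "half t 1 0 x = x" "half t (-1) 0 x = x"
      using elim(1)[rule_format, of 0] elim(2)[rule_format, of 0] LBINT_singleton[of 0 "\<lambda>q. 1 *\<^sub>R u (t + 1 * q) (half t 1 q x)"]
        LBINT_singleton[of 0 "\<lambda>q. (-1) *\<^sub>R u (t + (-1) * q) (half t (-1) q x)"] by (metis add.right_neutral order_refl)+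
    have yt: "y t = x" by (simp add: y_def X_def h0)
    have fwd: "set_integrable lborel {t..b} ?f \<and> y b - x = (LBINT r:{t..b}. ?f r)" if "t \<le> b" for b
    proof -
      have e: "1 *\<^sub>R u (t + 1 * q) (half t 1 q x) = ?f (t + 1 * q)" if "q \<in> {0..b - t}" for q
        using that by (simp add: y_def X_def)
      have h: "set_integrable lborel {0..b - t} (\<lambda>q. 1 *\<^sub>R u (t + 1 * q) (half t 1 q x))"
        "half t 1 (b - t) x = x + (LBINT q:{0..b - t}. 1 *\<^sub>R u (t + 1 * q) (half t 1 q x))"
        using elim(1)[rule_format, of "b - t"] that by auto
      have "set_integrable lborel {0..b - t} (\<lambda>q. ?f (t + 1 * q))"
        by (rule set_integral_eq_on(1)[THEN iffD1, OF _ h(1)]) (rule e)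
      moreover have "half t 1 (b - t) x = x + (LBINT q:{0..b - t}. ?f (t + 1 * q))"
        unfolding h(2) by (intro arg_cong2[of _ _ _ _ "(+)"] refl set_integral_eq_on(2) e)
      moreover have "y b = half t 1 (b - t) x" using that by (simp add: y_def X_def)
      moreover have "seg t (t + 1 * (b - t)) = {t..b}" using that by (simp add: seg_def)
      ultimately show ?thesis using affine_segment(1,2)[OF one(1), of "b - t" ?f t] that by simp
    qed
    have bwd: "set_integrable lborel {a..t} ?f \<and> x - y a = (LBINT r:{a..t}. ?f r)" if "a \<le> t" for a
    proof -
      \<comment> \<open>At q = 0 the definition of \<open>X\<close> refers to the forward half; the
        two halves agree there because both start in \<open>x\<close>.\<close>
      have e: "(-1) *\<^sub>R u (t + (-1) * q) (half t (-1) q x) = (-1) *\<^sub>R ?f (t + (-1) * q)" if "q \<in> {0..t - a}" for q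
        using that h0 by (cases "q = 0") (auto simp: y_def X_def)
      have h: "set_integrable lborel {0..t - a} (\<lambda>q. (-1) *\<^sub>R u (t + (-1) * q) (half t (-1) q x))"
        "half t (-1) (t - a) x = x + (LBINT q:{0..t - a}. (-1) *\<^sub>R u (t + (-1) * q) (half t (-1) q x))"
        using elim(2)[rule_format, of "t - a"] that by auto
      have "set_integrable lborel {0..t - a} (\<lambda>q. (-1) *\<^sub>R ?f (t + (-1) * q))"
        by (rule set_integral_eq_on(1)[THEN iffD1, OF _ h(1)]) (rule e)
      then have "set_integrable lborel {0..t - a} (\<lambda>q. ?f (t + (-1) * q))"
        using set_integrable_scaleR_right[of "-1::real" lborel "{0..t - a}" "\<lambda>q. (-1) *\<^sub>R ?f (t + (-1) * q)"] by simp
      moreover have "half t (-1) (t - a) x = x - (LBINT q:{0..t - a}. ?f (t + (-1) * q))"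
      proof -
        have "half t (-1) (t - a) x = x + (LBINT q:{0..t - a}. (-1) *\<^sub>R ?f (t + (-1) * q))"
          unfolding h(2) by (intro arg_cong2[of _ _ _ _ "(+)"] refl set_integral_eq_on(2) e)
        also have "(LBINT q:{0..t - a}. (-1) *\<^sub>R ?f (t + (-1) * q)) = - (LBINT q:{0..t - a}. ?f (t + (-1) * q))"
          by (subst set_integral_scaleR_right) simp
        finally show ?thesis by simp
      qed
      moreover have "y a = half t (-1) (t - a) x" using that h0 by (cases "a = t") (auto simp: y_def X_def)
      moreover have "seg t (t + (-1) * (t - a)) = {a..t}" using that by (simp add: seg_def)
      ultimately show ?thesis using affine_segment(1,2)[OF one(2), of "t - a" ?f t] that by simp
    qed
    have int: "set_integrable lborel {a..b} ?f" for a b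
    proof (rule set_integrable_subset)
      show "set_integrable lborel ({min a t..t} \<union> {t..max b t}) ?f"
        using fwd[of "max b t"] bwd[of "min a t"] by (intro set_integrable_Un) auto
    qed auto
    have "y b - y a = (LBINT r:{a..b}. ?f r)" if ab: "a \<le> b" for a b
    proof -
      consider "t \<le> a" | "b \<le> t" | "a \<le> t" "t \<le> b" using ab by linarith
      then show ?thesis
      proof cases
        case 1
        then show ?thesis using fwd[of a] fwd[of b] LBINT_split[OF int[of t b], of a] ab by (simp add: algebra_simps)
      next
        case 2
        then show ?thesis using bwd[of a] bwd[of b] LBINT_split[OF int[of a t], of b] ab by (simp add: algebra_simps)
      next
        case 3
        then show ?thesis using bwd[of a] fwd[of b] LBINT_split[OF int[of a b], of t] by (simp add: algebra_simps)
      qed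
    qed
    then show ?case using int yt unfolding integral_curve_def y_def by blast
  qed
qed

section \<open>Uniqueness, group law and invariance of the domain\<close>

lemma integral_curve_half:
  assumes y: "integral_curve y" and \<sigma>: "\<sigma> = 1 \<or> \<sigma> = -1" and r: "0 \<le> r"
  shows "set_integrable lborel {0..r} (\<lambda>q. \<sigma> *\<^sub>R u (\<tau> + \<sigma> * q) (y (\<tau> + \<sigma> * q)))"
    "y (\<tau> + \<sigma> * r) = y \<tau> + (LBINT q:{0..r}. \<sigma> *\<^sub>R u (\<tau> + \<sigma> * q) (y (\<tau> + \<sigma> * q)))"
proof -
  let ?f = "\<lambda>r. u r (y r)"
  have i: "set_integrable lborel (seg \<tau> (\<tau> + \<sigma> * r)) ?f" using y unfolding seg_def integral_curve_def by blast
  have "set_integrable lborel {0..r} (\<lambda>q. ?f (\<tau> + \<sigma> * q))"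
    using affine_segment(1)[OF \<sigma> r, of ?f \<tau>] i by simp
  then show "set_integrable lborel {0..r} (\<lambda>q. \<sigma> *\<^sub>R u (\<tau> + \<sigma> * q) (y (\<tau> + \<sigma> * q)))" by (intro set_integrable_scaleR_right)
  have "(LBINT q:{0..r}. \<sigma> *\<^sub>R u (\<tau> + \<sigma> * q) (y (\<tau> + \<sigma> * q))) = \<sigma> *\<^sub>R (LBINT q:seg \<tau> (\<tau> + \<sigma> * r). ?f q)"
    using affine_segment(2)[OF \<sigma> r, of ?f \<tau>] by simp
  also have "\<dots> = y (\<tau> + \<sigma> * r) - y \<tau>"
  proof (cases "\<sigma> = 1")
    case True
    then have "seg \<tau> (\<tau> + \<sigma> * r) = {\<tau>..\<tau> + \<sigma> * r}" using r by (simp add: seg_def)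
    then show ?thesis using y True r unfolding integral_curve_def by simp
  next
    case False
    then have s: "\<sigma> = -1" using \<sigma> by simp
    then have "seg \<tau> (\<tau> + \<sigma> * r) = {\<tau> + \<sigma> * r..\<tau>}" using r by (simp add: seg_def)
    moreover have "y \<tau> - y (\<tau> + \<sigma> * r) = (LBINT q:{\<tau> + \<sigma> * r..\<tau>}. ?f q)" using y s r unfolding integral_curve_def by simp
    ultimately show ?thesis using s by (metis minus_diff_eq scaleR_minus1_left)
  qed
  finally show "y (\<tau> + \<sigma> * r) = y \<tau> + (LBINT q:{0..r}. \<sigma> *\<^sub>R u (\<tau> + \<sigma> * q) (y (\<tau> + \<sigma> * q)))" by simp
qed

text \<open>The time \<tau> of agreement need not be the time at which either family starts, which
  is what the group law uses. Uniqueness is applied to the shifted field in both directions for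
  starting points in a ball of radius \<open>K\<close> and times within \<open>K\<close> of \<tau>;
  countably many \<open>K\<close> exhaust everything. The set \<open>S\<close> allows a comparison
  on the complement of the domain only.\<close>

lemma integral_curves_unique:
  assumes S[measurable]: "S \<in> sets borel" and j: "jmeas Y1" "jmeas Y2"
    and c: "\<And>T. \<exists>L. \<forall>s\<in>{\<tau>-T..\<tau>+T}. compr S L (Y1 s) \<and> compr S L (Y2 s)"
    and y: "AE x in lborel. x \<in> S \<longrightarrow> integral_curve (\<lambda>s. Y1 s x) \<and> integral_curve (\<lambda>s. Y2 s x) \<and> Y1 \<tau> x = Y2 \<tau> x"
  shows "AE x in lborel. x \<in> S \<longrightarrow> (\<forall>s. Y1 s x = Y2 s x)"
proof -
  note [measurable (raw)] = jmeasD[OF j(1)] jmeasD[OF j(2)]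
  have half: "AE x in lborel. x \<in> S \<inter> cball 0 (real K) \<longrightarrow> (\<forall>r\<in>{0..real K}. Y1 (\<tau> + \<sigma> * r) x = Y2 (\<tau> + \<sigma> * r) x)"
    if \<sigma>: "\<sigma> = 1 \<or> \<sigma> = -1" for \<sigma> and K :: nat
  proof -
    interpret F: sobolev_field_R3 "\<lambda>r x. \<sigma> *\<^sub>R u (\<tau> + \<sigma> * r) x" "\<lambda>r. A (\<tau> + \<sigma> * r)" "\<lambda>r. D (\<tau> + \<sigma> * r)"
      by (rule shifted_field[OF \<sigma>])
    let ?S = "S \<inter> cball 0 (real K)"
    obtain L where L: "\<And>s. s \<in> {\<tau>-real K..\<tau>+real K} \<Longrightarrow> compr S L (Y1 s) \<and> compr S L (Y2 s)" using c by blast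
    have fl: "F.approx_flow ?S (real K) L 0 (\<lambda>r. Y (\<tau> + \<sigma> * r)) (\<lambda>r x. \<sigma> *\<^sub>R u (\<tau> + \<sigma> * r) (Y (\<tau> + \<sigma> * r) x))"
      if jY: "jmeas Y" and cY: "\<And>s. s \<in> {\<tau>-real K..\<tau>+real K} \<Longrightarrow> compr S L (Y s)" and yY: "AE x in lborel. x \<in> S \<longrightarrow> integral_curve (\<lambda>s. Y s x)" for Y
      unfolding F.approx_flow_def
    proof (intro conjI ballI)
      note [measurable (raw)] = jmeasD[OF jY]
      show "jmeas (\<lambda>r. Y (\<tau> + \<sigma> * r))" "jmeas (\<lambda>r x. \<sigma> *\<^sub>R u (\<tau> + \<sigma> * r) (Y (\<tau> + \<sigma> * r) x))"
        unfolding jmeas_def by measurable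
      fix r assume "r \<in> {0..real K}"
      then have "\<tau> + \<sigma> * r \<in> {\<tau>-real K..\<tau>+real K}" using \<sigma> by auto
      then show "compr ?S L (Y (\<tau> + \<sigma> * r))" by (rule compr_subset'[OF cY]) auto
    next
      show "AE x in lborel. x \<in> ?S \<longrightarrow> set_integrable lborel {0..real K} (\<lambda>r. \<sigma> *\<^sub>R u (\<tau> + \<sigma> * r) (Y (\<tau> + \<sigma> * r) x)) \<and>
        (\<forall>t\<in>{0..real K}. Y (\<tau> + \<sigma> * t) x = Y (\<tau> + \<sigma> * 0) x + (LBINT r:{0..t}. \<sigma> *\<^sub>R u (\<tau> + \<sigma> * r) (Y (\<tau> + \<sigma> * r) x)))"
        using yY
      proof eventually_elim
        case (elim x)
        show ?case
          using integral_curve_half[OF _ \<sigma>, of "\<lambda>s. Y s x" _ \<tau>] elim by auto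
      qed
    qed simp
    have fin: "emeasure lborel ?S < \<infinity>"
      using emeasure_mono[of ?S "cball 0 (real K)" lborel] emeasure_lborel_cball_finite[of "0::real^3" "real K"] by (auto intro: le_less_trans)
    show ?thesis
    proof (rule F.uniqueness_finite[OF _ fin])
      show "F.approx_flow ?S (real K) L 0 (\<lambda>r. Y1 (\<tau> + \<sigma> * r)) (\<lambda>r x. \<sigma> *\<^sub>R u (\<tau> + \<sigma> * r) (Y1 (\<tau> + \<sigma> * r) x))"
        by (rule fl[OF j(1)]) (use L y in \<open>auto elim: eventually_mono\<close>)
      show "F.approx_flow ?S (real K) L 0 (\<lambda>r. Y2 (\<tau> + \<sigma> * r)) (\<lambda>r x. \<sigma> *\<^sub>R u (\<tau> + \<sigma> * r) (Y2 (\<tau> + \<sigma> * r) x))"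
        by (rule fl[OF j(2)]) (use L y in \<open>auto elim: eventually_mono\<close>)
      show "AE x in lborel. x \<in> ?S \<longrightarrow> Y1 (\<tau> + \<sigma> * 0) x = Y2 (\<tau> + \<sigma> * 0) x"
        using y by eventually_elim auto
    qed auto
  qed
  have "AE x in lborel. \<forall>K::nat. x \<in> S \<inter> cball 0 (real K) \<longrightarrow> (\<forall>r\<in>{0..real K}. Y1 (\<tau> + 1 * r) x = Y2 (\<tau> + 1 * r) x)"
    "AE x in lborel. \<forall>K::nat. x \<in> S \<inter> cball 0 (real K) \<longrightarrow> (\<forall>r\<in>{0..real K}. Y1 (\<tau> + (-1) * r) x = Y2 (\<tau> + (-1) * r) x)"
    unfolding AE_all_countable using half[of 1] half[of "-1"] by blast+
  then show ?thesis
  proof eventually_elim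
    case (elim x)
    show ?case
    proof (intro impI allI)
      fix s assume x: "x \<in> S"
      obtain K :: nat where K: "max (norm x) \<bar>s - \<tau>\<bar> \<le> real K" using real_arch_simple by blast
      show "Y1 s x = Y2 s x"
      proof (cases "\<tau> \<le> s")
        case True
        then show ?thesis using elim(1)[rule_format, of K "s - \<tau>"] x K by auto
      next
        case False
        then show ?thesis using elim(2)[rule_format, of K "\<tau> - s"] x K by auto
      qed
    qed
  qed
qed

lemma D_integrable: "set_integrable lborel (seg s t) D"
proof -
  have "set_integrable lborel {0..\<bar>t - s\<bar>} (\<lambda>q. D (min s t + 1 * q))"
    using affine_segment(3)[of 1 "\<bar>t - s\<bar>" "\<lambda>r. ennreal (D r)" "min s t"] seg_finite[of "\<lambda>r. ennreal (D r)", OF D_int]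
    by (intro set_integrable_nonneg) (auto simp: D_nonneg)
  then have "set_integrable lborel (seg (min s t) (min s t + 1 * \<bar>t - s\<bar>)) D"
    using affine_segment(1)[of 1 "\<bar>t - s\<bar>" D "min s t"] by simp
  moreover have "seg (min s t) (min s t + 1 * \<bar>t - s\<bar>) = seg s t" by (auto simp: seg_def)
  ultimately show ?thesis by simp
qed

lemma X_compr_bounded: "\<exists>L. \<forall>s\<in>{a..b}. compr UNIV L (X s t)"
proof (intro exI ballI)
  fix s assume s: "s \<in> {a..b}"
  let ?M = "{min a t..max b t}"
  have "seg (min a t) (max b t) = ?M" using s by (auto simp: seg_def)
  then have i: "set_integrable lborel ?M D" using D_integrable[of "min a t" "max b t"] by simp
  have "(LBINT r:seg t s. D r) \<le> (LBINT r:?M. D r)"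
    unfolding set_lebesgue_integral_def
  proof (rule integral_mono)
    show "integrable lborel (\<lambda>r. indicator (seg t s) r *\<^sub>R D r)" using D_integrable by (simp add: set_integrable_def)
    show "integrable lborel (\<lambda>r. indicator ?M r *\<^sub>R D r)" using i by (simp add: set_integrable_def)
    show "indicator (seg t s) r *\<^sub>R D r \<le> indicator ?M r *\<^sub>R D r" for r
      using s D_nonneg[of r] by (auto simp: indicator_def seg_def)
  qed
  then show "compr UNIV (exp (LBINT r:?M. D r)) (X s t)" by (intro compr_mono[OF X_compr]) simp
qed

text \<open>As functions of \<open>s\<close> both sides are integral curves, and they agree at s =
  \<tau>. The composed family has bounded compression because the factors multiply, and
  \<open>compr_AE\<close> ensures that almost every \<open>x\<close> is carried to a point from
  which the second flow is an integral curve.\<close>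

theorem X_group: "AE x in lborel. \<forall>s. X s t x = X s \<tau> (X \<tau> t x)"
proof -
  have "AE x in lborel. x \<in> UNIV \<longrightarrow> (\<forall>s. X s t x = X s \<tau> (X \<tau> t x))"
  proof (rule integral_curves_unique[where \<tau>=\<tau>])
    note [measurable (raw)] = jmeasD[OF X_jmeas]
    show "jmeas (\<lambda>s. X s t)" by (rule X_jmeas)
    show "jmeas (\<lambda>s x. X s \<tau> (X \<tau> t x))" unfolding jmeas_def by measurable
    fix T
    obtain L1 L2 L3 where L: "\<And>s. s \<in> {\<tau>-T..\<tau>+T} \<Longrightarrow> compr UNIV L1 (X s t)" "\<And>s. s \<in> {\<tau>-T..\<tau>+T} \<Longrightarrow> compr UNIV L2 (X s \<tau>)" "compr UNIV L3 (X \<tau> t)"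
      using X_compr_bounded[of "\<tau>-T" "\<tau>+T" t] X_compr_bounded[of "\<tau>-T" "\<tau>+T" \<tau>] X_compr[of t \<tau>] by blast
    show "\<exists>L. \<forall>s\<in>{\<tau>-T..\<tau>+T}. compr UNIV L (X s t) \<and> compr UNIV L (\<lambda>x. X s \<tau> (X \<tau> t x))"
    proof (intro exI ballI conjI)
      fix s assume s: "s \<in> {\<tau>-T..\<tau>+T}"
      show "compr UNIV (max L1 (L2 * L3)) (X s t)" by (rule compr_mono[OF L(1)[OF s]]) simp
      show "compr UNIV (max L1 (L2 * L3)) (\<lambda>x. X s \<tau> (X \<tau> t x))"
        by (rule compr_mono[OF compr_compose[OF L(2)[OF s] L(3)]]) simp
    qed
  next
    have "AE x in lborel. integral_curve (\<lambda>s. X s \<tau> (X \<tau> t x)) \<and> X \<tau> \<tau> (X \<tau> t x) = X \<tau> t x"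
      by (rule compr_AE[OF X_compr X_integral_curve])
    then show "AE x in lborel. x \<in> UNIV \<longrightarrow> integral_curve (\<lambda>s. X s t x) \<and> integral_curve (\<lambda>s. X s \<tau> (X \<tau> t x)) \<and> X \<tau> t x = X \<tau> \<tau> (X \<tau> t x)"
      using X_integral_curve[of t] by eventually_elim simp
  qed simp
  then show ?thesis by simp
qed

lemma X_inverse: "AE x in lborel. X t s (X s t x) = x"
  using X_group[of t s] X_integral_curve[of t] by eventually_elim metis

lemma X_fixed_outside:
  assumes \<Omega>[measurable]: "\<Omega> \<in> sets borel" and out: "\<And>r x. x \<notin> \<Omega> \<Longrightarrow> u r x = 0"
  shows "AE x in lborel. x \<notin> \<Omega> \<longrightarrow> (\<forall>s. X s t x = x)"
proof -
  have "AE x in lborel. x \<in> - \<Omega> \<longrightarrow> (\<forall>s. X s t x = x)"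
  proof (rule integral_curves_unique[where \<tau>=t])
    show "jmeas (\<lambda>s. X s t)" by (rule X_jmeas)
    show "jmeas (\<lambda>s x. x :: real^3)" unfolding jmeas_def by measurable
    fix T
    obtain L where L: "\<And>s. s \<in> {t-T..t+T} \<Longrightarrow> compr UNIV L (X s t)" using X_compr_bounded[of "t-T" "t+T" t] by blast
    show "\<exists>L. \<forall>s\<in>{t-T..t+T}. compr (- \<Omega>) L (X s t) \<and> compr (- \<Omega>) L (\<lambda>x. x)"
    proof (intro exI ballI conjI)
      fix s assume s: "s \<in> {t-T..t+T}"
      show "compr (- \<Omega>) (max L 1) (X s t)" by (rule compr_subset[OF compr_mono[OF L[OF s]]]) simp
      show "compr (- \<Omega>) (max L 1) (\<lambda>x. x)" by (rule compr_subset[OF compr_mono[OF compr_id]]) simp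
    qed
  next
    have ic: "integral_curve (\<lambda>s. x)" if "x \<in> - \<Omega>" for x
      using that out by (simp add: integral_curve_def set_integrable_def set_lebesgue_integral_def)
    show "AE x in lborel. x \<in> - \<Omega> \<longrightarrow> integral_curve (\<lambda>s. X s t x) \<and> integral_curve (\<lambda>s. x) \<and> X t t x = x"
      using X_integral_curve[of t] by eventually_elim (use ic in blast)
  qed simp
  then show ?thesis by simp
qed

text \<open>If \<open>x\<close> were carried outside \<Omega> at time \<open>s\<close>, the flow
  from there would be constant, so returning to time \<open>t\<close> would leave the point where it
  is. The return leads to \<open>x\<close>, hence \<open>x\<close> would itself lie outside.\<close>

lemma X_stays_inside:
  assumes "\<Omega> \<in> sets borel" and "\<And>r x. x \<notin> \<Omega> \<Longrightarrow> u r x = 0"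
  shows "AE x in lborel. x \<in> \<Omega> \<longrightarrow> X s t x \<in> \<Omega>"
proof -
  have "AE x in lborel. X s t x \<notin> \<Omega> \<longrightarrow> (\<forall>r. X r s (X s t x) = X s t x)"
    by (rule compr_AE[OF X_compr X_fixed_outside[OF assms]])
  with X_inverse[of t s] show ?thesis by eventually_elim metis
qed

end

section \<open>Test functions\<close>

lemma partial_eq:
  assumes "(f has_derivative f') (at x)"
  shows "partial f e x = f' e"
  using frechet_derivative_at[OF assms] by (simp add: partial_def)

lemma has_derivative_partial:
  assumes "f differentiable (at x)"
  shows "(f has_derivative (\<lambda>h. frechet_derivative f (at x) h)) (at x)"
  using assms by (simp add: frechet_derivative_works)

lemma Ck_Suc_D: "Ck (Suc k) f \<Longrightarrow> Ck k f"
proof (induction k arbitrary: f)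
  case 0
  then have "f differentiable (at x)" for x by simp
  then show ?case by (auto intro!: continuous_at_imp_continuous_on differentiable_imp_continuous_within)
next
  case (Suc k)
  then show ?case by simp
qed

lemma Ck_const: "Ck k (\<lambda>x::'a::euclidean_space. c)"
proof (induction k arbitrary: c)
  case (Suc k)
  have "partial (\<lambda>x::'a. c) e = (\<lambda>x. 0)" for e
    by (rule ext, rule partial_eq) simp
  then show ?case using Suc by simp
qed simp

lemma Ck_add: "Ck k f \<Longrightarrow> Ck k g \<Longrightarrow> Ck k (\<lambda>x. f x + g x)"
proof (induction k arbitrary: f g)
  case 0
  then show ?case by (auto intro: continuous_on_add)
next
  case (Suc k)
  then have d: "f differentiable (at x)" "g differentiable (at x)" for x by auto
  have p: "partial (\<lambda>x. f x + g x) e = (\<lambda>x. partial f e x + partial g e x)" for e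
  proof
    fix x
    show "partial (\<lambda>x. f x + g x) e x = partial f e x + partial g e x"
      using partial_eq[OF has_derivative_add[OF has_derivative_partial[OF d(1)[of x]] has_derivative_partial[OF d(2)[of x]]], of e]
      by (simp add: partial_def)
  qed
  show ?case using Suc by (auto simp: p)
qed

lemma Ck_mult: "Ck k f \<Longrightarrow> Ck k g \<Longrightarrow> Ck k (\<lambda>x. f x * g x)"
proof (induction k arbitrary: f g)
  case 0
  then show ?case by (auto intro: continuous_on_mult)
next
  case (Suc k)
  then have d: "f differentiable (at x)" "g differentiable (at x)" for x by auto
  have p: "partial (\<lambda>x. f x * g x) e = (\<lambda>x. f x * partial g e x + partial f e x * g x)" for e
  proof
    fix x
    show "partial (\<lambda>x. f x * g x) e x = f x * partial g e x + partial f e x * g x"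
      using partial_eq[OF has_derivative_mult[OF has_derivative_partial[OF d(1)[of x]] has_derivative_partial[OF d(2)[of x]]], of e]
      by (simp add: partial_def)
  qed
  have "Ck k f" "Ck k g" using Suc.prems Ck_Suc_D by blast+
  then show ?case using Suc by (auto simp: p intro!: Ck_add)
qed

lemma Ck_prod:
  assumes "finite I" "\<And>i. i \<in> I \<Longrightarrow> Ck k (f i)"
  shows "Ck k (\<lambda>x. \<Prod>i\<in>I. f i x)"
  using assms by (induction I) (auto intro: Ck_const Ck_mult)

text \<open>\<open>Ck\<close> refers only to partial derivatives along \<open>Basis\<close>, so the
  induction needs each basis vector to be mapped to 0 or to a basis vector. The two projections of a
  product have this property.\<close>

lemma Ck_compose_linear:
  fixes T :: "'a::euclidean_space \<Rightarrow> 'b::euclidean_space"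
  assumes T: "bounded_linear T" and B: "\<And>e. e \<in> Basis \<Longrightarrow> T e = 0 \<or> T e \<in> Basis"
  shows "Ck k f \<Longrightarrow> Ck k (\<lambda>x. f (T x))"
proof (induction k arbitrary: f)
  case 0
  have "continuous_on UNIV T" by (rule linear_continuous_on[OF T])
  then show ?case using 0 by (auto intro: continuous_on_compose2)
next
  case (Suc k)
  then have d: "f differentiable (at y)" for y by simp
  have h: "((\<lambda>x. f (T x)) has_derivative (\<lambda>h. frechet_derivative f (at (T x)) (T h))) (at x)" for x
    by (rule has_derivative_compose[OF bounded_linear.has_derivative[OF T has_derivative_ident] has_derivative_partial[OF d]])
  have p: "partial (\<lambda>x. f (T x)) e = (\<lambda>x. partial f (T e) (T x))" for e
    by (rule ext) (simp add: partial_eq[OF h] partial_def)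
  have z: "partial f 0 = (\<lambda>x. 0)"
    using linear_0[OF linear_frechet_derivative[OF d]] by (auto simp: partial_def)
  show ?case
    unfolding Ck.simps
  proof (intro conjI allI ballI)
    show "(\<lambda>x. f (T x)) differentiable (at x)" for x using h by (auto simp: differentiable_def)
    fix e :: 'a assume e: "e \<in> Basis"
    show "Ck k (partial (\<lambda>x. f (T x)) e)"
      using B[OF e] Suc.prems unfolding p by (auto simp: z intro!: Ck_const Suc.IH)
  qed
qed

text \<open>The family \<open>p (1 / x) exp (- c / x)\<close> (extended by zero to \<open>x \<le> 0\<close>), \<open>p\<close> a polynomial, is closed under
  differentiation.\<close>

definition flat :: "real \<Rightarrow> real poly \<Rightarrow> real \<Rightarrow> real" where
  "flat c p x = (if 0 < x then poly p (1 / x) * exp (- c / x) else 0)"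

text \<open>The additional power \<open>y ^ k\<close> makes induction on the polynomial possible:
  splitting off the constant coefficient raises \<open>k\<close> by one.\<close>

lemma poly_exp_tendsto:
  fixes c :: real
  assumes c: "0 < c"
  shows "((\<lambda>y. y ^ k * poly p y * exp (- c * y)) \<longlongrightarrow> 0) at_top"
proof (induction p arbitrary: k)
  case (pCons a p)
  have "((\<lambda>y. (c * y) ^ k / exp (c * y)) \<longlongrightarrow> 0) at_top"
    by (rule filterlim_compose[OF tendsto_power_div_exp_0])
      (rule filterlim_tendsto_pos_mult_at_top[OF tendsto_const c filterlim_ident])
  then have "((\<lambda>y. (a / c ^ k) * ((c * y) ^ k / exp (c * y))) \<longlongrightarrow> 0) at_top"
    by (rule tendsto_mult_right_zero)
  moreover have "(a / c ^ k) * ((c * y) ^ k / exp (c * y)) = a * y ^ k * exp (- c * y)" for y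
    using c by (simp add: power_mult_distrib exp_minus field_simps)
  ultimately have "((\<lambda>y. a * y ^ k * exp (- c * y)) \<longlongrightarrow> 0) at_top" by simp
  from tendsto_add[OF this pCons.IH[of "Suc k"]] show ?case by (simp add: algebra_simps)
qed simp

lemma flat_at_zero:
  assumes c: "0 < c"
  shows "(flat c p has_field_derivative 0) (at 0)"
  unfolding has_field_derivative_iff
proof -
  have "((\<lambda>h. inverse h ^ 1 * poly p (inverse h) * exp (- c * inverse h)) \<longlongrightarrow> 0) (at_right 0)"
    by (rule filterlim_compose[OF poly_exp_tendsto[OF c] filterlim_inverse_at_top_right])
  then have r: "((\<lambda>h. (flat c p (0 + h) - flat c p 0) / (h - 0)) \<longlongrightarrow> 0) (at_right 0)"
  proof (rule Lim_transform_eventually)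
    show "eventually (\<lambda>h. inverse h ^ 1 * poly p (inverse h) * exp (- c * inverse h) = (flat c p (0 + h) - flat c p 0) / (h - 0)) (at_right 0)"
      unfolding eventually_at_right_field by (intro exI[of _ 1]) (auto simp: flat_def inverse_eq_divide)
  qed
  have "((\<lambda>h. 0 :: real) \<longlongrightarrow> 0) (at_left 0)" by simp
  then have l: "((\<lambda>h. (flat c p (0 + h) - flat c p 0) / (h - 0)) \<longlongrightarrow> 0) (at_left 0)"
  proof (rule Lim_transform_eventually)
    show "eventually (\<lambda>h. 0 = (flat c p (0 + h) - flat c p 0) / (h - 0)) (at_left 0)"
      unfolding eventually_at_left_field by (intro exI[of _ "-1"]) (auto simp: flat_def)
  qed
  show "(\<lambda>y. (flat c p y - flat c p 0) / (y - 0)) \<midarrow>0\<rightarrow> 0"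
    using l r unfolding filterlim_at_split by simp
qed

text \<open>In terms of y = 1/x the derivative with respect to x is - y^2 times the derivative with
  respect to y; \<open>[:0, 0, 1:]\<close> is the polynomial y^2.\<close>

lemma flat_has_derivative:
  assumes c: "0 < c"
  shows "(flat c p has_field_derivative flat c ([:0, 0, 1:] * (smult c p - pderiv p)) x) (at x)"
proof -
  consider "0 < x" | "x = 0" | "x < 0" by linarith
  then show ?thesis
  proof cases
    case 1
    have "((\<lambda>x. poly p (1 / x) * exp (- c / x)) has_field_derivative
       (poly (pderiv p) (1 / x) * (- 1 / x\<^sup>2)) * exp (- c / x) + poly p (1 / x) * (exp (- c / x) * (c / x\<^sup>2))) (at x)"
      using 1 by (auto intro!: derivative_eq_intros DERIV_chain2[OF poly_DERIV] simp: power2_eq_square field_simps)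
    then have "(flat c p has_field_derivative
       (poly (pderiv p) (1 / x) * (- 1 / x\<^sup>2)) * exp (- c / x) + poly p (1 / x) * (exp (- c / x) * (c / x\<^sup>2))) (at x)"
      by (rule has_field_derivative_transform_within_open[where S="{0<..}"]) (use 1 in \<open>auto simp: flat_def\<close>)
    moreover have "(poly (pderiv p) (1 / x) * (- 1 / x\<^sup>2)) * exp (- c / x) + poly p (1 / x) * (exp (- c / x) * (c / x\<^sup>2))
      = flat c ([:0, 0, 1:] * (smult c p - pderiv p)) x"
      using 1 by (simp add: flat_def power2_eq_square field_simps)
    ultimately show ?thesis by simp
  next
    case 2
    then show ?thesis using flat_at_zero[OF c, of p] by (simp add: flat_def)
  next
    case 3
    have "((\<lambda>x. 0) has_field_derivative 0) (at x)" by simp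
    then have "(flat c p has_field_derivative 0) (at x)"
      by (rule has_field_derivative_transform_within_open[where S="{..<0}"]) (use 3 in \<open>auto simp: flat_def\<close>)
    then show ?thesis using 3 by (simp add: flat_def)
  qed
qed

lemma flat_affine_has_derivative:
  fixes e :: "'a::euclidean_space"
  assumes c: "0 < c"
  shows "((\<lambda>x::'a. flat c p (s * (x \<bullet> e) + a)) has_derivative
      (\<lambda>h. flat c ([:0, 0, 1:] * (smult c p - pderiv p)) (s * (x \<bullet> e) + a) * (s * (h \<bullet> e)))) (at x)"
proof -
  have 1: "((\<lambda>x. s * (x \<bullet> e) + a) has_derivative (\<lambda>h. s * (h \<bullet> e))) (at x)"
    by (auto intro!: derivative_eq_intros)
  have 2: "(flat c p has_derivative (*) (flat c ([:0, 0, 1:] * (smult c p - pderiv p)) (s * (x \<bullet> e) + a))) (at (s * (x \<bullet> e) + a))"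
    using flat_has_derivative[OF c] by (simp add: has_field_derivative_def)
  show ?thesis using has_derivative_compose[OF 1 2] by simp
qed

lemma Ck_flat:
  fixes e :: "'a::euclidean_space"
  assumes c: "0 < c"
  shows "Ck k (\<lambda>x::'a. flat c p (s * (x \<bullet> e) + a))"
proof (induction k arbitrary: p)
  case 0
  have "(\<lambda>x::'a. flat c p (s * (x \<bullet> e) + a)) differentiable (at x)" for x
    using flat_affine_has_derivative[OF c, of p s e a x] unfolding differentiable_def by blast
  then show ?case by (auto intro!: continuous_at_imp_continuous_on differentiable_imp_continuous_within)
next
  case (Suc k)
  have p: "partial (\<lambda>x::'a. flat c p (s * (x \<bullet> e) + a)) e' = (\<lambda>x. flat c ([:0, 0, 1:] * (smult c p - pderiv p)) (s * (x \<bullet> e) + a) * (s * (e' \<bullet> e)))" for e'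
    by (rule ext) (rule partial_eq[OF flat_affine_has_derivative[OF c]])
  have "(\<lambda>x::'a. flat c p (s * (x \<bullet> e) + a)) differentiable (at x)" for x
    using flat_affine_has_derivative[OF c, of p s e a x] unfolding differentiable_def by blast
  then show ?case unfolding Ck.simps p using Suc by (auto intro!: Ck_mult Ck_const)
qed

text \<open>Each factor is \<open>exp (- c / x)\<close> in the distance to one face, so the product
  tends to the indicator of the open box as \<open>c\<close> tends to 0. Rational corners and c = 1
  / (n + 1) give a countable family of explicit test functions.\<close>

definition bump :: "real \<Rightarrow> 'a::euclidean_space \<Rightarrow> 'a \<Rightarrow> 'a \<Rightarrow> real" where
  "bump c a b x = (\<Prod>e\<in>Basis. flat c 1 (x \<bullet> e - a \<bullet> e) * flat c 1 (b \<bullet> e - x \<bullet> e))"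

lemma bump_smooth:
  assumes c: "0 < c"
  shows "smooth (bump c a b)"
proof -
  have "Ck k (\<lambda>x. flat c 1 (x \<bullet> e - a \<bullet> e) * flat c 1 (b \<bullet> e - x \<bullet> e))" for k and e :: 'a
    using Ck_mult[OF Ck_flat[OF c, of k 1 1 e "- (a \<bullet> e)"] Ck_flat[OF c, of k 1 "-1" e "b \<bullet> e"]] by (simp add: algebra_simps)
  then show ?thesis unfolding smooth_def bump_def by (auto intro: Ck_prod)
qed

lemma flat_1: "0 < c \<Longrightarrow> 0 \<le> flat c 1 x" "0 < c \<Longrightarrow> flat c 1 x \<le> 1" "0 < x \<Longrightarrow> flat c 1 x = exp (- c / x)" "x \<le> 0 \<Longrightarrow> flat c 1 x = 0"
  by (auto simp: flat_def)

lemma bump_bounds: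
  assumes c: "0 < c"
  shows "0 \<le> bump c a b x" "bump c a b x \<le> 1"
  unfolding bump_def using flat_1(1,2)[OF c] by (auto intro!: prod_nonneg prod_le_1 mult_le_one)

lemma bump_outside: "x \<notin> box a b \<Longrightarrow> bump c a b x = 0"
proof -
  assume "x \<notin> box a b"
  then obtain e where e: "e \<in> Basis" "\<not> (a \<bullet> e < x \<bullet> e \<and> x \<bullet> e < b \<bullet> e)" by (auto simp: mem_box)
  then have "flat c 1 (x \<bullet> e - a \<bullet> e) * flat c 1 (b \<bullet> e - x \<bullet> e) = 0" by (auto simp: flat_def)
  then show ?thesis unfolding bump_def using e(1) by (intro prod_zero) auto
qed

lemma bump_tsupport: "tsupport (bump c a b) \<subseteq> cbox a b"
  unfolding tsupport_def
proof (intro closure_minimal closed_cbox subsetI)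
  fix x assume "x \<in> {x. bump c a b x \<noteq> 0}"
  then show "x \<in> cbox a b" using bump_outside[of x a b c] box_subset_cbox[of a b] by auto
qed

lemma bump_test_fun:
  assumes c: "0 < c" and U: "cbox a b \<subseteq> U"
  shows "test_fun U (bump c a b)"
  unfolding test_fun_def
proof (intro conjI bump_smooth[OF c])
  show "compact (tsupport (bump c a b))"
    using bump_tsupport[of c a b] by (metis tsupport_def closed_closure compact_cbox compact_Int_closed inf.absorb_iff2)
  show "tsupport (bump c a b) \<subseteq> U" using bump_tsupport U by blast
qed

lemma bump_tendsto: "(\<lambda>n. bump (1 / real (Suc n)) a b x) \<longlonglongrightarrow> indicator (box a b) x"
proof (cases "x \<in> box a b")
  case True
  have "(\<lambda>n. flat (1 / real (Suc n)) 1 y) \<longlonglongrightarrow> 1" if "0 < y" for y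
  proof -
    have "(\<lambda>n. exp (- (1 / real (Suc n)) / y)) \<longlonglongrightarrow> exp (- 0 / y)"
      by (intro tendsto_exp tendsto_divide tendsto_minus tendsto_const LIMSEQ_Suc[OF lim_1_over_n]) (use that in auto)
    then show ?thesis using that by (simp add: flat_def)
  qed
  then have "(\<lambda>n. bump (1 / real (Suc n)) a b x) \<longlonglongrightarrow> (\<Prod>e\<in>(Basis::'a set). 1 * 1)"
    unfolding bump_def using True by (intro tendsto_prod tendsto_mult) (auto simp: mem_box)
  then show ?thesis using True by simp
next
  case False
  then show ?thesis by (simp add: bump_outside)
qed

section \<open>A countable determining family of test functions\<close>

definition rat_points :: "'a::euclidean_space set" where
  "rat_points = {x. \<forall>e\<in>Basis. x \<bullet> e \<in> \<rat>}"

lemma rat_points_countable: "countable (rat_points :: 'a::euclidean_space set)"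
proof -
  have "countable ((Basis :: 'a set) \<rightarrow>\<^sub>E \<rat>)" by (intro countable_PiE countable_rat) auto
  moreover have "rat_points \<subseteq> (\<lambda>f. \<Sum>e\<in>Basis. f e *\<^sub>R e) ` ((Basis :: 'a set) \<rightarrow>\<^sub>E \<rat>)"
  proof
    fix x :: 'a assume x: "x \<in> rat_points"
    have "x = (\<Sum>e\<in>Basis. restrict (\<lambda>e. x \<bullet> e) Basis e *\<^sub>R e)" by (simp add: euclidean_representation)
    then show "x \<in> (\<lambda>f. \<Sum>e\<in>Basis. f e *\<^sub>R e) ` ((Basis :: 'a set) \<rightarrow>\<^sub>E \<rat>)"
      using x by (intro image_eqI[where x="restrict (\<lambda>e. x \<bullet> e) Basis"]) (auto simp: rat_points_def)
  qed
  ultimately show ?thesis by (rule countable_subset[OF _ countable_image, rotated])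
qed

lemma borel_eq_rat_boxes:
  "sets (borel :: 'a::euclidean_space measure) = sigma_sets UNIV {box a b | a b. a \<in> rat_points \<and> b \<in> rat_points}"
proof -
  let ?E = "{box a b | a b :: 'a. a \<in> rat_points \<and> b \<in> rat_points}"
  have "U \<in> sigma_sets UNIV ?E" if U: "open U" for U :: "'a set"
  proof -
    let ?F = "{B \<in> ?E. B \<subseteq> U}"
    have "countable ?E"
    proof -
      have "?E = (\<lambda>(a, b). box a b) ` (rat_points \<times> rat_points)" by auto
      then show ?thesis using rat_points_countable by auto
    qed
    then have cF: "countable ?F" by (rule countable_subset[rotated]) auto
    have "U = \<Union> ?F"
    proof (intro equalityI subsetI)
      fix x assume x: "x \<in> U"
      then obtain e where e: "0 < e" "ball x e \<subseteq> U" using U openE by blast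
      obtain a b where "\<forall>i\<in>Basis. a \<bullet> i \<in> \<rat> \<and> b \<bullet> i \<in> \<rat>" "x \<in> box a b" "box a b \<subseteq> ball x e"
        using rational_boxes[OF e(1), of x] by blast
      then show "x \<in> \<Union> ?F" using e(2) by (intro UnionI[of "box a b"]) (auto simp: rat_points_def)
    qed auto
    also have "\<dots> \<in> sigma_sets UNIV ?E"
      by (rule sigma_sets_UNION[OF cF]) (auto intro: sigma_sets.Basic)
    finally show ?thesis .
  qed
  then show ?thesis
    unfolding borel_def by (subst sets_measure_of, simp) (rule sigma_sets_eqI, auto intro: sigma_sets.Basic)
qed

text \<open>The positive and the negative part of \<open>w\<close> are densities of two measures,
  since \<open>ennreal\<close> cuts off negative values. The measures agree on boxes with rational
  corners, which are stable under intersection and generate the Borel sets.\<close>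

lemma AE_zero_of_rat_boxes:
  fixes w :: "'a::euclidean_space \<Rightarrow> real"
  assumes w: "integrable lborel w"
    and z: "\<And>a b. a \<in> rat_points \<Longrightarrow> b \<in> rat_points \<Longrightarrow> (\<integral>x. indicator (box a b) x * w x \<partial>lborel) = 0"
  shows "AE x in lborel. w x = 0"
proof -
  have [measurable]: "w \<in> borel_measurable borel" using w by auto
  let ?E = "{box a b | a b :: 'a. a \<in> rat_points \<and> b \<in> rat_points}"
  let ?P = "density lborel (\<lambda>x. ennreal (w x))" and ?N = "density lborel (\<lambda>x. ennreal (- w x))"
  have P: "emeasure ?P B = ennreal (\<integral>x. max 0 (w x) * indicator B x \<partial>lborel)" if [measurable]: "B \<in> sets borel" for B
  proof -
    have i: "integrable lborel (\<lambda>x. max 0 (w x) * indicator B x)"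
      by (rule Bochner_Integration.integrable_bound[OF w]) (auto simp: indicator_def)
    have "emeasure ?P B = (\<integral>\<^sup>+x. ennreal (max 0 (w x) * indicator B x) \<partial>lborel)"
      by (subst emeasure_density) (auto intro!: nn_integral_cong simp: indicator_def max_def ennreal_neg)
    also have "\<dots> = ennreal (\<integral>x. max 0 (w x) * indicator B x \<partial>lborel)"
      by (rule nn_integral_eq_integral[OF i]) auto
    finally show ?thesis .
  qed
  have N: "emeasure ?N B = ennreal (\<integral>x. max 0 (- w x) * indicator B x \<partial>lborel)" if [measurable]: "B \<in> sets borel" for B
  proof -
    have i: "integrable lborel (\<lambda>x. max 0 (- w x) * indicator B x)"
      by (rule Bochner_Integration.integrable_bound[OF w]) (auto simp: indicator_def)
    have "emeasure ?N B = (\<integral>\<^sup>+x. ennreal (max 0 (- w x) * indicator B x) \<partial>lborel)"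
      by (subst emeasure_density) (auto intro!: nn_integral_cong simp: indicator_def max_def ennreal_neg)
    also have "\<dots> = ennreal (\<integral>x. max 0 (- w x) * indicator B x \<partial>lborel)"
      by (rule nn_integral_eq_integral[OF i]) auto
    finally show ?thesis .
  qed
  have "?P = ?N"
  proof (rule measure_eqI_generator_eq[where E="?E" and \<Omega>=UNIV and A="\<lambda>n. box (- (real n *\<^sub>R One)) (real n *\<^sub>R One)"])
    show "Int_stable ?E"
    proof (rule Int_stableI, safe)
      fix a b c d :: 'a assume r: "a \<in> rat_points" "b \<in> rat_points" "c \<in> rat_points" "d \<in> rat_points"
      let ?s = "\<Sum>i\<in>Basis. max (a \<bullet> i) (c \<bullet> i) *\<^sub>R i" and ?t = "\<Sum>i\<in>Basis. min (b \<bullet> i) (d \<bullet> i) *\<^sub>R i"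
      have "box a b \<inter> box c d = box ?s ?t" by (rule box_Int_box)
      moreover have "?s \<in> rat_points" "?t \<in> rat_points" using r by (auto simp: rat_points_def max_def min_def)
      ultimately show "\<exists>a' b'. box a b \<inter> box c d = box a' b' \<and> a' \<in> rat_points \<and> b' \<in> rat_points" by blast
    qed
    show "emeasure ?P B = emeasure ?N B" if "B \<in> ?E" for B
    proof -
      from that obtain a b where B: "B = box a b" "a \<in> rat_points" "b \<in> rat_points" by auto
      have [measurable]: "B \<in> sets borel" using B by simp
      have i: "integrable lborel (\<lambda>x. max 0 (w x) * indicator B x)" "integrable lborel (\<lambda>x. max 0 (- w x) * indicator B x)"
        by (rule Bochner_Integration.integrable_bound[OF w]; auto simp: indicator_def)+
      have "(\<integral>x. max 0 (w x) * indicator B x \<partial>lborel) - (\<integral>x. max 0 (- w x) * indicator B x \<partial>lborel)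
        = (\<integral>x. indicator B x * w x \<partial>lborel)"
        unfolding Bochner_Integration.integral_diff[OF i, symmetric]
        by (intro Bochner_Integration.integral_cong) (auto simp: indicator_def max_def)
      then show ?thesis using P[of B] N[of B] z[OF B(2,3)] B(1) by simp
    qed
    show "(\<Union>n. box (- (real n *\<^sub>R One)) (real n *\<^sub>R One)) = (UNIV :: 'a set)"
      using UN_box_eq_UNIV by simp
    show "range (\<lambda>n. box (- (real n *\<^sub>R One)) (real n *\<^sub>R One)) \<subseteq> ?E"
      by (auto simp: rat_points_def intro!: exI)
    show "emeasure ?P (box (- (real n *\<^sub>R One)) (real n *\<^sub>R One)) \<noteq> \<infinity>" for n using P by simp
  qed (auto simp: borel_eq_rat_boxes)
  then have "AE x in lborel. ennreal (w x) = ennreal (- w x)"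
    by (intro sigma_finite_measure.density_unique[OF lborel.sigma_finite_measure_axioms]) auto
  then show ?thesis
  proof eventually_elim
    case (elim x)
    show ?case
    proof (cases "0 \<le> w x")
      case True
      then have "ennreal (- w x) = 0" by (simp add: ennreal_neg)
      then have "ennreal (w x) = 0" using elim by simp
      then show ?thesis using True by (simp add: ennreal_eq_0_iff)
    next
      case False
      then have "ennreal (w x) = 0" by (simp add: ennreal_neg)
      then have "ennreal (- w x) = 0" using elim by simp
      then show ?thesis using False by (simp add: ennreal_eq_0_iff)
    qed
  qed
qed

lemma bump_integral_box:
  fixes w :: "'a::euclidean_space \<Rightarrow> real"
  assumes w: "integrable lborel w" and z: "\<And>n. (\<integral>x. bump (1 / real (Suc n)) a b x * w x \<partial>lborel) = 0"
  shows "(\<integral>x. indicator (box a b) x * w x \<partial>lborel) = 0"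
proof -
  have [measurable]: "w \<in> borel_measurable borel" using w by auto
  have [measurable]: "bump (1 / real (Suc n)) a b \<in> borel_measurable borel" for n
    using bump_smooth[of "1 / real (Suc n)" a b] by (intro borel_measurable_continuous_onI) (metis Ck.simps(1) smooth_def of_nat_0_less_iff zero_less_Suc zero_less_divide_1_iff)
  have "(\<lambda>n. \<integral>x. bump (1 / real (Suc n)) a b x * w x \<partial>lborel) \<longlonglongrightarrow> (\<integral>x. indicator (box a b) x * w x \<partial>lborel)"
  proof (rule integral_dominated_convergence[where w="\<lambda>x. norm (w x)"])
    show "AE x in lborel. norm (bump (1 / real (Suc n)) a b x * w x) \<le> norm (w x)" for n
      using bump_bounds[of "1 / real (Suc n)" a b] by (intro AE_I2) (simp add: abs_mult mult_left_le_one_le)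
    show "AE x in lborel. (\<lambda>n. bump (1 / real (Suc n)) a b x * w x) \<longlonglongrightarrow> indicator (box a b) x * w x"
      by (intro AE_I2 tendsto_mult tendsto_const bump_tendsto)
  qed (use w in \<open>auto simp del: of_nat_Suc\<close>)
  then show ?thesis unfolding z by (simp add: LIMSEQ_const_iff)
qed

text \<open>The fundamental lemma of the calculus of variations for countably many test functions.
  It is proved inside each rational box whose closure lies in \<open>U\<close>, where the
  intersection with any other rational box is again an admissible one.\<close>

lemma AE_zero_of_bumps:
  fixes w :: "'a::euclidean_space \<Rightarrow> real"
  assumes U: "open U" and w: "integrable lborel w"
    and z: "\<And>a b n. a \<in> rat_points \<Longrightarrow> b \<in> rat_points \<Longrightarrow> cbox a b \<subseteq> U \<Longrightarrow> (\<integral>x. bump (1 / real (Suc n)) a b x * w x \<partial>lborel) = 0"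
  shows "AE x in lborel. x \<in> U \<longrightarrow> w x = 0"
proof -
  have loc: "AE x in lborel. x \<in> box a b \<longrightarrow> w x = 0" if ab: "a \<in> rat_points" "b \<in> rat_points" "cbox a b \<subseteq> U" for a b
  proof -
    have "AE x in lborel. indicator (box a b) x * w x = 0"
    proof (rule AE_zero_of_rat_boxes)
      show "integrable lborel (\<lambda>x. indicator (box a b) x * w x)" using integrable_mult_indicator[of "box a b" lborel w] w by simp
      fix c d :: 'a assume cd: "c \<in> rat_points" "d \<in> rat_points"
      let ?s = "\<Sum>i\<in>Basis. max (a \<bullet> i) (c \<bullet> i) *\<^sub>R i" and ?t = "\<Sum>i\<in>Basis. min (b \<bullet> i) (d \<bullet> i) *\<^sub>R i"
      have r: "?s \<in> rat_points" "?t \<in> rat_points" using ab cd by (auto simp: rat_points_def max_def min_def)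
      have "cbox ?s ?t \<subseteq> cbox a b" by (auto simp: mem_box)
      then have "(\<integral>x. indicator (box ?s ?t) x * w x \<partial>lborel) = 0"
        using ab(3) r by (intro bump_integral_box w z) auto
      moreover have "indicator (box ?s ?t) x * w x = indicator (box c d) x * (indicator (box a b) x * w x)" for x
      proof -
        have "x \<in> box ?s ?t \<longleftrightarrow> x \<in> box a b \<and> x \<in> box c d" by (auto simp: mem_box)
        then show ?thesis by (auto simp: indicator_def)
      qed
      ultimately show "(\<integral>x. indicator (box c d) x * (indicator (box a b) x * w x) \<partial>lborel) = 0" by simp
    qed
    then show ?thesis by eventually_elim auto
  qed
  let ?I = "{p \<in> rat_points \<times> rat_points. cbox (fst p) (snd p) \<subseteq> U}"
  have "countable ?I" by (rule countable_subset[of _ "rat_points \<times> rat_points"]) (auto simp: rat_points_countable)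
  then have "AE x in lborel. \<forall>p\<in>?I. x \<in> box (fst p) (snd p) \<longrightarrow> w x = 0"
    by (subst AE_ball_countable) (use loc in auto)
  then show ?thesis
  proof eventually_elim
    case (elim x)
    show ?case
    proof
      assume "x \<in> U"
      then obtain e where e: "0 < e" "ball x e \<subseteq> U" using U openE by blast
      \<comment> \<open>Half the radius keeps the closed box inside \<open>U\<close>, not merely the
        open one.\<close>
      then have e2: "0 < e/2" by simp
      obtain a b where ab: "\<forall>i\<in>Basis. a \<bullet> i \<in> \<rat> \<and> b \<bullet> i \<in> \<rat>" "x \<in> box a b" "box a b \<subseteq> ball x (e/2)"
        using rational_boxes[OF e2, of x] by blast
      have "cbox a b = closure (box a b)" using ab(2) by (metis closure_box empty_iff)
      also have "\<dots> \<subseteq> cball x (e/2)" using ab(3) by (intro closure_minimal) auto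
      also have "\<dots> \<subseteq> U" using e by force
      finally have "(a, b) \<in> ?I" using ab(1) by (auto simp: rat_points_def)
      then show "w x = 0" using elim ab(2) by force
    qed
  qed
qed

section \<open>Borel representatives and time slices\<close>

text \<open>The given functions are only Lebesgue measurable, and composing such a function with a
  Borel map may destroy measurability; a Borel version avoids this. The value 0 off \<open>S\<close>
  is the extension to the whole space.\<close>

lemma borel_version_exists:
  fixes f :: "'a::euclidean_space \<Rightarrow> real"
  assumes S: "S \<in> sets borel" and f: "f \<in> borel_measurable (lebesgue_on S)"
  shows "\<exists>f'. f' \<in> borel_measurable borel \<and> (\<forall>x. x \<notin> S \<longrightarrow> f' x = 0) \<and> (AE x in lborel. x \<in> S \<longrightarrow> f' x = f x)"
proof -
  have "(\<lambda>x. f x * indicator S x) \<in> borel_measurable lebesgue"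
    using f S by (subst (asm) borel_measurable_restrict_space_iff) (auto simp: mult.commute)
  then obtain g where g: "g \<in> borel_measurable lborel" "AE x in lborel. f x * indicator S x = g x"
    using completion_ex_borel_measurable_real[of "\<lambda>x. f x * indicator S x" lborel] by auto
  show ?thesis
  proof (intro exI[of _ "\<lambda>x. indicator S x * g x"] conjI)
    show "(\<lambda>x. indicator S x * g x) \<in> borel_measurable borel" using g(1) S by (auto intro!: borel_measurable_times)
    show "AE x in lborel. x \<in> S \<longrightarrow> indicator S x * g x = f x" using g(2) by eventually_elim (auto simp: indicator_def split: if_splits)
  qed auto
qed

lemma borel_version_integral:
  fixes F F' :: "'a::euclidean_space \<Rightarrow> real"
  assumes S: "S \<in> sets borel" and F: "F \<in> borel_measurable (lebesgue_on S)" and F'[measurable]: "F' \<in> borel_measurable borel"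
    and out: "\<And>x. x \<notin> S \<Longrightarrow> F' x = 0" and eq: "AE x in lborel. x \<in> S \<longrightarrow> F' x = F x"
  shows "(\<integral>x. F x \<partial>lebesgue_on S) = (\<integral>x. F' x \<partial>lborel)" "integrable (lebesgue_on S) F \<longleftrightarrow> integrable lborel F'"
proof -
  have m1: "(\<lambda>x. indicator S x *\<^sub>R F x) \<in> borel_measurable lebesgue"
    using F S by (subst (asm) borel_measurable_restrict_space_iff) (auto simp: mult.commute)
  have m2: "F' \<in> borel_measurable lebesgue" by (rule measurable_completion) simp
  have ae: "AE x in lebesgue. indicator S x *\<^sub>R F x = F' x"
  proof (rule AE_completion)
    show "AE x in lborel. indicator S x *\<^sub>R F x = F' x"
      using eq by eventually_elim (use out in \<open>auto simp: indicator_def\<close>)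
  qed
  have "(\<integral>x. F x \<partial>lebesgue_on S) = (\<integral>x. indicator S x *\<^sub>R F x \<partial>lebesgue)"
    using S by (intro integral_restrict_space) auto
  also have "\<dots> = (\<integral>x. F' x \<partial>lebesgue)" by (rule integral_cong_AE[OF m1 m2 ae])
  also have "\<dots> = (\<integral>x. F' x \<partial>lborel)" by (rule integral_completion) simp
  finally show "(\<integral>x. F x \<partial>lebesgue_on S) = (\<integral>x. F' x \<partial>lborel)" .
  have "integrable (lebesgue_on S) F \<longleftrightarrow> integrable lebesgue (\<lambda>x. indicator S x *\<^sub>R F x)"
    using S by (intro integrable_restrict_space) auto
  also have "\<dots> \<longleftrightarrow> integrable lebesgue F'" by (rule integrable_cong_AE[OF m1 m2 ae])
  also have "\<dots> \<longleftrightarrow> integrable lborel F'" by (rule integrable_completion) simp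
  finally show "integrable (lebesgue_on S) F \<longleftrightarrow> integrable lborel F'" .
qed

definition gradient :: "('a::euclidean_space \<Rightarrow> real) \<Rightarrow> 'a \<Rightarrow> 'a" where
  "gradient \<phi> x = (\<Sum>e\<in>Basis. partial \<phi> e x *\<^sub>R e)"

lemma gradient_inner: "e \<in> Basis \<Longrightarrow> gradient \<phi> x \<bullet> e = partial \<phi> e x"
  by (simp add: gradient_def inner_sum_left inner_Basis if_distrib cong: if_cong)

lemma test_fun_facts:
  fixes \<phi> :: "'a::euclidean_space \<Rightarrow> real"
  assumes t: "test_fun U \<phi>"
  shows "has_grad \<phi> (gradient \<phi>)" "compact_supp \<phi>" "compact_supp (gradient \<phi>)" "x \<notin> U \<Longrightarrow> \<phi> x = 0" "x \<notin> U \<Longrightarrow> gradient \<phi> x = 0"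
proof -
  have s: "smooth \<phi>" and c: "compact (tsupport \<phi>)" and U: "tsupport \<phi> \<subseteq> U" using t by (auto simp: test_fun_def)
  have c1: "Ck (Suc 0) \<phi>" using s by (auto simp: smooth_def)
  then have d: "\<phi> differentiable (at x)" and p: "e \<in> Basis \<Longrightarrow> continuous_on UNIV (partial \<phi> e)" for x e by auto
  show "has_grad \<phi> (gradient \<phi>)"
    unfolding has_grad_def
  proof (intro conjI allI)
    fix x
    have "frechet_derivative \<phi> (at x) h = gradient \<phi> x \<bullet> h" for h
    proof -
      have l: "linear (frechet_derivative \<phi> (at x))" by (rule linear_frechet_derivative[OF d])
      have "frechet_derivative \<phi> (at x) h = frechet_derivative \<phi> (at x) (\<Sum>e\<in>Basis. (h \<bullet> e) *\<^sub>R e)" by (simp add: euclidean_representation)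
      also have "\<dots> = (\<Sum>e\<in>Basis. (h \<bullet> e) * partial \<phi> e x)"
        by (simp add: linear_sum[OF l] linear_scale[OF l] partial_def)
      also have "\<dots> = gradient \<phi> x \<bullet> h" unfolding gradient_def inner_sum_left
        by (intro sum.cong refl) (simp add: inner_commute[of _ h] mult.commute)
      finally show ?thesis .
    qed
    then show "(\<phi> has_derivative (\<bullet>) (gradient \<phi> x)) (at x)" using has_derivative_partial[OF d, of x] by simp
  next
    show "continuous_on UNIV (gradient \<phi>)" unfolding gradient_def using p by (intro continuous_intros) auto
  qed
  have z: "\<phi> x = 0" if "x \<notin> tsupport \<phi>" for x
    using that closure_subset[of "{x. \<phi> x \<noteq> 0}"] by (auto simp: tsupport_def)
  have gz: "gradient \<phi> x = 0" if x: "x \<notin> tsupport \<phi>" for x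
  proof -
    have o: "open (- tsupport \<phi>)" by (simp add: tsupport_def open_Compl)
    have "((\<lambda>x. 0::real) has_derivative (\<lambda>h. 0)) (at x)" by simp
    then have "(\<phi> has_derivative (\<lambda>h. 0)) (at x)"
      by (rule has_derivative_transform_within_open[OF _ o]) (use x z in auto)
    then have "partial \<phi> e x = 0" for e by (simp add: partial_eq)
    then show ?thesis by (simp add: gradient_def)
  qed
  obtain R where R: "\<forall>x\<in>tsupport \<phi>. norm x \<le> R" using compact_imp_bounded[OF c] unfolding bounded_iff by blast
  then have "x \<notin> tsupport \<phi>" if "R < norm x" for x using that by force
  then show "compact_supp \<phi>" "compact_supp (gradient \<phi>)" unfolding compact_supp_def using z gz by blast+
  show "x \<notin> U \<Longrightarrow> \<phi> x = 0" "x \<notin> U \<Longrightarrow> gradient \<phi> x = 0" using z gz U by auto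
qed

lemma test_fun_measurable:
  assumes t: "test_fun U \<phi>"
  shows "\<phi> \<in> borel_measurable borel" "e \<in> Basis \<Longrightarrow> partial \<phi> e \<in> borel_measurable borel"
    "\<exists>C. \<forall>x. \<bar>\<phi> x\<bar> \<le> C" "e \<in> Basis \<Longrightarrow> \<exists>C. \<forall>x. \<bar>partial \<phi> e x\<bar> \<le> C"
proof -
  note g = test_fun_facts(1)[OF t]
  have [measurable]: "\<phi> \<in> borel_measurable borel" "gradient \<phi> \<in> borel_measurable borel" by (rule has_grad_measurable[OF g])+
  then show "\<phi> \<in> borel_measurable borel" by simp
  have p: "partial \<phi> e = (\<lambda>x. gradient \<phi> x \<bullet> e)" if "e \<in> Basis" for e using that by (auto simp: gradient_inner)
  show "e \<in> Basis \<Longrightarrow> partial \<phi> e \<in> borel_measurable borel" by (simp add: p)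
  obtain C where "\<And>x. norm (\<phi> x) \<le> C" by (rule compact_supp_bounded[OF test_fun_facts(2)[OF t] has_grad_measurable(3)[OF g]]) blast
  then show "\<exists>C. \<forall>x. \<bar>\<phi> x\<bar> \<le> C" by auto
  obtain C' where C': "\<And>x. norm (gradient \<phi> x) \<le> C'" by (rule compact_supp_bounded[OF test_fun_facts(3)[OF t]]) (use g in \<open>auto simp: has_grad_def\<close>)
  show "\<exists>C. \<forall>x. \<bar>partial \<phi> e x\<bar> \<le> C" if e: "e \<in> Basis"
    using order_trans[OF Basis_le_norm[OF e] C'] by (auto simp: p[OF e])
qed

lemma integrable_mult_bounded:
  fixes f h :: "'a::euclidean_space \<Rightarrow> real"
  assumes f: "integrable lborel f" and h: "h \<in> borel_measurable borel" "\<exists>C. \<forall>x. \<bar>h x\<bar> \<le> C"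
  shows "integrable lborel (\<lambda>x. f x * h x)"
proof -
  obtain C where C: "\<And>x. \<bar>h x\<bar> \<le> C" using h(2) by blast
  have "integrable lborel (\<lambda>x. h x *\<^sub>R f x)" by (rule integrable_bounded_scaleR(1)[OF f h(1) C])
  then show ?thesis by (simp add: mult.commute)
qed

text \<open>The gradient \<open>g\<close> supplied by \<open>W110\<close> belongs to a single slice,
  and nothing ties it measurably to other times. \<open>G\<close> is meant to be a slice of a
  jointly measurable derivative; tested against the bumps the two coincide almost everywhere. The
  approximating test functions vanish off \<Omega> together with their gradients, so they
  approximate the zero extension on the whole space, and no derivative is created at the
  boundary.\<close>

lemma W110_imp_W11:
  fixes f f' :: "'a::euclidean_space \<Rightarrow> real" and G :: "'a \<Rightarrow> 'a"
  assumes \<Omega>: "open \<Omega>" and w: "W110 \<Omega> f"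
    and f'[measurable]: "f' \<in> borel_measurable borel" and f'0: "\<And>x. x \<notin> \<Omega> \<Longrightarrow> f' x = 0" and ff': "AE x in lborel. x \<in> \<Omega> \<longrightarrow> f' x = f x"
    and G: "integrable lborel G" and G0: "\<And>x. x \<notin> \<Omega> \<Longrightarrow> G x = 0"
    and weak: "\<And>a b n e. a \<in> rat_points \<Longrightarrow> b \<in> rat_points \<Longrightarrow> cbox a b \<subseteq> \<Omega> \<Longrightarrow> e \<in> Basis \<Longrightarrow>
      (\<integral>x. f' x * partial (bump (1 / real (Suc n)) a b) e x + (G x \<bullet> e) * bump (1 / real (Suc n)) a b x \<partial>lborel) = 0"
  shows "W11 f' G"
proof -
  have \<Omega>b: "\<Omega> \<in> sets borel" using \<Omega> by simp
  have [measurable]: "G \<in> borel_measurable borel" using G by auto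
  obtain g \<phi> where f: "integrable (lebesgue_on \<Omega>) f" and g: "\<And>e. e \<in> Basis \<Longrightarrow> integrable (lebesgue_on \<Omega>) (g e)"
    and wp: "\<And>e. e \<in> Basis \<Longrightarrow> weak_partial \<Omega> f e (g e)" and t: "\<And>n. test_fun \<Omega> (\<phi> n)"
    and lim: "(\<lambda>n::nat. (\<integral>x. \<bar>\<phi> n x - f x\<bar> \<partial>lebesgue_on \<Omega>) + (\<Sum>e\<in>Basis. \<integral>x. \<bar>partial (\<phi> n) e x - g e x\<bar> \<partial>lebesgue_on \<Omega>)) \<longlonglongrightarrow> 0"
    using w unfolding W110_def by blast
  have fm: "f \<in> borel_measurable (lebesgue_on \<Omega>)" and gm: "e \<in> Basis \<Longrightarrow> g e \<in> borel_measurable (lebesgue_on \<Omega>)" for e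
    using f g by auto
  have hm: "h \<in> borel_measurable (lebesgue_on \<Omega>)" if "h \<in> borel_measurable borel" for h :: "'a \<Rightarrow> real"
    by (rule measurable_restrict_space1) (use that in \<open>auto intro: measurable_completion\<close>)
  have f'i: "integrable lborel f'" using borel_version_integral(2)[OF \<Omega>b fm f' f'0 ff'] f by simp
  have "\<forall>e. \<exists>k. e \<in> Basis \<longrightarrow> k \<in> borel_measurable borel \<and> (\<forall>x. x \<notin> \<Omega> \<longrightarrow> k x = 0) \<and> (AE x in lborel. x \<in> \<Omega> \<longrightarrow> k x = g e x)"
    using borel_version_exists[OF \<Omega>b gm] by blast
  then obtain k where k: "\<And>e. e \<in> Basis \<Longrightarrow> k e \<in> borel_measurable borel" "\<And>e x. e \<in> Basis \<Longrightarrow> x \<notin> \<Omega> \<Longrightarrow> k e x = 0"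
    "\<And>e. e \<in> Basis \<Longrightarrow> AE x in lborel. x \<in> \<Omega> \<longrightarrow> k e x = g e x" by metis
  have ki: "integrable lborel (k e)" if "e \<in> Basis" for e
    using borel_version_integral(2)[OF \<Omega>b gm[OF that] k(1)[OF that] k(2)[OF that] k(3)[OF that]] g[OF that] by simp
  have kG: "AE x in lborel. G x \<bullet> e = k e x" if e: "e \<in> Basis" for e
  proof -
    have "AE x in lborel. x \<in> \<Omega> \<longrightarrow> k e x - G x \<bullet> e = 0"
    proof (rule AE_zero_of_bumps[OF \<Omega>])
      show "integrable lborel (\<lambda>x. k e x - G x \<bullet> e)" using ki[OF e] G by simp
      fix a b :: 'a and n :: nat assume ab: "a \<in> rat_points" "b \<in> rat_points" "cbox a b \<subseteq> \<Omega>"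
      let ?\<beta> = "bump (1 / real (Suc n)) a b"
      have tb: "test_fun \<Omega> ?\<beta>" by (rule bump_test_fun) (use ab in auto)
      note \<beta>[measurable] = test_fun_measurable(1)[OF tb] test_fun_measurable(2)[OF tb e]
      have i1: "integrable lborel (\<lambda>x. f' x * partial ?\<beta> e x)" by (rule integrable_mult_bounded[OF f'i test_fun_measurable(2,4)[OF tb e]])
      have i2: "integrable lborel (\<lambda>x. k e x * ?\<beta> x)" by (rule integrable_mult_bounded[OF ki[OF e] test_fun_measurable(1,3)[OF tb]])
      have i3: "integrable lborel (\<lambda>x. (G x \<bullet> e) * ?\<beta> x)" by (rule integrable_mult_bounded[OF _ test_fun_measurable(1,3)[OF tb]]) (use G in simp)
      have "(\<integral>x. f x * partial ?\<beta> e x \<partial>lebesgue_on \<Omega>) = (\<integral>x. f' x * partial ?\<beta> e x \<partial>lborel)"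
      proof (rule borel_version_integral(1)[OF \<Omega>b])
        show "AE x in lborel. x \<in> \<Omega> \<longrightarrow> f' x * partial ?\<beta> e x = f x * partial ?\<beta> e x" using ff' by eventually_elim simp
        show "(\<lambda>x. f x * partial ?\<beta> e x) \<in> borel_measurable (lebesgue_on \<Omega>)" by (rule borel_measurable_times[OF fm hm[OF \<beta>(2)]])
        show "(\<lambda>x. f' x * partial ?\<beta> e x) \<in> borel_measurable borel" by (rule borel_measurable_times[OF f' \<beta>(2)])
      qed (simp add: f'0)
      moreover have "(\<integral>x. g e x * ?\<beta> x \<partial>lebesgue_on \<Omega>) = (\<integral>x. k e x * ?\<beta> x \<partial>lborel)"
      proof (rule borel_version_integral(1)[OF \<Omega>b])
        show "AE x in lborel. x \<in> \<Omega> \<longrightarrow> k e x * ?\<beta> x = g e x * ?\<beta> x" using k(3)[OF e] by eventually_elim simp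
        show "(\<lambda>x. g e x * ?\<beta> x) \<in> borel_measurable (lebesgue_on \<Omega>)" by (rule borel_measurable_times[OF gm[OF e] hm[OF \<beta>(1)]])
        show "(\<lambda>x. k e x * ?\<beta> x) \<in> borel_measurable borel" by (rule borel_measurable_times[OF k(1)[OF e] \<beta>(1)])
      qed (simp add: k(2)[OF e])
      moreover have "(\<integral>x. f x * partial ?\<beta> e x \<partial>lebesgue_on \<Omega>) = - (\<integral>x. g e x * ?\<beta> x \<partial>lebesgue_on \<Omega>)"
        using wp[OF e] tb unfolding weak_partial_def by blast
      moreover have "(\<integral>x. f' x * partial ?\<beta> e x \<partial>lborel) + (\<integral>x. (G x \<bullet> e) * ?\<beta> x \<partial>lborel) = 0"
        using weak[OF ab e, of n] Bochner_Integration.integral_add[OF i1 i3] by simp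
      ultimately have "(\<integral>x. k e x * ?\<beta> x \<partial>lborel) - (\<integral>x. (G x \<bullet> e) * ?\<beta> x \<partial>lborel) = 0" by simp
      then show "(\<integral>x. ?\<beta> x * (k e x - G x \<bullet> e) \<partial>lborel) = 0"
        using Bochner_Integration.integral_diff[OF i2 i3] by (simp add: algebra_simps)
    qed
    then show ?thesis by eventually_elim (use k(2)[OF e] G0 in force)
  qed
  show ?thesis
    unfolding W11_def
  proof (intro conjI allI impI f'i G)
    fix \<eta> :: real assume \<eta>: "0 < \<eta>"
    \<comment> \<open>The norm of the gradient error is at most the sum of its components, and there
      are \<open>DIM('a)\<close> of them.\<close>
    let ?d = "\<eta> / real DIM('a)"
    have d: "0 < ?d" using \<eta> by simp
    obtain n where n: "(\<integral>x. \<bar>\<phi> n x - f x\<bar> \<partial>lebesgue_on \<Omega>) + (\<Sum>e\<in>Basis. \<integral>x. \<bar>partial (\<phi> n) e x - g e x\<bar> \<partial>lebesgue_on \<Omega>) < ?d"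
      using order_tendstoD(2)[OF lim d] by (auto simp: eventually_sequentially)
    note tf = test_fun_facts[OF t[of n]]
    note tm[measurable] = test_fun_measurable(1)[OF t[of n]] and tp[measurable] = test_fun_measurable(2)[OF t[of n]]
    have nn: "0 \<le> (\<integral>x. \<bar>\<phi> n x - f x\<bar> \<partial>lebesgue_on \<Omega>)" "0 \<le> (\<integral>x. \<bar>partial (\<phi> n) e x - g e x\<bar> \<partial>lebesgue_on \<Omega>)" for e by auto
    have \<phi>i: "integrable lborel (\<phi> n)" by (rule compact_supp_integrable[OF tf(2) has_grad_measurable(3)[OF tf(1)]])
    have gri: "integrable lborel (gradient (\<phi> n))" by (rule compact_supp_integrable[OF tf(3)]) (use tf(1) in \<open>simp add: has_grad_def\<close>)
    have pi: "integrable lborel (partial (\<phi> n) e)" if e: "e \<in> Basis" for e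
    proof -
      have "integrable lborel (\<lambda>x. gradient (\<phi> n) x \<bullet> e)" using gri by simp
      then show ?thesis by (simp add: gradient_inner[OF e])
    qed
    have 1: "(\<integral>x. \<bar>\<phi> n x - f' x\<bar> \<partial>lborel) \<le> ?d"
    proof -
      have "(\<integral>x. \<bar>\<phi> n x - f x\<bar> \<partial>lebesgue_on \<Omega>) = (\<integral>x. \<bar>\<phi> n x - f' x\<bar> \<partial>lborel)"
        by (rule borel_version_integral(1)[OF \<Omega>b]) (use ff' f'0 tf(4) fm hm[OF tm] in \<open>auto elim: eventually_mono intro!: borel_measurable_abs borel_measurable_diff\<close>)
      moreover have "0 \<le> (\<Sum>e\<in>(Basis::'a set). \<integral>x. \<bar>partial (\<phi> n) e x - g e x\<bar> \<partial>lebesgue_on \<Omega>)" using nn by (intro sum_nonneg) auto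
      ultimately show ?thesis using n by simp
    qed
    have 2: "(\<integral>x. \<bar>partial (\<phi> n) e x - k e x\<bar> \<partial>lborel) \<le> ?d" if e: "e \<in> Basis" for e
    proof -
      have "(\<integral>x. \<bar>partial (\<phi> n) e x - g e x\<bar> \<partial>lebesgue_on \<Omega>) = (\<integral>x. \<bar>partial (\<phi> n) e x - k e x\<bar> \<partial>lborel)"
      proof (rule borel_version_integral(1)[OF \<Omega>b])
        show "(\<lambda>x. \<bar>partial (\<phi> n) e x - g e x\<bar>) \<in> borel_measurable (lebesgue_on \<Omega>)"
          using gm[OF e] hm[OF tp[OF e]] by (intro borel_measurable_abs borel_measurable_diff)
        show "(\<lambda>x. \<bar>partial (\<phi> n) e x - k e x\<bar>) \<in> borel_measurable borel"
          using k(1)[OF e] tp[OF e] by (intro borel_measurable_abs borel_measurable_diff)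
        show "\<bar>partial (\<phi> n) e x - k e x\<bar> = 0" if "x \<notin> \<Omega>" for x
          using tf(5)[OF that] k(2)[OF e that] gradient_inner[OF e, of "\<phi> n" x] by simp
        show "AE x in lborel. x \<in> \<Omega> \<longrightarrow> \<bar>partial (\<phi> n) e x - k e x\<bar> = \<bar>partial (\<phi> n) e x - g e x\<bar>"
          using k(3)[OF e] by eventually_elim auto
      qed
      moreover have "(\<integral>x. \<bar>partial (\<phi> n) e x - g e x\<bar> \<partial>lebesgue_on \<Omega>) \<le> (\<Sum>e\<in>Basis. \<integral>x. \<bar>partial (\<phi> n) e x - g e x\<bar> \<partial>lebesgue_on \<Omega>)"
        using nn e by (intro member_le_sum) auto
      ultimately show ?thesis using n nn(1) by linarith
    qed
    have d1: "?d \<le> \<eta>" using \<eta> by (simp add: divide_le_eq)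
    have A: "(\<integral>\<^sup>+x. \<bar>f' x - \<phi> n x\<bar> \<partial>lborel) \<le> ennreal \<eta>"
    proof -
      have "(\<integral>\<^sup>+x. \<bar>f' x - \<phi> n x\<bar> \<partial>lborel) = ennreal (\<integral>x. \<bar>f' x - \<phi> n x\<bar> \<partial>lborel)"
        using f'i \<phi>i by (intro nn_integral_eq_integral) auto
      then show ?thesis using 1 d1 by (auto intro!: ennreal_leI simp: abs_minus_commute)
    qed
    have B: "(\<integral>\<^sup>+x. norm (G x - gradient (\<phi> n) x) \<partial>lborel) \<le> ennreal \<eta>"
    proof -
      have "(\<integral>\<^sup>+x. norm (G x - gradient (\<phi> n) x) \<partial>lborel) \<le> (\<integral>\<^sup>+x. (\<Sum>e\<in>Basis. ennreal \<bar>partial (\<phi> n) e x - k e x\<bar>) \<partial>lborel)"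
      proof (rule nn_integral_mono_AE)
        have "AE x in lborel. \<forall>e\<in>(Basis::'a set). G x \<bullet> e = k e x"
          by (subst AE_ball_countable) (use kG in \<open>auto intro: countable_finite\<close>)
        then show "AE x in lborel. ennreal (norm (G x - gradient (\<phi> n) x)) \<le> (\<Sum>e\<in>Basis. ennreal \<bar>partial (\<phi> n) e x - k e x\<bar>)"
        proof eventually_elim
          case (elim x)
          have "norm (G x - gradient (\<phi> n) x) \<le> (\<Sum>e\<in>Basis. \<bar>(G x - gradient (\<phi> n) x) \<bullet> e\<bar>)" by (rule norm_le_l1)
          also have "\<dots> = (\<Sum>e\<in>Basis. \<bar>partial (\<phi> n) e x - k e x\<bar>)"
            using elim by (intro sum.cong) (auto simp: inner_diff_left gradient_inner abs_minus_commute)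
          finally show ?case by (subst sum_ennreal) (auto intro: ennreal_leI)
        qed
      qed
      also have "\<dots> = (\<Sum>e\<in>Basis. \<integral>\<^sup>+x. ennreal \<bar>partial (\<phi> n) e x - k e x\<bar> \<partial>lborel)"
        using k(1) tp by (intro nn_integral_sum) auto
      also have "\<dots> \<le> (\<Sum>e\<in>(Basis::'a set). ennreal ?d)"
      proof (rule sum_mono)
        fix e :: 'a assume e: "e \<in> Basis"
        have "(\<integral>\<^sup>+x. ennreal \<bar>partial (\<phi> n) e x - k e x\<bar> \<partial>lborel) = ennreal (\<integral>x. \<bar>partial (\<phi> n) e x - k e x\<bar> \<partial>lborel)"
          using pi[OF e] ki[OF e] by (intro nn_integral_eq_integral) auto
        then show "(\<integral>\<^sup>+x. ennreal \<bar>partial (\<phi> n) e x - k e x\<bar> \<partial>lborel) \<le> ennreal ?d" using 2[OF e] by (simp add: ennreal_leI)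
      qed
      also have "\<dots> = ennreal (\<Sum>e\<in>(Basis::'a set). ?d)" using d by (intro sum_ennreal) auto
      also have "(\<Sum>e\<in>(Basis::'a set). ?d) = \<eta>" by simp
      finally show ?thesis .
    qed
    show "\<exists>\<phi> \<psi>. has_grad \<phi> \<psi> \<and> compact_supp \<phi> \<and> compact_supp \<psi> \<and> (\<integral>\<^sup>+x. ennreal \<bar>f' x - \<phi> x\<bar> \<partial>lborel) \<le> ennreal \<eta> \<and>
       (\<integral>\<^sup>+x. ennreal (norm (G x - \<psi> x)) \<partial>lborel) \<le> ennreal \<eta>"
      using tf(1,2,3) A B by blast
  qed
qed

section \<open>Weak derivatives of time slices\<close>

lemma test_fun_product:
  fixes \<alpha> :: "real \<Rightarrow> real" and \<beta> :: "'a::euclidean_space \<Rightarrow> real"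
  assumes a: "test_fun UNIV \<alpha>" and b: "test_fun U \<beta>"
  shows "test_fun (UNIV \<times> U) (\<lambda>p. \<alpha> (fst p) * \<beta> (snd p))" and "partial (\<lambda>p. \<alpha> (fst p) * \<beta> (snd p)) (0, e) p = \<alpha> (fst p) * partial \<beta> e (snd p)"
proof -
  have B1: "fst e = 0 \<or> fst e \<in> Basis" "snd e = 0 \<or> snd e \<in> Basis" if "e \<in> Basis" for e :: "real \<times> 'a"
    using that by (auto simp: Basis_prod_def)
  have ck: "Ck k (\<lambda>p::real \<times> 'a. \<alpha> (fst p))" "Ck k (\<lambda>p::real \<times> 'a. \<beta> (snd p))" for k
    using a b Ck_compose_linear[OF bounded_linear_fst B1(1), of k \<alpha>] Ck_compose_linear[OF bounded_linear_snd B1(2), of k \<beta>]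
    unfolding test_fun_def smooth_def by blast+
  have s: "smooth (\<lambda>p::real \<times> 'a. \<alpha> (fst p) * \<beta> (snd p))" unfolding smooth_def using ck by (auto intro: Ck_mult)
  have sub: "tsupport (\<lambda>p::real \<times> 'a. \<alpha> (fst p) * \<beta> (snd p)) \<subseteq> tsupport \<alpha> \<times> tsupport \<beta>"
    unfolding tsupport_def
  proof (rule closure_minimal)
    show "{p::real \<times> 'a. \<alpha> (fst p) * \<beta> (snd p) \<noteq> 0} \<subseteq> closure {x. \<alpha> x \<noteq> 0} \<times> closure {x. \<beta> x \<noteq> 0}"
    proof
      fix p :: "real \<times> 'a" assume "p \<in> {p. \<alpha> (fst p) * \<beta> (snd p) \<noteq> 0}"
      then have p: "fst p \<in> {x. \<alpha> x \<noteq> 0}" "snd p \<in> {x. \<beta> x \<noteq> 0}" by auto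
      have "fst p \<in> closure {x. \<alpha> x \<noteq> 0}" "snd p \<in> closure {x. \<beta> x \<noteq> 0}"
        by (rule closure_subset[THEN subsetD, OF p(1)], rule closure_subset[THEN subsetD, OF p(2)])
      then show "p \<in> closure {x. \<alpha> x \<noteq> 0} \<times> closure {x. \<beta> x \<noteq> 0}" by (simp add: mem_Times_iff)
    qed
  qed (auto intro: closed_Times)
  have c: "compact (tsupport \<alpha> \<times> tsupport \<beta>)" using a b by (auto simp: test_fun_def intro: compact_Times)
  show "test_fun (UNIV \<times> U) (\<lambda>p. \<alpha> (fst p) * \<beta> (snd p))"
    unfolding test_fun_def
  proof (intro conjI s)
    have "closed (tsupport (\<lambda>p::real \<times> 'a. \<alpha> (fst p) * \<beta> (snd p)))" by (simp add: tsupport_def)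
    then show "compact (tsupport (\<lambda>p::real \<times> 'a. \<alpha> (fst p) * \<beta> (snd p)))"
      using compact_Int_closed[OF c, of "tsupport (\<lambda>p::real \<times> 'a. \<alpha> (fst p) * \<beta> (snd p))"] by (simp add: Int_absorb1[OF sub])
    show "tsupport (\<lambda>p. \<alpha> (fst p) * \<beta> (snd p)) \<subseteq> UNIV \<times> U" using sub b by (auto simp: test_fun_def)
  qed
  obtain t x where p: "p = (t, x)" by force
  have d: "(\<lambda>p::real \<times> 'a. \<alpha> (fst p) * \<beta> (snd p)) differentiable (at p)" using s unfolding smooth_def by (metis Ck.simps(2))
  have "((\<lambda>y. (\<lambda>p. \<alpha> (fst p) * \<beta> (snd p)) (t, y)) has_derivative (\<lambda>h. frechet_derivative (\<lambda>p. \<alpha> (fst p) * \<beta> (snd p)) (at (t, x)) (0, h))) (at x)"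
    by (rule has_derivative_compose[of "\<lambda>y. (t, y)" "\<lambda>h. (0, h)" x UNIV "\<lambda>p. \<alpha> (fst p) * \<beta> (snd p)" "frechet_derivative (\<lambda>p. \<alpha> (fst p) * \<beta> (snd p)) (at (t, x))"])
      (use has_derivative_partial[OF d[unfolded p]] in \<open>auto intro!: derivative_eq_intros\<close>)
  then have 1: "((\<lambda>y. \<alpha> t * \<beta> y) has_derivative (\<lambda>h. frechet_derivative (\<lambda>p. \<alpha> (fst p) * \<beta> (snd p)) (at (t, x)) (0, h))) (at x)" by simp
  have db: "\<beta> differentiable (at x)" using b unfolding test_fun_def smooth_def by (metis Ck.simps(2))
  have 2: "((\<lambda>y. \<alpha> t * \<beta> y) has_derivative (\<lambda>h. \<alpha> t * frechet_derivative \<beta> (at x) h)) (at x)"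
    by (rule has_derivative_mult_right[OF has_derivative_partial[OF db]])
  from has_derivative_unique[OF 1 2]
  show "partial (\<lambda>p. \<alpha> (fst p) * \<beta> (snd p)) (0, e) p = \<alpha> (fst p) * partial \<beta> e (snd p)"
    unfolding p partial_def by (metis fst_conv snd_conv)
qed

text \<open>Only countably many test functions occur, so one null set of times serves all of them; by
  \<open>AE_zero_of_bumps\<close> they still determine the weak derivative.\<close>

lemma weak_partial_slices:
  fixes f G :: "real \<Rightarrow> 'a::euclidean_space \<Rightarrow> real"
  assumes f: "jmeas f" and G: "jmeas G"
    and fi: "\<And>M. integrable lborel (\<lambda>p. indicator {-M..M} (fst p) * f (fst p) (snd p))"
    and Gi: "\<And>M. integrable lborel (\<lambda>p. indicator {-M..M} (fst p) * G (fst p) (snd p))"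
    and e: "e \<in> Basis"
    and weak: "\<And>\<phi>. test_fun (UNIV \<times> \<Omega>) \<phi> \<Longrightarrow> (\<integral>p. f (fst p) (snd p) * partial \<phi> (0, e) p \<partial>lborel) = - (\<integral>p. G (fst p) (snd p) * \<phi> p \<partial>lborel)"
  shows "AE t in lborel. \<forall>a\<in>rat_points. \<forall>b\<in>rat_points. \<forall>n. cbox a b \<subseteq> \<Omega> \<longrightarrow>
    (\<integral>x. f t x * partial (bump (1 / real (Suc n)) a b) e x + G t x * bump (1 / real (Suc n)) a b x \<partial>lborel) = 0"
proof -
  note [measurable (raw)] = jmeasD[OF f] jmeasD[OF G]
  have one: "AE t in lborel. (\<integral>x. f t x * partial \<beta> e x + G t x * \<beta> x \<partial>lborel) = 0" if b: "test_fun \<Omega> \<beta>" for \<beta>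
  proof -
    note [measurable] = test_fun_measurable(1)[OF b] test_fun_measurable(2)[OF b e]
    define H where "H t = (\<integral>x. f t x * partial \<beta> e x + G t x * \<beta> x \<partial>lborel)" for t
    let ?F = "\<lambda>p. f (fst p) (snd p) * partial \<beta> e (snd p) + G (fst p) (snd p) * \<beta> (snd p)"
    have bd: "\<exists>C. \<forall>p::real \<times> 'a. \<bar>partial \<beta> e (snd p)\<bar> \<le> C" "\<exists>C. \<forall>p::real \<times> 'a. \<bar>\<beta> (snd p)\<bar> \<le> C"
      using test_fun_measurable(3)[OF b] test_fun_measurable(4)[OF b e] by auto
    have m2: "(\<lambda>p::real \<times> 'a. partial \<beta> e (snd p)) \<in> borel_measurable borel" "(\<lambda>p::real \<times> 'a. \<beta> (snd p)) \<in> borel_measurable borel"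
      unfolding borel_prod[symmetric] by measurable
    have Fi: "integrable lborel (\<lambda>p. indicator {-M..M} (fst p) * ?F p)" for M
    proof -
      have "integrable lborel (\<lambda>p. (indicator {-M..M} (fst p) * f (fst p) (snd p)) * partial \<beta> e (snd p) + (indicator {-M..M} (fst p) * G (fst p) (snd p)) * \<beta> (snd p))"
        by (intro Bochner_Integration.integrable_add integrable_mult_bounded fi Gi bd m2)
      then show ?thesis by (simp add: algebra_simps)
    qed
    \<comment> \<open>With products of a bump in time and \<beta> in space, the weak identity says
      that \<open>H\<close> is orthogonal to all bumps in time, so the determining property is
      applied on the time axis. The truncation at \<open>M\<close> is due to integrability on
      bounded time slabs only.\<close>
    have loc: "AE t in lborel. t \<in> {-M<..<M} \<longrightarrow> indicator {-M..M} t * H t = 0" for M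
    proof (rule AE_zero_of_bumps)
      show "open {-M<..<M}" by simp
      have "integrable lborel (\<lambda>t. \<integral>x. indicator {-M..M} t * (f t x * partial \<beta> e x + G t x * \<beta> x) \<partial>lborel)"
        using lborel_pair.integrable_fst'[of "\<lambda>p. indicator {-M..M} (fst p) * ?F p"] Fi[of M] by (simp add: lborel_prod)
      then show "integrable lborel (\<lambda>t. indicator {-M..M} t * H t)" by (simp add: H_def)
      fix a b :: real and n :: nat assume ab: "cbox a b \<subseteq> {-M<..<M}"
      let ?\<alpha> = "bump (1 / real (Suc n)) a b"
      have ta: "test_fun UNIV ?\<alpha>" by (rule bump_test_fun) auto
      note [measurable] = test_fun_measurable(1)[OF ta]
      note tp = test_fun_product[OF ta b]
      have bd\<alpha>: "\<exists>C. \<forall>p::real \<times> 'a. \<bar>?\<alpha> (fst p)\<bar> \<le> C" using test_fun_measurable(3)[OF ta] by auto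
      have m\<alpha>: "(\<lambda>p::real \<times> 'a. ?\<alpha> (fst p)) \<in> borel_measurable borel" unfolding borel_prod[symmetric] by measurable
      have \<alpha>M: "?\<alpha> t * indicator {-M..M} t = ?\<alpha> t" for t
      proof (cases "t \<in> box a b")
        case True
        then have "t \<in> {-M<..<M}" using ab box_subset_cbox[of a b] by blast
        then show ?thesis by simp
      qed (simp add: bump_outside)
      have i1: "integrable lborel (\<lambda>p. (f (fst p) (snd p) * partial \<beta> e (snd p)) * ?\<alpha> (fst p))"
      proof -
        have "integrable lborel (\<lambda>p. ((indicator {-M..M} (fst p) * f (fst p) (snd p)) * partial \<beta> e (snd p)) * ?\<alpha> (fst p))"
          by (intro integrable_mult_bounded fi bd m2 bd\<alpha> m\<alpha>)
        moreover have "((indicator {-M..M} (fst p) * f (fst p) (snd p)) * partial \<beta> e (snd p)) * ?\<alpha> (fst p) = (f (fst p) (snd p) * partial \<beta> e (snd p)) * (?\<alpha> (fst p) * indicator {-M..M} (fst p))" for p :: "real \<times> 'a"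
          by (simp only: mult_ac)
        ultimately show ?thesis by (simp only: \<alpha>M)
      qed
      have i2: "integrable lborel (\<lambda>p. (G (fst p) (snd p) * \<beta> (snd p)) * ?\<alpha> (fst p))"
      proof -
        have "integrable lborel (\<lambda>p. ((indicator {-M..M} (fst p) * G (fst p) (snd p)) * \<beta> (snd p)) * ?\<alpha> (fst p))"
          by (intro integrable_mult_bounded Gi bd m2 bd\<alpha> m\<alpha>)
        moreover have "((indicator {-M..M} (fst p) * G (fst p) (snd p)) * \<beta> (snd p)) * ?\<alpha> (fst p) = (G (fst p) (snd p) * \<beta> (snd p)) * (?\<alpha> (fst p) * indicator {-M..M} (fst p))" for p :: "real \<times> 'a"
          by (simp only: mult_ac)
        ultimately show ?thesis by (simp only: \<alpha>M)
      qed
      have "(\<integral>p. (f (fst p) (snd p) * partial \<beta> e (snd p)) * ?\<alpha> (fst p) \<partial>lborel) = - (\<integral>p. (G (fst p) (snd p) * \<beta> (snd p)) * ?\<alpha> (fst p) \<partial>lborel)"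
        using weak[OF tp(1)] unfolding tp(2) by (simp add: mult_ac)
      then have "0 = (\<integral>p. (f (fst p) (snd p) * partial \<beta> e (snd p)) * ?\<alpha> (fst p) + (G (fst p) (snd p) * \<beta> (snd p)) * ?\<alpha> (fst p) \<partial>lborel)"
        by (subst Bochner_Integration.integral_add[OF i1 i2]) simp
      also have "\<dots> = (\<integral>p. ?\<alpha> (fst p) * ?F p \<partial>(lborel \<Otimes>\<^sub>M lborel))" by (simp add: lborel_prod algebra_simps)
      also have "\<dots> = (\<integral>t. \<integral>x. ?\<alpha> t * (f t x * partial \<beta> e x + G t x * \<beta> x) \<partial>lborel \<partial>lborel)"
      proof -
        have "integrable (lborel \<Otimes>\<^sub>M lborel) (\<lambda>p. ?\<alpha> (fst p) * ?F p)"
          using Bochner_Integration.integrable_add[OF i1 i2] by (simp add: lborel_prod algebra_simps)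
        from lborel_pair.integral_fst'[OF this] show ?thesis by simp
      qed
      also have "\<dots> = (\<integral>t. ?\<alpha> t * (indicator {-M..M} t * H t) \<partial>lborel)"
        unfolding mult.assoc[symmetric] \<alpha>M by (simp add: H_def)
      finally show "(\<integral>t. ?\<alpha> t * (indicator {-M..M} t * H t) \<partial>lborel) = 0" by simp
    qed
    have "AE t in lborel. \<forall>k::nat. t \<in> {-real k<..<real k} \<longrightarrow> indicator {-real k..real k} t * H t = 0"
      unfolding AE_all_countable using loc by blast
    then show ?thesis
    proof eventually_elim
      case (elim t)
      obtain k :: nat where "\<bar>t\<bar> < real k" using reals_Archimedean2 by blast
      then have "- real k < t" "t < real k" by linarith+
      then show ?case using elim[rule_format, of k] by (simp add: H_def)
    qed
  qed
  let ?I = "{q \<in> (rat_points \<times> rat_points) \<times> (UNIV :: nat set). cbox (fst (fst q)) (snd (fst q)) \<subseteq> \<Omega>}"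
  have "countable ((rat_points \<times> rat_points) \<times> (UNIV :: nat set) :: (('a \<times> 'a) \<times> nat) set)" using rat_points_countable by auto
  then have "countable ?I" by (rule countable_subset[rotated]) auto
  then have "AE t in lborel. \<forall>q\<in>?I. (\<integral>x. f t x * partial (bump (1 / real (Suc (snd q))) (fst (fst q)) (snd (fst q))) e x + G t x * bump (1 / real (Suc (snd q))) (fst (fst q)) (snd (fst q)) x \<partial>lborel) = 0"
    by (subst AE_ball_countable) (auto intro!: one bump_test_fun)
  then show ?thesis by eventually_elim force
qed

lemma AE_lborel_prod_slices:
  fixes Q :: "'a::euclidean_space \<times> 'b::euclidean_space \<Rightarrow> bool"
  assumes Q: "AE p in lborel. Q p"
  shows "AE s in lborel. AE x in lborel. Q (s, x)" "AE x in lborel. AE s in lborel. Q (s, x)"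
proof -
  obtain N where N: "N \<in> null_sets lborel" "{p. \<not> Q p} \<subseteq> N" using Q by (auto simp: eventually_ae_filter)
  have Nm: "N \<in> sets (lborel \<Otimes>\<^sub>M lborel)" using null_setsD2[OF N(1)] unfolding lborel_prod .
  have "AE p in lborel \<Otimes>\<^sub>M lborel. p \<notin> N" using AE_not_in[OF N(1)] unfolding lborel_prod .
  from lborel_pair.AE_pair[OF this] have 1: "AE s in lborel. AE x in lborel. (s, x) \<notin> N" .
  have "{x \<in> space (lborel \<Otimes>\<^sub>M lborel). (fst x, snd x) \<notin> N} = space (lborel \<Otimes>\<^sub>M lborel) - N" by auto
  then have "{x \<in> space (lborel \<Otimes>\<^sub>M lborel). (fst x, snd x) \<notin> N} \<in> sets (lborel \<Otimes>\<^sub>M lborel)"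
    using sets.compl_sets[OF Nm] by metis
  from iffD1[OF lborel_pair.AE_commute[OF this] 1] have 2: "AE x in lborel. AE s in lborel. (s, x) \<notin> N" .
  have i: "(s, x) \<notin> N \<Longrightarrow> Q (s, x)" for s x using N(2) by blast
  show "AE s in lborel. AE x in lborel. Q (s, x)" using 1 by eventually_elim (erule eventually_mono, erule i)
  show "AE x in lborel. AE s in lborel. Q (s, x)" using 2 by eventually_elim (erule eventually_mono, erule i)
qed

text \<open>Tonelli: null sections make a set null only once the set is known to be
  measurable.\<close>

lemma AE_lborel_prodI:
  fixes N :: "('a::euclidean_space \<times> 'b::euclidean_space) set"
  assumes N: "N \<in> sets borel" and ae: "AE s in lborel. AE x in lborel. (s, x) \<notin> N"
  shows "AE p in lborel. p \<notin> N"
proof -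
  have "AE p in lborel \<Otimes>\<^sub>M lborel. p \<notin> N"
  proof (rule lborel_pair.AE_pair_measure[OF _ ae])
    have "{p \<in> space (lborel \<Otimes>\<^sub>M lborel). p \<notin> N} = space (lborel \<Otimes>\<^sub>M lborel) - N" by auto
    moreover have "N \<in> sets (lborel \<Otimes>\<^sub>M lborel)" using N unfolding lborel_prod by simp
    ultimately show "{p \<in> space (lborel \<Otimes>\<^sub>M lborel). p \<notin> N} \<in> sets (lborel \<Otimes>\<^sub>M lborel)" using sets.compl_sets by metis
  qed
  then show ?thesis unfolding lborel_prod .
qed

text \<open>Completeness of Lebesgue measure. Along a flow \<open>v\<close> is known only to agree
  almost everywhere with a Borel function, and this already yields its measurability.\<close>

lemma lebesgue_cong_AE:
  fixes f g :: "'a::euclidean_space \<Rightarrow> 'b::euclidean_space"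
  assumes g: "g \<in> borel_measurable borel" and ae: "AE x in lborel. f x = g x"
  shows "f \<in> borel_measurable lebesgue" "(\<integral>x. f x \<partial>lebesgue) = (\<integral>x. g x \<partial>lborel)" "integrable lebesgue f \<longleftrightarrow> integrable lborel g"
proof -
  have gl: "g \<in> borel_measurable lebesgue" using g by (auto intro: measurable_completion)
  have ael: "AE x in lebesgue. f x = g x" by (rule AE_completion[OF ae])
  show fl: "f \<in> borel_measurable lebesgue"
  proof (rule measurableI)
    fix B :: "'b set" assume B: "B \<in> sets borel"
    show "f -` B \<inter> space lebesgue \<in> sets lebesgue"
    proof (rule completion.in_sets_AE)
      show "AE x in lebesgue. (x \<in> g -` B \<inter> space lebesgue) = (x \<in> f -` B \<inter> space lebesgue)" using ael by eventually_elim auto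
      show "g -` B \<inter> space lebesgue \<in> sets lebesgue" by (rule measurable_sets[OF gl B])
    qed auto
  qed simp
  have gb: "g \<in> borel_measurable lborel" using g by simp
  show "(\<integral>x. f x \<partial>lebesgue) = (\<integral>x. g x \<partial>lborel)" using integral_cong_AE[OF fl gl ael] integral_completion[OF gb] by simp
  show "integrable lebesgue f \<longleftrightarrow> integrable lborel g" using integrable_cong_AE[OF fl gl ael] integrable_completion[OF gb] by simp
qed

lemma integrable_lebesgue_on_AE:
  fixes f g :: "'a::euclidean_space \<Rightarrow> 'b::euclidean_space"
  assumes S: "S \<in> sets borel" and g: "set_integrable lborel S g" and ae: "AE x in lborel. x \<in> S \<longrightarrow> f x = g x"
  shows "integrable (lebesgue_on S) f"
proof -
  have i: "integrable lborel (\<lambda>x. indicator S x *\<^sub>R g x)" using g by (simp add: set_integrable_def)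
  have "integrable lebesgue (\<lambda>x. indicator S x *\<^sub>R f x)"
  proof (rule lebesgue_cong_AE(3)[THEN iffD2, OF _ _ i])
    show "(\<lambda>x. indicator S x *\<^sub>R g x) \<in> borel_measurable borel" using borel_measurable_integrable[OF i] by simp
    show "AE x in lborel. indicator S x *\<^sub>R f x = indicator S x *\<^sub>R g x" using ae by eventually_elim (auto simp: indicator_def)
  qed
  then show ?thesis using S by (subst integrable_restrict_space) auto
qed

lemma AE_lebesgue_on:
  assumes "S \<in> sets borel"
  shows "(AE x in lebesgue_on S. P x) \<longleftrightarrow> (AE x in lborel. x \<in> S \<longrightarrow> P x)"
  using assms by (subst AE_restrict_space_iff) (auto simp: AE_completion_iff)

section \<open>Borel versions on the space-time cylinder\<close>

definition slab_integrable :: "(real \<Rightarrow> 'a::euclidean_space \<Rightarrow> real) \<Rightarrow> bool" where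
  "slab_integrable F \<longleftrightarrow> jmeas F \<and> (\<forall>M. integrable lborel (\<lambda>p. indicator {-M..M} (fst p) * F (fst p) (snd p)))"

lemma slab_integrable_finite:
  assumes F: "slab_integrable F"
  shows "(\<integral>\<^sup>+r\<in>{-M..M}. \<integral>\<^sup>+x. ennreal \<bar>F r x\<bar> \<partial>lborel \<partial>lborel) < \<infinity>" "AE r in lborel. integrable lborel (F r)"
proof -
  have j: "jmeas F" and i: "\<And>M. integrable lborel (\<lambda>p. indicator {-M..M} (fst p) * F (fst p) (snd p))" using F by (auto simp: slab_integrable_def)
  note [measurable (raw)] = jmeasD[OF j]
  have "(\<integral>\<^sup>+r\<in>{-M..M}. \<integral>\<^sup>+x. ennreal \<bar>F r x\<bar> \<partial>lborel \<partial>lborel) = (\<integral>\<^sup>+r. \<integral>\<^sup>+x. ennreal \<bar>indicator {-M..M} r * F r x\<bar> \<partial>lborel \<partial>lborel)"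
    by (intro nn_integral_cong) (auto simp: indicator_def)
  also have "\<dots> = (\<integral>\<^sup>+p. ennreal \<bar>indicator {-M..M} (fst p) * F (fst p) (snd p)\<bar> \<partial>(lborel \<Otimes>\<^sub>M lborel))"
    using lborel.nn_integral_fst[of "\<lambda>p. ennreal \<bar>indicator {-M..M} (fst p) * F (fst p) (snd p)\<bar>" lborel] by simp
  also have "\<dots> < \<infinity>" using i[of M] by (simp add: integrable_iff_bounded lborel_prod)
  finally show "(\<integral>\<^sup>+r\<in>{-M..M}. \<integral>\<^sup>+x. ennreal \<bar>F r x\<bar> \<partial>lborel \<partial>lborel) < \<infinity>" .
  have "AE r in lborel. integrable lborel (\<lambda>x. indicator {-real n..real n} r * F r x)" for n
    using lborel_pair.AE_integrable_fst'[of "\<lambda>p. indicator {-real n..real n} (fst p) * F (fst p) (snd p)"] i[of "real n"] unfolding lborel_prod fst_conv snd_conv by blast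
  then have "AE r in lborel. \<forall>n. integrable lborel (\<lambda>x. indicator {-real n..real n} r * F r x)" unfolding AE_all_countable by blast
  then show "AE r in lborel. integrable lborel (F r)"
  proof eventually_elim
    case (elim r)
    obtain n :: nat where "\<bar>r\<bar> < real n" using reals_Archimedean2 by blast
    then have "r \<in> {-real n..real n}" by (auto simp: abs_less_iff)
    then show ?case using elim[rule_format, of n] by simp
  qed
qed

text \<open>Integrability is given on bounded time slabs, so measurability on the whole cylinder is
  obtained as a limit over growing slabs, and one Borel version serves all of them.\<close>

lemma slab_version_exists:
  fixes f :: "real \<times> 'a::euclidean_space \<Rightarrow> real"
  assumes \<Omega>: "open \<Omega>" and f: "\<And>T0 T1. T0 < T1 \<Longrightarrow> integrable (lebesgue_on ({T0..T1} \<times> \<Omega>)) f"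
  shows "f \<in> borel_measurable (lebesgue_on (UNIV \<times> \<Omega>))"
    and "\<exists>F. slab_integrable F \<and> (\<forall>t x. x \<notin> \<Omega> \<longrightarrow> F t x = 0) \<and> (AE p in lborel. p \<in> UNIV \<times> \<Omega> \<longrightarrow> F (fst p) (snd p) = f p)"
proof -
  have Sb: "UNIV \<times> \<Omega> \<in> sets (borel :: (real \<times> 'a) measure)" by (rule borel_open[OF open_Times[OF open_UNIV \<Omega>]])
  have \<Omega>b: "\<Omega> \<in> sets borel" using \<Omega> by simp
  have Tb: "{a..b} \<times> \<Omega> \<in> sets (borel :: (real \<times> 'a) measure)" for a b
    unfolding borel_prod[symmetric] using \<Omega>b by auto
  have "(\<lambda>p. indicator (UNIV \<times> \<Omega>) p *\<^sub>R f p) \<in> borel_measurable lebesgue"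
  proof (rule borel_measurable_LIMSEQ_metric)
    show "(\<lambda>p. indicator ({- real (Suc n)..real (Suc n)} \<times> \<Omega>) p *\<^sub>R f p) \<in> borel_measurable lebesgue" for n
    proof -
      have "f \<in> borel_measurable (lebesgue_on ({- real (Suc n)..real (Suc n)} \<times> \<Omega>))" by (rule borel_measurable_integrable[OF f]) simp
      then show ?thesis using Tb[of "- real (Suc n)" "real (Suc n)"]
        by (subst (asm) borel_measurable_restrict_space_iff) (auto simp: mult.commute)
    qed
    fix p :: "real \<times> 'a"
    obtain k :: nat where k: "\<bar>fst p\<bar> < real k" using reals_Archimedean2 by blast
    have "\<forall>\<^sub>F n in sequentially. indicator ({- real (Suc n)..real (Suc n)} \<times> \<Omega>) p *\<^sub>R f p = indicator (UNIV \<times> \<Omega>) p *\<^sub>R f p"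
      using eventually_ge_at_top[of k]
    proof eventually_elim
      case (elim n)
      then have "real k \<le> real (Suc n)" by simp
      then have "- real (Suc n) \<le> fst p" "fst p \<le> real (Suc n)" using k by linarith+
      then show ?case by (auto simp: indicator_def mem_Times_iff)
    qed
    then show "(\<lambda>n. indicator ({- real (Suc n)..real (Suc n)} \<times> \<Omega>) p *\<^sub>R f p) \<longlonglongrightarrow> indicator (UNIV \<times> \<Omega>) p *\<^sub>R f p"
      by (rule tendsto_eventually)
  qed
  then show fm: "f \<in> borel_measurable (lebesgue_on (UNIV \<times> \<Omega>))"
    using Sb by (subst borel_measurable_restrict_space_iff) (auto simp: mult.commute)
  obtain F where Fm: "F \<in> borel_measurable borel" and F0: "\<And>p. p \<notin> UNIV \<times> \<Omega> \<Longrightarrow> F p = 0" and Fae: "AE p in lborel. p \<in> UNIV \<times> \<Omega> \<longrightarrow> F p = f p"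
    using borel_version_exists[OF Sb fm] by blast
  have ind: "(\<lambda>p::real \<times> 'a. indicator {-M..M} (fst p) :: real) \<in> borel_measurable borel" for M
    unfolding borel_prod[symmetric] by measurable
  have i: "integrable lborel (\<lambda>p. indicator {-M..M} (fst p) * F p)" if "0 < M" for M
  proof (rule borel_version_integral(2)[THEN iffD1, OF Tb[of "-M" M]])
    show fi: "integrable (lebesgue_on ({-M..M} \<times> \<Omega>)) f" using f that by simp
    show "f \<in> borel_measurable (lebesgue_on ({-M..M} \<times> \<Omega>))" using fi by simp
    show "(\<lambda>p. indicator {-M..M} (fst p) * F p) \<in> borel_measurable borel" using ind Fm by (rule borel_measurable_times)
    show "indicator {-M..M} (fst p) * F p = 0" if "p \<notin> {-M..M} \<times> \<Omega>" for p
      using that F0[of p] by (auto simp: indicator_def mem_Times_iff)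
    show "AE p in lborel. p \<in> {-M..M} \<times> \<Omega> \<longrightarrow> indicator {-M..M} (fst p) * F p = f p"
      using Fae by eventually_elim (auto simp: indicator_def)
  qed
  have "integrable lborel (\<lambda>p. indicator {-M..M} (fst p) * F p)" for M
  proof -
    have "integrable lborel (\<lambda>p. (indicator {-(max 1 M)..max 1 M} (fst p) * F p) * indicator {-M..M} (fst p))"
      by (rule integrable_mult_bounded[OF i ind]) (auto intro!: exI[of _ 1] simp: indicator_def)
    moreover have "(indicator {-(max 1 M)..max 1 M} (fst p) * F p) * indicator {-M..M} (fst p) = indicator {-M..M} (fst p) * F p" for p
      by (auto simp: indicator_def)
    ultimately show ?thesis by simp
  qed
  then have "slab_integrable (\<lambda>t x. F (t, x))" using Fm unfolding slab_integrable_def jmeas_def by (simp add: borel_prod)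
  moreover have "\<forall>t x. x \<notin> \<Omega> \<longrightarrow> F (t, x) = 0" using F0 by auto
  ultimately show "\<exists>F. slab_integrable F \<and> (\<forall>t x. x \<notin> \<Omega> \<longrightarrow> F t x = 0) \<and> (AE p in lborel. p \<in> UNIV \<times> \<Omega> \<longrightarrow> F (fst p) (snd p) = f p)"
    using Fae by (intro exI[of _ "\<lambda>t x. F (t, x)"]) simp
qed

lemma weak_partial_slab:
  fixes f g :: "real \<times> 'a::euclidean_space \<Rightarrow> real"
  assumes \<Omega>: "open \<Omega>" and w: "weak_partial (UNIV \<times> \<Omega>) f (0, e) g" and e: "e \<in> Basis"
    and f: "f \<in> borel_measurable (lebesgue_on (UNIV \<times> \<Omega>))" and g: "g \<in> borel_measurable (lebesgue_on (UNIV \<times> \<Omega>))"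
    and F: "slab_integrable F" "\<And>t x. x \<notin> \<Omega> \<Longrightarrow> F t x = 0" "AE p in lborel. p \<in> UNIV \<times> \<Omega> \<longrightarrow> F (fst p) (snd p) = f p"
    and G: "slab_integrable G" "\<And>t x. x \<notin> \<Omega> \<Longrightarrow> G t x = 0" "AE p in lborel. p \<in> UNIV \<times> \<Omega> \<longrightarrow> G (fst p) (snd p) = g p"
  shows "AE t in lborel. \<forall>a\<in>rat_points. \<forall>b\<in>rat_points. \<forall>n. cbox a b \<subseteq> \<Omega> \<longrightarrow>
    (\<integral>x. F t x * partial (bump (1 / real (Suc n)) a b) e x + G t x * bump (1 / real (Suc n)) a b x \<partial>lborel) = 0"
proof -
  have Sb: "UNIV \<times> \<Omega> \<in> sets (borel :: (real \<times> 'a) measure)" by (rule borel_open[OF open_Times[OF open_UNIV \<Omega>]])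
  have hm: "h \<in> borel_measurable (lebesgue_on (UNIV \<times> \<Omega>))" if "h \<in> borel_measurable borel" for h :: "real \<times> 'a \<Rightarrow> real"
    by (rule measurable_restrict_space1) (use that in \<open>auto intro: measurable_completion\<close>)
  have Fm: "(\<lambda>p. F (fst p) (snd p)) \<in> borel_measurable borel" and Gm: "(\<lambda>p. G (fst p) (snd p)) \<in> borel_measurable borel"
    using F(1) G(1) by (auto simp: slab_integrable_def jmeas_def borel_prod)
  have e': "(0, e) \<in> Basis" using e by (auto simp: Basis_prod_def)
  show ?thesis
  proof (rule weak_partial_slices[OF _ _ _ _ e])
    show "jmeas F" "jmeas G" using F(1) G(1) by (auto simp: slab_integrable_def)
    show "\<And>M. integrable lborel (\<lambda>p. indicator {-M..M} (fst p) * F (fst p) (snd p))" "\<And>M. integrable lborel (\<lambda>p. indicator {-M..M} (fst p) * G (fst p) (snd p))"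
      using F(1) G(1) by (auto simp: slab_integrable_def)
    fix \<phi> :: "real \<times> 'a \<Rightarrow> real" assume t: "test_fun (UNIV \<times> \<Omega>) \<phi>"
    note tm = test_fun_measurable(1)[OF t] test_fun_measurable(2)[OF t e']
    have "(\<integral>p. f p * partial \<phi> (0, e) p \<partial>lebesgue_on (UNIV \<times> \<Omega>)) = (\<integral>p. F (fst p) (snd p) * partial \<phi> (0, e) p \<partial>lborel)"
    proof (rule borel_version_integral(1)[OF Sb])
      show "(\<lambda>p. f p * partial \<phi> (0, e) p) \<in> borel_measurable (lebesgue_on (UNIV \<times> \<Omega>))" by (rule borel_measurable_times[OF f hm[OF tm(2)]])
      show "(\<lambda>p. F (fst p) (snd p) * partial \<phi> (0, e) p) \<in> borel_measurable borel" by (rule borel_measurable_times[OF Fm tm(2)])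
      show "AE p in lborel. p \<in> UNIV \<times> \<Omega> \<longrightarrow> F (fst p) (snd p) * partial \<phi> (0, e) p = f p * partial \<phi> (0, e) p" using F(3) by eventually_elim simp
    qed (auto simp: F(2) mem_Times_iff)
    moreover have "(\<integral>p. g p * \<phi> p \<partial>lebesgue_on (UNIV \<times> \<Omega>)) = (\<integral>p. G (fst p) (snd p) * \<phi> p \<partial>lborel)"
    proof (rule borel_version_integral(1)[OF Sb])
      show "(\<lambda>p. g p * \<phi> p) \<in> borel_measurable (lebesgue_on (UNIV \<times> \<Omega>))" by (rule borel_measurable_times[OF g hm[OF tm(1)]])
      show "(\<lambda>p. G (fst p) (snd p) * \<phi> p) \<in> borel_measurable borel" by (rule borel_measurable_times[OF Gm tm(1)])
      show "AE p in lborel. p \<in> UNIV \<times> \<Omega> \<longrightarrow> G (fst p) (snd p) * \<phi> p = g p * \<phi> p" using G(3) by eventually_elim simp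
    qed (auto simp: G(2) mem_Times_iff)
    moreover have "(\<integral>p. f p * partial \<phi> (0, e) p \<partial>lebesgue_on (UNIV \<times> \<Omega>)) = - (\<integral>p. g p * \<phi> p \<partial>lebesgue_on (UNIV \<times> \<Omega>))"
      using w t unfolding weak_partial_def by blast
    ultimately show "(\<integral>p. F (fst p) (snd p) * partial \<phi> (0, e) p \<partial>lborel) = - (\<integral>p. G (fst p) (snd p) * \<phi> p \<partial>lborel)" by simp
  qed
qed

lemma W11_zero: "W11 (\<lambda>x. 0) (\<lambda>x. 0)"
  unfolding W11_def
proof (intro conjI allI impI)
  fix \<eta> :: real assume "0 < \<eta>"
  show "\<exists>\<phi> \<psi>. has_grad \<phi> \<psi> \<and> compact_supp \<phi> \<and> compact_supp \<psi> \<and> (\<integral>\<^sup>+x. ennreal \<bar>0 - \<phi> x\<bar> \<partial>lborel) \<le> ennreal \<eta> \<and>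
     (\<integral>\<^sup>+x. ennreal (norm (0 - \<psi> x)) \<partial>lborel) \<le> ennreal \<eta>"
    by (intro exI[of _ "\<lambda>x. 0"]) (auto simp: has_grad_def compact_supp_def)
qed auto

lemma Basis_vec_eq: "(Basis :: (real^'n) set) = range (\<lambda>i. axis i 1)"
  by (auto simp: Basis_vec_def)

lemma sum_Basis_vec: "(\<Sum>e\<in>(Basis :: (real^'n) set). f e) = (\<Sum>i\<in>UNIV. f (axis i 1))"
  unfolding Basis_vec_eq by (subst sum.reindex) (auto simp: inj_on_def axis_eq_axis)

lemma AE_div_Linf:
  assumes \<Omega>: "open \<Omega>" and fin: "div_Linf \<Omega> Dv t = ennreal d" "0 \<le> d"
  shows "AE x in lborel. x \<in> \<Omega> \<longrightarrow> \<bar>divergence Dv t x\<bar> \<le> d"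
proof -
  let ?E = "esssup (lebesgue_on \<Omega>) (\<lambda>x. ereal \<bar>divergence Dv t x\<bar>)"
  have "?E \<le> ereal d"
  \<comment> \<open>Over the empty set the essential supremum is -\<infinity>, which
    \<open>e2ennreal\<close> turns into 0; hence the distinction.\<close>
  proof (cases "0 \<le> ?E")
    case True
    then have "?E = enn2ereal (ennreal d)" using fin(1) enn2ereal_e2ennreal[OF True] by (simp add: div_Linf_def)
    then show ?thesis using fin(2) by (simp add: enn2ereal_ennreal)
  next
    case False
    then have "?E \<le> 0" by simp
    also have "0 \<le> ereal d" using fin(2) by simp
    finally show ?thesis .
  qed
  then have i: "ereal \<bar>divergence Dv t x\<bar> \<le> ?E \<Longrightarrow> \<bar>divergence Dv t x\<bar> \<le> d" for x
    using order_trans[of "ereal \<bar>divergence Dv t x\<bar>" ?E "ereal d"] by simp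
  have "AE x in lebesgue_on \<Omega>. \<bar>divergence Dv t x\<bar> \<le> d"
    using esssup_AE[of "\<lambda>x. ereal \<bar>divergence Dv t x\<bar>" "lebesgue_on \<Omega>"] by eventually_elim (rule i)
  then show ?thesis using \<Omega> by (simp add: AE_lebesgue_on)
qed

section \<open>The velocity field of the theorem\<close>

text \<open>Passes from the given \<open>v\<close> and \<open>Dv\<close> to one jointly Borel field
  whose slices are all regular. \<open>D\<close> agrees with the essential supremum of the
  divergence at almost every time instead of merely dominating it, so that the compression factor is
  exactly the constant of the theorem.\<close>

lemma velocity_field_exists:
  assumes sa: "standing_assumptions \<Omega> v Dv"
  shows "\<exists>u A D. sobolev_field_all_times u A D \<and> (\<forall>r x. x \<notin> \<Omega> \<longrightarrow> u r x = 0) \<and>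
    (AE p in lborel. p \<in> UNIV \<times> \<Omega> \<longrightarrow> u (fst p) (snd p) = v (fst p) (snd p)) \<and> (AE r in lborel. div_Linf \<Omega> Dv r = ennreal (D r))"
proof -
  have \<Omega>: "open \<Omega>" and vi: "\<And>i T0 T1. T0 < T1 \<Longrightarrow> integrable (lebesgue_on ({T0..T1} \<times> \<Omega>)) (\<lambda>p. v (fst p) (snd p) $ i)"
    and wp: "\<And>i j. weak_partial (UNIV \<times> \<Omega>) (\<lambda>p. v (fst p) (snd p) $ i) (0, axis j 1) (\<lambda>p. Dv (fst p) (snd p) $ i $ j)"
    and Dvi: "\<And>i j T0 T1. T0 < T1 \<Longrightarrow> integrable (lebesgue_on ({T0..T1} \<times> \<Omega>)) (\<lambda>p. Dv (fst p) (snd p) $ i $ j)"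
    and w0: "AE t in lebesgue. \<forall>i. W110 \<Omega> (\<lambda>x. v t x $ i)"
    and dm: "div_Linf \<Omega> Dv \<in> borel_measurable lebesgue"
    and df: "\<And>T0 T1. T0 < T1 \<Longrightarrow> (\<integral>\<^sup>+ t \<in> {T0..T1}. div_Linf \<Omega> Dv t \<partial>lebesgue) < \<infinity>"
    using sa unfolding standing_assumptions_def by blast+
  have "\<forall>i. \<exists>F. slab_integrable F \<and> (\<forall>t x. x \<notin> \<Omega> \<longrightarrow> F t x = 0) \<and> (AE p in lborel. p \<in> UNIV \<times> \<Omega> \<longrightarrow> F (fst p) (snd p) = v (fst p) (snd p) $ i)"
    using slab_version_exists(2)[OF \<Omega> vi] by blast
  from choice[OF this] obtain V where V: "\<forall>i. slab_integrable (V i) \<and> (\<forall>t x. x \<notin> \<Omega> \<longrightarrow> V i t x = 0) \<and> (AE p in lborel. p \<in> UNIV \<times> \<Omega> \<longrightarrow> V i (fst p) (snd p) = v (fst p) (snd p) $ i)" ..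
  have V1: "slab_integrable (V i)" and V2: "\<And>t x. x \<notin> \<Omega> \<Longrightarrow> V i t x = 0"
    and V3: "AE p in lborel. p \<in> UNIV \<times> \<Omega> \<longrightarrow> V i (fst p) (snd p) = v (fst p) (snd p) $ i" for i using V[rule_format, of i] by auto
  have "\<forall>q. \<exists>F. slab_integrable F \<and> (\<forall>t x. x \<notin> \<Omega> \<longrightarrow> F t x = 0) \<and> (AE p in lborel. p \<in> UNIV \<times> \<Omega> \<longrightarrow> F (fst p) (snd p) = Dv (fst p) (snd p) $ fst q $ snd q)"
    using slab_version_exists(2)[OF \<Omega> Dvi] by blast
  from choice[OF this] obtain G where G: "\<forall>q. slab_integrable (G q) \<and> (\<forall>t x. x \<notin> \<Omega> \<longrightarrow> G q t x = 0) \<and> (AE p in lborel. p \<in> UNIV \<times> \<Omega> \<longrightarrow> G q (fst p) (snd p) = Dv (fst p) (snd p) $ fst q $ snd q)" ..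
  have G1: "slab_integrable (G q)" and G2: "\<And>t x. x \<notin> \<Omega> \<Longrightarrow> G q t x = 0"
    and G3: "AE p in lborel. p \<in> UNIV \<times> \<Omega> \<longrightarrow> G q (fst p) (snd p) = Dv (fst p) (snd p) $ fst q $ snd q" for q using G[rule_format, of q] by auto
  have Vj: "jmeas (V i)" and Gj: "jmeas (G q)" for i q using V1[of i] G1[of q] by (auto simp: slab_integrable_def)
  note [measurable (raw)] = jmeasD[OF Vj] jmeasD[OF Gj]

  \<comment> \<open>The gradient of the component \<open>i\<close>, assembled from the Borel
    versions of its partial derivatives.\<close>
  define gr where "gr i t x = (\<Sum>j\<in>UNIV. G (i, j) t x *\<^sub>R axis j (1::real))" for i t x
  have gri: "gr i t x \<bullet> axis j 1 = G (i, j) t x" for i j t x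
    by (simp add: gr_def inner_sum_left inner_axis_axis if_distrib cong: if_cong)
  have grj: "jmeas (gr i)" for i unfolding jmeas_def gr_def by measurable
  note [measurable (raw)] = jmeasD[OF grj]

  have W: "AE t in lborel. \<forall>q\<in>UNIV. \<forall>a\<in>rat_points. \<forall>b\<in>rat_points. \<forall>n. cbox a b \<subseteq> \<Omega> \<longrightarrow>
    (\<integral>x. V (fst q) t x * partial (bump (1 / real (Suc n)) a b) (axis (snd q) 1) x + G q t x * bump (1 / real (Suc n)) a b x \<partial>lborel) = 0"
  proof (rule AE_finite_allI)
    fix q :: "3 \<times> 3"
    show "AE t in lborel. \<forall>a\<in>rat_points. \<forall>b\<in>rat_points. \<forall>n. cbox a b \<subseteq> \<Omega> \<longrightarrow>
      (\<integral>x. V (fst q) t x * partial (bump (1 / real (Suc n)) a b) (axis (snd q) 1) x + G q t x * bump (1 / real (Suc n)) a b x \<partial>lborel) = 0"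
      by (rule weak_partial_slab[OF \<Omega> wp[of "fst q" "snd q"] _ slab_version_exists(1)[OF \<Omega> vi] slab_version_exists(1)[OF \<Omega> Dvi] V1 V2 V3 G1 G2 G3])
        (auto simp: Basis_vec_def)
  qed simp
  have Vs: "AE t in lborel. \<forall>i\<in>UNIV. AE x in lborel. x \<in> \<Omega> \<longrightarrow> V i t x = v t x $ i"
    using AE_lborel_prod_slices(1)[OF V3] by (intro AE_finite_allI) auto
  have Gs: "AE t in lborel. \<forall>q\<in>UNIV. AE x in lborel. x \<in> \<Omega> \<longrightarrow> G q t x = Dv t x $ fst q $ snd q"
    using AE_lborel_prod_slices(1)[OF G3] by (intro AE_finite_allI) auto
  have Gint: "AE t in lborel. \<forall>q\<in>UNIV. integrable lborel (G q t)"
    using slab_integrable_finite(2)[OF G1] by (intro AE_finite_allI) auto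
  have grad: "AE t in lborel. \<forall>i. W11 (V i t) (gr i t)"
    using W Vs Gint w0[unfolded AE_completion_iff]
  proof eventually_elim
    case (elim t)
    show ?case
    proof
      fix i
      show "W11 (V i t) (gr i t)"
      proof (rule W110_imp_W11[OF \<Omega>, of "\<lambda>x. v t x $ i"])
        show "W110 \<Omega> (\<lambda>x. v t x $ i)" using elim(4) by blast
        show "V i t \<in> borel_measurable borel" by measurable
        show "AE x in lborel. x \<in> \<Omega> \<longrightarrow> V i t x = v t x $ i" using elim(2) by blast
        show "integrable lborel (gr i t)" unfolding gr_def using elim(3) by (intro Bochner_Integration.integrable_sum Bochner_Integration.integrable_scaleR_left) auto
        fix a b :: "real^3" and n :: nat and e :: "real^3" assume ab: "a \<in> rat_points" "b \<in> rat_points" "cbox a b \<subseteq> \<Omega>" and "e \<in> Basis"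
        then obtain j where e: "e = axis j 1" by (auto simp: Basis_vec_def)
        show "(\<integral>x. V i t x * partial (bump (1 / real (Suc n)) a b) e x + (gr i t x \<bullet> e) * bump (1 / real (Suc n)) a b x \<partial>lborel) = 0"
          using elim(1)[rule_format, of "(i, j)" a b n] ab unfolding e gri by simp
      qed (simp_all add: V2 gr_def G2)
    qed
  qed

  obtain d' where d'm[measurable]: "d' \<in> borel_measurable borel" and d'ae: "AE t in lborel. div_Linf \<Omega> Dv t = d' t"
    using completion_ex_borel_measurable[OF dm] by auto
  have d'f: "(\<integral>\<^sup>+t\<in>{-T..T}. d' t \<partial>lborel) < \<infinity>" for T
  proof -
    have pos: "(\<integral>\<^sup>+t\<in>{-T..T}. d' t \<partial>lborel) < \<infinity>" if "0 < T" for T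
    proof -
      have "(\<integral>\<^sup>+t\<in>{-T..T}. d' t \<partial>lborel) = (\<integral>\<^sup>+t\<in>{-T..T}. d' t \<partial>lebesgue)" by (rule nn_integral_completion[symmetric])
      also have "\<dots> = (\<integral>\<^sup>+t\<in>{-T..T}. div_Linf \<Omega> Dv t \<partial>lebesgue)"
      proof (rule nn_integral_cong_AE)
        show "AE t in lebesgue. d' t * indicator {-T..T} t = div_Linf \<Omega> Dv t * indicator {-T..T} t"
          using AE_completion[OF d'ae] by eventually_elim simp
      qed
      also have "\<dots> < \<infinity>" using df[of "-T" T] that by simp
      finally show ?thesis .
    qed
    have "(\<integral>\<^sup>+t\<in>{-T..T}. d' t \<partial>lborel) \<le> (\<integral>\<^sup>+t\<in>{-(max 1 T)..max 1 T}. d' t \<partial>lborel)"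
      by (intro nn_integral_mono) (auto simp: indicator_def)
    then show ?thesis using pos[of "max 1 T"] by (simp add: le_less_trans)
  qed
  \<comment> \<open>Integrability on bounded intervals makes \<open>d'\<close> finite at almost
    every time, so it may be replaced by a real function.\<close>
  have "AE t in lborel. \<forall>n. d' t * indicator {-real n..real n} t \<noteq> \<infinity>"
    unfolding AE_all_countable by (intro allI nn_integral_noteq_infinite) (use d'f in \<open>auto simp: less_top\<close>)
  then have d'fin: "AE t in lborel. d' t < top"
  proof eventually_elim
    case (elim t)
    obtain n :: nat where "\<bar>t\<bar> < real n" using reals_Archimedean2 by blast
    then have "t \<in> {-real n..real n}" by (auto simp: abs_less_iff)
    then show ?case using elim[rule_format, of n] by (simp add: less_top)
  qed
  define D0 where "D0 t = enn2real (d' t)" for t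
  have D0m[measurable]: "D0 \<in> borel_measurable borel" unfolding D0_def by measurable
  have D0nn: "0 \<le> D0 t" for t by (simp add: D0_def)
  have D0eq: "AE t in lborel. div_Linf \<Omega> Dv t = ennreal (D0 t)" using d'ae d'fin by eventually_elim (simp add: D0_def)
  have D0le: "ennreal (D0 t) \<le> d' t" for t unfolding D0_def by (cases "d' t") auto
  have div: "AE t in lborel. AE x in lborel. \<bar>\<Sum>i\<in>UNIV. G (i, i) t x\<bar> \<le> D0 t"
    using D0eq Gs
  proof eventually_elim
    case (elim t)
    have "AE x in lborel. \<forall>q\<in>UNIV. x \<in> \<Omega> \<longrightarrow> G q t x = Dv t x $ fst q $ snd q" using elim(2) by (intro AE_finite_allI) auto
    then show ?case using AE_div_Linf[OF \<Omega> elim(1) D0nn]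
    proof eventually_elim
      case (elim x)
      show ?case
      proof (cases "x \<in> \<Omega>")
        case True
        then have "G (i, i) t x = Dv t x $ i $ i" for i using elim(1) by auto
        then show ?thesis using elim(2) True by (simp add: divergence_def)
      qed (simp add: G2 D0nn)
    qed
  qed

  define good where "good t \<longleftrightarrow> (\<forall>i. W11 (V i t) (gr i t)) \<and> (AE x in lborel. \<bar>\<Sum>i\<in>UNIV. G (i, i) t x\<bar> \<le> D0 t)" for t
  have "AE t in lborel. good t" using grad div by eventually_elim (simp add: good_def)
  then obtain N where N: "N \<in> null_sets lborel" "{t. \<not> good t} \<subseteq> N" by (auto simp: eventually_ae_filter)
  have Nm[measurable]: "N \<in> sets borel" using null_setsD2[OF N(1)] by simp
  have gd: "good t" if "t \<notin> N" for t using that N(2) by blast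
  have Nae: "AE t in lborel. t \<notin> N" by (rule AE_not_in[OF N(1)])
  define a where "a t = (\<Sum>i\<in>UNIV. \<integral>\<^sup>+x. norm (gr i t x) \<partial>lborel)" for t
  have am[measurable]: "a \<in> borel_measurable borel" unfolding a_def by measurable
  \<comment> \<open>Setting \<open>u\<close> to zero at the exceptional times makes every slice regular.\<close>
  define u where "u t x = (if t \<in> N then 0 else \<Sum>i\<in>UNIV. V i t x *\<^sub>R axis i (1::real))" for t x
  define A where "A t = (if t \<in> N then 0 else enn2real (a t))" for t
  define D where "D t = (if t \<in> N then 0 else D0 t)" for t
  have uj: "jmeas u" unfolding jmeas_def u_def by measurable
  have Am: "A \<in> borel_measurable borel" unfolding A_def by measurable
  have Dm: "D \<in> borel_measurable borel" unfolding D_def by measurable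
  have grle: "(\<integral>\<^sup>+r\<in>{-T..T}. a r \<partial>lborel) < \<infinity>" for T
  proof -
    have "(\<integral>\<^sup>+r\<in>{-T..T}. a r \<partial>lborel) \<le> (\<integral>\<^sup>+r. (\<Sum>i\<in>UNIV. \<Sum>j\<in>UNIV. (\<integral>\<^sup>+x. ennreal \<bar>G (i, j) r x\<bar> \<partial>lborel) * indicator {-T..T} r) \<partial>lborel)"
    proof (rule nn_integral_mono)
      fix r
      have "a r \<le> (\<Sum>i\<in>UNIV. \<Sum>j\<in>UNIV. \<integral>\<^sup>+x. ennreal \<bar>G (i, j) r x\<bar> \<partial>lborel)"
        unfolding a_def
      proof (rule sum_mono)
        fix i
        have "(\<integral>\<^sup>+x. norm (gr i r x) \<partial>lborel) \<le> (\<integral>\<^sup>+x. (\<Sum>j\<in>UNIV. ennreal \<bar>G (i, j) r x\<bar>) \<partial>lborel)"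
        proof (rule nn_integral_mono)
          fix x
          have "norm (gr i r x) \<le> (\<Sum>j\<in>UNIV. \<bar>G (i, j) r x\<bar>)" unfolding gr_def by (rule order_trans[OF norm_sum]) simp
          then show "ennreal (norm (gr i r x)) \<le> (\<Sum>j\<in>UNIV. ennreal \<bar>G (i, j) r x\<bar>)" by (subst sum_ennreal) (auto intro: ennreal_leI)
        qed
        also have "\<dots> = (\<Sum>j\<in>UNIV. \<integral>\<^sup>+x. ennreal \<bar>G (i, j) r x\<bar> \<partial>lborel)" by (rule nn_integral_sum) measurable
        finally show "(\<integral>\<^sup>+x. norm (gr i r x) \<partial>lborel) \<le> (\<Sum>j\<in>UNIV. \<integral>\<^sup>+x. ennreal \<bar>G (i, j) r x\<bar> \<partial>lborel)" .
      qed
      then show "a r * indicator {-T..T} r \<le> (\<Sum>i\<in>UNIV. \<Sum>j\<in>UNIV. (\<integral>\<^sup>+x. ennreal \<bar>G (i, j) r x\<bar> \<partial>lborel) * indicator {-T..T} r)"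
        by (auto simp: indicator_def)
    qed
    also have "\<dots> = (\<Sum>i\<in>UNIV. \<Sum>j\<in>UNIV. \<integral>\<^sup>+r\<in>{-T..T}. (\<integral>\<^sup>+x. ennreal \<bar>G (i, j) r x\<bar> \<partial>lborel) \<partial>lborel)"
      by (subst nn_integral_sum, measurable, subst nn_integral_sum, measurable)
    also have "\<dots> < \<infinity>" using slab_integrable_finite(1)[OF G1] by (auto simp: less_top)
    finally show ?thesis .
  qed
  have uf: "(\<integral>\<^sup>+r\<in>{-T..T}. \<integral>\<^sup>+x. norm (u r x) \<partial>lborel \<partial>lborel) < \<infinity>" for T
  proof -
    have "(\<integral>\<^sup>+r\<in>{-T..T}. \<integral>\<^sup>+x. norm (u r x) \<partial>lborel \<partial>lborel) \<le> (\<integral>\<^sup>+r. (\<Sum>i\<in>UNIV. (\<integral>\<^sup>+x. ennreal \<bar>V i r x\<bar> \<partial>lborel) * indicator {-T..T} r) \<partial>lborel)"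
    proof (rule nn_integral_mono)
      fix r
      have "(\<integral>\<^sup>+x. norm (u r x) \<partial>lborel) \<le> (\<integral>\<^sup>+x. (\<Sum>i\<in>UNIV. ennreal \<bar>V i r x\<bar>) \<partial>lborel)"
      proof (rule nn_integral_mono)
        fix x
        have "norm (\<Sum>i\<in>UNIV. V i r x *\<^sub>R axis i (1::real)) \<le> (\<Sum>i\<in>UNIV. \<bar>V i r x\<bar>)" by (rule order_trans[OF norm_sum]) simp
        then have "norm (u r x) \<le> (\<Sum>i\<in>UNIV. \<bar>V i r x\<bar>)" by (auto simp: u_def intro: sum_nonneg)
        then show "ennreal (norm (u r x)) \<le> (\<Sum>i\<in>UNIV. ennreal \<bar>V i r x\<bar>)" by (subst sum_ennreal) (auto intro: ennreal_leI)
      qed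
      also have "\<dots> = (\<Sum>i\<in>UNIV. \<integral>\<^sup>+x. ennreal \<bar>V i r x\<bar> \<partial>lborel)" by (rule nn_integral_sum) measurable
      finally show "(\<integral>\<^sup>+x. norm (u r x) \<partial>lborel) * indicator {-T..T} r \<le> (\<Sum>i\<in>UNIV. (\<integral>\<^sup>+x. ennreal \<bar>V i r x\<bar> \<partial>lborel) * indicator {-T..T} r)"
        by (auto simp: indicator_def)
    qed
    also have "\<dots> = (\<Sum>i\<in>UNIV. \<integral>\<^sup>+r\<in>{-T..T}. (\<integral>\<^sup>+x. ennreal \<bar>V i r x\<bar> \<partial>lborel) \<partial>lborel)"
      by (rule nn_integral_sum) measurable
    also have "\<dots> < \<infinity>" using slab_integrable_finite(1)[OF V1] by (auto simp: less_top)
    finally show ?thesis .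
  qed
  have sl: "slice (u r) (A r) (D r)" for r
  proof (cases "r \<in> N")
    case True
    then show ?thesis unfolding slice_def by (intro exI[of _ "\<lambda>e x. 0"]) (simp add: u_def A_def D_def W11_zero)
  next
    case False
    have g: "good r" by (rule gd[OF False])
    \<comment> \<open>\<open>slice\<close> indexes gradients by basis vectors rather than by
      coordinates; the linear extension reduces to \<open>gr i\<close> at
      \<open>axis i 1\<close>.\<close>
    define g where "g e x = (\<Sum>k\<in>UNIV. (e $ k) *\<^sub>R gr k r x)" for e :: "real^3" and x
    have gax: "g (axis i 1) = gr i r" for i
      by (simp add: g_def axis_def if_distrib[of "\<lambda>c. c *\<^sub>R _"] fun_eq_iff cong: if_cong)
    have uax: "u r x \<bullet> axis i 1 = V i r x" for x i
      using False by (simp add: u_def inner_sum_left inner_axis_axis if_distrib cong: if_cong)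
    have "(\<integral>\<^sup>+x. norm (gr i r x) \<partial>lborel) < \<infinity>" for i using g unfolding good_def W11_def integrable_iff_bounded by blast
    then have "a r < top" by (simp add: a_def less_top)
    then have Ar: "ennreal (A r) = a r" using False by (simp add: A_def)
    show ?thesis
      unfolding slice_def
    proof (intro exI[of _ g] conjI ballI)
      fix e :: "real^3" assume "e \<in> Basis"
      then obtain i where e: "e = axis i 1" by (auto simp: Basis_vec_def)
      show "W11 (\<lambda>x. u r x \<bullet> e) (g e)" unfolding e uax gax using g by (simp add: good_def)
      show "(\<integral>\<^sup>+x. norm (g e x) \<partial>lborel) \<le> ennreal (A r)" unfolding e gax Ar a_def by (rule member_le_sum) auto
    next
      show "AE x in lborel. \<bar>\<Sum>e\<in>Basis. g e x \<bullet> e\<bar> \<le> D r"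
        using g False by (simp add: good_def sum_Basis_vec gax gri D_def)
    qed
  qed
  have "sobolev_field_all_times u A D"
  proof
    show "0 \<le> A r" "0 \<le> D r" for r by (auto simp: A_def D_def D0nn)
    show "(\<integral>\<^sup>+r\<in>{-T..T}. A r \<partial>lborel) < \<infinity>" for T
    proof (rule le_less_trans[OF nn_integral_mono grle[of T]])
      show "ennreal (A r) * indicator {-T..T} r \<le> a r * indicator {-T..T} r" for r
        by (cases "a r") (auto simp: A_def indicator_def)
    qed
    show "(\<integral>\<^sup>+r\<in>{-T..T}. D r \<partial>lborel) < \<infinity>" for T
    proof (rule le_less_trans[OF nn_integral_mono d'f[of T]])
      show "ennreal (D r) * indicator {-T..T} r \<le> d' r * indicator {-T..T} r" for r
        using D0le[of r] by (auto simp: D_def indicator_def)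
    qed
  qed (fact uj Am Dm uf sl)+
  moreover have "\<forall>r x. x \<notin> \<Omega> \<longrightarrow> u r x = 0" by (simp add: u_def V2)
  moreover have "AE p in lborel. p \<in> UNIV \<times> \<Omega> \<longrightarrow> u (fst p) (snd p) = v (fst p) (snd p)"
  proof -
    have V': "AE p in lborel. \<forall>i\<in>UNIV. p \<in> UNIV \<times> \<Omega> \<longrightarrow> V i (fst p) (snd p) = v (fst p) (snd p) $ i" using V3 by (intro AE_finite_allI) auto
    have NU: "N \<times> (UNIV :: (real^3) set) \<in> sets borel" unfolding borel_prod[symmetric] using Nm by auto
    have "AE p in lborel. p \<notin> N \<times> (UNIV :: (real^3) set)" by (rule AE_lborel_prodI[OF NU]) (use Nae in auto)
    with V' show ?thesis
    proof eventually_elim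
      case (elim p)
      show ?case
      proof
        assume p: "p \<in> UNIV \<times> \<Omega>"
        have "fst p \<notin> N" using elim(2) by (auto simp: mem_Times_iff)
        then have "u (fst p) (snd p) = (\<Sum>i\<in>UNIV. (v (fst p) (snd p) $ i) *\<^sub>R axis i 1)" using elim(1) p by (simp add: u_def)
        also have "\<dots> = v (fst p) (snd p)" by (simp add: vec_eq_iff axis_def if_distrib cong: if_cong)
        finally show "u (fst p) (snd p) = v (fst p) (snd p)" .
      qed
    qed
  qed
  moreover have "AE r in lborel. div_Linf \<Omega> Dv r = ennreal (D r)" using D0eq Nae by eventually_elim (simp add: D_def)
  ultimately show ?thesis by blast
qed

section \<open>Composition of the field with the flow\<close>

context sobolev_field_all_times
begin

lemma X_borel: "(\<lambda>p. X (fst p) t (snd p)) \<in> borel_measurable borel"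
  using X_jmeas[of t] unfolding jmeas_def borel_prod .

text \<open>\<open>u\<close> and \<open>v\<close> agree only almost everywhere in space-time. The
  map from \<open>(s, x)\<close> to \<open>(s, X s t x)\<close> pulls null sets back to null sets,
  since at each time the compression bound does so.\<close>

lemma X_AE_product:
  assumes Q: "AE p in lborel. Q p"
  shows "AE p in lborel. Q (fst p, X (fst p) t (snd p))"
proof -
  obtain N where N: "N \<in> null_sets lborel" "{p. \<not> Q p} \<subseteq> N" using Q by (auto simp: eventually_ae_filter)
  let ?g = "\<lambda>p. (fst p, X (fst p) t (snd p))"
  have g: "?g \<in> borel_measurable borel" using borel_measurable_continuous_onI[OF continuous_on_fst[OF continuous_on_id]] X_borel
    by (intro borel_measurable_Pair) auto
  have "?g -` N \<in> sets borel" using measurable_sets[OF g, of N] null_setsD2[OF N(1)] by simp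
  then have "AE p in lborel. p \<notin> ?g -` N"
  proof (rule AE_lborel_prodI)
    show "AE s in lborel. AE x in lborel. (s, x) \<notin> ?g -` N"
      using AE_lborel_prod_slices(1)[OF AE_not_in[OF N(1)]]
    proof eventually_elim
      case (elim s)
      show ?case using compr_AE[OF X_compr[of t s] elim] by simp
    qed
  qed
  then show ?thesis by eventually_elim (use N(2) in auto)
qed

text \<open>A compression constant common to all times in the interval reduces the integral along
  the flow to the space-time integral of \<open>u\<close>.\<close>

lemma u_X_integrable: "set_integrable lborel ({a..b} \<times> UNIV) (\<lambda>p. u (fst p) (X (fst p) t (snd p)))"
proof -
  note [measurable (raw)] = jmeasD[OF X_jmeas]
  obtain L where L: "\<And>s. s \<in> {a..b} \<Longrightarrow> compr UNIV L (X s t)" using X_compr_bounded by blast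
  let ?h = "\<lambda>p. indicator {a..b} (fst p) *\<^sub>R u (fst p) (X (fst p) t (snd p))"
  have m: "?h \<in> borel_measurable (borel \<Otimes>\<^sub>M borel)" by measurable
  have "(\<integral>\<^sup>+p. ennreal (norm (?h p)) \<partial>(lborel \<Otimes>\<^sub>M lborel)) = (\<integral>\<^sup>+s. \<integral>\<^sup>+x. ennreal (norm (?h (s, x))) \<partial>lborel \<partial>lborel)"
    by (rule lborel.nn_integral_fst[symmetric]) simp
  also have "\<dots> \<le> (\<integral>\<^sup>+s. ennreal L * ((\<integral>\<^sup>+x. norm (u s x) \<partial>lborel) * indicator {-max \<bar>a\<bar> \<bar>b\<bar>..max \<bar>a\<bar> \<bar>b\<bar>} s) \<partial>lborel)"
  proof (rule nn_integral_mono)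
    fix s
    show "(\<integral>\<^sup>+x. ennreal (norm (?h (s, x))) \<partial>lborel) \<le> ennreal L * ((\<integral>\<^sup>+x. norm (u s x) \<partial>lborel) * indicator {-max \<bar>a\<bar> \<bar>b\<bar>..max \<bar>a\<bar> \<bar>b\<bar>} s)"
    proof (cases "s \<in> {a..b}")
      case True
      then have s: "s \<in> {-max \<bar>a\<bar> \<bar>b\<bar>..max \<bar>a\<bar> \<bar>b\<bar>}" by auto
      have "(\<integral>\<^sup>+x\<in>UNIV. ennreal (norm (u s (X s t x))) \<partial>lborel) \<le> ennreal L * (\<integral>\<^sup>+x. norm (u s x) \<partial>lborel)"
        by (rule comprD(3)[OF L[OF True]]) measurable
      then show ?thesis using True s by simp
    qed simp
  qed
  also have "\<dots> = ennreal L * (\<integral>\<^sup>+s\<in>{-max \<bar>a\<bar> \<bar>b\<bar>..max \<bar>a\<bar> \<bar>b\<bar>}. (\<integral>\<^sup>+x. norm (u s x) \<partial>lborel) \<partial>lborel)"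
    by (rule nn_integral_cmult) measurable
  also have "\<dots> < \<infinity>" using u_int[of "max \<bar>a\<bar> \<bar>b\<bar>"] by (simp add: ennreal_mult_less_top)
  finally have "integrable (lborel \<Otimes>\<^sub>M lborel) ?h" using m by (simp add: integrable_iff_bounded)
  moreover have "(\<lambda>p. indicator ({a..b} \<times> UNIV) p *\<^sub>R u (fst p) (X (fst p) t (snd p))) = ?h"
    by (auto simp: fun_eq_iff indicator_def mem_Times_iff)
  ultimately show ?thesis unfolding set_integrable_def lborel_prod by simp
qed

end

theorem theorem1p1:
  fixes \<Omega> :: "(real^3) set"
    and v :: "real \<Rightarrow> real^3 \<Rightarrow> real^3"
    and Dv :: "real \<Rightarrow> real^3 \<Rightarrow> real^3^3"
  assumes "standing_assumptions \<Omega> v Dv"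
  shows "\<exists>X :: real \<Rightarrow> real \<Rightarrow> real^3 \<Rightarrow> real^3.
    (\<forall>s t x. x \<in> \<Omega> \<longrightarrow> X s t x \<in> closure \<Omega>) \<and>
    (\<forall>t. (\<lambda>p. X (fst p) t (snd p)) \<in> borel_measurable (lebesgue_on (UNIV \<times> \<Omega>)) \<and>
         (\<forall>T0 T1. T0 < T1 \<longrightarrow> (\<forall>i. integrable (lebesgue_on ({T0..T1} \<times> \<Omega>))
                     (\<lambda>p. v (fst p) (X (fst p) t (snd p)) $ i)))) \<and>
    (\<forall>s t \<tau> A. A \<in> sets borel \<longrightarrow> A \<subseteq> \<Omega> \<longrightarrow>
        (AE x in lebesgue_on \<Omega>. X t s (X s t x) = x) \<and>
        (AE x in lebesgue_on \<Omega>. X s t x = X s \<tau> (X \<tau> t x)) \<and>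
        {x\<in>\<Omega>. X s t x \<in> A} \<in> sets lebesgue \<and>
        measure lebesgue A / cst \<Omega> Dv s t \<le> measure lebesgue {x\<in>\<Omega>. X s t x \<in> A} \<and>
        measure lebesgue {x\<in>\<Omega>. X s t x \<in> A} \<le> cst \<Omega> Dv s t * measure lebesgue A) \<and>
    (\<forall>t. AE x in lebesgue_on \<Omega>.
        (\<forall>T0 T1. T0 < T1 \<longrightarrow> (\<forall>i. integrable (lebesgue_on {T0..T1}) (\<lambda>s. v s (X s t x) $ i))) \<and>
        (\<exists>N. N \<in> null_sets lebesgue \<and>
           (\<forall>s. s \<notin> N \<longrightarrow> X s t x = x + interval_lebesgue_integral lebesgue (ereal t) (ereal s) (\<lambda>r. v r (X r t x)))))"
proof -
  have \<Omega>: "open \<Omega>" "bounded \<Omega>" using assms by (auto simp: standing_assumptions_def)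
  have \<Omega>b[measurable]: "\<Omega> \<in> sets borel" using \<Omega> by simp
  obtain u A D where f: "sobolev_field_all_times u A D" and u0: "\<And>r x. x \<notin> \<Omega> \<Longrightarrow> u r x = 0"
    and uv: "AE p in lborel. p \<in> UNIV \<times> \<Omega> \<longrightarrow> u (fst p) (snd p) = v (fst p) (snd p)" and dD: "AE r in lborel. div_Linf \<Omega> Dv r = ennreal (D r)"
    using velocity_field_exists[OF assms] by blast
  interpret sobolev_field_all_times u A D by (rule f)
  note [measurable (raw)] = jmeasD[OF X_jmeas]
  \<comment> \<open>\<open>X\<close> leaves \<open>\<Omega>\<close> only for a null set of \<open>x\<close>, but \<open>Y\<close> must map all of \<open>\<Omega>\<close> into its closure.\<close>
  define Y where "Y s t x = (if X s t x \<in> \<Omega> then X s t x else x)" for s t x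
  have stay: "AE x in lborel. x \<in> \<Omega> \<longrightarrow> X s t x \<in> \<Omega>" for s t by (rule X_stays_inside[OF \<Omega>b u0])
  have Yin: "Y s t x \<in> \<Omega>" if "x \<in> \<Omega>" for s t x using that by (simp add: Y_def)
  have YX: "Y s t x = X s t x" if "X s t x \<in> \<Omega>" for s t x using that by (simp add: Y_def)
  have Ym: "(\<lambda>p. Y (fst p) t (snd p)) \<in> borel_measurable borel" for t
    unfolding Y_def borel_prod[symmetric] by measurable
  have Ysm[measurable]: "Y s t \<in> borel_measurable borel" for s t
  proof -
    have [measurable]: "X s t \<in> borel_measurable borel" using comprD(1)[OF X_compr] .
    show ?thesis unfolding Y_def by measurable
  qed
  \<comment> \<open>Two null sets are discarded: the pullback along the flow of the set where
    \<open>u\<close> and \<open>v\<close> differ, and the points of space-time at which the flow has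
    left \<Omega>. The latter set is Borel and has null sections by \<open>stay\<close>.\<close>
  have vY: "AE p in lborel. p \<in> UNIV \<times> \<Omega> \<longrightarrow> v (fst p) (Y (fst p) t (snd p)) = u (fst p) (X (fst p) t (snd p)) \<and> Y (fst p) t (snd p) = X (fst p) t (snd p)" for t
  proof -
    let ?N = "{p. snd p \<in> \<Omega> \<and> X (fst p) t (snd p) \<notin> \<Omega>}"
    have N: "?N = (UNIV \<times> \<Omega>) - (\<lambda>p. X (fst p) t (snd p)) -` \<Omega>" by (auto simp: mem_Times_iff)
    have "(\<lambda>p. X (fst p) t (snd p)) -` \<Omega> \<in> sets borel" using measurable_sets[OF X_borel \<Omega>b] by simp
    then have "?N \<in> sets borel" unfolding N by (rule sets.Diff[OF borel_open[OF open_Times[OF open_UNIV \<Omega>(1)]]])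
    then have "AE p in lborel. p \<notin> ?N" by (rule AE_lborel_prodI) (use stay in \<open>auto elim: eventually_mono\<close>)
    with X_AE_product[OF uv, of t] show ?thesis by eventually_elim (auto simp: YX mem_Times_iff)
  qed
  \<comment> \<open>The integral is finite because \<open>D\<close> is integrable over bounded
    intervals, so the value 0 of \<open>enn2real\<close> at infinity does not interfere.\<close>
  have cst: "cst \<Omega> Dv s t = exp (LBINT r:seg s t. D r)" for s t
  proof -
    have i: "integrable lborel (\<lambda>r. indicator (seg s t) r *\<^sub>R D r)" using D_integrable by (simp add: set_integrable_def)
    have "(\<integral>\<^sup>+r\<in>seg s t. div_Linf \<Omega> Dv r \<partial>lebesgue) = (\<integral>\<^sup>+r. ennreal (indicator (seg s t) r *\<^sub>R D r) \<partial>lebesgue)"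
    proof (rule nn_integral_cong_AE)
      show "AE r in lebesgue. div_Linf \<Omega> Dv r * indicator (seg s t) r = ennreal (indicator (seg s t) r *\<^sub>R D r)"
        using AE_completion[OF dD] by eventually_elim (auto simp: indicator_def)
    qed
    also have "\<dots> = (\<integral>\<^sup>+r. ennreal (indicator (seg s t) r *\<^sub>R D r) \<partial>lborel)" by (rule nn_integral_completion)
    also have "\<dots> = ennreal (LBINT r:seg s t. D r)"
      unfolding set_lebesgue_integral_def by (rule nn_integral_eq_integral[OF i]) (simp add: D_nonneg)
    finally show ?thesis unfolding cst_def seg_def[symmetric]
      by (simp add: set_lebesgue_integral_def D_nonneg integral_nonneg_AE)
  qed
  have cst_sym: "cst \<Omega> Dv s t = cst \<Omega> Dv t s" for s t by (simp add: cst_def min.commute max.commute)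
  have cst_pos: "0 < cst \<Omega> Dv s t" for s t by (simp add: cst_def)
  have pre: "{x\<in>\<Omega>. Y s t x \<in> B} \<in> sets borel" if "B \<in> sets borel" for s t B
  proof -
    have "{x\<in>\<Omega>. Y s t x \<in> B} = \<Omega> \<inter> Y s t -` B" by auto
    then show ?thesis using measurable_sets[OF Ysm that, of s t] \<Omega>b by (simp add: sets.Int)
  qed
  have fin: "emeasure lborel B = ennreal (measure lborel B)" if "B \<subseteq> \<Omega>" for B
    using emeasure_bounded_finite[OF bounded_subset[OF \<Omega>(2) that]] by (intro emeasure_eq_ennreal_measure) auto
  have upper: "measure lborel {x\<in>\<Omega>. Y s t x \<in> B} \<le> cst \<Omega> Dv s t * measure lborel B" if B: "B \<in> sets borel" "B \<subseteq> \<Omega>" for s t B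
  proof -
    have c: "compr UNIV (cst \<Omega> Dv s t) (X s t)" using X_compr[of t s] cst[of t s] cst_sym[of s t] by simp
    have Xm: "X s t \<in> borel_measurable borel" using comprD(1)[OF c] .
    have "emeasure lborel {x\<in>\<Omega>. Y s t x \<in> B} \<le> emeasure lborel {x\<in>UNIV. X s t x \<in> B}"
    proof (rule emeasure_mono_AE)
      show "AE x in lborel. x \<in> {x\<in>\<Omega>. Y s t x \<in> B} \<longrightarrow> x \<in> {x\<in>UNIV. X s t x \<in> B}"
        using stay[of s t] by eventually_elim (auto simp: YX)
      show "{x\<in>UNIV. X s t x \<in> B} \<in> sets lborel" using measurable_sets[OF Xm B(1)] by (simp add: vimage_def)
    qed
    also have "\<dots> \<le> ennreal (cst \<Omega> Dv s t) * emeasure lborel B" by (rule compr_emeasure[OF c _ B(1)]) simp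
    finally have "ennreal (measure lborel {x\<in>\<Omega>. Y s t x \<in> B}) \<le> ennreal (cst \<Omega> Dv s t * measure lborel B)"
      using cst_pos[of s t] fin[OF B(2)] fin[of "{x\<in>\<Omega>. Y s t x \<in> B}"] by (simp add: ennreal_mult)
    then show ?thesis using cst_pos[of s t] by (simp add: ennreal_le_iff)
  qed
  have inv: "AE x in lborel. x \<in> \<Omega> \<longrightarrow> Y t s (Y s t x) = x" for s t
    using X_inverse[of t s] stay[of s t] by eventually_elim (auto simp: Y_def)
  \<comment> \<open>Apply \<open>upper\<close> to the inverse map \<open>Y t s\<close> and the set
    \<open>?C\<close>: almost every point of \<open>B\<close> is mapped into \<open>?C\<close> by
    \<open>Y t s\<close>, since \<open>Y s t\<close> brings it back into \<open>B\<close>. The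
    constant is symmetric in \<open>s\<close> and \<open>t\<close>.\<close>
  have lower: "measure lborel B / cst \<Omega> Dv s t \<le> measure lborel {x\<in>\<Omega>. Y s t x \<in> B}" if B: "B \<in> sets borel" "B \<subseteq> \<Omega>" for s t B
  proof -
    let ?C = "{x\<in>\<Omega>. Y s t x \<in> B}"
    have C: "?C \<in> sets borel" "?C \<subseteq> \<Omega>" using pre[OF B(1)] by auto
    have "emeasure lborel B \<le> emeasure lborel {y\<in>\<Omega>. Y t s y \<in> ?C}"
    proof (rule emeasure_mono_AE)
      show "AE y in lborel. y \<in> B \<longrightarrow> y \<in> {y\<in>\<Omega>. Y t s y \<in> ?C}"
        using inv[of s t] by eventually_elim (use B(2) Yin in auto)
      show "{y\<in>\<Omega>. Y t s y \<in> ?C} \<in> sets lborel" using pre[OF C(1)] by simp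
    qed
    then have "measure lborel B \<le> measure lborel {y\<in>\<Omega>. Y t s y \<in> ?C}"
      using fin[OF B(2)] fin[of "{y\<in>\<Omega>. Y t s y \<in> ?C}"] by (simp add: ennreal_le_iff)
    also have "\<dots> \<le> cst \<Omega> Dv s t * measure lborel ?C" using upper[OF C, of t s] by (simp add: cst_sym[of t s])
    finally show ?thesis using cst_pos[of s t] by (simp add: divide_le_eq mult.commute)
  qed
  have group: "AE x in lborel. x \<in> \<Omega> \<longrightarrow> Y s t x = Y s \<tau> (Y \<tau> t x)" for s t \<tau>
    using X_group[of t \<tau>] stay[of \<tau> t] stay[of s t] by eventually_elim (metis YX)
  have curve: "AE x in lborel. x \<in> \<Omega> \<longrightarrow> (\<forall>T0 T1. T0 < T1 \<longrightarrow> (\<forall>i. integrable (lebesgue_on {T0..T1}) (\<lambda>s. v s (Y s t x) $ i))) \<and>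
      (\<exists>N. N \<in> null_sets lebesgue \<and>
         (\<forall>s. s \<notin> N \<longrightarrow> Y s t x = x + interval_lebesgue_integral lebesgue (ereal t) (ereal s) (\<lambda>r. v r (Y r t x))))" for t
    using X_integral_curve[of t] AE_lborel_prod_slices(2)[OF vY[of t]]
  proof eventually_elim
    case (elim x)
    show ?case
    proof
      assume x: "x \<in> \<Omega>"
      define y where "y s = X s t x" for s
      have int: "set_integrable lborel {a..b} (\<lambda>r. u r (y r))" and ode: "a \<le> b \<Longrightarrow> y b - y a = (LBINT r:{a..b}. u r (y r))" for a b
        using elim(1) unfolding integral_curve_def y_def by blast+
      have yt: "y t = x" using elim(1) by (simp add: y_def)
      have ae: "AE s in lborel. v s (Y s t x) = u s (y s) \<and> Y s t x = y s" using elim(2) x by (simp add: y_def)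
      have I1: "integrable (lebesgue_on {a..b}) (\<lambda>s. v s (Y s t x))" for a b
        by (rule integrable_lebesgue_on_AE[OF _ int[of a b]]) (use ae in \<open>auto elim: eventually_mono\<close>)
      \<comment> \<open>\<open>interval_lebesgue_integral\<close> integrates over the open interval,
        \<open>integral_curve\<close> over the closed one; the two endpoints form a null
        set.\<close>
      have I2: "(LINT r:{a<..<b}|lebesgue. v r (Y r t x)) = y b - y a" if "a \<le> b" for a b
      proof -
        have "(\<integral>r. indicator {a<..<b} r *\<^sub>R v r (Y r t x) \<partial>lebesgue) = (\<integral>r. indicator {a..b} r *\<^sub>R u r (y r) \<partial>lborel)"
        proof (rule lebesgue_cong_AE(2))
          show "(\<lambda>r. indicator {a..b} r *\<^sub>R u r (y r)) \<in> borel_measurable borel"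
            using int[of a b] unfolding set_integrable_def by (auto dest: borel_measurable_integrable)
          show "AE r in lborel. indicator {a<..<b} r *\<^sub>R v r (Y r t x) = indicator {a..b} r *\<^sub>R u r (y r)"
            using ae AE_lborel_singleton[of a] AE_lborel_singleton[of b] by eventually_elim (auto simp: indicator_def)
        qed
        then show ?thesis using ode[OF that] by (simp add: set_lebesgue_integral_def)
      qed
      \<comment> \<open>The curve \<open>y\<close> satisfies its equation at every time. Exceptional
        times arise only from the modification of \<open>X\<close> into \<open>Y\<close>.\<close>
      obtain N where N: "N \<in> null_sets lborel" "{s. Y s t x \<noteq> y s} \<subseteq> N" using ae by (auto simp: eventually_ae_filter)
      have "Y s t x = x + interval_lebesgue_integral lebesgue (ereal t) (ereal s) (\<lambda>r. v r (Y r t x))" if s: "s \<notin> N" for s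
      proof -
        have "interval_lebesgue_integral lebesgue (ereal t) (ereal s) (\<lambda>r. v r (Y r t x)) = y s - y t"
          using I2[of t s] I2[of s t] by (simp add: interval_lebesgue_integral_def)
        moreover have "Y s t x = y s" using s N(2) by blast
        ultimately show ?thesis using yt by simp
      qed
      moreover have "N \<in> null_sets lebesgue" by (rule null_sets_completionI[OF N(1)])
      moreover have "integrable (lebesgue_on {T0..T1}) (\<lambda>s. v s (Y s t x) $ i)" for T0 T1 i
        by (rule integrable_bounded_linear[OF bounded_linear_vec_nth I1])
      ultimately show "(\<forall>T0 T1. T0 < T1 \<longrightarrow> (\<forall>i. integrable (lebesgue_on {T0..T1}) (\<lambda>s. v s (Y s t x) $ i))) \<and>
        (\<exists>N. N \<in> null_sets lebesgue \<and>
           (\<forall>s. s \<notin> N \<longrightarrow> Y s t x = x + interval_lebesgue_integral lebesgue (ereal t) (ereal s) (\<lambda>r. v r (Y r t x))))" by blast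
    qed
  qed
  show ?thesis
  proof (intro exI[of _ Y] conjI allI impI)
    show "x \<in> \<Omega> \<Longrightarrow> Y s t x \<in> closure \<Omega>" for s t x using Yin closure_subset by blast
    show "(\<lambda>p. Y (fst p) t (snd p)) \<in> borel_measurable (lebesgue_on (UNIV \<times> \<Omega>))" for t
      by (rule measurable_restrict_space1, rule measurable_completion) (use Ym in simp)
    show "integrable (lebesgue_on ({T0..T1} \<times> \<Omega>)) (\<lambda>p. v (fst p) (Y (fst p) t (snd p)) $ i)" for t T0 T1 i
    proof (rule integrable_bounded_linear[OF bounded_linear_vec_nth], rule integrable_lebesgue_on_AE)
      show S: "{T0..T1} \<times> \<Omega> \<in> sets borel" unfolding borel_prod[symmetric] using \<Omega>b by auto
      show "set_integrable lborel ({T0..T1} \<times> \<Omega>) (\<lambda>p. u (fst p) (X (fst p) t (snd p)))"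
        by (rule set_integrable_subset[OF u_X_integrable]) (use S in auto)
      show "AE p in lborel. p \<in> {T0..T1} \<times> \<Omega> \<longrightarrow> v (fst p) (Y (fst p) t (snd p)) = u (fst p) (X (fst p) t (snd p))"
        using vY[of t] by eventually_elim auto
    qed
    show "AE x in lebesgue_on \<Omega>. Y t s (Y s t x) = x" "AE x in lebesgue_on \<Omega>. Y s t x = Y s \<tau> (Y \<tau> t x)" for s t \<tau>
      unfolding AE_lebesgue_on[OF \<Omega>b] by (rule inv group)+
    fix s t :: real and A :: "(real^3) set" assume A: "A \<in> sets borel" "A \<subseteq> \<Omega>"
    have ml: "measure lebesgue B = measure lborel B" if "B \<in> sets borel" for B :: "(real^3) set" using that by simp
    show "{x\<in>\<Omega>. Y s t x \<in> A} \<in> sets lebesgue" using pre[OF A(1)] by (intro sets_completionI_sets) simp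
    show "measure lebesgue A / cst \<Omega> Dv s t \<le> measure lebesgue {x\<in>\<Omega>. Y s t x \<in> A}"
      unfolding ml[OF A(1)] ml[OF pre[OF A(1)]] by (rule lower[OF A])
    show "measure lebesgue {x\<in>\<Omega>. Y s t x \<in> A} \<le> cst \<Omega> Dv s t * measure lebesgue A"
      unfolding ml[OF A(1)] ml[OF pre[OF A(1)]] by (rule upper[OF A])
  next
    fix t
    show "AE x in lebesgue_on \<Omega>. (\<forall>T0 T1. T0 < T1 \<longrightarrow> (\<forall>i. integrable (lebesgue_on {T0..T1}) (\<lambda>s. v s (Y s t x) $ i))) \<and>
      (\<exists>N. N \<in> null_sets lebesgue \<and>
         (\<forall>s. s \<notin> N \<longrightarrow> Y s t x = x + interval_lebesgue_integral lebesgue (ereal t) (ereal s) (\<lambda>r. v r (Y r t x))))"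
      unfolding AE_lebesgue_on[OF \<Omega>b] by (rule curve)
  qed
qed

end
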